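(* Let $\phi$ be a non-negative Borel measure on $(0,\infty)$ with $\int_{(0,\infty)}(z^2\wedge z)\,\phi(dz)<\infty$ and $\int_{(0,1)}z\,\phi(dz)=\infty$. Then each of the twelve operators $(G^-,\mathrm{LR})$ on $C_0(\Omega)$ and $(G^+,\mathrm{LR})$ on $L^1[-1,1]$, $\mathrm{LR}\in\{\mathrm{DD},\mathrm{DN},\mathrm{ND},\mathrm{NN},\mathrm{N^*D},\mathrm{N^*N}\}$ (defined in the context), generates a positive strongly continuous contraction semigroup on its respective Banach space.
   Context: Let $\Phi(x)=\Phi^+(x)=\int_x^\infty\phi((y,\infty))\,dy$ for $x>0$, $\Phi(x)=0$ for $x\le 0$, and $\Phi^-(x)=\Phi(-x)$. Functions on $[-1,1]$ are extended by zero to $\mathbb R$ before convolving ($\star$), so on $[-1,1]$: $\Phi^+\star u(x)=\int_{-1}^x\Phi(x-y)u(y)\,dy$ and $\Phi^-\star u(x)=\int_x^1\Phi(y-x)u(y)\,dy$. Derivatives are (weak) derivatives on $(-1,1)$. Define on $[-1,1]$ - $\partial^{\psi}_{\pm}f=\frac{d}{dx}[\Phi^\pm\star f']$ and $\partial^{\psi-1}_{\pm}f=\Phi^\pm\star f'$, for $f\in W^{1,1}[-1,1]$; - $D^{\psi}_+f=\frac{d^2}{dx^2}[\Phi\star f]$ and $D^{\psi-1}_+f=\frac{d}{dx}[\Phi\star f]$, for $f\in L^1[-1,1]$. For each $\mathrm{LR}$, $\Omega$ is the interval with endpoints $-1,1$ which excludes $-1$ iff $\mathrm L=\mathrm D$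 and excludes $1$ iff $\mathrm R=\mathrm D$. $C_0(\Omega)$ is the closure in the supremum norm of the continuous functions with compact support in $\Omega$. Backward operators: $G^-=\partial^{\psi}_-$ for all six $\mathrm{LR}$, on $X=C_0(\Omega)$. Forward operators, on $X=L^1[-1,1]$: $G^+=\partial^{\psi}_+$ for $\mathrm{DD},\mathrm{DN},\mathrm{ND},\mathrm{NN}$ and $G^+=D^{\psi}_+$ for $\mathrm{N^*D},\mathrm{N^*N}$. The domain $\mathcal D(G^\pm,\mathrm{LR})$ is the set of $f\in X$ (with $f\in W^{1,1}[-1,1]$ when the operator is $\partial^\psi_\pm$) such that $G^\pm f\in X$, $f$ satisfies boundary condition $\mathrm L$ at $-1$ and boundary condition $\mathrm R$ at $1$; $(G^\pm,\mathrm{LR})$ denotes $G^\pm:\mathcal D(G^\pm,\mathrm{LR})\to X$. Boundary conditions at an endpoint $e\in\{-1,1\}$ (one-sided limits from inside $(-1,1)$): - $\mathrm D$: $\lim_{x\to e}f(x)=0$. - $\mathrm N$: $\lim_{x\to e}\partial^{\psi-1}_\pm f(x)=0$ (sign $-$ for $G^-$, sign $+$ for $G^+$), except that for $(D^\psi_+,\mathrm{N^*N})$ the condition at $1$ is $\lim_{x\uparrow1}D^{\psi-1}_+f(x)=0$. - $\mathrm{N^*}$ (at $-1$): $\lim_{x\downarrow-1}f'(x)=0$ for $G^-$; $\lim_{x\downarrow-1}D^{\psi-1}_+f(x)=0$ for $G^+=D^\psi_+$. A semigroup $(P_t)$ is positive if $f\ge0$ implies $P_tf\ge0$ for all $t>0$.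 *)

theory Defs
  imports "HOL-Analysis.Analysis"
begin

section \<open>Semigroups on a subspace of a normed space\<close>

text \<open>
  The Banach space is a closed subspace \<open>X\<close> of the ambient type; the values of \<open>P t\<close> outside \<open>X\<close>
  and of \<open>P\<close> at negative times are irrelevant. An operator is identified with its graph.
\<close>

definition contraction_semigroup ::
    "'a::real_normed_vector set \<Rightarrow> (real \<Rightarrow> 'a \<Rightarrow> 'a) \<Rightarrow> bool" where
  "contraction_semigroup X P \<longleftrightarrow>
     (\<forall>t\<ge>0. \<forall>f\<in>X. P t f \<in> X) \<and>
     (\<forall>t\<ge>0. \<forall>f\<in>X. \<forall>g\<in>X. P t (f + g) = P t f + P t g) \<and>
     (\<forall>t\<ge>0. \<forall>c. \<forall>f\<in>X. P t (c *\<^sub>R f) = c *\<^sub>R P t f) \<and>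
     (\<forall>t\<ge>0. \<forall>f\<in>X. norm (P t f) \<le> norm f) \<and>
     (\<forall>f\<in>X. P 0 f = f) \<and>
     (\<forall>s\<ge>0. \<forall>t\<ge>0. \<forall>f\<in>X. P (s + t) f = P s (P t f))"

definition strongly_continuous ::
    "'a::real_normed_vector set \<Rightarrow> (real \<Rightarrow> 'a \<Rightarrow> 'a) \<Rightarrow> bool" where
  "strongly_continuous X P \<longleftrightarrow> (\<forall>f\<in>X. continuous_on {0..} (\<lambda>t. P t f))"

definition generator ::
    "'a::real_normed_vector set \<Rightarrow> (real \<Rightarrow> 'a \<Rightarrow> 'a) \<Rightarrow> ('a \<times> 'a) set" where
  "generator X P = {(f, g). f \<in> X \<and> g \<in> X \<and>
     ((\<lambda>t. (P t f - f) /\<^sub>R t) \<longlongrightarrow> g) (at_right 0)}"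

text \<open>\<open>C\<close> is the set of all \<open>f\<close> with \<open>f \<ge> 0\<close>.\<close>

definition generates_positive_sc_contraction_semigroup ::
    "'a::real_normed_vector set \<Rightarrow> 'a set \<Rightarrow> ('a \<times> 'a) set \<Rightarrow> bool" where
  "generates_positive_sc_contraction_semigroup X C G \<longleftrightarrow>
     (\<exists>P. contraction_semigroup X P \<and> strongly_continuous X P \<and>
          (\<forall>t>0. \<forall>f\<in>X. f \<in> C \<longrightarrow> P t f \<in> C) \<and>
          generator X P = G)"


section \<open>The Banach space of continuous functions on the interval\<close>

typedef ival = "{-1..1::real}" by auto

setup_lifting type_definition_ival

instantiation ival :: metric_space
begin

lift_definition dist_ival :: "ival \<Rightarrow> ival \<Rightarrow> real" is dist .

definition uniformity_ival :: "(ival \<times> ival) filter" where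
  "uniformity_ival = (INF e\<in>{0<..}. principal {(x, y). dist x y < e})"

definition open_ival :: "ival set \<Rightarrow> bool" where
  "open_ival S = (\<forall>x\<in>S. \<forall>\<^sub>F (x', y) in uniformity. x' = x \<longrightarrow> y \<in> S)"

instance
proof
  fix x y z :: ival
  show "dist x y = 0 \<longleftrightarrow> x = y" by transfer simp
  show "dist x y \<le> dist x z + dist y z" by transfer (rule dist_triangle2)
qed (simp_all add: uniformity_ival_def open_ival_def)

end

text \<open>\<open>C[-1,1]\<close> with the supremum norm is the type \<open>ival \<Rightarrow>\<^sub>C real\<close>.\<close>

definition fun_of :: "(ival \<Rightarrow>\<^sub>C real) \<Rightarrow> real \<Rightarrow> real" where
  "fun_of f x = (if x \<in> {-1..1} then apply_bcontfun f (Abs_ival x) else 0)"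

lemma fun_of_Rep_ival: "fun_of f (Rep_ival x) = apply_bcontfun f x"
  using Rep_ival[of x] by (simp add: fun_of_def Rep_ival_inverse)

lemma continuous_on_fun_of: "continuous_on {-1..1} (fun_of f)"
proof -
  have "continuous_on {-1..1} (\<lambda>x. apply_bcontfun f (Abs_ival x))"
  proof (rule continuous_on_compose2[where g = "apply_bcontfun f" and t = UNIV])
    show "continuous_on {-1..1} Abs_ival"
      unfolding continuous_on_iff dist_ival.rep_eq by (auto simp: Abs_ival_inverse)
  qed auto
  then show ?thesis
    by (rule continuous_on_eq) (simp add: fun_of_def)
qed

lemma continuous_imp_fun_of:
  assumes "continuous_on {-1..1} h"
  shows "\<exists>f. \<forall>x\<in>{-1..1}. fun_of f x = h x"
proof -
  have "continuous_on UNIV Rep_ival"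
    unfolding continuous_on_iff by (auto simp: dist_ival.rep_eq)
  then have c: "continuous_on UNIV (\<lambda>x. h (Rep_ival x))"
    by (rule continuous_on_compose2[OF assms]) (use Rep_ival in auto)
  have "bounded (h ` {-1..1})"
    using assms by (intro compact_imp_bounded compact_continuous_image) auto
  then have "bounded (range (\<lambda>x. h (Rep_ival x)))"
    by (rule bounded_subset) (use Rep_ival in auto)
  with c have "(\<lambda>x. h (Rep_ival x)) \<in> bcontfun"
    by (simp add: bcontfun_def)
  then obtain f where "(\<lambda>x. h (Rep_ival x)) = apply_bcontfun f"
    by (rule bcontfunE)
  then have "apply_bcontfun f y = h (Rep_ival y)" for y
    by metis
  then show ?thesis
    by (intro exI[of _ f]) (simp add: fun_of_def Abs_ival_inverse)
qed

lemma norm_eq_SUP_fun_of: "norm f = (SUP x\<in>{-1..1}. \<bar>fun_of f x\<bar>)"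
proof -
  have "norm f = (SUP x. \<bar>apply_bcontfun f x\<bar>)"
    by (simp add: norm_bcontfun_def dist_bcontfun.rep_eq)
  also have "(\<lambda>x. \<bar>apply_bcontfun f x\<bar>) = (\<lambda>x. \<bar>fun_of f (Rep_ival x)\<bar>)"
    by (simp add: fun_of_Rep_ival)
  also have "range (\<lambda>x. \<bar>fun_of f (Rep_ival x)\<bar>) = (\<lambda>x. \<bar>fun_of f x\<bar>) ` range Rep_ival"
    by (simp add: image_image)
  also have "range Rep_ival = {-1..1}"
    using type_definition_ival by (rule type_definition.Rep_range)
  finally show ?thesis .
qed

text \<open>For relatively open \<open>\<Omega>\<close>, extension by zero identifies the continuous functions with compact
  support in \<open>\<Omega>\<close> with the members of the set whose closure is taken.\<close>

definition C0 :: "real set \<Rightarrow> (ival \<Rightarrow>\<^sub>C real) set" where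
  "C0 \<Omega> = closure {f. \<exists>K. compact K \<and> K \<subseteq> \<Omega> \<and> (\<forall>x. x \<notin> K \<longrightarrow> fun_of f x = 0)}"

definition nonneg_C :: "(ival \<Rightarrow>\<^sub>C real) set" where
  "nonneg_C = {f. \<forall>x\<in>{-1..1}. 0 \<le> fun_of f x}"


section \<open>The Banach space \<open>L\<^sup>1[-1,1]\<close>\<close>

abbreviation Leb :: "real measure" where
  "Leb \<equiv> restrict_space lborel {-1..1}"

definition L1_rel :: "(real \<Rightarrow> real) \<Rightarrow> (real \<Rightarrow> real) \<Rightarrow> bool" where
  "L1_rel f g \<longleftrightarrow> integrable Leb f \<and> integrable Leb g \<and> (AE x in Leb. f x = g x)"

lemma part_equivp_L1_rel: "part_equivp L1_rel"
proof (rule part_equivpI)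
  show "\<exists>f. L1_rel f f"
    by (intro exI[of _ "\<lambda>_. 0"]) (simp add: L1_rel_def)
  show "symp L1_rel"
    by (auto simp: symp_def L1_rel_def)
  show "transp L1_rel"
    unfolding transp_def L1_rel_def by auto
qed

quotient_type L1 = "real \<Rightarrow> real" / partial: L1_rel
  morphisms rep_L1 abs_L1
  by (rule part_equivp_L1_rel)

instantiation L1 :: real_normed_vector
begin

lift_definition zero_L1 :: L1 is "\<lambda>_. 0"
  by (simp add: L1_rel_def)

lift_definition plus_L1 :: "L1 \<Rightarrow> L1 \<Rightarrow> L1" is "\<lambda>f g x. f x + g x"
  unfolding L1_rel_def by auto

lift_definition minus_L1 :: "L1 \<Rightarrow> L1 \<Rightarrow> L1" is "\<lambda>f g x. f x - g x"
  unfolding L1_rel_def by auto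

lift_definition uminus_L1 :: "L1 \<Rightarrow> L1" is "\<lambda>f x. - f x"
  unfolding L1_rel_def by auto

lift_definition scaleR_L1 :: "real \<Rightarrow> L1 \<Rightarrow> L1" is "\<lambda>c f x. c * f x"
  unfolding L1_rel_def by auto

lift_definition norm_L1 :: "L1 \<Rightarrow> real" is "\<lambda>f. \<integral>x. \<bar>f x\<bar> \<partial>Leb"
  unfolding L1_rel_def by (auto intro!: integral_cong_AE)

definition dist_L1 :: "L1 \<Rightarrow> L1 \<Rightarrow> real" where
  "dist_L1 f g = norm (f - g)"

definition sgn_L1 :: "L1 \<Rightarrow> L1" where
  "sgn_L1 f = scaleR (inverse (norm f)) f"

definition uniformity_L1 :: "(L1 \<times> L1) filter" where
  "uniformity_L1 = (INF e\<in>{0<..}. principal {(x, y). dist x y < e})"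

definition open_L1 :: "L1 set \<Rightarrow> bool" where
  "open_L1 S = (\<forall>x\<in>S. \<forall>\<^sub>F (x', y) in uniformity. x' = x \<longrightarrow> y \<in> S)"

instance
proof
  fix f g h :: L1 and a b :: real
  show "f + g + h = f + (g + h)" by transfer (auto simp: L1_rel_def algebra_simps)
  show "f + g = g + f" by transfer (auto simp: L1_rel_def algebra_simps)
  show "0 + f = f" by transfer (auto simp: L1_rel_def)
  show "- f + f = 0" by transfer (auto simp: L1_rel_def)
  show "f - g = f + - g" by transfer (auto simp: L1_rel_def)
  show "a *\<^sub>R (f + g) = a *\<^sub>R f + a *\<^sub>R g" by transfer (auto simp: L1_rel_def algebra_simps)
  show "(a + b) *\<^sub>R f = a *\<^sub>R f + b *\<^sub>R f" by transfer (auto simp: L1_rel_def algebra_simps)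
  show "a *\<^sub>R b *\<^sub>R f = (a * b) *\<^sub>R f" by transfer (auto simp: L1_rel_def algebra_simps)
  show "1 *\<^sub>R f = f" by transfer (auto simp: L1_rel_def)
  show "norm f = 0 \<longleftrightarrow> f = 0"
    by transfer (auto simp: L1_rel_def integral_nonneg_eq_0_iff_AE)
  show "norm (f + g) \<le> norm f + norm g"
  proof transfer
    fix f g assume "L1_rel f f" "L1_rel g g"
    then have [simp]: "integrable Leb f" "integrable Leb g" by (auto simp: L1_rel_def)
    have "(\<integral>x. \<bar>f x + g x\<bar> \<partial>Leb) \<le> (\<integral>x. \<bar>f x\<bar> + \<bar>g x\<bar> \<partial>Leb)"
      by (intro integral_mono) auto
    then show "(\<integral>x. \<bar>f x + g x\<bar> \<partial>Leb) \<le> (\<integral>x. \<bar>f x\<bar> \<partial>Leb) + (\<integral>x. \<bar>g x\<bar> \<partial>Leb)"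
      by simp
  qed
  show "norm (a *\<^sub>R f) = \<bar>a\<bar> * norm f"
    by transfer (auto simp: L1_rel_def abs_mult)
qed (simp_all add: dist_L1_def sgn_L1_def uniformity_L1_def open_L1_def)

end

lemma integrable_rep_L1: "integrable Leb (rep_L1 f)"
  using Quotient_rep_reflp[OF Quotient_L1, of f] by (simp add: L1_rel_def)

lemma abs_L1_rep_L1 [simp]: "abs_L1 (rep_L1 f) = f"
  using Quotient_abs_rep[OF Quotient_L1] .

lemma L1_eq_iff: "f = g \<longleftrightarrow> (AE x in Leb. rep_L1 f x = rep_L1 g x)"
  using Quotient_rel_rep[OF Quotient_L1, of f g] by (simp add: L1_rel_def integrable_rep_L1)

lemma rep_abs_L1: "integrable Leb h \<Longrightarrow> AE x in Leb. rep_L1 (abs_L1 h) x = h x"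
  using Quotient_rep_abs[OF Quotient_L1, of h] by (simp add: L1_rel_def)

lemma norm_L1_eq: "norm f = (\<integral>x. \<bar>rep_L1 f x\<bar> \<partial>Leb)"
  by (simp add: norm_L1.rep_eq)

lemma norm_abs_L1: "integrable Leb h \<Longrightarrow> norm (abs_L1 h) = (\<integral>x. \<bar>h x\<bar> \<partial>Leb)"
  by (simp add: norm_L1.abs_eq L1_rel_def)

lemma rep_L1_add: "AE x in Leb. rep_L1 (f + g) x = rep_L1 f x + rep_L1 g x"
proof -
  have "f + g = abs_L1 (\<lambda>x. rep_L1 f x + rep_L1 g x)"
    using plus_L1.abs_eq[of "rep_L1 f" "rep_L1 g"] by (simp add: L1_rel_def integrable_rep_L1)
  then show ?thesis
    using rep_abs_L1[of "\<lambda>x. rep_L1 f x + rep_L1 g x"] by (simp add: integrable_rep_L1)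
qed

lemma rep_L1_diff: "AE x in Leb. rep_L1 (f - g) x = rep_L1 f x - rep_L1 g x"
proof -
  have "f - g = abs_L1 (\<lambda>x. rep_L1 f x - rep_L1 g x)"
    using minus_L1.abs_eq[of "rep_L1 f" "rep_L1 g"] by (simp add: L1_rel_def integrable_rep_L1)
  then show ?thesis
    using rep_abs_L1[of "\<lambda>x. rep_L1 f x - rep_L1 g x"] by (simp add: integrable_rep_L1)
qed

lemma rep_L1_scaleR: "AE x in Leb. rep_L1 (c *\<^sub>R f) x = c * rep_L1 f x"
proof -
  have "c *\<^sub>R f = abs_L1 (\<lambda>x. c * rep_L1 f x)"
    using scaleR_L1.abs_eq[of "rep_L1 f" c] by (simp add: L1_rel_def integrable_rep_L1)
  then show ?thesis
    using rep_abs_L1[of "\<lambda>x. c * rep_L1 f x"] by (simp add: integrable_rep_L1)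
qed

lemma rep_L1_zero: "AE x in Leb. rep_L1 0 x = 0"
  using rep_abs_L1[of "\<lambda>_. 0"] by (simp add: zero_L1.abs_eq)

lemma rep_L1_sum: "AE x in Leb. rep_L1 (\<Sum>i<n. f i) x = (\<Sum>i<n. rep_L1 (f i) x)" for n :: nat
proof (induction n)
  case 0
  then show ?case using rep_L1_zero by simp
next
  case (Suc n)
  have "AE x in Leb. rep_L1 ((\<Sum>i<n. f i) + f n) x = rep_L1 (\<Sum>i<n. f i) x + rep_L1 (f n) x"
    by (rule rep_L1_add)
  with Suc show ?case by auto
qed

instance L1 :: banach
proof
  fix X :: "nat \<Rightarrow> L1"
  assume X: "Cauchy X"
  have "\<exists>N. \<forall>m\<ge>N. \<forall>n\<ge>N. dist (X m) (X n) < (1/2)^k" for k :: nat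
    using X by (simp add: Cauchy_def)
  then obtain N where N: "\<And>k m n. m \<ge> N k \<Longrightarrow> n \<ge> N k \<Longrightarrow> dist (X m) (X n) < (1/2)^k"
    by metis
  define r where "r k = (\<Sum>i\<le>k. N i) + k" for k
  have r: "strict_mono r"
    by (simp add: strict_mono_Suc_iff r_def)
  have rN: "r k \<ge> N k" for k
    unfolding r_def by (rule trans_le_add1) (auto intro: member_le_sum)
  define d where "d n = X (r (Suc n)) - X (r n)" for n
  have d: "norm (d n) \<le> (1/2)^n" for n
  proof -
    have "r (Suc n) \<ge> N n"
      using rN[of n] strict_mono_less_eq[OF r, of n "Suc n"] by simp
    then show ?thesis
      using N[of n "r (Suc n)" "r n"] rN[of n] by (simp add: d_def dist_norm)
  qed
  define u where "u n = rep_L1 (d n)" for n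
  have u [measurable, simp]: "integrable Leb (u n)" for n
    by (simp add: u_def integrable_rep_L1)
  have nu: "norm (d n) = (\<integral>x. \<bar>u n x\<bar> \<partial>Leb)" for n
    by (simp add: u_def norm_L1_eq)
  have sm: "summable (\<lambda>n. \<integral>x. \<bar>u n x\<bar> \<partial>Leb)"
    unfolding nu[symmetric]
    by (rule summable_comparison_test'[of "\<lambda>n. (1/2)^n" 0]) (use d in auto)
  have "(\<integral>\<^sup>+x. (\<Sum>n. ennreal \<bar>u n x\<bar>) \<partial>Leb) = (\<Sum>n. \<integral>\<^sup>+x. ennreal \<bar>u n x\<bar> \<partial>Leb)"
    by (intro nn_integral_suminf) auto
  also have "\<dots> = (\<Sum>n. ennreal (\<integral>x. \<bar>u n x\<bar> \<partial>Leb))"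
    by (intro arg_cong[where f = suminf] ext nn_integral_eq_integral) auto
  also have "\<dots> \<noteq> \<infinity>"
    unfolding infinity_ennreal_def by (rule ennreal_suminf_neq_top[OF sm]) simp
  finally have "AE x in Leb. (\<Sum>n. ennreal \<bar>u n x\<bar>) \<noteq> \<infinity>"
    by (intro nn_integral_noteq_infinite) simp_all
  then have ae: "AE x in Leb. summable (\<lambda>n. \<bar>u n x\<bar>)"
  proof (rule AE_mp, intro AE_I2 impI)
    fix x assume "(\<Sum>n. ennreal \<bar>u n x\<bar>) \<noteq> \<infinity>"
    then show "summable (\<lambda>n. \<bar>u n x\<bar>)"
      unfolding infinity_ennreal_def by (intro summable_suminf_not_top) simp_all
  qed
  define S where "S x = (\<Sum>n. u n x)" for x
  define w where "w x = (\<Sum>n. \<bar>u n x\<bar>)" for x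
  have S: "integrable Leb S"
    unfolding S_def by (rule integrable_suminf) (use ae sm in auto)
  have w: "integrable Leb w"
    unfolding w_def by (rule integrable_suminf) (use ae sm in auto)
  have "(\<lambda>n. \<integral>x. \<bar>(\<Sum>i<n. u i x) - S x\<bar> \<partial>Leb) \<longlonglongrightarrow> (\<integral>x. 0 \<partial>Leb)"
  proof (rule integral_dominated_convergence[where w = "\<lambda>x. w x + \<bar>S x\<bar>"])
    show "AE x in Leb. (\<lambda>n. \<bar>(\<Sum>i<n. u i x) - S x\<bar>) \<longlonglongrightarrow> 0"
      using ae
    proof (rule AE_mp, intro AE_I2 impI)
      fix x assume "summable (\<lambda>n. \<bar>u n x\<bar>)"
      then have "(\<lambda>n. \<Sum>i<n. u i x) \<longlonglongrightarrow> S x"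
        unfolding S_def by (rule summable_LIMSEQ[OF summable_rabs_cancel])
      then have "(\<lambda>n. (\<Sum>i<n. u i x) - S x) \<longlonglongrightarrow> 0"
        by (rule LIM_zero)
      then show "(\<lambda>n. \<bar>(\<Sum>i<n. u i x) - S x\<bar>) \<longlonglongrightarrow> 0"
        by (rule tendsto_rabs_zero)
    qed
    show "AE x in Leb. norm \<bar>(\<Sum>i<n. u i x) - S x\<bar> \<le> w x + \<bar>S x\<bar>" for n
      using ae
    proof (rule AE_mp, intro AE_I2 impI)
      fix x assume *: "summable (\<lambda>n. \<bar>u n x\<bar>)"
      have "\<bar>\<Sum>i<n. u i x\<bar> \<le> (\<Sum>i<n. \<bar>u i x\<bar>)" by (rule sum_abs)
      also have "\<dots> \<le> w x" unfolding w_def by (rule sum_le_suminf[OF *]) auto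
      finally show "norm \<bar>(\<Sum>i<n. u i x) - S x\<bar> \<le> w x + \<bar>S x\<bar>" by simp
    qed
    show "(\<lambda>x. \<bar>(\<Sum>i<n. u i x) - S x\<bar>) \<in> borel_measurable Leb" for n
      using S by (intro borel_measurable_abs borel_measurable_integrable) simp
    show "integrable Leb (\<lambda>x. w x + \<bar>S x\<bar>)"
      using S w by simp
  qed simp
  then have lim: "(\<lambda>n. \<integral>x. \<bar>(\<Sum>i<n. u i x) - S x\<bar> \<partial>Leb) \<longlonglongrightarrow> 0" by simp
  have eq: "norm ((X (r n) - X (r 0)) - abs_L1 S) = (\<integral>x. \<bar>(\<Sum>i<n. u i x) - S x\<bar> \<partial>Leb)" for n
  proof -
    have "X (r n) - X (r 0) = (\<Sum>i<n. d i)"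
      by (simp add: d_def sum_lessThan_telescope[of "\<lambda>n. X (r n)"])
    moreover have "AE x in Leb. rep_L1 ((\<Sum>i<n. d i) - abs_L1 S) x = (\<Sum>i<n. u i x) - S x"
      using rep_L1_diff[of "\<Sum>i<n. d i" "abs_L1 S"] rep_L1_sum[of d n] rep_abs_L1[OF S]
    proof eventually_elim
      case (elim x)
      then show ?case by (simp only: u_def)
    qed
    ultimately have "AE x in Leb. rep_L1 ((X (r n) - X (r 0)) - abs_L1 S) x = (\<Sum>i<n. u i x) - S x"
      by (simp only:)
    then show ?thesis
      unfolding norm_L1_eq
    proof (intro integral_cong_AE)
      show "(\<lambda>x. \<bar>rep_L1 ((X (r n) - X (r 0)) - abs_L1 S) x\<bar>) \<in> borel_measurable Leb"
        by (intro borel_measurable_abs borel_measurable_integrable integrable_rep_L1)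
      show "(\<lambda>x. \<bar>(\<Sum>i<n. u i x) - S x\<bar>) \<in> borel_measurable Leb"
        using S by (intro borel_measurable_abs borel_measurable_integrable) simp
    qed (auto elim: eventually_mono)
  qed
  have "(\<lambda>n. (X (r n) - X (r 0)) - abs_L1 S) \<longlonglongrightarrow> 0"
    by (rule tendsto_norm_zero_cancel) (simp add: eq lim)
  then have "(\<lambda>n. X (r n) - (X (r 0) + abs_L1 S)) \<longlonglongrightarrow> 0"
    by (simp add: algebra_simps)
  then have "(X \<circ> r) \<longlonglongrightarrow> X (r 0) + abs_L1 S"
    unfolding comp_def by (rule LIM_zero_cancel)
  with X r show "convergent X"
    unfolding convergent_def by (blast intro: Cauchy_converges_subseq)
qed

definition nonneg_L1 :: "L1 set" where
  "nonneg_L1 = {f. AE x in Leb. 0 \<le> rep_L1 f x}"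


section \<open>Weak derivatives on \<open>(-1,1)\<close>\<close>

definition test_function :: "(real \<Rightarrow> real) \<Rightarrow> bool" where
  "test_function \<eta> \<longleftrightarrow>
     (\<forall>n x. (deriv ^^ n) \<eta> differentiable (at x)) \<and>
     (\<exists>K. compact K \<and> K \<subseteq> {-1<..<1} \<and> (\<forall>x. x \<notin> K \<longrightarrow> \<eta> x = 0))"

definition locally_integrable :: "(real \<Rightarrow> real) \<Rightarrow> bool" where
  "locally_integrable u \<longleftrightarrow> (\<forall>K. compact K \<and> K \<subseteq> {-1<..<1} \<longrightarrow> set_integrable lborel K u)"

definition has_weak_deriv :: "(real \<Rightarrow> real) \<Rightarrow> (real \<Rightarrow> real) \<Rightarrow> bool" where
  "has_weak_deriv u v \<longleftrightarrow> locally_integrable u \<and> locally_integrable v \<and>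
     (\<forall>\<eta>. test_function \<eta> \<longrightarrow>
        (LINT x:{-1<..<1}|lborel. u x * deriv \<eta> x) = - (LINT x:{-1<..<1}|lborel. v x * \<eta> x))"

text \<open>A representative of the weak derivative, meaningful only if one exists; everything below is
  invariant under almost everywhere modification of it.\<close>

definition weak_deriv :: "(real \<Rightarrow> real) \<Rightarrow> real \<Rightarrow> real" where
  "weak_deriv u = (SOME v. has_weak_deriv u v)"

definition W11 :: "(real \<Rightarrow> real) \<Rightarrow> bool" where
  "W11 f \<longleftrightarrow> set_integrable lborel {-1..1} f \<and>
     (\<exists>v. set_integrable lborel {-1..1} v \<and> has_weak_deriv f v)"


section \<open>The nonlocal operators\<close>

definition Phi :: "real measure \<Rightarrow> real \<Rightarrow> real" where
  "Phi \<phi> x = (if x > 0 then LINT y:{x<..}|lborel. measure \<phi> {y<..} else 0)"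

definition Phi_minus :: "real measure \<Rightarrow> real \<Rightarrow> real" where
  "Phi_minus \<phi> x = Phi \<phi> (- x)"

text \<open>The convolution \<open>k \<star> u\<close>, where \<open>u\<close> is extended by zero outside \<open>[-1,1]\<close>.\<close>

definition conv :: "(real \<Rightarrow> real) \<Rightarrow> (real \<Rightarrow> real) \<Rightarrow> real \<Rightarrow> real" where
  "conv k u x = (LINT y:{-1..1}|lborel. k (x - y) * u y)"

text \<open>With kernel \<open>k = \<Phi>\<^sup>\<plusminus>\<close>, \<open>partial1 k f\<close> is \<open>\<partial>\<^bsup>\<psi>-1\<^esup> f\<close> and \<open>is_partial k f g\<close> says that
  \<open>f \<in> W\<^bsup>1,1\<^esup>\<close> and \<open>\<partial>\<^bsup>\<psi>\<^esup> f = g\<close>; likewise \<open>D1\<close> and \<open>is_D\<close> for \<open>D\<^bsup>\<psi>-1\<^esup>\<close> and \<open>D\<^bsup>\<psi>\<^esup>\<close>.\<close>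

definition partial1 :: "(real \<Rightarrow> real) \<Rightarrow> (real \<Rightarrow> real) \<Rightarrow> real \<Rightarrow> real" where
  "partial1 k f = conv k (weak_deriv f)"

definition is_partial :: "(real \<Rightarrow> real) \<Rightarrow> (real \<Rightarrow> real) \<Rightarrow> (real \<Rightarrow> real) \<Rightarrow> bool" where
  "is_partial k f g \<longleftrightarrow> W11 f \<and> has_weak_deriv (partial1 k f) g"

definition D1 :: "(real \<Rightarrow> real) \<Rightarrow> (real \<Rightarrow> real) \<Rightarrow> real \<Rightarrow> real" where
  "D1 k f = weak_deriv (conv k f)"

definition is_D :: "(real \<Rightarrow> real) \<Rightarrow> (real \<Rightarrow> real) \<Rightarrow> (real \<Rightarrow> real) \<Rightarrow> bool" where
  "is_D k f g \<longleftrightarrow> has_weak_deriv (conv k f) (D1 k f) \<and> has_weak_deriv (D1 k f) g"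


section \<open>Boundary conditions and the twelve operators\<close>

text \<open>The limit of \<open>h\<close> at the endpoint \<open>e\<close> from inside \<open>(-1,1)\<close> is zero. As \<open>h\<close> is in general only
  determined up to null sets, this is the limit of a suitable representative.\<close>

definition vanishes_at :: "real \<Rightarrow> (real \<Rightarrow> real) \<Rightarrow> bool" where
  "vanishes_at e h \<longleftrightarrow>
     (\<exists>h'. (AE x in lborel. x \<in> {-1<..<1} \<longrightarrow> h' x = h x) \<and>
           (h' \<longlongrightarrow> 0) (at e within {-1<..<1}))"

datatype left_bc = Left_D | Left_N | Left_Nstar

datatype right_bc = Right_D | Right_N

definition Omega :: "left_bc \<Rightarrow> right_bc \<Rightarrow> real set" where
  "Omega L R = {-1..1} - (if L = Left_D then {-1} else {}) - (if R = Right_D then {1} else {})"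

fun backward_left_bc :: "real measure \<Rightarrow> left_bc \<Rightarrow> (real \<Rightarrow> real) \<Rightarrow> bool" where
  "backward_left_bc \<phi> Left_D f \<longleftrightarrow> vanishes_at (-1) f"
| "backward_left_bc \<phi> Left_N f \<longleftrightarrow> vanishes_at (-1) (partial1 (Phi_minus \<phi>) f)"
| "backward_left_bc \<phi> Left_Nstar f \<longleftrightarrow> vanishes_at (-1) (weak_deriv f)"

fun backward_right_bc :: "real measure \<Rightarrow> right_bc \<Rightarrow> (real \<Rightarrow> real) \<Rightarrow> bool" where
  "backward_right_bc \<phi> Right_D f \<longleftrightarrow> vanishes_at 1 f"
| "backward_right_bc \<phi> Right_N f \<longleftrightarrow> vanishes_at 1 (partial1 (Phi_minus \<phi>) f)"

definition G_minus ::
    "real measure \<Rightarrow> left_bc \<Rightarrow> right_bc \<Rightarrow> ((ival \<Rightarrow>\<^sub>C real) \<times> (ival \<Rightarrow>\<^sub>C real)) set" where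
  "G_minus \<phi> L R = {(f, g). f \<in> C0 (Omega L R) \<and> g \<in> C0 (Omega L R) \<and>
     is_partial (Phi_minus \<phi>) (fun_of f) (fun_of g) \<and>
     backward_left_bc \<phi> L (fun_of f) \<and> backward_right_bc \<phi> R (fun_of f)}"

fun is_forward ::
    "real measure \<Rightarrow> left_bc \<Rightarrow> (real \<Rightarrow> real) \<Rightarrow> (real \<Rightarrow> real) \<Rightarrow> bool" where
  "is_forward \<phi> Left_Nstar f g \<longleftrightarrow> is_D (Phi \<phi>) f g"
| "is_forward \<phi> _ f g \<longleftrightarrow> is_partial (Phi \<phi>) f g"

fun forward_left_bc :: "real measure \<Rightarrow> left_bc \<Rightarrow> (real \<Rightarrow> real) \<Rightarrow> bool" where
  "forward_left_bc \<phi> Left_D f \<longleftrightarrow> vanishes_at (-1) f"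
| "forward_left_bc \<phi> Left_N f \<longleftrightarrow> vanishes_at (-1) (partial1 (Phi \<phi>) f)"
| "forward_left_bc \<phi> Left_Nstar f \<longleftrightarrow> vanishes_at (-1) (D1 (Phi \<phi>) f)"

fun forward_right_bc :: "real measure \<Rightarrow> left_bc \<Rightarrow> right_bc \<Rightarrow> (real \<Rightarrow> real) \<Rightarrow> bool" where
  "forward_right_bc \<phi> _ Right_D f \<longleftrightarrow> vanishes_at 1 f"
| "forward_right_bc \<phi> Left_Nstar Right_N f \<longleftrightarrow> vanishes_at 1 (D1 (Phi \<phi>) f)"
| "forward_right_bc \<phi> _ Right_N f \<longleftrightarrow> vanishes_at 1 (partial1 (Phi \<phi>) f)"

definition G_plus :: "real measure \<Rightarrow> left_bc \<Rightarrow> right_bc \<Rightarrow> (L1 \<times> L1) set" where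
  "G_plus \<phi> L R = {(f, g).
     is_forward \<phi> L (rep_L1 f) (rep_L1 g) \<and>
     forward_left_bc \<phi> L (rep_L1 f) \<and> forward_right_bc \<phi> L R (rep_L1 f)}"

end

(*
The generators are identified through their resolvents. On [0,2] the kernel Phi is convolved causally,
and everything is expressed through one scale function W, whose Laplace transform is 1/(psi - l):
W' = k and Phi * k = Z with Z = 1 + l (1 * W) and V = l (1 * Z). W is obtained as a limit of discrete scale
functions: on a grid the kernel is a decreasing convex sequence, its renewal-type inverse satisfies
total positivity inequalities such as W(x - y) W(2) <= W(2 - y) W(x), and Helly's selection theorem
passes these to the limit. Each boundary value problem (l - G) f = p then has exactly one solution
f = A H - W * p, where H in {W, Z, k} is determined by one endpoint and A by the other, so that the
resolvent is an integral operator with an explicit kernel. The inequalities for W make this kernel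
nonnegative, its total mass is at most 1/l, and smooth functions corrected near one endpoint show
that the domain is dense. The Hille-Yosida theorem, proved through the backward Euler scheme with
dyadic step sizes, turns the positive contractive resolvents into the semigroups.
*)

theory Submission
  imports Defs "HOL-Probability.Helly_Selection"
begin

section \<open>Generation of contraction semigroups from resolvents\<close>

text \<open>Positivity and contractivity of the resolvents come down to a few inequalities between
  \<open>W\<close>, \<open>W'\<close> and \<open>Z\<close> on \<open>[0,2]\<close>. For Levy
  processes they would follow from fluctuation theory; here they need a direct source. On a grid
  they follow from a comparison principle for a linear recursion whose memory coefficients are
  second differences of the kernel, nonnegative because Phi is convex. The obstacle in the limit is
  the derivative \<open>k = W'\<close>: it need not stay bounded near 0, and it is not known to be
  monotone. What is monotone is the quotient \<open>k/W\<close>, so the compactness argument is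
  applied to \<open>W\<close> and to \<open>1/(1 + k/W)\<close>, which takes values in
  \<open>[0,1]\<close>. A limit of monotone functions could still jump at 0; the infinite first
  moment of the small jumps makes Phi unbounded at 0, and this forces \<open>W(0+) = 0\<close>, so
  that \<open>W\<close> is the integral of \<open>k\<close>. Reflection brings the backward
  operators into the causal form of the forward ones, and the two Green kernels are transposes of
  each other, so one set of inequalities serves all twelve operators.\<close>

locale resolvent_family =
  fixes X :: "'a::banach set" and G :: "('a \<times> 'a) set" and R :: "real \<Rightarrow> 'a \<Rightarrow> 'a" and C :: "'a set"
  assumes subspace_X: "subspace X" and closed_X: "closed X"
    and R_add: "\<And>l f g. l > 0 \<Longrightarrow> f \<in> X \<Longrightarrow> g \<in> X \<Longrightarrow> R l (f + g) = R l f + R l g"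
    and R_scale: "\<And>l c f. l > 0 \<Longrightarrow> f \<in> X \<Longrightarrow> R l (c *\<^sub>R f) = c *\<^sub>R R l f"
    and R_norm: "\<And>l f. l > 0 \<Longrightarrow> f \<in> X \<Longrightarrow> l * norm (R l f) \<le> norm f"
    and R_graph: "\<And>l f. l > 0 \<Longrightarrow> f \<in> X \<Longrightarrow> (R l f, l *\<^sub>R R l f - f) \<in> G"
    and graph_R: "\<And>l f g. l > 0 \<Longrightarrow> (f, g) \<in> G \<Longrightarrow> f \<in> X \<and> g \<in> X \<and> R l (l *\<^sub>R f - g) = f"
    and dense: "\<And>f e. f \<in> X \<Longrightarrow> e > 0 \<Longrightarrow> \<exists>u v. (u, v) \<in> G \<and> norm (f - u) < e"
    and closed_C: "closed C"
    and C_scale: "\<And>c f. c > 0 \<Longrightarrow> f \<in> C \<Longrightarrow> c *\<^sub>R f \<in> C"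
    and R_pos: "\<And>l f. l > 0 \<Longrightarrow> f \<in> X \<Longrightarrow> f \<in> C \<Longrightarrow> R l f \<in> C"
begin

text \<open>The backward Euler step \<open>(1 - h G)^-1\<close>: \<open>h\<close> is the step size
  and \<open>1/h\<close> the resolvent parameter.\<close>

definition J :: "real \<Rightarrow> 'a \<Rightarrow> 'a" where "J h f = (1 / h) *\<^sub>R R (1 / h) f"

lemma X_add: "f \<in> X \<Longrightarrow> g \<in> X \<Longrightarrow> f + g \<in> X"
  and X_diff: "f \<in> X \<Longrightarrow> g \<in> X \<Longrightarrow> f - g \<in> X"
  and X_scale: "f \<in> X \<Longrightarrow> c *\<^sub>R f \<in> X"
  using subspace_X by (auto simp: subspace_add subspace_diff subspace_scale)

lemma G_X: "(f, g) \<in> G \<Longrightarrow> f \<in> X" "(f, g) \<in> G \<Longrightarrow> g \<in> X"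
  using graph_R[of 1 f g] by auto

lemma R_X: "l > 0 \<Longrightarrow> f \<in> X \<Longrightarrow> R l f \<in> X"
  using R_graph G_X by blast

lemma J_X: "h > 0 \<Longrightarrow> f \<in> X \<Longrightarrow> J h f \<in> X"
  by (simp add: J_def R_X X_scale)

lemma J_add: "h > 0 \<Longrightarrow> f \<in> X \<Longrightarrow> g \<in> X \<Longrightarrow> J h (f + g) = J h f + J h g"
  by (simp add: J_def R_add scaleR_add_right)

lemma J_scale: "h > 0 \<Longrightarrow> f \<in> X \<Longrightarrow> J h (c *\<^sub>R f) = c *\<^sub>R J h f"
  by (simp add: J_def R_scale)

lemma J_diff: "h > 0 \<Longrightarrow> f \<in> X \<Longrightarrow> g \<in> X \<Longrightarrow> J h (f - g) = J h f - J h g"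
  using J_add[of h f "(-1) *\<^sub>R g"] J_scale[of h g "-1"] X_scale[of g "-1"] by simp

lemma J_norm: "h > 0 \<Longrightarrow> f \<in> X \<Longrightarrow> norm (J h f) \<le> norm f"
  using R_norm[of "1 / h" f] by (simp add: J_def)

lemma J_graph:
  assumes "h > 0" "f \<in> X" shows "(J h f, (1 / h) *\<^sub>R (J h f - f)) \<in> G"
proof -
  have "R (1 / h) ((1 / h) *\<^sub>R f) = J h f"
    using assms by (simp add: J_def R_scale)
  then show ?thesis
    using R_graph[of "1 / h" "(1 / h) *\<^sub>R f"] assms X_scale by (simp add: scaleR_diff_right)
qed

lemma graph_J:
  assumes "h > 0" "(f, g) \<in> G" shows "J h (f - h *\<^sub>R g) = f"
proof -
  note X = G_X[OF assms(2)]
  have "(1 / h) *\<^sub>R R (1 / h) (f - h *\<^sub>R g) = R (1 / h) ((1 / h) *\<^sub>R (f - h *\<^sub>R g))"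
    using X assms by (intro R_scale[symmetric] X_diff X_scale) auto
  also have "(1 / h) *\<^sub>R (f - h *\<^sub>R g) = (1 / h) *\<^sub>R f - g"
    using assms by (simp add: scaleR_diff_right)
  finally show ?thesis
    using graph_R[of "1 / h" f g] assms by (simp add: J_def)
qed

text \<open>Since \<open>G\<close> commutes with its resolvent, the Euler increment of a domain
  element is \<open>h\<close> times the step applied to \<open>g\<close>, hence at most
  \<open>h * norm g\<close>.\<close>

lemma J_step:
  assumes "h > 0" "(f, g) \<in> G" shows "J h f - f = h *\<^sub>R J h g"
  using graph_J[OF assms] J_diff[of h f "h *\<^sub>R g"] J_scale[of h g h] G_X[OF assms(2)] X_scale[of g h] assms(1)
  by (simp add: algebra_simps)

lemma J_G:
  assumes "h > 0" "(f, g) \<in> G" shows "(J h f, J h g) \<in> G"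
  using J_graph[OF assms(1) G_X(1)[OF assms(2)]] J_step[OF assms] assms(1) by simp

section \<open>Iterates of the backward Euler step\<close>

abbreviation Jp :: "real \<Rightarrow> nat \<Rightarrow> 'a \<Rightarrow> 'a" where "Jp h m \<equiv> J h ^^ m"

lemma Jp_X: "h > 0 \<Longrightarrow> f \<in> X \<Longrightarrow> Jp h m f \<in> X"
  by (induction m) (auto simp: J_X)

lemma Jp_add: "h > 0 \<Longrightarrow> f \<in> X \<Longrightarrow> g \<in> X \<Longrightarrow> Jp h m (f + g) = Jp h m f + Jp h m g"
  by (induction m) (auto simp: J_add Jp_X)

lemma Jp_diff: "h > 0 \<Longrightarrow> f \<in> X \<Longrightarrow> g \<in> X \<Longrightarrow> Jp h m (f - g) = Jp h m f - Jp h m g"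
  by (induction m) (auto simp: J_diff Jp_X)

lemma Jp_scale: "h > 0 \<Longrightarrow> f \<in> X \<Longrightarrow> Jp h m (c *\<^sub>R f) = c *\<^sub>R Jp h m f"
  by (induction m) (auto simp: J_scale Jp_X)

lemma Jp_norm: "h > 0 \<Longrightarrow> f \<in> X \<Longrightarrow> norm (Jp h m f) \<le> norm f"
  by (induction m) (auto intro: order_trans[OF J_norm] simp: Jp_X)

lemma Jp_G: "h > 0 \<Longrightarrow> (f, g) \<in> G \<Longrightarrow> (Jp h m f, Jp h m g) \<in> G"
  by (induction m) (auto simp: J_G)

lemma Jp_C: "h > 0 \<Longrightarrow> f \<in> X \<Longrightarrow> f \<in> C \<Longrightarrow> Jp h m f \<in> C"
  by (induction m) (auto simp: J_def Jp_X intro!: C_scale R_pos)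

lemma Jp_increment_G:
  assumes "h > 0" "(f, g) \<in> G"
  shows "norm (Jp h m f - f) \<le> real m * h * norm g"
proof (induction m)
  case (Suc m)
  note X = G_X[OF assms(2)]
  have "Jp h (Suc m) f - f = (Jp h m f - f) + h *\<^sub>R J h (Jp h m g)"
    using J_step[OF assms(1) Jp_G[OF assms, of m]] by (simp add: algebra_simps)
  also have "norm \<dots> \<le> norm (Jp h m f - f) + norm (h *\<^sub>R J h (Jp h m g))"
    by (rule norm_triangle_ineq)
  also have "norm (h *\<^sub>R J h (Jp h m g)) \<le> h * norm g"
    using assms X by (auto intro!: mult_left_mono order_trans[OF J_norm] Jp_norm Jp_X)
  finally show ?case using Suc by (simp add: algebra_simps)
qed simp

lemma Jp_diff_G:
  assumes "h > 0" "(f, g) \<in> G"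
  shows "norm (Jp h m f - Jp h n f) \<le> \<bar>real m - real n\<bar> * h * norm g"
proof -
  have *: "norm (Jp h (n + k) f - Jp h n f) \<le> real k * h * norm g" for n k
  proof -
    have "Jp h (n + k) f - Jp h n f = Jp h n (Jp h k f - f)"
      using assms by (simp add: funpow_add Jp_diff Jp_X G_X[OF assms(2)])
    then have "norm (Jp h (n + k) f - Jp h n f) \<le> norm (Jp h k f - f)"
      using Jp_norm[OF assms(1), of "Jp h k f - f" n] G_X[OF assms(2)] Jp_X[OF assms(1)] X_diff by auto
    then show ?thesis using Jp_increment_G[OF assms, of k] by linarith
  qed
  show ?thesis
  proof (cases "n \<le> m")
    case True
    then show ?thesis using *[of n "m - n"] by simp
  next
    case False
    then show ?thesis using *[of m "n - m"] by (simp add: norm_minus_commute)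
  qed
qed

text \<open>From \<open>(1 - s G)^2 = (1 - 2 s G) + s^2 G^2\<close>, two half steps solve the
  equation of one full step with a right-hand side perturbed by \<open>s^2\<close> times a bounded
  vector. This is second order only on the domain of \<open>G^2\<close>, where \<open>e\<close>
  plays the role of \<open>G^2 f\<close>.\<close>

lemma J_half_step:
  assumes "s > 0" "(f, g) \<in> G" "(g, e) \<in> G"
  shows "norm (J (2 * s) f - J s (J s f)) \<le> s\<^sup>2 * norm e"
proof -
  note X = G_X[OF assms(2)] G_X[OF assms(3)]
  define w where "w = J s (J s f)"
  define w1 where "w1 = J s (J s g)"
  define w2 where "w2 = J s (J s e)"
  have G1: "(w, w1) \<in> G" and G2: "(w1, w2) \<in> G"
    using assms by (auto simp: w_def w1_def w2_def J_G)
  have w: "J s f - f = s *\<^sub>R J s g" "w - J s f = s *\<^sub>R w1"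
    "J s g - g = s *\<^sub>R J s e" "w1 - J s g = s *\<^sub>R w2"
    using J_step assms J_G unfolding w_def w1_def w2_def by blast+
  have "w - (2 * s) *\<^sub>R w1 = f - s\<^sup>2 *\<^sub>R w2"
  proof -
    have "w = f + s *\<^sub>R (w1 - s *\<^sub>R w2) + s *\<^sub>R w1"
      using w by (simp add: algebra_simps)
    then show ?thesis by (simp add: algebra_simps power2_eq_square scaleR_2[symmetric])
  qed
  moreover have "J (2 * s) (w - (2 * s) *\<^sub>R w1) = w"
    using graph_J[OF _ G1, of "2 * s"] assms by simp
  ultimately have "w = J (2 * s) f - s\<^sup>2 *\<^sub>R J (2 * s) w2"
    using assms X by (simp add: J_diff J_scale X_scale w2_def J_X)
  then have "norm (J (2 * s) f - w) = s\<^sup>2 * norm (J (2 * s) w2)" by simp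
  also have "norm (J (2 * s) w2) \<le> norm e"
    unfolding w2_def using assms X by (auto intro!: order_trans[OF J_norm] J_norm J_X)
  finally show ?thesis using assms by (simp add: w_def mult_left_mono)
qed

text \<open>The one-step errors merely add up: \<open>J\<close> is a contraction, so every step
  carries the old error forward without enlarging it and contributes at most
  \<open>s^2 * norm e\<close>.\<close>

lemma Jp_half_step:
  assumes "s > 0" "(f, g) \<in> G" "(g, e) \<in> G"
  shows "norm (Jp (2 * s) m f - Jp s (2 * m) f) \<le> real m * s\<^sup>2 * norm e"
proof (induction m)
  case (Suc m)
  note X = G_X[OF assms(2)] G_X[OF assms(3)]
  let ?v = "Jp s (2 * m) f"
  have s2: "0 < 2 * s" using assms(1) by simp
  have eq: "Jp (2 * s) (Suc m) f - Jp s (2 * Suc m) f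
      = J (2 * s) (Jp (2 * s) m f - ?v) + (J (2 * s) ?v - J s (J s ?v))"
  proof -
    have "J (2 * s) (Jp (2 * s) m f - ?v) = J (2 * s) (Jp (2 * s) m f) - J (2 * s) ?v"
      by (rule J_diff[OF s2 Jp_X[OF s2 X(1)] Jp_X[OF assms(1) X(1)]])
    then show ?thesis by simp
  qed
  have "norm (J (2 * s) (Jp (2 * s) m f - ?v)) \<le> norm (Jp (2 * s) m f - ?v)"
    by (rule J_norm[OF s2 X_diff[OF Jp_X[OF s2 X(1)] Jp_X[OF assms(1) X(1)]]])
  moreover have "norm (J (2 * s) ?v - J s (J s ?v)) \<le> s\<^sup>2 * norm (Jp s (2 * m) e)"
    by (rule J_half_step[OF assms(1) Jp_G[OF assms(1,2)] Jp_G[OF assms(1,3)]])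
  moreover have "s\<^sup>2 * norm (Jp s (2 * m) e) \<le> s\<^sup>2 * norm e"
    by (rule mult_left_mono[OF Jp_norm[OF assms(1) X(4)]]) simp
  moreover have "real (Suc m) * s\<^sup>2 * norm e = real m * s\<^sup>2 * norm e + s\<^sup>2 * norm e"
    by (simp add: algebra_simps)
  ultimately show ?case
    unfolding eq using Suc norm_triangle_ineq[of "J (2 * s) (Jp (2 * s) m f - ?v)" "J (2 * s) ?v - J s (J s ?v)"]
    by linarith
qed simp

section \<open>The semigroup as a limit along dyadic step sizes\<close>

definition T :: "nat \<Rightarrow> real \<Rightarrow> 'a \<Rightarrow> 'a" where
  "T n t = Jp (1 / 2 ^ n) (nat \<lfloor>2 ^ n * t\<rfloor>)"

definition P :: "real \<Rightarrow> 'a \<Rightarrow> 'a" where "P t f = lim (\<lambda>n. T n t f)"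

lemma T_X: "f \<in> X \<Longrightarrow> T n t f \<in> X" by (simp add: T_def Jp_X)
lemma T_norm: "f \<in> X \<Longrightarrow> norm (T n t f) \<le> norm f" by (simp add: T_def Jp_norm)
lemma T_add: "f \<in> X \<Longrightarrow> g \<in> X \<Longrightarrow> T n t (f + g) = T n t f + T n t g" by (simp add: T_def Jp_add)
lemma T_diff: "f \<in> X \<Longrightarrow> g \<in> X \<Longrightarrow> T n t (f - g) = T n t f - T n t g" by (simp add: T_def Jp_diff)
lemma T_scale: "f \<in> X \<Longrightarrow> T n t (c *\<^sub>R f) = c *\<^sub>R T n t f" by (simp add: T_def Jp_scale)
lemma T_C: "f \<in> X \<Longrightarrow> f \<in> C \<Longrightarrow> T n t f \<in> C" by (simp add: T_def Jp_C)

text \<open>Applying \<open>J h\<close> to a domain element near \<open>f\<close> lands in the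
  domain of \<open>G^2\<close>, and for small \<open>h\<close> it moves that element by less than
  \<open>e/2\<close>.\<close>

lemma dense2:
  assumes "f \<in> X" "e > 0"
  shows "\<exists>u v w. (u, v) \<in> G \<and> (v, w) \<in> G \<and> norm (f - u) < e"
proof -
  obtain u v where uv: "(u, v) \<in> G" "norm (f - u) < e / 2"
    using dense[OF assms(1), of "e / 2"] assms(2) by auto
  define h where "h = e / (2 * (norm v + 1))"
  have h: "h > 0" using assms by (simp add: h_def add_nonneg_pos)
  have "norm (J h u - u) \<le> h * norm v"
    using Jp_increment_G[OF h uv(1), of 1] by simp
  also have "\<dots> < e / 2"
    using assms by (simp add: h_def divide_less_eq add_nonneg_pos)
  finally have *: "norm (J h u - u) < e / 2" .
  have "(J h u, J h v) \<in> G" by (rule J_G[OF h uv(1)])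
  moreover have "J h v = (1 / h) *\<^sub>R (J h u - u)" using J_step[OF h uv(1)] h by simp
  moreover have "norm (f - J h u) < e"
    using norm_triangle_ineq[of "f - u" "u - J h u"] * uv(2) by (simp add: norm_minus_commute)
  moreover have "(J h v, (1 / h) *\<^sub>R (J h v - v)) \<in> G"
    by (rule J_graph[OF h G_X(2)[OF uv(1)]])
  ultimately show ?thesis by blast
qed

text \<open>Consecutive dyadic levels differ by a geometrically small amount. Halving the step costs
  \<open>t * s / 2 * norm e\<close>; in addition the floor at the finer level may exceed twice the
  floor at the coarser one by 1, which costs one more step, \<open>s * norm g\<close>.\<close>

lemma T_convergent_G2:
  assumes "(f, g) \<in> G" "(g, e) \<in> G" "t \<ge> 0"
  shows "convergent (\<lambda>n. T n t f)"
proof -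
  note X = G_X[OF assms(1)] G_X[OF assms(2)]
  have b: "norm (T (Suc n) t f - T n t f) \<le> (norm g + t * norm e) * (1 / 2) ^ n" for n
  proof -
    define s :: real where "s = 1 / 2 ^ Suc n"
    define m where "m = nat \<lfloor>2 ^ n * t\<rfloor>"
    define m' where "m' = nat \<lfloor>2 ^ Suc n * t\<rfloor>"
    have s: "s > 0" and s2: "2 * s = 1 / 2 ^ n" by (auto simp: s_def)
    have m: "real m \<le> 2 ^ n * t" "2 ^ n * t < real m + 1"
      unfolding m_def using assms(3) by (auto simp: of_nat_nat)
    have m': "real m' \<le> 2 * (2 ^ n * t)" "2 * (2 ^ n * t) < real m' + 1"
      unfolding m'_def using assms(3) by (auto simp: of_nat_nat mult.assoc)
    have "m' \<ge> 2 * m" "m' \<le> 2 * m + 1" using m m' by linarith+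
    then have "\<bar>real m' - real (2 * m)\<bar> \<le> 1" by linarith
    have "norm (Jp s m' f - Jp s (2 * m) f) \<le> \<bar>real m' - real (2 * m)\<bar> * s * norm g"
      by (rule Jp_diff_G[OF s assms(1)])
    also have "\<dots> \<le> 1 * s * norm g"
      using \<open>\<bar>real m' - real (2 * m)\<bar> \<le> 1\<close> s by (intro mult_right_mono) auto
    finally have 1: "norm (Jp s m' f - Jp s (2 * m) f) \<le> s * norm g" by simp
    have "norm (Jp (2 * s) m f - Jp s (2 * m) f) \<le> real m * s\<^sup>2 * norm e"
      by (rule Jp_half_step[OF s assms(1,2)])
    also have "\<dots> \<le> (2 ^ n * t) * s\<^sup>2 * norm e"
      using m s by (intro mult_right_mono) auto
    also have "(2 ^ n * t) * s\<^sup>2 = t * s / 2"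
      by (simp add: s_def power2_eq_square field_simps)
    finally have 2: "norm (Jp (2 * s) m f - Jp s (2 * m) f) \<le> t * s / 2 * norm e" .
    have "T (Suc n) t f - T n t f = (Jp s m' f - Jp s (2 * m) f) - (Jp (2 * s) m f - Jp s (2 * m) f)"
      by (simp add: T_def s2 m_def m'_def s_def)
    then have "norm (T (Suc n) t f - T n t f) \<le> s * norm g + t * s / 2 * norm e"
      using norm_triangle_ineq4[of "Jp s m' f - Jp s (2 * m) f" "Jp (2 * s) m f - Jp s (2 * m) f"] 1 2
      by (simp only:)
    also have "\<dots> \<le> (norm g + t * norm e) * (2 * s)"
      using s assms(3) by (auto simp: algebra_simps intro!: add_mono)
    also have "2 * s = (1 / 2) ^ n" by (simp add: s2 power_one_over)
    finally show ?thesis .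
  qed
  have "summable (\<lambda>n. T (Suc n) t f - T n t f)"
    by (rule summable_comparison_test'[where g = "\<lambda>n. (norm g + t * norm e) * (1 / 2) ^ n" and N = 0])
      (use b in \<open>auto intro!: summable_mult summable_geometric\<close>)
  then have "(\<lambda>n. (\<Sum>i<n. T (Suc i) t f - T i t f)) \<longlonglongrightarrow> (\<Sum>i. T (Suc i) t f - T i t f)"
    by (rule summable_LIMSEQ)
  then have "(\<lambda>n. T n t f - T 0 t f) \<longlonglongrightarrow> (\<Sum>i. T (Suc i) t f - T i t f)"
    by (simp only: sum_lessThan_telescope[of "\<lambda>n. T n t f"])
  from tendsto_add[OF this tendsto_const[of "T 0 t f"]] show ?thesis
    unfolding convergent_def by auto
qed

lemma T_convergent:
  assumes "f \<in> X" "t \<ge> 0" shows "convergent (\<lambda>n. T n t f)"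
proof -
  have "Cauchy (\<lambda>n. T n t f)"
  proof (rule metric_CauchyI)
    fix e :: real assume e: "e > 0"
    obtain u v w where u: "(u, v) \<in> G" "(v, w) \<in> G" "norm (f - u) < e / 3"
      using dense2[OF assms(1), of "e / 3"] e by auto
    have X: "u \<in> X" using G_X u by blast
    have "Cauchy (\<lambda>n. T n t u)"
      using T_convergent_G2[OF u(1,2) assms(2)] by (rule convergent_Cauchy)
    then obtain N where N: "\<And>m n. m \<ge> N \<Longrightarrow> n \<ge> N \<Longrightarrow> dist (T m t u) (T n t u) < e / 3"
      using e unfolding Cauchy_def by (meson zero_less_divide_iff zero_less_numeral)
    have b: "norm (T n t f - T n t u) < e / 3" for n
      using T_norm[of "f - u" n t] T_diff[OF assms(1) X, of n t] u(3) X_diff[OF assms(1) X] by auto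
    have "dist (T m t f) (T n t f) < e" if "m \<ge> N" "n \<ge> N" for m n
      using norm_triangle_ineq[of "T m t f - T m t u" "T m t u - T n t f"]
        norm_triangle_ineq[of "T m t u - T n t u" "T n t u - T n t f"]
        b[of m] b[of n] N[OF that] by (simp add: dist_norm norm_minus_commute)
    then show "\<exists>M. \<forall>m\<ge>M. \<forall>n\<ge>M. dist (T m t f) (T n t f) < e" by blast
  qed
  then show ?thesis by (rule Cauchy_convergent)
qed

lemma T_lim: "f \<in> X \<Longrightarrow> t \<ge> 0 \<Longrightarrow> (\<lambda>n. T n t f) \<longlonglongrightarrow> P t f"
  unfolding P_def using T_convergent by (simp add: convergent_LIMSEQ_iff)

lemma P_X: "f \<in> X \<Longrightarrow> t \<ge> 0 \<Longrightarrow> P t f \<in> X"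
  by (rule closed_sequentially[OF closed_X, of "\<lambda>n. T n t f"]) (auto simp: T_X T_lim)

lemma P_C: "f \<in> X \<Longrightarrow> f \<in> C \<Longrightarrow> t \<ge> 0 \<Longrightarrow> P t f \<in> C"
  by (rule closed_sequentially[OF closed_C, of "\<lambda>n. T n t f"]) (auto simp: T_C T_lim)

lemma P_norm: "f \<in> X \<Longrightarrow> t \<ge> 0 \<Longrightarrow> norm (P t f) \<le> norm f"
  by (rule LIMSEQ_le_const2[OF tendsto_norm[OF T_lim]]) (auto simp: T_norm)

lemma P_add: "f \<in> X \<Longrightarrow> g \<in> X \<Longrightarrow> t \<ge> 0 \<Longrightarrow> P t (f + g) = P t f + P t g"
  by (rule LIMSEQ_unique[OF T_lim]) (auto simp: T_add X_add intro!: tendsto_add T_lim)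

lemma P_diff: "f \<in> X \<Longrightarrow> g \<in> X \<Longrightarrow> t \<ge> 0 \<Longrightarrow> P t (f - g) = P t f - P t g"
  by (rule LIMSEQ_unique[OF T_lim]) (auto simp: T_diff X_diff intro!: tendsto_diff T_lim)

lemma P_scale: "f \<in> X \<Longrightarrow> t \<ge> 0 \<Longrightarrow> P t (c *\<^sub>R f) = c *\<^sub>R P t f"
  by (rule LIMSEQ_unique[OF T_lim]) (auto simp: T_scale X_scale intro!: tendsto_scaleR T_lim)

lemma P_0: "f \<in> X \<Longrightarrow> P 0 f = f"
  by (rule LIMSEQ_unique[OF T_lim]) (auto simp: T_def)

lemma half_pow_lim: "(\<lambda>n. 1 / 2 ^ n :: real) \<longlonglongrightarrow> 0"
  using LIMSEQ_power_zero[of "1/2 :: real"] by (simp add: power_one_over)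

lemma P_lipschitz_G:
  assumes "(f, g) \<in> G" "t \<ge> 0" "s \<ge> 0"
  shows "norm (P t f - P s f) \<le> \<bar>t - s\<bar> * norm g"
proof (rule LIMSEQ_le)
  note X = G_X[OF assms(1)]
  show "(\<lambda>n. norm (T n t f - T n s f)) \<longlonglongrightarrow> norm (P t f - P s f)"
    using X assms by (intro tendsto_intros T_lim)
  show "(\<lambda>n. (\<bar>t - s\<bar> + 1 / 2 ^ n) * norm g) \<longlonglongrightarrow> \<bar>t - s\<bar> * norm g"
    using tendsto_mult_right[OF tendsto_add[OF tendsto_const[of "\<bar>t - s\<bar>"] half_pow_lim], of "norm g"] by simp
  have "norm (T n t f - T n s f) \<le> (\<bar>t - s\<bar> + 1 / 2 ^ n) * norm g" for n
  proof -
    let ?m = "nat \<lfloor>2 ^ n * t\<rfloor>" and ?k = "nat \<lfloor>2 ^ n * s\<rfloor>"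
    have "\<bar>real ?m - real ?k\<bar> \<le> \<bar>2 ^ n * t - 2 ^ n * s\<bar> + 1"
      using assms by (simp add: of_nat_nat) linarith
    also have "\<bar>2 ^ n * t - 2 ^ n * s\<bar> = 2 ^ n * \<bar>t - s\<bar>"
      by (simp add: abs_mult right_diff_distrib[symmetric])
    finally have "\<bar>real ?m - real ?k\<bar> * (1 / 2 ^ n) \<le> (2 ^ n * \<bar>t - s\<bar> + 1) * (1 / 2 ^ n)"
      by (intro mult_right_mono) auto
    then have "\<bar>real ?m - real ?k\<bar> * (1 / 2 ^ n) * norm g \<le> (\<bar>t - s\<bar> + 1 / 2 ^ n) * norm g"
      by (intro mult_right_mono) (auto simp: field_simps)
    then show ?thesis
      using Jp_diff_G[of "1 / 2 ^ n" f g ?m ?k] assms(1) by (simp add: T_def)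
  qed
  then show "\<exists>N. \<forall>n\<ge>N. norm (T n t f - T n s f) \<le> (\<bar>t - s\<bar> + 1 / 2 ^ n) * norm g" by blast
qed

lemma P_strongly_continuous: "strongly_continuous X P"
  unfolding strongly_continuous_def
proof
  fix f assume f: "f \<in> X"
  show "continuous_on {0..} (\<lambda>t. P t f)"
    unfolding continuous_on_iff
  proof (intro ballI allI impI)
    fix t e :: real assume t: "t \<in> {0..}" and e: "e > 0"
    obtain u v where u: "(u, v) \<in> G" "norm (f - u) < e / 3"
      using dense[OF f, of "e / 3"] e by auto
    have X: "u \<in> X" using G_X u by blast
    have b: "norm (P r f - P r u) < e / 3" if "r \<ge> 0" for r
      using P_norm[OF X_diff[OF f X] that] P_diff[OF f X that] u(2) by simp
    define d where "d = e / (3 * (norm v + 1))"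
    have d: "d > 0" using e by (simp add: d_def add_nonneg_pos)
    have "dist (P r f) (P t f) < e" if "r \<in> {0..}" "dist r t < d" for r
    proof -
      have "norm (P r u - P t u) \<le> \<bar>r - t\<bar> * norm v"
        using P_lipschitz_G[OF u(1)] that t by auto
      also have "\<dots> \<le> d * norm v"
        using that by (intro mult_right_mono) (auto simp: dist_real_def)
      also have "\<dots> < e / 3" using e by (simp add: d_def divide_less_eq add_nonneg_pos)
      finally show ?thesis
        using norm_triangle_ineq[of "P r f - P r u" "P r u - P t f"]
          norm_triangle_ineq[of "P r u - P t u" "P t u - P t f"] b[of r] b[of t] that t
        by (simp add: dist_norm norm_minus_commute)
    qed
    then show "\<exists>d>0. \<forall>r\<in>{0..}. dist r t < d \<longrightarrow> dist (P r f) (P t f) < e" using d by blast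
  qed
qed

text \<open>Rounding down \<open>s + t\<close> and rounding down the two summands differ by at most
  one step, whose effect is at most \<open>norm g / 2^n\<close> and disappears in the limit.\<close>

lemma P_semigroup_G:
  assumes "(f, g) \<in> G" "s \<ge> 0" "t \<ge> 0"
  shows "P (s + t) f = P s (P t f)"
proof -
  note X = G_X[OF assms(1)]
  have b: "norm (T n (s + t) f - T n s (T n t f)) \<le> 1 / 2 ^ n * norm g" for n
  proof -
    let ?k = "nat \<lfloor>2 ^ n * (s + t)\<rfloor>" and ?m = "nat \<lfloor>2 ^ n * s\<rfloor> + nat \<lfloor>2 ^ n * t\<rfloor>"
    have "\<bar>real ?k - real ?m\<bar> \<le> 1"
    proof -
      have "real ?k = of_int \<lfloor>2 ^ n * s + 2 ^ n * t\<rfloor>"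
        "real ?m = of_int \<lfloor>2 ^ n * s\<rfloor> + of_int \<lfloor>2 ^ n * t\<rfloor>"
        using assms by (simp_all add: distrib_left)
      moreover have "\<bar>of_int \<lfloor>a + b\<rfloor> - (of_int \<lfloor>a\<rfloor> + of_int \<lfloor>b\<rfloor>)\<bar> \<le> (1 :: real)" for a b :: real
      proof -
        have "\<bar>\<lfloor>a + b\<rfloor> - (\<lfloor>a\<rfloor> + \<lfloor>b\<rfloor>)\<bar> \<le> 1" by linarith
        then show ?thesis by linarith
      qed
      ultimately show ?thesis by (simp only:)
    qed
    then have "\<bar>real ?k - real ?m\<bar> * (1 / 2 ^ n) * norm g \<le> 1 * (1 / 2 ^ n) * norm g"
      by (intro mult_right_mono) auto
    then show ?thesis
      using Jp_diff_G[of "1 / 2 ^ n" f g ?k ?m] assms(1) by (simp add: T_def funpow_add)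
  qed
  have 1: "(\<lambda>n. T n (s + t) f - T n s (T n t f)) \<longlonglongrightarrow> 0"
    by (rule Lim_null_comparison[OF _ tendsto_mult_left_zero[OF half_pow_lim, of "norm g"]])
      (use b in auto)
  have 2: "(\<lambda>n. T n s (T n t f) - T n s (P t f)) \<longlonglongrightarrow> 0"
  proof (rule Lim_null_comparison)
    show "(\<lambda>n. norm (T n t f - P t f)) \<longlonglongrightarrow> 0"
      using T_lim[OF X(1) assms(3)] by (intro tendsto_norm_zero LIM_zero)
    show "\<forall>\<^sub>F n in sequentially. norm (T n s (T n t f) - T n s (P t f)) \<le> norm (T n t f - P t f)"
      using X assms T_norm[OF X_diff] by (auto simp: T_diff[symmetric] T_X P_X)
  qed
  have "(\<lambda>n. T n (s + t) f) \<longlonglongrightarrow> P s (P t f)"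
    using tendsto_add[OF 1 tendsto_add[OF 2 T_lim[OF P_X[OF X(1) assms(3)] assms(2)]]] by simp
  then show ?thesis using T_lim[of f "s + t"] X assms LIMSEQ_unique by force
qed

lemma P_semigroup:
  assumes f: "f \<in> X" and st: "s \<ge> 0" "t \<ge> 0"
  shows "P (s + t) f = P s (P t f)"
proof -
  have "norm (P (s + t) f - P s (P t f)) \<le> e" if e: "e > 0" for e
  proof -
    obtain u v where u: "(u, v) \<in> G" "norm (f - u) < e / 2"
      using dense[OF f, of "e / 2"] e by auto
    have X: "u \<in> X" using G_X u by blast
    have fu: "f - u \<in> X" using X f X_diff by blast
    have "P (s + t) f - P s (P t f) = P (s + t) (f - u) - P s (P t (f - u))"
      using P_semigroup_G[OF u(1) st] f X st by (simp add: P_diff P_X)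
    also have "norm \<dots> \<le> norm (P (s + t) (f - u)) + norm (P s (P t (f - u)))"
      by (rule norm_triangle_ineq4)
    also have "norm (P s (P t (f - u))) \<le> norm (P t (f - u))"
      using st fu by (intro P_norm P_X)
    finally show ?thesis
      using P_norm[OF fu, of "s + t"] P_norm[OF fu, of t] st u(2) by linarith
  qed
  from field_le_epsilon[of "norm (P (s + t) f - P s (P t f))" 0] this show ?thesis by force
qed

text \<open>A first-order expansion for \<open>f\<close> in the domain of \<open>G\<close> only. As
  \<open>g\<close> itself need not lie in the domain, it is compared with a domain element
  \<open>u\<close>, for which the iterates move slowly.\<close>

lemma Jp_first_order:
  assumes "h > 0" "(f, g) \<in> G" "(u, v) \<in> G"
  shows "norm (Jp h m f - f - (real m * h) *\<^sub>R g) \<le> real m * h * (2 * norm (g - u) + real m * h * norm v)"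
proof (induction m)
  case (Suc m)
  note X = G_X[OF assms(2)] G_X[OF assms(3)]
  have gu: "g - u \<in> X" using X X_diff by blast
  have "Jp h (Suc m) f - f - (real (Suc m) * h) *\<^sub>R g
      = (Jp h m f - f - (real m * h) *\<^sub>R g) + h *\<^sub>R (Jp h (Suc m) g - g)"
    using J_step[OF assms(1) Jp_G[OF assms(1,2), of m]] by (simp add: algebra_simps)
  also have "norm \<dots> \<le> norm (Jp h m f - f - (real m * h) *\<^sub>R g) + norm (h *\<^sub>R (Jp h (Suc m) g - g))"
    by (rule norm_triangle_ineq)
  also have "norm (h *\<^sub>R (Jp h (Suc m) g - g)) = h * norm (Jp h (Suc m) g - g)"
    using assms(1) by simp
  also have "norm (Jp h (Suc m) g - g) \<le> 2 * norm (g - u) + real (Suc m) * h * norm v"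
  proof -
    have "Jp h (Suc m) g - g = Jp h (Suc m) (g - u) - (g - u) + (Jp h (Suc m) u - u)"
      using assms X Jp_diff[OF assms(1) X(2) X(3), of "Suc m"] by simp
    also have "norm \<dots> \<le> norm (Jp h (Suc m) (g - u)) + norm (g - u) + norm (Jp h (Suc m) u - u)"
      by (rule order_trans[OF norm_triangle_ineq add_right_mono[OF norm_triangle_ineq4]])
    finally show ?thesis
      using Jp_norm[OF assms(1) gu, of "Suc m"] Jp_increment_G[OF assms(1,3), of "Suc m"] by linarith
  qed
  finally have "norm (Jp h (Suc m) f - f - (real (Suc m) * h) *\<^sub>R g)
     \<le> real m * h * (2 * norm (g - u) + real m * h * norm v) + h * (2 * norm (g - u) + real (Suc m) * h * norm v)"
    using Suc assms(1) by (auto intro: mult_left_mono)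
  also have "\<dots> \<le> real m * h * (2 * norm (g - u) + real (Suc m) * h * norm v) + h * (2 * norm (g - u) + real (Suc m) * h * norm v)"
    using assms(1) by (intro add_mono mult_left_mono mult_right_mono) auto
  finally show ?case by (simp add: algebra_simps)
qed simp

lemma P_first_order:
  assumes "(f, g) \<in> G" "(u, v) \<in> G" "t \<ge> 0"
  shows "norm (P t f - f - t *\<^sub>R g) \<le> t * (2 * norm (g - u) + t * norm v)"
proof (rule LIMSEQ_le)
  note X = G_X[OF assms(1)]
  define m where "m n = nat \<lfloor>2 ^ n * t\<rfloor>" for n
  have m: "(\<lambda>n. real (m n) * (1 / 2 ^ n)) \<longlonglongrightarrow> t"
  proof (rule real_tendsto_sandwich[of "\<lambda>n. t - 1 / 2 ^ n" _ _ "\<lambda>n. t"])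
    have "real (m n) \<le> 2 ^ n * t" "2 ^ n * t - 1 \<le> real (m n)" for n
      unfolding m_def using assms(3) by (auto simp: of_nat_nat)
    then show "\<forall>\<^sub>F n in sequentially. t - 1 / 2 ^ n \<le> real (m n) * (1 / 2 ^ n)"
      "\<forall>\<^sub>F n in sequentially. real (m n) * (1 / 2 ^ n) \<le> t"
      by (auto simp: divide_le_eq diff_le_eq le_divide_eq add_divide_distrib[symmetric] mult.commute left_diff_distrib algebra_simps)
    show "(\<lambda>n. t - 1 / 2 ^ n) \<longlonglongrightarrow> t"
      using tendsto_diff[OF tendsto_const[of t] half_pow_lim] by simp
  qed simp
  have T: "T n t f = Jp (1 / 2 ^ n) (m n) f" for n by (simp add: T_def m_def)
  show "(\<lambda>n. norm (T n t f - f - (real (m n) * (1 / 2 ^ n)) *\<^sub>R g)) \<longlonglongrightarrow> norm (P t f - f - t *\<^sub>R g)"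
    using X assms by (intro tendsto_intros T_lim m)
  show "(\<lambda>n. real (m n) * (1 / 2 ^ n) * (2 * norm (g - u) + real (m n) * (1 / 2 ^ n) * norm v))
     \<longlonglongrightarrow> t * (2 * norm (g - u) + t * norm v)"
    by (intro tendsto_intros m)
  show "\<exists>N. \<forall>n\<ge>N. norm (T n t f - f - (real (m n) * (1 / 2 ^ n)) *\<^sub>R g)
     \<le> real (m n) * (1 / 2 ^ n) * (2 * norm (g - u) + real (m n) * (1 / 2 ^ n) * norm v)"
    unfolding T by (intro exI allI impI Jp_first_order assms) simp
qed

text \<open>Divided by \<open>t\<close>, the first-order bound leaves
  \<open>2 * norm (g - u) + t * norm v\<close>: density makes the first term small, and then small
  \<open>t\<close> the second.\<close>

lemma G_subset_generator:
  assumes "(f, g) \<in> G" shows "((\<lambda>t. (P t f - f) /\<^sub>R t) \<longlongrightarrow> g) (at_right 0)"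
proof (rule tendstoI)
  fix e :: real assume e: "e > 0"
  note X = G_X[OF assms]
  obtain u v where u: "(u, v) \<in> G" "norm (g - u) < e / 4"
    using dense[OF X(2), of "e / 4"] e by auto
  define d where "d = e / (2 * (norm v + 1))"
  have d: "d > 0" using e by (simp add: d_def add_nonneg_pos)
  have "dist ((P t f - f) /\<^sub>R t) g < e" if t: "0 < t" "t < d" for t
  proof -
    have "(P t f - f) /\<^sub>R t - g = (P t f - f - t *\<^sub>R g) /\<^sub>R t"
      using t by (simp add: scaleR_diff_right)
    then have "norm ((P t f - f) /\<^sub>R t - g) = norm (P t f - f - t *\<^sub>R g) / t"
      using t by (simp add: divide_inverse mult.commute)
    also have "\<dots> \<le> 2 * norm (g - u) + t * norm v"
      using P_first_order[OF assms u(1), of t] t by (simp add: divide_le_eq mult.commute)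
    also have "t * norm v \<le> d * norm v" using t by (intro mult_right_mono) auto
    also have "d * norm v < e / 2" using e by (simp add: d_def divide_less_eq add_nonneg_pos)
    finally show ?thesis using u(2) by (simp add: dist_norm)
  qed
  then show "\<forall>\<^sub>F t in at_right 0. dist ((P t f - f) /\<^sub>R t) g < e"
    unfolding eventually_at_right_field using d by (auto intro!: exI[of _ d])
qed

lemma generator_eq: "generator X P = G"
proof (intro equalityI subsetI)
  fix x assume "x \<in> G"
  then show "x \<in> generator X P"
    unfolding generator_def using G_X G_subset_generator by (cases x) auto
next
  fix x assume "x \<in> generator X P"
  then obtain f g where x: "x = (f, g)" "f \<in> X" "g \<in> X"
    and lim: "((\<lambda>t. (P t f - f) /\<^sub>R t) \<longlongrightarrow> g) (at_right 0)"
    by (auto simp: generator_def)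
  \<comment> \<open>The generator extends \<open>G\<close>. To see that it is no larger,
    \<open>f\<close> is compared with the solution \<open>u\<close> of
    \<open>u - G u = f - g\<close>.\<close>
  define u where "u = R 1 (f - g)"
  have fg: "f - g \<in> X" using x X_diff by blast
  have u: "(u, u - (f - g)) \<in> G" using R_graph[of 1 "f - g"] fg by (simp add: u_def)
  have uX: "u \<in> X" using G_X u by blast
  define w where "w = f - u"
  have wX: "w \<in> X" using x uX X_diff by (simp add: w_def)
  have "((\<lambda>t. (P t f - f) /\<^sub>R t - (P t u - u) /\<^sub>R t) \<longlongrightarrow> g - (u - (f - g))) (at_right 0)"
    by (intro tendsto_diff lim G_subset_generator[OF u])
  moreover have "g - (u - (f - g)) = w" by (simp add: w_def)
  moreover have "\<forall>\<^sub>F t in at_right (0::real). (P t f - f) /\<^sub>R t - (P t u - u) /\<^sub>R t = (P t w - w) /\<^sub>R t"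
    using eventually_at_right_less[of 0]
    by eventually_elim (use x uX in \<open>simp add: w_def P_diff scaleR_diff_right\<close>)
  ultimately have lw: "((\<lambda>t. (P t w - w) /\<^sub>R t) \<longlongrightarrow> w) (at_right 0)"
    using Lim_transform_eventually by fastforce
  \<comment> \<open>\<open>w\<close> would be an eigenvector of the generator for the eigenvalue 1,
    so it would grow like \<open>1 + t\<close>; contractivity excludes this.\<close>
  have "norm w \<le> 0"
  proof (rule tendsto_lowerbound)
    show "((\<lambda>t. norm ((P t w - w) /\<^sub>R t - w)) \<longlongrightarrow> 0) (at_right 0)"
      using lw by (intro tendsto_norm_zero LIM_zero)
    show "\<forall>\<^sub>F t in at_right 0. norm w \<le> norm ((P t w - w) /\<^sub>R t - w)"
      using eventually_at_right_less[of 0]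
    proof eventually_elim
      case (elim t)
      have "(1 + t) * norm w = norm ((1 + t) *\<^sub>R w)" using elim by simp
      also have "(1 + t) *\<^sub>R w = P t w - t *\<^sub>R ((P t w - w) /\<^sub>R t - w)"
        using elim by (simp add: algebra_simps)
      also have "norm \<dots> \<le> norm (P t w) + norm (t *\<^sub>R ((P t w - w) /\<^sub>R t - w))"
        by (rule norm_triangle_ineq4)
      also have "norm (P t w) \<le> norm w" using P_norm wX elim by simp
      also have "norm (t *\<^sub>R ((P t w - w) /\<^sub>R t - w)) = t * norm ((P t w - w) /\<^sub>R t - w)"
        using elim by simp
      finally have "t * norm w \<le> t * norm ((P t w - w) /\<^sub>R t - w)" by (simp add: algebra_simps)
      then show ?case using elim by simp
    qed
  qed simp
  then have "f = u" by (simp add: w_def)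
  then show "x \<in> G" using u x by simp
qed

theorem hille_yosida: "generates_positive_sc_contraction_semigroup X C G"
  unfolding generates_positive_sc_contraction_semigroup_def contraction_semigroup_def
  using P_X P_add P_scale P_norm P_0 P_semigroup P_strongly_continuous P_C generator_eq
  by (intro exI[of _ P]) auto

end

section \<open>Discrete scale functions\<close>

text \<open>The equation \<open>a * k = Z\<close> for discrete convolutions, solved for its newest
  term. The double sum stops at \<open>j < n\<close>, so \<open>k n\<close> does not occur on the
  right and the scheme is explicit for every \<open>\<mu>\<close>.\<close>

fun kap :: "(nat \<Rightarrow> real) \<Rightarrow> real \<Rightarrow> nat \<Rightarrow> real" where
  "kap a \<mu> n = (1 + \<mu> * (\<Sum>j<n. \<Sum>i\<le>j. kap a \<mu> i) - (\<Sum>i\<in>{1..n}. a i * kap a \<mu> (n - i))) / a 0"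

declare kap.simps [simp del]

text \<open>Summation by parts, with \<open>u\<close> read as 0 at index -1: increments are moved
  from \<open>u\<close> to \<open>b\<close>.\<close>

lemma abel_sum:
  fixes b u :: "nat \<Rightarrow> real"
  shows "(\<Sum>i\<le>n. b i * (if i = n then u 0 else u (n - i) - u (n - Suc i)))
    = b 0 * u n - (\<Sum>i\<in>{1..n}. (b (i - 1) - b i) * u (n - i))"
proof -
  have "(\<Sum>i\<le>n. b i * (if i = n then u 0 else u (n - i) - u (n - Suc i)))
      = (\<Sum>i\<le>n. b i * u (n - i) - (if i = n then 0 else b i * u (n - Suc i)))"
    by (intro sum.cong) (auto simp: algebra_simps)
  also have "\<dots> = (\<Sum>i\<le>n. b i * u (n - i)) - (\<Sum>i\<le>n. if i = n then 0 else b i * u (n - Suc i))"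
    by (rule sum_subtractf)
  also have "(\<Sum>i\<le>n. if i = n then 0 else b i * u (n - Suc i)) = (\<Sum>i<n. b i * u (n - Suc i))"
    by (simp add: lessThan_Suc_atMost[symmetric])
  also have "\<dots> = (\<Sum>i\<in>{1..n}. b (i - 1) * u (n - i))"
    by (rule sum.reindex_bij_witness[of _ "\<lambda>i. i - 1" Suc]) auto
  also have "(\<Sum>i\<le>n. b i * u (n - i)) = b 0 * u n + (\<Sum>i\<in>{1..n}. b i * u (n - i))"
    by (simp add: atMost_atLeast0 sum.atLeast_Suc_atMost)
  finally show ?thesis by (simp add: left_diff_distrib sum_subtractf)
qed

locale scheme =
  fixes a :: "nat \<Rightarrow> real" and \<mu> :: real
  assumes a0: "a 0 > 0" and a_nonneg: "\<And>n. a n \<ge> 0" and a_dec: "\<And>n. a (Suc n) \<le> a n"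
    and a_conv: "\<And>n. a (Suc n) - a (Suc (Suc n)) \<le> a n - a (Suc n)" and \<mu>: "\<mu> > 0"
begin

definition k :: "nat \<Rightarrow> real" where "k = kap a \<mu>"
definition W :: "nat \<Rightarrow> real" where "W n = (\<Sum>i\<le>n. k i)"
definition Z :: "nat \<Rightarrow> real" where "Z n = 1 + \<mu> * (\<Sum>j<n. W j)"
text \<open>First and, in \<open>c\<close>, second differences of the kernel: monotonicity and
  convexity of \<open>a\<close> enter all recursions as nonnegativity of \<open>b\<close> and
  \<open>c\<close>. Truncated subtraction gives \<open>c 0 = 0\<close>.\<close>

definition b :: "nat \<Rightarrow> real" where "b n = a n - a (Suc n)"
definition c :: "nat \<Rightarrow> real" where "c i = b (i - 1) - b i"

lemma b_nonneg: "b n \<ge> 0" using a_dec by (simp add: b_def)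
lemma c_nonneg: "c n \<ge> 0" using a_conv[of "n - 1"] by (cases n) (simp_all add: c_def b_def)
lemma W_0: "W 0 = k 0" by (simp add: W_def)
lemma W_Suc: "W (Suc n) = W n + k (Suc n)" by (simp add: W_def)
lemma Z_0: "Z 0 = 1" by (simp add: Z_def)
lemma Z_Suc: "Z (Suc n) = Z n + \<mu> * W n" by (simp add: Z_def algebra_simps)

lemma conv_k: "(\<Sum>i\<le>n. a i * k (n - i)) = Z n"
proof -
  have "a 0 * k n = Z n - (\<Sum>i\<in>{1..n}. a i * k (n - i))"
    unfolding k_def Z_def W_def using a0 by (subst kap.simps) simp
  then show ?thesis by (simp add: atMost_atLeast0 sum.atLeast_Suc_atMost)
qed

lemma conv_W: "(\<Sum>i\<le>n. a i * W (n - i)) = (\<Sum>i\<le>n. Z i)"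
proof (induction n)
  case 0
  then show ?case using conv_k[of 0] by (simp add: W_0)
next
  case (Suc n)
  have "(\<Sum>i\<le>Suc n. a i * W (Suc n - i)) = (\<Sum>i\<le>n. a i * W (n - i)) + (\<Sum>i\<le>Suc n. a i * k (Suc n - i))"
    by (simp add: W_Suc Suc_diff_le W_0 algebra_simps sum.distrib)
  then show ?case using Suc conv_k[of "Suc n"] by simp
qed

lemma W_step: "k n = (if n = 0 then W 0 else W n - W (n - 1))"
  by (cases n) (auto simp: W_0 W_Suc)

text \<open>Differencing \<open>conv_k\<close> once yields a recursion with nonnegative
  coefficients, from which positivity of \<open>k\<close> follows by induction.\<close>

lemma k_Suc: "a 0 * k (Suc n) = \<mu> * W n + (\<Sum>i\<le>n. b i * k (n - i))"
proof -
  have "a 0 * k (Suc n) + (\<Sum>i\<le>n. a (Suc i) * k (n - i)) = Z n + \<mu> * W n"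
    using conv_k[of "Suc n"] unfolding Z_Suc sum.atMost_Suc_shift by simp
  then show ?thesis
    by (simp add: conv_k[symmetric] b_def left_diff_distrib sum_subtractf)
qed

text \<open>The same recursion after summation by parts, now in terms of \<open>W\<close> and the
  second differences \<open>c\<close>; this is the form to which the comparison principle
  applies.\<close>

lemma k_Suc': "a 0 * k (Suc n) = (\<mu> + b 0) * W n - (\<Sum>i\<in>{1..n}. c i * W (n - i))"
proof -
  have "(\<Sum>i\<le>n. b i * k (n - i)) = (\<Sum>i\<le>n. b i * (if i = n then W 0 else W (n - i) - W (n - Suc i)))"
    by (intro sum.cong) (auto simp: W_step)
  then show ?thesis
    using k_Suc[of n] abel_sum[of b n W] by (simp add: c_def algebra_simps)
qed

lemma k_pos: "k n > 0"
proof (induction n rule: less_induct)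
  case (less n)
  show ?case
  proof (cases n)
    case 0
    have "0 < a 0 * k 0" using conv_k[of 0] by (simp add: Z_0)
    then show ?thesis using a0 0 by (simp add: zero_less_mult_iff)
  next
    case (Suc m)
    have "0 < W m" unfolding W_def using less.IH Suc by (intro sum_pos) simp_all
    moreover have "0 \<le> (\<Sum>i\<le>m. b i * k (m - i))"
      by (intro sum_nonneg mult_nonneg_nonneg b_nonneg less_imp_le[OF less.IH]) (simp add: Suc)
    ultimately have "0 < a 0 * k (Suc m)" unfolding k_Suc using \<mu> by (simp add: add_pos_nonneg)
    then show ?thesis using a0 Suc by (simp add: zero_less_mult_iff)
  qed
qed

lemma W_pos: "W n > 0" unfolding W_def using k_pos by (intro sum_pos) auto
lemma W_mono: "m \<le> n \<Longrightarrow> W m \<le> W n"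
  unfolding W_def using k_pos by (intro sum_mono2) (auto intro: less_imp_le)
lemma Z_ge_1: "Z n \<ge> 1"
  unfolding Z_def using W_pos \<mu> by (simp add: sum_nonneg less_imp_le)

text \<open>A comparison principle for quotients: for a subsolution \<open>u\<close> and a
  supersolution \<open>v\<close> of the same recursion, \<open>v/u\<close> is nondecreasing. In the
  induction the past quotients are at most the present one, and the memory term enters with a minus
  sign and coefficients \<open>c >= 0\<close>, so it favours \<open>v\<close>. The recursions are
  demanded only where \<open>v > 0\<close>, because \<open>v\<close> will be a delayed sequence that
  starts with zeros.\<close>

lemma comparison:
  assumes u: "\<And>n. u n > 0" and v: "\<And>n. v n \<ge> 0"
    and du: "\<And>n. v n > 0 \<Longrightarrow> a 0 * (u (Suc n) - u n) \<le> M * u n - (\<Sum>i\<in>{1..n}. c i * u (n - i))"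
    and dv: "\<And>n. v n > 0 \<Longrightarrow> a 0 * (v (Suc n) - v n) \<ge> M * v n - (\<Sum>i\<in>{1..n}. c i * v (n - i))"
  shows "i \<le> n \<Longrightarrow> v i * u n \<le> v n * u i"
proof (induction n arbitrary: i)
  case (Suc n)
  have step: "v n * u (Suc n) \<le> v (Suc n) * u n"
  proof (cases "v n = 0")
    case True
    then show ?thesis using u[of n] v[of "Suc n"] by simp
  next
    case False
    then have vn: "v n > 0" using v[of n] by simp
    have "(\<Sum>i\<in>{1..n}. c i * v (n - i)) * u n = (\<Sum>i\<in>{1..n}. c i * (v (n - i) * u n))"
      by (simp add: sum_distrib_right mult.assoc)
    also have "\<dots> \<le> (\<Sum>i\<in>{1..n}. c i * (v n * u (n - i)))"
      using Suc.IH c_nonneg by (intro sum_mono mult_left_mono) auto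
    also have "\<dots> = (\<Sum>i\<in>{1..n}. c i * u (n - i)) * v n"
      unfolding sum_distrib_right by (intro sum.cong) (auto simp: mult_ac)
    finally have s: "(\<Sum>i\<in>{1..n}. c i * v (n - i)) * u n \<le> (\<Sum>i\<in>{1..n}. c i * u (n - i)) * v n" .
    have "a 0 * (u (Suc n) - u n) * v n \<le> (M * u n - (\<Sum>i\<in>{1..n}. c i * u (n - i))) * v n"
      using du[OF vn] vn by (intro mult_right_mono) auto
    also have "\<dots> \<le> (M * v n - (\<Sum>i\<in>{1..n}. c i * v (n - i))) * u n"
      using s by (simp add: algebra_simps)
    also have "\<dots> \<le> a 0 * (v (Suc n) - v n) * u n"
      using dv[OF vn] u[of n] by (intro mult_right_mono) auto
    finally have "a 0 * (v n * u (Suc n)) \<le> a 0 * (v (Suc n) * u n)" by (simp add: algebra_simps)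
    then show ?thesis using a0 by simp
  qed
  show ?case
  proof (cases "i = Suc n")
    case False
    then have "v i * u n \<le> v n * u i" using Suc by simp
    then have "v i * u n * u (Suc n) \<le> v n * u i * u (Suc n)"
      using u[of "Suc n"] by (intro mult_right_mono) auto
    also have "\<dots> = v n * u (Suc n) * u i" by (simp add: mult_ac)
    also have "\<dots> \<le> v (Suc n) * u n * u i"
      using step u[of i] by (intro mult_right_mono) auto
    finally have "u n * (v i * u (Suc n)) \<le> u n * (v (Suc n) * u i)" by (simp add: mult_ac)
    then show ?thesis using u[of n] by simp
  qed simp
qed simp

text \<open>Delaying by \<open>m\<close> and padding with zeros preserves the recursion from index
  \<open>m\<close> on: the memory sum loses only terms that are 0.\<close>

lemma W_shift_rec:
  assumes nm: "m \<le> n"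
  shows "(\<mu> + b 0) * (if n < m then 0 else W (n - m)) - (\<Sum>i\<in>{1..n}. c i * (if n - i < m then 0 else W (n - i - m)))
    \<le> a 0 * ((if Suc n < m then 0 else W (Suc n - m)) - (if n < m then 0 else W (n - m)))"
proof -
  define q where "q = n - m"
  have n: "n = q + m" using nm by (simp add: q_def)
  have "(\<Sum>i\<in>{1..n}. c i * (if n - i < m then 0 else W (n - i - m))) = (\<Sum>i\<in>{1..q}. c i * W (q - i))"
    by (intro sum.mono_neutral_cong_right) (auto simp: n algebra_simps)
  moreover have "a 0 * k (Suc q) = (\<mu> + b 0) * W q - (\<Sum>i\<in>{1..q}. c i * W (q - i))"
    by (rule k_Suc')
  moreover have "Suc n - m = Suc q" by (simp add: n)
  ultimately show "(\<mu> + b 0) * (if n < m then 0 else W (n - m)) - (\<Sum>i\<in>{1..n}. c i * (if n - i < m then 0 else W (n - i - m)))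
    \<le> a 0 * ((if Suc n < m then 0 else W (Suc n - m)) - (if n < m then 0 else W (n - m)))"
    using nm by (simp add: n W_Suc)
qed

text \<open>\<open>k\<close> obeys the difference of two consecutive recursions for
  \<open>W\<close>, which is available from index 1 on; hence the delay of at least 1.\<close>

lemma W_shift_k:
  assumes m: "m \<ge> 1" and "i \<le> j"
  shows "(if i < m then 0 else W (i - m)) * k j \<le> (if j < m then 0 else W (j - m)) * k i"
proof (rule comparison[where M = "\<mu> + b 0" and u = k and v = "\<lambda>i. if i < m then 0 else W (i - m)"])
  show "k n > 0" for n by (rule k_pos)
  show "0 \<le> (if n < m then 0 else W (n - m))" for n using W_pos by (simp add: less_imp_le)
next
  fix n assume "0 < (if n < m then 0 else W (n - m))"
  then have nm: "n \<ge> m" by (auto split: if_splits)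
  then obtain p where p: "n = Suc p" using m by (cases n) auto
  have "a 0 * (k (Suc n) - k n) = (\<mu> + b 0) * (W n - W p) - ((\<Sum>i\<in>{1..n}. c i * W (n - i)) - (\<Sum>i\<in>{1..p}. c i * W (p - i)))"
    using k_Suc'[of n] k_Suc'[of p] unfolding p by (simp add: algebra_simps)
  also have "W n - W p = k n" by (simp add: p W_Suc)
  also have "(\<Sum>i\<in>{1..n}. c i * W (n - i)) - (\<Sum>i\<in>{1..p}. c i * W (p - i)) = (\<Sum>i\<in>{1..n}. c i * k (n - i))"
    unfolding p by (simp add: W_0 Suc_diff_le W_Suc algebra_simps sum.distrib)
  finally show "a 0 * (k (Suc n) - k n) \<le> (\<mu> + b 0) * k n - (\<Sum>i\<in>{1..n}. c i * k (n - i))" by simp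
  show "(\<mu> + b 0) * (if n < m then 0 else W (n - m)) - (\<Sum>i\<in>{1..n}. c i * (if n - i < m then 0 else W (n - i - m)))
    \<le> a 0 * ((if Suc n < m then 0 else W (Suc n - m)) - (if n < m then 0 else W (n - m)))"
    by (rule W_shift_rec[OF nm])
qed (use assms in auto)

text \<open>The quotient of a delayed copy of \<open>W\<close> by \<open>W\<close> increases, which
  is log-concavity of \<open>W\<close>.\<close>

lemma W_shift_W:
  assumes "i \<le> j"
  shows "(if i < m then 0 else W (i - m)) * W j \<le> (if j < m then 0 else W (j - m)) * W i"
proof (rule comparison[where M = "\<mu> + b 0" and u = W and v = "\<lambda>i. if i < m then 0 else W (i - m)"])
  show "a 0 * (W (Suc n) - W n) \<le> (\<mu> + b 0) * W n - (\<Sum>i\<in>{1..n}. c i * W (n - i))" for n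
    using k_Suc'[of n] by (simp add: W_Suc)
qed (use assms W_pos W_shift_rec in \<open>auto simp: less_imp_le\<close>)

text \<open>The delay by one step compares with \<open>W (i - 1)\<close>; adding
  \<open>k i * k j\<close> on both sides turns it into \<open>W i\<close>. Thus \<open>k/W\<close>
  is nonincreasing, the monotonicity on which the later selection argument rests.\<close>

lemma k_W_dec: "i \<le> j \<Longrightarrow> W i * k j \<le> W j * k i"
proof -
  assume ij: "i \<le> j"
  show ?thesis
  proof (cases "i = 0")
    case True
    have "k j \<le> W j" unfolding W_def by (rule member_le_sum) (auto simp: k_pos less_imp_le)
    from mult_left_mono[OF this, of "k 0"] show ?thesis using k_pos[of 0] True by (simp add: W_0 mult.commute)
  next
    case False
    then have "W (i - 1) * k j \<le> W (j - 1) * k i" using W_shift_k[of 1 i j] ij by auto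
    moreover have "W i = W (i - 1) + k i" "W j = W (j - 1) + k j"
      using False ij W_step[of i] W_step[of j] by auto
    ultimately show ?thesis by (simp add: algebra_simps)
  qed
qed

text \<open>\<open>Z\<close> solves the recursion of \<open>W\<close> up to the defect
  \<open>- b n\<close>, whose sign makes \<open>Z\<close> a subsolution.\<close>

lemma Z_rec: "a 0 * (Z (Suc n) - Z n) \<le> (\<mu> + b 0) * Z n - (\<Sum>i\<in>{1..n}. c i * Z (n - i))"
proof -
    have "Z n = (\<Sum>i\<le>n. a i * (if i = n then W 0 else W (n - i) - W (n - Suc i)))"
      unfolding conv_k[symmetric] by (intro sum.cong) (auto simp: W_step)
    also have "\<dots> = a 0 * W n - (\<Sum>i\<in>{1..n}. b (i - 1) * W (n - i))"
      unfolding abel_sum b_def by simp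
    finally have 1: "a 0 * W n = Z n + (\<Sum>i\<in>{1..n}. b (i - 1) * W (n - i))" by simp
    have "b 0 * Z n - (\<Sum>i\<in>{1..n}. c i * Z (n - i))
      = (\<Sum>i\<le>n. b i * (if i = n then Z 0 else Z (n - i) - Z (n - Suc i)))"
      unfolding abel_sum c_def by simp
    \<comment> \<open>The top term \<open>b n * Z 0 = b n\<close> has no counterpart in the other
      sum; it is the defect caused by the initial value 1.\<close>
    also have "\<dots> = b n + (\<Sum>i<n. b i * (Z (n - i) - Z (n - Suc i)))"
      by (simp add: lessThan_Suc_atMost[symmetric] Z_0)
    also have "(\<Sum>i<n. b i * (Z (n - i) - Z (n - Suc i))) = (\<Sum>i<n. b i * (\<mu> * W (n - Suc i)))"
      by (intro sum.cong refl) (metis Suc_diff_Suc Z_Suc add_diff_cancel_left' lessThan_iff)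
    also have "\<dots> = (\<Sum>i\<in>{1..n}. b (i - 1) * (\<mu> * W (n - i)))"
      by (rule sum.reindex_bij_witness[of _ "\<lambda>i. i - 1" Suc]) auto
    also have "\<dots> = \<mu> * (\<Sum>i\<in>{1..n}. b (i - 1) * W (n - i))"
      by (simp add: sum_distrib_left mult_ac)
    finally have 2: "b 0 * Z n - (\<Sum>i\<in>{1..n}. c i * Z (n - i)) = b n + \<mu> * (\<Sum>i\<in>{1..n}. b (i - 1) * W (n - i))" .
    have "a 0 * (Z (Suc n) - Z n) = \<mu> * (a 0 * W n)" by (simp add: Z_Suc)
    also have "\<dots> = \<mu> * Z n + \<mu> * (\<Sum>i\<in>{1..n}. b (i - 1) * W (n - i))" unfolding 1 by (simp add: algebra_simps)
    finally show "a 0 * (Z (Suc n) - Z n) \<le> (\<mu> + b 0) * Z n - (\<Sum>i\<in>{1..n}. c i * Z (n - i))"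
      using 2 b_nonneg[of n] by (simp add: algebra_simps)
qed

lemma W_shift_Z:
  assumes "i \<le> j"
  shows "(if i < m then 0 else W (i - m)) * Z j \<le> (if j < m then 0 else W (j - m)) * Z i"
proof (rule comparison[where M = "\<mu> + b 0" and u = Z and v = "\<lambda>i. if i < m then 0 else W (i - m)"])
  show "Z n > 0" for n using Z_ge_1[of n] by simp
qed (use assms W_pos W_shift_rec Z_rec in \<open>auto simp: less_imp_le\<close>)

text \<open>The comparison without delay at two consecutive indices, expanded with
  \<open>Z (Suc n) = Z n + \<mu> * W n\<close>. The price is that \<open>k\<close> appears at the
  next index.\<close>

lemma W_sq_le: "\<mu> * (W n)\<^sup>2 \<le> k (Suc n) * Z n"
proof -
  have "W n * Z (Suc n) \<le> W (Suc n) * Z n" using W_shift_Z[of n "Suc n" 0] by simp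
  then show ?thesis by (simp add: W_Suc Z_Suc algebra_simps power2_eq_square)
qed

text \<open>Both sides are convolutions with \<open>a\<close>, namely of \<open>W\<close> and of
  \<open>k\<close>, and \<open>k_W_dec\<close> compares them term by term.\<close>

lemma k_sum_Z_le: "k n * (\<Sum>i\<le>n. Z i) \<le> W n * Z n"
proof -
  have "k n * (\<Sum>i\<le>n. Z i) = (\<Sum>i\<le>n. a i * (W (n - i) * k n))"
    unfolding conv_W[symmetric] by (simp add: sum_distrib_left mult_ac)
  also have "\<dots> \<le> (\<Sum>i\<le>n. a i * (W n * k (n - i)))"
    using a_nonneg k_W_dec by (intro sum_mono mult_left_mono) auto
  also have "\<dots> = W n * Z n"
    unfolding conv_k[symmetric] by (simp add: sum_distrib_left mult_ac)
  finally show ?thesis .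
qed

lemma W_lower: "real (Suc n) \<le> W n * (\<Sum>i\<le>n. a i)"
proof -
  have "real (Suc n) = (\<Sum>i\<le>n. 1)" by simp
  also have "\<dots> \<le> (\<Sum>i\<le>n. Z i)" by (intro sum_mono Z_ge_1)
  also have "\<dots> = (\<Sum>i\<le>n. a i * W (n - i))" by (rule conv_W[symmetric])
  also have "\<dots> \<le> (\<Sum>i\<le>n. a i * W n)" by (intro sum_mono mult_left_mono W_mono a_nonneg) auto
  finally show ?thesis by (simp add: sum_distrib_right[symmetric] mult.commute)
qed

text \<open>Growth is controlled window by window. On a window of length \<open>p\<close> the kernel
  is at least \<open>C\<close>, so the increase of \<open>W\<close> over the window is at most
  \<open>Z / C\<close>; the share of \<open>Z\<close> collected inside the window is absorbed
  because \<open>\<mu> * p <= C / 2\<close>. The bound depends only on \<open>q\<close>,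
  \<open>\<tau>\<close> and \<open>C\<close>, so it will be uniform in the mesh.\<close>

lemma W_upper:
  assumes p: "p > 0" and C: "C > 0" and ap: "\<And>i. i < p \<Longrightarrow> C \<le> a i"
    and mp: "\<mu> * real p \<le> C / 2"
  shows "n < q * p \<Longrightarrow> \<mu> * real n \<le> \<tau> \<Longrightarrow> W n \<le> ((\<lambda>x. 2 * ((1 + \<tau> / C) * x + 1 / C)) ^^ q) 0"
proof (induction q arbitrary: n)
  case (Suc q)
  \<comment> \<open>The value one window earlier, and 0 as long as the first window lasts.\<close>
  define w where "w = (if n < p then 0 else W (n - p))"
  have w0: "w \<ge> 0" unfolding w_def using W_pos by (simp add: less_imp_le)
  have tau: "\<tau> \<ge> 0" using Suc.prems(2) mult_nonneg_nonneg[OF less_imp_le[OF \<mu>] of_nat_0_le_iff[of n]] by linarith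
  have 1: "C * (W n - w) \<le> Z n"
  proof -
    have "W n - w = (\<Sum>i\<in>{i. i \<le> n \<and> i < p}. k (n - i))"
    proof (cases "n < p")
      case True
      have "W n = (\<Sum>i\<le>n. k (n - i))" unfolding W_def
        by (rule sum.reindex_bij_witness[of _ "\<lambda>i. n - i" "\<lambda>i. n - i"]) simp_all
      moreover have "{i. i \<le> n \<and> i < p} = {..n}" using True by auto
      ultimately show ?thesis using True by (simp add: w_def)
    next
      case False
      have "W n = (\<Sum>i\<le>n - p. k i) + (\<Sum>i\<in>{n - p<..n}. k i)" unfolding W_def
        using sum.union_disjoint[of "{..n - p}" "{n - p<..n}" k] ivl_disj_int(11)[of "n - p" n]
        by (simp add: ivl_disj_un disjoint_iff)
      also have "(\<Sum>i\<in>{n - p<..n}. k i) = (\<Sum>i\<in>{i. i \<le> n \<and> i < p}. k (n - i))"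
        by (rule sum.reindex_bij_witness[of _ "\<lambda>i. n - i" "\<lambda>i. n - i"]) (use False in \<open>auto intro!: diff_less_mono2\<close>)
      finally show ?thesis using False by (simp add: w_def W_def)
    qed
    then have "C * (W n - w) = (\<Sum>i\<in>{i. i \<le> n \<and> i < p}. C * k (n - i))"
      by (simp add: sum_distrib_left)
    also have "\<dots> \<le> (\<Sum>i\<in>{i. i \<le> n \<and> i < p}. a i * k (n - i))"
      using ap k_pos by (intro sum_mono mult_right_mono) (auto intro: less_imp_le)
    also have "\<dots> \<le> (\<Sum>i\<le>n. a i * k (n - i))"
      by (intro sum_mono2) (auto simp: a_nonneg less_imp_le[OF k_pos])
    finally show ?thesis by (simp add: conv_k)
  qed
  have 2: "Z n \<le> 1 + \<tau> * w + C / 2 * W n"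
  proof -
    \<comment> \<open>Terms before the last window are at most \<open>w\<close>; the remaining ones,
      at most \<open>p\<close> in number, are at most \<open>W n\<close>.\<close>
    have "(\<Sum>j<n. W j) \<le> (\<Sum>j<n. w + (if n - p < j \<or> n < p then W n else 0))"
    proof (intro sum_mono)
      fix j assume j: "j \<in> {..<n}"
      show "W j \<le> w + (if n - p < j \<or> n < p then W n else 0)"
      proof (cases "n - p < j \<or> n < p")
        case True
        then show ?thesis using W_mono[of j n] j w0 by simp
      next
        case False
        then show ?thesis using W_mono[of j "n - p"] by (simp add: w_def)
      qed
    qed
    also have "\<dots> = real n * w + real (card {j. j < n \<and> (n - p < j \<or> n < p)}) * W n"
      by (simp add: sum.distrib sum.If_cases Int_def)
    also have "\<dots> \<le> real n * w + real p * W n"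
    proof -
      have "card {j. j < n \<and> (n - p < j \<or> n < p)} \<le> card {n - p..<n}"
        by (rule card_mono) auto
      also have "\<dots> \<le> p" by simp
      finally show ?thesis using W_pos[of n] by simp
    qed
    finally have "\<mu> * (\<Sum>j<n. W j) \<le> \<mu> * (real n * w + real p * W n)" using \<mu> by simp
    also have "\<dots> = (\<mu> * real n) * w + (\<mu> * real p) * W n" by (simp add: algebra_simps)
    also have "\<dots> \<le> \<tau> * w + C / 2 * W n"
      using Suc.prems(2) mp w0 W_pos[of n] by (intro add_mono mult_right_mono) auto
    finally show ?thesis by (simp add: Z_def)
  qed
  have 3: "W n \<le> 2 * ((1 + \<tau> / C) * w + 1 / C)"
  proof -
    have "C * W n / 2 \<le> C * w + 1 + \<tau> * w" using 1 2 by (simp add: algebra_simps)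
    moreover have "C * (2 * ((1 + \<tau> / C) * w + 1 / C)) = 2 * (C * w + 1 + \<tau> * w)"
      using C by (simp add: field_simps)
    ultimately have "C * W n \<le> C * (2 * ((1 + \<tau> / C) * w + 1 / C))" by simp
    then show ?thesis using C by simp
  qed
  let ?f = "\<lambda>x. 2 * ((1 + \<tau> / C) * x + 1 / C)"
  have f0: "0 \<le> (?f ^^ q) 0" by (induction q) (use tau C in auto)
  have "w \<le> (?f ^^ q) 0"
  proof (cases "n < p")
    case False
    have "\<mu> * real (n - p) \<le> \<mu> * real n" using \<mu> by (intro mult_left_mono) auto
    then have "\<mu> * real (n - p) \<le> \<tau>" using Suc.prems(2) by linarith
    then show ?thesis using Suc.IH[of "n - p"] Suc.prems False by (auto simp: w_def)
  qed (use f0 in \<open>simp add: w_def\<close>)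
  then have "?f w \<le> ?f ((?f ^^ q) 0)"
    using tau C by (intro mult_left_mono add_mono) auto
  then show ?case using 3 by simp
qed simp

end

section \<open>Convolution on the half-line\<close>

definition full :: "(real \<Rightarrow> real) \<Rightarrow> (real \<Rightarrow> real) \<Rightarrow> real \<Rightarrow> real" where
  "full f g x = (LINT y|lborel. f (x - y) * g y)"

lemma integrable_reflect_shift:
  fixes f :: "real \<Rightarrow> real"
  assumes "integrable lborel f" shows "integrable lborel (\<lambda>y. f (x - y))"
  using lborel_integrable_real_affine[OF assms, of "-1" x] by simp

lemma integral_reflect_shift:
  fixes f :: "real \<Rightarrow> real"
  shows "(LINT y|lborel. f (x - y)) = (LINT y|lborel. f y)"
  using lborel_integral_real_affine[of "-1" f x] by simp

lemma integral_shift: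
  fixes f :: "real \<Rightarrow> real"
  shows "(LINT y|lborel. f (y - x)) = (LINT y|lborel. f y)"
  using lborel_integral_real_affine[of 1 f "-x"] by (simp add: algebra_simps)

lemma full_comm: "full f g x = full g f x"
  unfolding full_def using integral_reflect_shift[of "\<lambda>y. f (x - y) * g y" x] by (simp add: mult.commute)

lemma integrable_pair_full:
  fixes f g :: "real \<Rightarrow> real"
  assumes f: "integrable lborel f" and g: "integrable lborel g"
  shows "integrable (lborel \<Otimes>\<^sub>M lborel) (\<lambda>(x, y). f (x - y) * g y)"
proof -
  have [measurable]: "f \<in> borel_measurable borel" "g \<in> borel_measurable borel"
    using f g by (auto dest: borel_measurable_integrable)
  have shift: "integrable lborel (\<lambda>x. f (x - y))" for y
    using lborel_integrable_real_affine[OF f, of 1 "- y"] by simp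
  have "integrable (lborel \<Otimes>\<^sub>M lborel) (\<lambda>(y, x). f (x - y) * g y)"
  proof (rule lborel_pair.Fubini_integrable)
    have "(LINT x|lborel. norm (f (x - y) * g y)) = (LINT x|lborel. \<bar>f x\<bar>) * \<bar>g y\<bar>" for y
      using integral_shift[of "\<lambda>x. \<bar>f x\<bar>" y] by (simp add: abs_mult)
    then show "integrable lborel (\<lambda>y. LINT x|lborel. norm (case (y, x) of (y, x) \<Rightarrow> f (x - y) * g y))"
      using g by (simp only: prod.case) (auto intro: integrable_mult_right)
    show "AE y in lborel. integrable lborel (\<lambda>x. case (y, x) of (y, x) \<Rightarrow> f (x - y) * g y)"
      using shift by (intro AE_I2) (auto intro!: integrable_mult_left)
  qed measurable
  from lborel_pair.integrable_product_swap[OF this] show ?thesis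
    by (simp add: case_prod_beta')
qed

lemma AE_integrable_full:
  fixes f g :: "real \<Rightarrow> real"
  assumes "integrable lborel f" "integrable lborel g"
  shows "AE x in lborel. integrable lborel (\<lambda>y. f (x - y) * g y)"
  using lborel_pair.AE_integrable_fst'[OF integrable_pair_full[OF assms]] by simp

lemma integrable_full:
  assumes "integrable lborel f" "integrable lborel g"
  shows "integrable lborel (full f g)"
  using lborel_pair.integrable_fst'[OF integrable_pair_full[OF assms]] by (simp add: full_def[abs_def])

text \<open>Fubini applies at those points where the convolution of the absolute values converges,
  that is, almost everywhere.\<close>

lemma full_assoc:
  assumes f: "integrable lborel f" and g: "integrable lborel g" and h: "integrable lborel h"
  shows "AE x in lborel. full f (full g h) x = full (full f g) h x"
proof -
  have [measurable]: "f \<in> borel_measurable borel" "g \<in> borel_measurable borel" "h \<in> borel_measurable borel"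
    using f g h by (auto dest: borel_measurable_integrable)
  let ?a = "\<lambda>f x. \<bar>f x\<bar> :: real"
  have gh: "integrable lborel (full (?a g) (?a h))" using g h by (intro integrable_full) auto
  have "AE x in lborel. integrable lborel (\<lambda>y. ?a f (x - y) * full (?a g) (?a h) y)"
    using f gh by (intro AE_integrable_full) auto
  then show ?thesis
  proof eventually_elim
    fix x assume x: "integrable lborel (\<lambda>y. ?a f (x - y) * full (?a g) (?a h) y)"
    have i: "integrable (lborel \<Otimes>\<^sub>M lborel) (\<lambda>(y, z). f (x - y) * (g (y - z) * h z))"
    proof (rule lborel_pair.Fubini_integrable)
      show "integrable lborel (\<lambda>y. LINT z|lborel. norm (case (y, z) of (y, z) \<Rightarrow> f (x - y) * (g (y - z) * h z)))"
        using x by (simp add: abs_mult full_def)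
      show "AE y in lborel. integrable lborel (\<lambda>z. case (y, z) of (y, z) \<Rightarrow> f (x - y) * (g (y - z) * h z))"
        using AE_integrable_full[OF g h] by eventually_elim simp
    qed measurable
    have "full f (full g h) x = (LINT y|lborel. LINT z|lborel. f (x - y) * (g (y - z) * h z))"
      by (simp add: full_def)
    also have "\<dots> = (LINT z|lborel. LINT y|lborel. f (x - y) * (g (y - z) * h z))"
      using lborel_pair.Fubini_integral[OF i] by simp
    also have "\<dots> = (LINT z|lborel. full f g (x - z) * h z)"
    proof (intro Bochner_Integration.integral_cong refl)
      fix z
      have "(LINT y|lborel. f (x - y) * (g (y - z) * h z)) = (LINT y|lborel. f (x - y) * g (y - z)) * h z"
        by (simp add: mult.assoc[symmetric])
      also have "(LINT y|lborel. f (x - y) * g (y - z)) = (LINT y|lborel. f (x - z - y) * g y)"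
        using integral_shift[of "\<lambda>y. f (x - z - y) * g y" z] by simp
      finally show "(LINT y|lborel. f (x - y) * (g (y - z) * h z)) = full f g (x - z) * h z"
        by (simp add: full_def)
    qed
    finally show "full f (full g h) x = full (full f g) h x" by (simp add: full_def)
  qed
qed

definition cv :: "(real \<Rightarrow> real) \<Rightarrow> (real \<Rightarrow> real) \<Rightarrow> real \<Rightarrow> real" where
  "cv f g x = (LINT y:{0..x}|lborel. f (x - y) * g y)"

abbreviation L :: "(real \<Rightarrow> real) \<Rightarrow> bool" where
  "L f \<equiv> set_integrable lborel {0..2} f"

text \<open>Existence of the convolution integral at the single point \<open>x\<close>. It is
  tracked separately, since two integrable factors guarantee it only almost everywhere.\<close>

definition ci :: "(real \<Rightarrow> real) \<Rightarrow> (real \<Rightarrow> real) \<Rightarrow> real \<Rightarrow> bool" where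
  "ci f g x \<longleftrightarrow> set_integrable lborel {0..x} (\<lambda>y. f (x - y) * g y)"

definition zx :: "(real \<Rightarrow> real) \<Rightarrow> real \<Rightarrow> real" where
  "zx f x = indicator {0..2} x * f x"

lemma L_zx: "L f \<longleftrightarrow> integrable lborel (zx f)"
  by (simp add: set_integrable_def zx_def[abs_def])

lemma cv_full: "x \<le> 2 \<Longrightarrow> cv f g x = full (zx f) (zx g) x"
  unfolding cv_def full_def set_lebesgue_integral_def
  by (intro Bochner_Integration.integral_cong) (auto simp: zx_def indicator_def)

lemma ci_full: "x \<le> 2 \<Longrightarrow> ci f g x \<longleftrightarrow> integrable lborel (\<lambda>y. zx f (x - y) * zx g y)"
  unfolding ci_def set_integrable_def
  by (intro Bochner_Integration.integrable_cong) (auto simp: zx_def indicator_def)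

lemma cv_comm: "cv f g x = cv g f x"
proof -
  have "cv f g x = full (\<lambda>y. indicator {0..} y * f y) (\<lambda>y. indicator {0..} y * g y) x" for f g
    unfolding cv_def full_def set_lebesgue_integral_def
    by (intro Bochner_Integration.integral_cong) (auto simp: indicator_def)
  then show ?thesis by (simp add: full_comm)
qed

lemma ci_comm: "ci f g x \<longleftrightarrow> ci g f x"
proof -
  have *: "ci f g x \<longleftrightarrow> integrable lborel (\<lambda>y. (indicator {0..} (x - y) * f (x - y)) * (indicator {0..} y * g y))" for f g
    unfolding ci_def set_integrable_def
    by (intro Bochner_Integration.integrable_cong) (auto simp: indicator_def)
  show ?thesis
    unfolding * using integrable_reflect_shift[of "\<lambda>y. (indicator {0..} (x - y) * f (x - y)) * (indicator {0..} y * g y)" x]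
      integrable_reflect_shift[of "\<lambda>y. (indicator {0..} (x - y) * g (x - y)) * (indicator {0..} y * f y)" x]
    by (auto simp: mult.commute)
qed

lemma cv_at_0: "cv f g 0 = 0"
proof -
  have "AE y in lborel. indicator {0..0::real} y *\<^sub>R (f (0 - y) * g y) = 0"
    using AE_lborel_singleton[of 0] by eventually_elim (auto simp: indicator_def)
  then show ?thesis unfolding cv_def set_lebesgue_integral_def by (rule integral_eq_zero_AE)
qed

lemma AE_ci: assumes "L f" "L g" shows "AE x in lborel. x \<le> 2 \<longrightarrow> ci f g x"
  using AE_integrable_full[of "zx f" "zx g"] assms unfolding L_zx
  by (auto simp: ci_full elim: eventually_mono)

lemma L_cv: assumes "L f" "L g" shows "L (cv f g)"
proof -
  have "integrable lborel (\<lambda>x. indicator {0..2} x * full (zx f) (zx g) x)"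
    using integrable_full[of "zx f" "zx g"] assms unfolding L_zx
    by (intro integrable_mult_indicator[where 'b = real, unfolded real_scaleR_def]) auto
  also have "(\<lambda>x. indicator {0..2} x * full (zx f) (zx g) x) = zx (cv f g)"
    by (auto simp: fun_eq_iff zx_def cv_full indicator_def)
  finally show ?thesis by (simp add: L_zx)
qed

lemma full_zx_neg: "y < 0 \<Longrightarrow> full (zx f) (zx g) y = 0"
  unfolding full_def by (rule integral_eq_zero_AE) (auto simp: zx_def indicator_def)

lemma cv_assoc:
  assumes "L f" "L g" "L h"
  shows "AE x in lborel. x \<in> {0..2} \<longrightarrow> cv f (cv g h) x = cv (cv f g) h x"
proof -
  have "AE x in lborel. full (zx f) (full (zx g) (zx h)) x = full (full (zx f) (zx g)) (zx h) x"
    using assms unfolding L_zx by (rule full_assoc)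
  then show ?thesis
  proof eventually_elim
    case (elim x)
    show ?case
    proof
      assume x: "x \<in> {0..2}"
      have "cv f (cv g h) x = full (zx f) (full (zx g) (zx h)) x"
        unfolding cv_full[OF x[unfolded atLeastAtMost_iff, THEN conjunct2]] unfolding full_def[of "zx f"]
        using x full_zx_neg[of _ g h]
        by (intro Bochner_Integration.integral_cong refl)
          (auto simp: zx_def[of "cv g h"] indicator_def cv_full zx_def[of f])
      moreover have "cv (cv f g) h x = full (full (zx f) (zx g)) (zx h) x"
        unfolding cv_full[OF x[unfolded atLeastAtMost_iff, THEN conjunct2]] unfolding full_def[of _ "zx h"]
        using x full_zx_neg[of _ f g]
        by (intro Bochner_Integration.integral_cong refl)
          (auto simp: zx_def[of "cv f g"] indicator_def cv_full zx_def[of h])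
      ultimately show "cv f (cv g h) x = cv (cv f g) h x" using elim by simp
    qed
  qed
qed

lemma cv_cong_right:
  assumes g: "AE y in lborel. y \<in> {0..2} \<longrightarrow> g y = g' y" and x: "x \<le> 2" and L: "L f" "L g" "L g'"
  shows "cv f g x = cv f g' x"
proof -
  have m: "(\<lambda>y. zx f (x - y) * zx h y) \<in> borel_measurable lborel" if "L h" for h
  proof -
    have [measurable]: "zx f \<in> borel_measurable borel" "zx h \<in> borel_measurable borel"
      using L that by (auto simp: L_zx dest: borel_measurable_integrable)
    show ?thesis by measurable
  qed
  show ?thesis
    unfolding cv_full[OF x] full_def
    by (rule integral_cong_AE[OF m[OF L(2)] m[OF L(3)]])
      (use g in \<open>auto simp: zx_def indicator_def elim: eventually_mono\<close>)
qed

lemma cv_cong_left: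
  assumes "AE y in lborel. y \<in> {0..2} \<longrightarrow> f y = f' y" "x \<le> 2" "L f" "L f'" "L g"
  shows "cv f g x = cv f' g x"
  using cv_cong_right[of f f' x g] assms by (simp add: cv_comm)

lemma cv_cong_all:
  assumes "\<And>y. y \<in> {0..x} \<Longrightarrow> f y = f' y" "\<And>y. y \<in> {0..x} \<Longrightarrow> g y = g' y"
  shows "cv f g x = cv f' g' x"
  unfolding cv_def by (rule set_lebesgue_integral_cong) (use assms in auto)

lemma cv_add_right: "ci f g x \<Longrightarrow> ci f h x \<Longrightarrow> cv f (\<lambda>y. g y + h y) x = cv f g x + cv f h x"
  unfolding cv_def ci_def by (simp add: distrib_left set_integral_add)

lemma cv_diff_right: "ci f g x \<Longrightarrow> ci f h x \<Longrightarrow> cv f (\<lambda>y. g y - h y) x = cv f g x - cv f h x"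
  unfolding cv_def ci_def by (simp add: right_diff_distrib set_integral_diff)

lemma cv_scale_right: "cv f (\<lambda>y. c * g y) x = c * cv f g x"
  unfolding cv_def set_lebesgue_integral_def by (simp add: mult_ac)

lemma ci_scale_right: "ci f g x \<Longrightarrow> ci f (\<lambda>y. c * g y) x"
  unfolding ci_def by (simp add: mult.left_commute)

lemma ci_add_right: "ci f g x \<Longrightarrow> ci f h x \<Longrightarrow> ci f (\<lambda>y. g y + h y) x"
  unfolding ci_def by (simp add: distrib_left set_integral_add)

lemma L_continuous: "continuous_on {0..2} f \<Longrightarrow> L f"
  by (rule borel_integrable_atLeastAtMost')

lemma L_subset: "L f \<Longrightarrow> x \<le> 2 \<Longrightarrow> set_integrable lborel {0..x} f"
  by (rule set_integrable_subset) auto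

lemma L_const: "L (\<lambda>_. c)" by (rule L_continuous) auto
lemma L_add: "L f \<Longrightarrow> L g \<Longrightarrow> L (\<lambda>x. f x + g x)" by (rule set_integral_add)
lemma L_diff: "L f \<Longrightarrow> L g \<Longrightarrow> L (\<lambda>x. f x - g x)" by (rule set_integral_diff)
lemma L_scale: "L f \<Longrightarrow> L (\<lambda>x. c * f x)" by simp

lemma ci_continuous:
  assumes f: "continuous_on {0..2} f" and g: "L g" and x: "x \<le> 2"
  shows "ci f g x"
proof -
  have fL: "L f" by (rule L_continuous[OF f])
  have [measurable]: "zx f \<in> borel_measurable borel" "zx g \<in> borel_measurable borel"
    using g fL by (auto simp: L_zx dest: borel_measurable_integrable)
  have "bounded (f ` {0..2})" using f by (intro compact_imp_bounded compact_continuous_image) auto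
  then obtain B where B: "\<And>y. y \<in> {0..2} \<Longrightarrow> \<bar>f y\<bar> \<le> B"
    unfolding bounded_iff by (metis image_eqI real_norm_def)
  have "integrable lborel (\<lambda>y. zx f (x - y) * zx g y)"
  proof (rule Bochner_Integration.integrable_bound)
    show "integrable lborel (\<lambda>y. \<bar>B\<bar> * zx g y)" using g by (simp add: L_zx)
    have "norm (zx f (x - y) * zx g y) \<le> norm (\<bar>B\<bar> * zx g y)" for y
      unfolding norm_mult using B[of "x - y"] by (intro mult_right_mono) (auto simp: zx_def indicator_def)
    then show "AE y in lborel. norm (zx f (x - y) * zx g y) \<le> norm (\<bar>B\<bar> * zx g y)" by simp
  qed measurable
  then show ?thesis using x by (simp add: ci_full)
qed

lemma cv_bound:
  assumes f: "continuous_on {0..2} f" and g: "L g" and x: "x \<le> 2" and B: "\<And>y. y \<in> {0..2} \<Longrightarrow> \<bar>f y\<bar> \<le> B"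
  shows "\<bar>cv f g x\<bar> \<le> B * (LINT y:{0..2}|lborel. \<bar>g y\<bar>)"
proof -
  have B0: "B \<ge> 0" using B[of 0] by auto
  have "\<bar>cv f g x\<bar> \<le> (LINT y:{0..x}|lborel. \<bar>f (x - y) * g y\<bar>)"
    unfolding cv_def using ci_continuous[OF f g x] unfolding ci_def
    by (metis (no_types, lifting) ext real_norm_def set_integral_norm_bound)
  also have "\<dots> \<le> (LINT y:{0..2}|lborel. B * \<bar>g y\<bar>)"
    unfolding set_lebesgue_integral_def
  proof (rule integral_mono)
    show "integrable lborel (\<lambda>y. indicator {0..x} y *\<^sub>R \<bar>f (x - y) * g y\<bar>)"
      using integrable_abs[OF ci_continuous[OF f g x, unfolded ci_def set_integrable_def]] by (simp add: abs_mult)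
    show "integrable lborel (\<lambda>y. indicator {0..2} y *\<^sub>R (B * \<bar>g y\<bar>))"
    proof -
      have "integrable lborel (\<lambda>y. B * \<bar>indicator {0..2} y * g y\<bar>)"
        using g unfolding set_integrable_def by (intro integrable_mult_right integrable_abs) simp
      then show ?thesis by (simp add: abs_mult mult_ac)
    qed
    fix y show "indicator {0..x} y *\<^sub>R \<bar>f (x - y) * g y\<bar> \<le> indicator {0..2} y *\<^sub>R (B * \<bar>g y\<bar>)"
      using B[of "x - y"] x B0 by (auto simp: indicator_def abs_mult intro!: mult_right_mono)
  qed
  finally show ?thesis by (simp add: set_lebesgue_integral_def)
qed

text \<open>Dominated convergence: the integrands converge except possibly at \<open>y = x\<close>,
  where the cut-off of \<open>f\<close> at 0 may jump, and a multiple of the absolute value of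
  \<open>g\<close> dominates them.\<close>

lemma continuous_cv:
  assumes f: "continuous_on {0..2} f" and g: "L g"
  shows "continuous_on {0..2} (cv f g)"
proof -
  have fL: "L f" by (rule L_continuous[OF f])
  have [measurable]: "zx f \<in> borel_measurable borel" "zx g \<in> borel_measurable borel"
    using g fL by (auto simp: L_zx dest: borel_measurable_integrable)
  have "bounded (f ` {0..2})" using f by (intro compact_imp_bounded compact_continuous_image) auto
  then obtain B where B: "\<And>y. y \<in> {0..2} \<Longrightarrow> \<bar>f y\<bar> \<le> B"
    unfolding bounded_iff by (metis image_eqI real_norm_def)
  have "continuous_on {0..2} (full (zx f) (zx g))"
    unfolding continuous_on_def
  proof
    fix x :: real assume x: "x \<in> {0..2}"
    show "(full (zx f) (zx g) \<longlongrightarrow> full (zx f) (zx g) x) (at x within {0..2})"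
      unfolding tendsto_at_iff_sequentially comp_def
    proof (intro allI impI)
      fix X :: "nat \<Rightarrow> real" assume X: "\<forall>i. X i \<in> {0..2} - {x}" "X \<longlonglongrightarrow> x"
      show "(\<lambda>i. full (zx f) (zx g) (X i)) \<longlonglongrightarrow> full (zx f) (zx g) x"
        unfolding full_def
      proof (rule integral_dominated_convergence[where w = "\<lambda>y. \<bar>B\<bar> * \<bar>zx g y\<bar>"])
        show "integrable lborel (\<lambda>y. \<bar>B\<bar> * \<bar>zx g y\<bar>)" using g by (simp add: L_zx)
        have "norm (zx f (X i - y) * zx g y) \<le> \<bar>B\<bar> * \<bar>zx g y\<bar>" for y i
          unfolding norm_mult using B[of "X i - y"]
          by (intro mult_mono) (auto simp: zx_def indicator_def)
        then show "AE y in lborel. norm (zx f (X i - y) * zx g y) \<le> \<bar>B\<bar> * \<bar>zx g y\<bar>" for i by simp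
        show "AE y in lborel. (\<lambda>i. zx f (X i - y) * zx g y) \<longlonglongrightarrow> zx f (x - y) * zx g y"
          using AE_lborel_singleton[of x]
        proof eventually_elim
          case (elim y)
          have lim: "(\<lambda>i. X i - y) \<longlonglongrightarrow> x - y" by (intro tendsto_intros X)
          show ?case
          proof (cases "y \<in> {0..2}")
            case False
            then show ?thesis by (simp add: zx_def)
          next
            case y: True
            show ?thesis
            proof (cases "y < x")
              case True
              have "\<forall>\<^sub>F i in sequentially. X i - y > 0" using order_tendstoD(1)[OF lim, of 0] True by simp
              then have ev: "\<forall>\<^sub>F i in sequentially. X i - y \<in> {0..2}"
              proof eventually_elim
                case (elim i)
                have "X i \<in> {0..2}" using X(1) by blast
                with elim y show ?case unfolding atLeastAtMost_iff by linarith
              qed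
              have "(\<lambda>i. f (X i - y)) \<longlonglongrightarrow> f (x - y)"
                by (rule continuous_on_tendsto_compose[OF f lim _ ev]) (use True x y in auto)
              moreover have "f (x - y) = zx f (x - y)" using True x y by (simp add: zx_def)
              moreover have "\<forall>\<^sub>F i in sequentially. f (X i - y) = zx f (X i - y)"
                using ev by eventually_elim (simp add: zx_def)
              ultimately have "(\<lambda>i. zx f (X i - y)) \<longlonglongrightarrow> zx f (x - y)"
                using Lim_transform_eventually by metis
              then show ?thesis by (intro tendsto_intros)
            next
              case False
              then have "x - y < 0" using elim by simp
              then have "\<forall>\<^sub>F i in sequentially. X i - y < 0" using order_tendstoD(2)[OF lim, of 0] by simp
              then have "\<forall>\<^sub>F i in sequentially. zx f (x - y) * zx g y = zx f (X i - y) * zx g y"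
                by eventually_elim (use \<open>x - y < 0\<close> in \<open>simp add: zx_def\<close>)
              then show ?thesis by (rule Lim_transform_eventually[OF tendsto_const])
            qed
          qed
        qed
      qed measurable
    qed
  qed
  then show ?thesis by (rule continuous_on_eq) (simp add: cv_full)
qed

lemma continuous_cv': "continuous_on {0..2} g \<Longrightarrow> L f \<Longrightarrow> continuous_on {0..2} (cv f g)"
  using continuous_cv[of g f] cv_comm[of g f] by (metis ext)

section \<open>Functions determined by their integrals\<close>

lemma cv_one: "cv (\<lambda>_. 1) g x = (LINT y:{0..x}|lborel. g y)"
  by (simp add: cv_def)

lemma AE_eq_continuous:
  fixes f g :: "real \<Rightarrow> real"
  assumes ae: "AE x in lborel. x \<in> {0..2} \<longrightarrow> f x = g x"
    and c: "continuous_on {0..2} f" "continuous_on {0..2} g" and x: "x \<in> {0..2}"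
  shows "f x = g x"
proof (rule ccontr)
  assume ne: "f x \<noteq> g x"
  define d where "d y = f y - g y" for y
  have "continuous_on {0..2} d" unfolding d_def using c by (intro continuous_intros)
  moreover have "\<bar>d x\<bar> > 0" using ne by (simp add: d_def)
  ultimately obtain e where e: "e > 0" "\<And>y. y \<in> {0..2} \<Longrightarrow> dist y x < e \<Longrightarrow> dist (d y) (d x) < \<bar>d x\<bar>"
    using x unfolding continuous_on_iff by meson
  define lo where "lo = max 0 (x - e / 2)"
  define hi where "hi = min 2 (x + e / 2)"
  have lohi: "lo < hi" using x e(1) by (auto simp: lo_def hi_def)
  have "d y \<noteq> 0" if "y \<in> {lo<..<hi}" for y
  proof -
    have "y \<in> {0..2}" "dist y x < e" using that e(1) x by (auto simp: lo_def hi_def dist_real_def)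
    then show ?thesis using e(2)[of y] by (auto simp: dist_real_def)
  qed
  then have nz: "\<forall>y. y \<in> {lo<..<hi} \<longrightarrow> d y \<noteq> 0" by blast
  have "AE y in lborel. y \<notin> {lo<..<hi}"
    using ae by eventually_elim (use nz in \<open>auto simp: d_def lo_def hi_def\<close>)
  then have "{lo<..<hi} \<in> null_sets lborel" by (subst AE_iff_null_sets) auto
  then have "emeasure lborel {lo<..<hi} = 0" by auto
  then show False using lohi by simp
qed

text \<open>The positive and the negative part of \<open>p\<close> serve as densities of two finite
  measures. These agree on all half-lines, hence coincide, and densities are unique almost
  everywhere.\<close>

lemma AE_zero_of_integrals:
  assumes p: "L p" and z: "\<And>x. x \<in> {0..2} \<Longrightarrow> (LINT y:{0..x}|lborel. p y) = 0"
  shows "AE x in lborel. x \<in> {0..2} \<longrightarrow> p x = 0"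
proof -
  define q where "q = zx p"
  have q: "integrable lborel q" using p by (simp add: L_zx q_def)
  have [measurable]: "q \<in> borel_measurable borel" using q by (auto dest: borel_measurable_integrable)
  have iz: "(LINT y:{..x}|lborel. q y) = 0" for x
  proof -
    have "(LINT y:{..x}|lborel. q y) = (LINT y:{0..min x 2}|lborel. p y)"
      unfolding set_lebesgue_integral_def q_def zx_def
      by (intro Bochner_Integration.integral_cong) (auto simp: indicator_def)
    also have "\<dots> = 0" using z[of "min x 2"]
      by (cases "x < 0") (auto simp: set_lebesgue_integral_def)
    finally show ?thesis .
  qed
  have tot: "(LINT y|lborel. q y) = 0"
  proof -
    have "(LINT y|lborel. q y) = (LINT y:{..2}|lborel. q y)"
      unfolding set_lebesgue_integral_def q_def zx_def
      by (intro Bochner_Integration.integral_cong) (auto simp: indicator_def)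
    then show ?thesis using iz by simp
  qed
  have si: "set_integrable lborel A q" if "A \<in> sets borel" for A
    using integrable_mult_indicator[OF _ q, of A] that by (simp add: set_integrable_def)
  have gt: "(LINT y:{x<..}|lborel. q y) = 0" for x
  proof -
    have "(LINT y:{..x} \<union> {x<..}|lborel. q y) = (LINT y:{..x}|lborel. q y) + (LINT y:{x<..}|lborel. q y)"
      by (intro set_integral_Un si) auto
    moreover have "{..x} \<union> {x<..} = UNIV" by auto
    ultimately show ?thesis using iz[of x] tot by (simp add: set_lebesgue_integral_def)
  qed
  define P where "P = density lborel (\<lambda>x. ennreal (max 0 (q x)))"
  define N where "N = density lborel (\<lambda>x. ennreal (max 0 (- q x)))"
  have iP: "integrable lborel (\<lambda>x. max 0 (q x))" "integrable lborel (\<lambda>x. max 0 (- q x))"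
    using q by (auto intro!: integrable_max)
  have sP: "set_integrable lborel A (\<lambda>x. max 0 (q x))" "set_integrable lborel A (\<lambda>x. max 0 (- q x))"
    if "A \<in> sets borel" for A
    unfolding set_integrable_def using that by (intro integrable_mult_indicator iP; simp)+
  have dens: "emeasure (density lborel (\<lambda>x. ennreal (u x))) {x<..} = ennreal (LINT y:{x<..}|lborel. u y)"
    if "\<And>y. 0 \<le> u y" "integrable lborel u" "set_integrable lborel {x<..} u" for u :: "real \<Rightarrow> real" and x
  proof -
    have "emeasure (density lborel (\<lambda>x. ennreal (u x))) {x<..} = (\<integral>\<^sup>+y. ennreal (u y) * indicator {x<..} y \<partial>lborel)"
      using that(2) by (intro emeasure_density) auto
    also have "\<dots> = (\<integral>\<^sup>+y. ennreal (indicator {x<..} y *\<^sub>R u y) \<partial>lborel)"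
      by (intro nn_integral_cong) (auto simp: indicator_def)
    also have "\<dots> = ennreal (LINT y:{x<..}|lborel. u y)"
      unfolding set_lebesgue_integral_def
      by (rule nn_integral_eq_integral) (use that in \<open>auto simp: set_integrable_def\<close>)
    finally show ?thesis .
  qed
  have eP: "emeasure P {x<..} = ennreal (LINT y:{x<..}|lborel. max 0 (q y))"
   and eN: "emeasure N {x<..} = ennreal (LINT y:{x<..}|lborel. max 0 (- q y))" for x
  proof -
    show "emeasure P {x<..} = ennreal (LINT y:{x<..}|lborel. max 0 (q y))"
      unfolding P_def by (rule dens[OF _ iP(1) sP(1)]) auto
    show "emeasure N {x<..} = ennreal (LINT y:{x<..}|lborel. max 0 (- q y))"
      unfolding N_def by (rule dens[OF _ iP(2) sP(2)]) auto
  qed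
  have "P = N"
  proof (rule measure_eqI_lessThan)
    fix x
    have "(LINT y:{x<..}|lborel. max 0 (q y)) - (LINT y:{x<..}|lborel. max 0 (- q y)) = (LINT y:{x<..}|lborel. q y)"
      by (subst set_integral_diff(2)[symmetric]) (auto intro!: sP set_lebesgue_integral_cong)
    then show "emeasure P {x<..} = emeasure N {x<..}" using gt[of x] eP eN by simp
    show "emeasure P {x<..} < \<infinity>" using eP by simp
  qed (auto simp: P_def N_def)
  then have "AE x in lborel. ennreal (max 0 (q x)) = ennreal (max 0 (- q x))"
    unfolding P_def N_def by (subst (asm) sigma_finite_measure.density_unique_iff[OF sigma_finite_lborel]) auto
  then have "AE x in lborel. q x = 0"
  proof eventually_elim
    fix x assume "ennreal (max 0 (q x)) = ennreal (max 0 (- q x))"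
    then have "max 0 (q x) = max 0 (- q x)" by (subst (asm) ennreal_inj) auto
    then show "q x = 0" by (auto simp: max_def split: if_splits)
  qed
  then show ?thesis by eventually_elim (auto simp: q_def zx_def)
qed

lemma L_cv_one_cong:
  assumes "L p" "L q" "\<And>x. x \<in> {0..2} \<Longrightarrow> cv (\<lambda>_. 1) p x = cv (\<lambda>_. 1) q x"
  shows "AE x in lborel. x \<in> {0..2} \<longrightarrow> p x = q x"
proof -
  have "AE x in lborel. x \<in> {0..2} \<longrightarrow> p x - q x = 0"
  proof (rule AE_zero_of_integrals[OF L_diff[OF assms(1,2)]])
    fix x :: real assume x: "x \<in> {0..2}"
    have "(LINT y:{0..x}|lborel. p y - q y) = (LINT y:{0..x}|lborel. p y) - (LINT y:{0..x}|lborel. q y)"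
      by (rule set_integral_diff(2)[OF L_subset[OF assms(1)] L_subset[OF assms(2)]]) (use x in auto)
    then show "(LINT y:{0..x}|lborel. p y - q y) = 0" using assms(3)[OF x] by (simp add: cv_one)
  qed
  then show ?thesis by auto
qed

lemma cv_mono:
  assumes "ci f g x" "ci f h x" "\<And>y. 0 \<le> y \<Longrightarrow> y \<le> x \<Longrightarrow> f y \<ge> 0"
    and "AE y in lborel. y \<in> {0..x} \<longrightarrow> g y \<le> h y"
  shows "cv f g x \<le> cv f h x"
  unfolding cv_def using assms(1,2) unfolding ci_def
proof (rule set_integral_mono_AE)
  show "AE y \<in> {0..x} in lborel. f (x - y) * g y \<le> f (x - y) * h y"
    using assms(4) by eventually_elim (use assms(3) in \<open>auto intro: mult_left_mono\<close>)
qed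

lemma cv_nonneg:
  assumes "AE y in lborel. y \<in> {0..x} \<longrightarrow> f (x - y) * g y \<ge> 0" shows "cv f g x \<ge> 0"
  unfolding cv_def set_lebesgue_integral_def
proof (rule integral_nonneg_AE)
  show "AE y in lborel. 0 \<le> indicator {0..x} y *\<^sub>R (f (x - y) * g y)"
    using assms by eventually_elim (auto simp: indicator_def)
qed

section \<open>The kernel\<close>

text \<open>The properties of Phi from which the scale functions are built. Convexity is put as a
  second difference with equal steps, the form that averages over cells of equal length
  inherit.\<close>

locale kernel =
  fixes F :: "real \<Rightarrow> real"
  assumes F_meas [measurable]: "F \<in> borel_measurable borel"
    and F_zero: "\<And>x. x \<le> 0 \<Longrightarrow> F x = 0"
    and F_nonneg: "\<And>x. F x \<ge> 0"
    and F_dec: "\<And>x y. 0 < x \<Longrightarrow> x \<le> y \<Longrightarrow> F y \<le> F x"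
    and F_conv: "\<And>x h. 0 < x \<Longrightarrow> 0 \<le> h \<Longrightarrow> 2 * F (x + h) \<le> F x + F (x + 2 * h)"
    and F_int: "\<And>M. set_integrable lborel {0..M} F"
    and F_unb: "\<And>M. \<exists>x>0. F x > M"

locale levy_measure =
  fixes \<phi> :: "real measure"
  assumes sets_phi: "sets \<phi> = sets (restrict_space borel {0<..})"
    and fin: "(\<integral>\<^sup>+ z. ennreal (min (z\<^sup>2) z) \<partial>\<phi>) < \<infinity>"
    and inf: "(\<integral>\<^sup>+ z \<in> {0<..<1}. ennreal z \<partial>\<phi>) = \<infinity>"
begin

lemma space_phi: "space \<phi> = {0<..}"
  using sets_eq_imp_space_eq[OF sets_phi] by simp

lemma measurable_id_phi [measurable]: "(\<lambda>z. z) \<in> borel_measurable \<phi>"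
  unfolding measurable_cong_sets[OF sets_phi refl] by (intro measurable_restrict_space1) simp

lemma set_phi: "A \<in> sets borel \<Longrightarrow> A \<subseteq> {0<..} \<Longrightarrow> A \<in> sets \<phi>"
  unfolding sets_phi sets_restrict_space by blast

text \<open>\<open>ennreal\<close> truncates negative numbers to 0, so this is the integral of the
  positive part of \<open>z - x\<close>; by Fubini it equals \<open>Phi\<close> at
  \<open>x > 0\<close>.\<close>

definition E :: "real \<Rightarrow> ennreal" where "E x = (\<integral>\<^sup>+ z. ennreal (z - x) \<partial>\<phi>)"

lemma E_finite: assumes "x > 0" shows "E x < \<infinity>"
proof -
  \<comment> \<open>The factor trades \<open>z\<close> for \<open>z^2\<close> on small jumps: where
    \<open>z > x\<close>, one has \<open>z <= z^2 / x\<close>.\<close>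
  have "E x \<le> (\<integral>\<^sup>+ z. ennreal (max 1 (1 / x)) * ennreal (min (z\<^sup>2) z) \<partial>\<phi>)"
    unfolding E_def
  proof (rule nn_integral_mono)
    fix z assume "z \<in> space \<phi>"
    then have z: "z > 0" by (simp add: space_phi)
    have "z - x \<le> max 1 (1 / x) * min (z\<^sup>2) z"
    proof (cases "z \<le> x")
      case True
      moreover have "0 \<le> max 1 (1 / x) * min (z\<^sup>2) z" using z by simp
      ultimately show ?thesis by linarith
    next
      case zx: False
      show ?thesis
      proof (cases "z \<le> 1")
        case True
        then have m: "min (z\<^sup>2) z = z\<^sup>2" using z by (simp add: power2_eq_square min_def mult_le_one)
        have "z - x \<le> z" using assms by simp
        also have "z \<le> (1 / x) * z\<^sup>2"
          using zx z assms by (simp add: power2_eq_square field_simps)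
        also have "\<dots> \<le> max 1 (1 / x) * z\<^sup>2" by (intro mult_right_mono) auto
        finally show ?thesis by (simp add: m)
      next
        case False
        then have m: "min (z\<^sup>2) z = z" using z by (simp add: power2_eq_square min_def)
        have "z - x \<le> 1 * z" using assms by simp
        also have "\<dots> \<le> max 1 (1 / x) * z" using z by (intro mult_right_mono) auto
        finally show ?thesis by (simp add: m)
      qed
    qed
    then show "ennreal (z - x) \<le> ennreal (max 1 (1 / x)) * ennreal (min (z\<^sup>2) z)"
      using z by (subst ennreal_mult[symmetric]) (auto intro: ennreal_leI)
  qed
  also have "\<dots> = ennreal (max 1 (1 / x)) * (\<integral>\<^sup>+ z. ennreal (min (z\<^sup>2) z) \<partial>\<phi>)"
    by (rule nn_integral_cmult) measurable
  also have "\<dots> < \<infinity>" using fin by (simp add: ennreal_mult_less_top)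
  finally show ?thesis .
qed

text \<open>Markov's inequality: for \<open>z > y\<close> the integrand of \<open>E (y / 2)\<close>
  exceeds \<open>y / 2\<close>.\<close>

lemma emeasure_tail: assumes "y > 0" shows "emeasure \<phi> {y<..} < \<infinity>"
proof -
  have "ennreal (y / 2) * emeasure \<phi> {y<..} = (\<integral>\<^sup>+ z. ennreal (y / 2) * indicator {y<..} z \<partial>\<phi>)"
    using assms by (subst nn_integral_cmult_indicator) (auto intro!: set_phi)
  also have "\<dots> \<le> E (y / 2)"
    unfolding E_def by (rule nn_integral_mono) (auto simp: indicator_def intro!: ennreal_leI)
  also have "\<dots> < \<infinity>" using assms by (intro E_finite) simp
  finally show ?thesis
    using assms by (auto simp: ennreal_mult_less_top)
qed

lemma sigma_finite_phi: "sigma_finite_measure \<phi>"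
proof
  let ?A = "(\<lambda>n::nat. {1 / real (Suc n)<..}) ` UNIV"
  have "\<Union>?A = space \<phi>"
  proof (intro equalityI subsetI)
    fix z assume "z \<in> space \<phi>"
    then obtain n where "inverse (real (Suc n)) < z" using reals_Archimedean[of z] by (auto simp: space_phi)
    then show "z \<in> \<Union>?A" by (auto simp: divide_inverse)
  qed (auto simp: space_phi intro: less_trans[rotated] order_le_less_trans[rotated])
  moreover have "?A \<subseteq> sets \<phi>"
    by (auto intro!: set_phi intro: order_le_less_trans[rotated])
  moreover have "\<forall>a\<in>?A. emeasure \<phi> a \<noteq> \<infinity>"
    using emeasure_tail by (auto simp: less_top)
  ultimately show "\<exists>A. countable A \<and> A \<subseteq> sets \<phi> \<and> \<Union>A = space \<phi> \<and> (\<forall>a\<in>A. emeasure \<phi> a \<noteq> \<infinity>)"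
    by (intro exI[of _ ?A]) auto
qed

sublocale pair_sigma_finite lborel \<phi>
  by (intro pair_sigma_finite.intro sigma_finite_lborel sigma_finite_phi)

text \<open>The tail of the measure as an integral of a jointly measurable function, ready for
  Fubini.\<close>

definition tail :: "real \<Rightarrow> ennreal" where
  "tail y = (\<integral>\<^sup>+ z. (if y < z then 1 else 0) \<partial>\<phi>)"

lemma tail_measurable [measurable]: "tail \<in> borel_measurable borel"
proof -
  have "(\<lambda>y. \<integral>\<^sup>+ z. (if y < z then 1 else 0) \<partial>\<phi>) \<in> borel_measurable lborel"
    by (rule M2.borel_measurable_nn_integral) measurable
  then show ?thesis by (simp add: tail_def[abs_def])
qed

lemma tail_eq: assumes "y > 0" shows "tail y = emeasure \<phi> {y<..}"
proof -
  have "tail y = (\<integral>\<^sup>+ z. indicator {y<..} z \<partial>\<phi>)"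
    unfolding tail_def by (intro nn_integral_cong) auto
  also have "\<dots> = emeasure \<phi> {y<..}"
    using assms by (intro nn_integral_indicator set_phi) auto
  finally show ?thesis .
qed

lemma nn_integral_tail: "(\<integral>\<^sup>+ y. indicator {x<..} y * tail y \<partial>lborel) = E x"
proof -
  have "(\<integral>\<^sup>+ y. indicator {x<..} y * tail y \<partial>lborel)
      = (\<integral>\<^sup>+ y. \<integral>\<^sup>+ z. (if x < y \<and> y < z then 1 else 0) \<partial>\<phi> \<partial>lborel)"
    unfolding tail_def by (intro nn_integral_cong) (auto simp: indicator_def)
  also have "\<dots> = (\<integral>\<^sup>+ z. \<integral>\<^sup>+ y. (if x < y \<and> y < z then 1 else 0) \<partial>lborel \<partial>\<phi>)"
    by (rule Fubini'[symmetric]) measurable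
  also have "\<dots> = E x"
    unfolding E_def
  proof (rule nn_integral_cong)
    fix z
    have "(\<integral>\<^sup>+ y. (if x < y \<and> y < z then 1 else 0) \<partial>lborel) = (\<integral>\<^sup>+ y. indicator {x<..<z} y \<partial>lborel)"
      by (intro nn_integral_cong) auto
    also have "\<dots> = ennreal (z - x)"
      by (cases "x \<le> z") (auto simp: ennreal_neg)
    finally show "(\<integral>\<^sup>+ y. (if x < y \<and> y < z then 1 else 0) \<partial>lborel) = ennreal (z - x)" .
  qed
  finally show ?thesis .
qed

lemma Phi_eq: assumes x: "x > 0" shows "Phi \<phi> x = enn2real (E x)"
proof -
  have eq: "indicator {x<..} y *\<^sub>R measure \<phi> {y<..} = indicator {x<..} y * enn2real (tail y)" for y
    using x by (auto simp: indicator_def tail_eq measure_def)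
  have "Phi \<phi> x = (LINT y|lborel. indicator {x<..} y * enn2real (tail y))"
    using x by (simp add: Phi_def set_lebesgue_integral_def eq del: real_scaleR_def)
  also have "\<dots> = enn2real (\<integral>\<^sup>+ y. ennreal (indicator {x<..} y * enn2real (tail y)) \<partial>lborel)"
    by (rule integral_eq_nn_integral) auto
  also have "(\<integral>\<^sup>+ y. ennreal (indicator {x<..} y * enn2real (tail y)) \<partial>lborel)
      = (\<integral>\<^sup>+ y. indicator {x<..} y * tail y \<partial>lborel)"
    using x emeasure_tail by (intro nn_integral_cong) (auto simp: indicator_def tail_eq less_top)
  finally show ?thesis by (simp add: nn_integral_tail)
qed

lemma ennreal_Phi: "x > 0 \<Longrightarrow> ennreal (Phi \<phi> x) = E x"
  using E_finite[of x] by (simp add: Phi_eq less_top)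

lemma E_measurable [measurable]: "E \<in> borel_measurable borel"
proof -
  have "(\<lambda>x. \<integral>\<^sup>+ z. ennreal (z - x) \<partial>\<phi>) \<in> borel_measurable lborel"
    by (rule M2.borel_measurable_nn_integral) measurable
  then show ?thesis by (simp add: E_def[abs_def])
qed

lemma Phi_eq': "Phi \<phi> = (\<lambda>x. if x > 0 then enn2real (E x) else 0)"
proof
  show "Phi \<phi> x = (if x > 0 then enn2real (E x) else 0)" for x
    using Phi_eq[of x] by (cases "x > 0") (simp_all add: Phi_def)
qed

text \<open>Everything is read off from the integral of the positive part of \<open>z - x\<close>:
  it is decreasing and convex in \<open>x\<close>, its integral over a bounded interval is
  controlled by \<open>min (z^2) z\<close>, and as \<open>x\<close> decreases to 0 it increases to
  the infinite first moment.\<close>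

lemma kernel_Phi: "kernel (Phi \<phi>)"
proof
  show [measurable]: "Phi \<phi> \<in> borel_measurable borel" unfolding Phi_eq' by measurable
  show "Phi \<phi> x = 0" if "x \<le> 0" for x using that by (simp add: Phi_def)
  show nonneg: "0 \<le> Phi \<phi> x" for x by (simp add: Phi_eq')
  show "Phi \<phi> y \<le> Phi \<phi> x" if "0 < x" "x \<le> y" for x y
  proof -
    have "E y \<le> E x" unfolding E_def using that by (intro nn_integral_mono ennreal_leI) auto
    then show ?thesis using that nonneg[of x] by (simp add: ennreal_Phi[symmetric])
  qed
  show "2 * Phi \<phi> (x + h) \<le> Phi \<phi> x + Phi \<phi> (x + 2 * h)" if xh: "0 < x" "0 \<le> h" for x h
  proof -
    have "2 * E (x + h) = (\<integral>\<^sup>+ z. 2 * ennreal (z - (x + h)) \<partial>\<phi>)"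
      unfolding E_def by (rule nn_integral_cmult[symmetric]) measurable
    also have "\<dots> \<le> (\<integral>\<^sup>+ z. ennreal (z - x) + ennreal (z - (x + 2 * h)) \<partial>\<phi>)"
    proof (rule nn_integral_mono)
      fix z
      have *: "ennreal u = ennreal (max 0 u)" for u by (auto simp: max_def ennreal_neg)
      have "2 * ennreal (z - (x + h)) = ennreal (2 * max 0 (z - (x + h)))"
        by (subst *) (simp add: ennreal_mult)
      also have "\<dots> \<le> ennreal (max 0 (z - x) + max 0 (z - (x + 2 * h)))"
        using xh by (intro ennreal_leI) (simp add: max_def)
      also have "\<dots> = ennreal (z - x) + ennreal (z - (x + 2 * h))"
        by (subst ennreal_plus) (auto simp: *[symmetric])
      finally show "2 * ennreal (z - (x + h)) \<le> ennreal (z - x) + ennreal (z - (x + 2 * h))" .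
    qed
    also have "\<dots> = E x + E (x + 2 * h)"
      unfolding E_def by (rule nn_integral_add) measurable
    finally have "2 * E (x + h) \<le> E x + E (x + 2 * h)" .
    moreover have "E (x + h) = ennreal (Phi \<phi> (x + h))" "E x = ennreal (Phi \<phi> x)" "E (x + 2 * h) = ennreal (Phi \<phi> (x + 2 * h))"
      using xh by (simp_all add: ennreal_Phi)
    ultimately have "ennreal (2 * Phi \<phi> (x + h)) \<le> ennreal (Phi \<phi> x + Phi \<phi> (x + 2 * h))"
      using nonneg by (simp add: ennreal_mult)
    then show ?thesis using nonneg by (subst (asm) ennreal_le_iff) (auto simp: add_nonneg_nonneg)
  qed
  show "set_integrable lborel {0..M} (Phi \<phi>)" for M
    unfolding set_integrable_def
  proof (rule integrableI_nonneg)
    have "(\<integral>\<^sup>+ x. ennreal (indicator {0..M} x *\<^sub>R Phi \<phi> x) \<partial>lborel)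
        \<le> (\<integral>\<^sup>+ x. \<integral>\<^sup>+ z. indicator {0<..M} x * ennreal (z - x) \<partial>\<phi> \<partial>lborel)"
    proof (rule nn_integral_mono)
      fix x
      have "(\<integral>\<^sup>+ z. indicator {0<..M} x * ennreal (z - x) \<partial>\<phi>) = indicator {0<..M} x * E x"
        unfolding E_def by (rule nn_integral_cmult) measurable
      moreover have "ennreal (indicator {0..M} x *\<^sub>R Phi \<phi> x) \<le> indicator {0<..M} x * E x"
      proof (cases "x > 0")
        case True
        then show ?thesis using ennreal_Phi[of x] by (simp add: indicator_def)
      next
        case False
        then have "Phi \<phi> x = 0" by (simp add: Phi_def)
        then show ?thesis by simp
      qed
      ultimately show "ennreal (indicator {0..M} x *\<^sub>R Phi \<phi> x) \<le> (\<integral>\<^sup>+ z. indicator {0<..M} x * ennreal (z - x) \<partial>\<phi>)"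
        by simp
    qed
    also have "\<dots> = (\<integral>\<^sup>+ z. \<integral>\<^sup>+ x. indicator {0<..M} x * ennreal (z - x) \<partial>lborel \<partial>\<phi>)"
      by (rule Fubini'[symmetric]) measurable
    also have "\<dots> \<le> (\<integral>\<^sup>+ z. ennreal (max 1 \<bar>M\<bar>) * ennreal (min (z\<^sup>2) z) \<partial>\<phi>)"
    proof (rule nn_integral_mono)
      fix z assume "z \<in> space \<phi>"
      then have z: "z > 0" by (simp add: space_phi)
      \<comment> \<open>Only \<open>x <= min \<bar>M\<bar> z\<close> contributes, and there the
        integrand is at most \<open>z\<close>.\<close>
      have "(\<integral>\<^sup>+ x. indicator {0<..M} x * ennreal (z - x) \<partial>lborel)
          \<le> (\<integral>\<^sup>+ x. ennreal z * indicator {0<..min \<bar>M\<bar> z} x \<partial>lborel)"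
        by (rule nn_integral_mono) (auto simp: indicator_def ennreal_neg intro!: ennreal_leI)
      also have "\<dots> = ennreal z * ennreal (min \<bar>M\<bar> z)"
        using z by (subst nn_integral_cmult_indicator) auto
      also have "\<dots> = ennreal (z * min \<bar>M\<bar> z)" using z by (simp add: ennreal_mult)
      also have "\<dots> \<le> ennreal (max 1 \<bar>M\<bar> * min (z\<^sup>2) z)"
      proof (rule ennreal_leI)
        show "z * min \<bar>M\<bar> z \<le> max 1 \<bar>M\<bar> * min (z\<^sup>2) z"
        proof (cases "z \<le> 1")
          case True
          then have m: "min (z\<^sup>2) z = z\<^sup>2" using z by (simp add: power2_eq_square min_def mult_le_one)
          have "z * min \<bar>M\<bar> z \<le> 1 * z\<^sup>2" using z by (simp add: power2_eq_square)
          also have "\<dots> \<le> max 1 \<bar>M\<bar> * z\<^sup>2" by (intro mult_right_mono) auto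
          finally show ?thesis by (simp add: m)
        next
          case False
          then have m: "min (z\<^sup>2) z = z" using z by (simp add: power2_eq_square min_def)
          have "z * min \<bar>M\<bar> z \<le> z * max 1 \<bar>M\<bar>" using z by (intro mult_left_mono) auto
          then show ?thesis by (simp add: m mult.commute)
        qed
      qed
      also have "\<dots> = ennreal (max 1 \<bar>M\<bar>) * ennreal (min (z\<^sup>2) z)" using z by (simp add: ennreal_mult)
      finally show "(\<integral>\<^sup>+ x. indicator {0<..M} x * ennreal (z - x) \<partial>lborel) \<le> ennreal (max 1 \<bar>M\<bar>) * ennreal (min (z\<^sup>2) z)" .
    qed
    also have "\<dots> = ennreal (max 1 \<bar>M\<bar>) * (\<integral>\<^sup>+ z. ennreal (min (z\<^sup>2) z) \<partial>\<phi>)"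
      by (rule nn_integral_cmult) measurable
    also have "\<dots> < \<infinity>" using fin by (simp add: ennreal_mult_less_top)
    finally show "(\<integral>\<^sup>+ x. ennreal (indicator {0..M} x *\<^sub>R Phi \<phi> x) \<partial>lborel) < \<infinity>" .
  qed (auto simp: nonneg)
  show "\<exists>x>0. M < Phi \<phi> x" for M
  proof -
    have "(\<integral>\<^sup>+ z. (SUP n. ennreal (z - 1 / real (Suc n))) \<partial>\<phi>) = (SUP n. E (1 / real (Suc n)))"
      unfolding E_def
    proof (rule nn_integral_monotone_convergence_SUP)
      show "incseq (\<lambda>n z. ennreal (z - 1 / real (Suc n)))"
        by (intro incseq_SucI le_funI ennreal_leI) (auto simp: field_simps)
    qed measurable
    moreover have "(SUP n. ennreal (z - 1 / real (Suc n))) = ennreal z" for z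
    proof (rule LIMSEQ_unique[OF LIMSEQ_SUP])
      show "incseq (\<lambda>n. ennreal (z - 1 / real (Suc n)))"
        by (intro incseq_SucI ennreal_leI) (auto simp: field_simps)
      have "(\<lambda>n. z - 1 / real (Suc n)) \<longlonglongrightarrow> z"
        using tendsto_diff[OF tendsto_const LIMSEQ_inverse_real_of_nat, of z] by (simp add: inverse_eq_divide)
      then show "(\<lambda>n. ennreal (z - 1 / real (Suc n))) \<longlonglongrightarrow> ennreal z" by (rule tendsto_ennrealI)
    qed
    ultimately have "(\<integral>\<^sup>+ z. ennreal z \<partial>\<phi>) = (SUP n. E (1 / real (Suc n)))" by simp
    moreover have "(\<integral>\<^sup>+ z \<in> {0<..<1}. ennreal z \<partial>\<phi>) \<le> (\<integral>\<^sup>+ z. ennreal z \<partial>\<phi>)"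
      by (rule nn_integral_mono) (auto simp: indicator_def)
    ultimately have "(SUP n. E (1 / real (Suc n))) = \<infinity>" using inf by (simp add: top_unique)
    then have "ennreal \<bar>M\<bar> < (SUP n. E (1 / real (Suc n)))" by (simp only:) simp
    then obtain n where n: "ennreal \<bar>M\<bar> < E (1 / real (Suc n))" by (auto simp: less_SUP_iff)
    have "E (1 / real (Suc n)) = ennreal (Phi \<phi> (1 / real (Suc n)))" by (subst ennreal_Phi) auto
    then have "\<bar>M\<bar> < Phi \<phi> (1 / real (Suc n))" using n by (simp add: ennreal_less_iff)
    then show ?thesis by (intro exI[of _ "1 / real (Suc n)"]) auto
  qed
qed

end

section \<open>Discretisation of the kernel\<close>

lemma integral_shift_set:
  fixes f :: "real \<Rightarrow> real"
  shows "(LINT y:{c + a<..c + b}|lborel. f y) = (LINT y:{a<..b}|lborel. f (c + y))"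
proof -
  have "(LINT y|lborel. indicator {c + a<..c + b} y * f y)
      = (LINT y|lborel. indicator {c + a<..c + b} (c + y) * f (c + y))"
    using lborel_integral_real_affine[of 1 "\<lambda>y. indicator {c + a<..c + b} y * f y" c] by simp
  also have "\<dots> = (LINT y|lborel. indicator {a<..b} y * f (c + y))"
    by (intro Bochner_Integration.integral_cong) (auto simp: indicator_def)
  finally show ?thesis by (simp add: set_lebesgue_integral_def)
qed

definition idx :: "real \<Rightarrow> real \<Rightarrow> nat" where "idx h x = nat \<lfloor>x / h\<rfloor>"

definition stp :: "real \<Rightarrow> (nat \<Rightarrow> real) \<Rightarrow> real \<Rightarrow> real" where "stp h s x = s (idx h x)"

lemma idx_bounds:
  assumes "h > 0" "x \<ge> 0"
  shows "real (idx h x) * h \<le> x" "x < (real (idx h x) + 1) * h"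
proof -
  have "0 \<le> x / h" using assms by simp
  then have "real (idx h x) = of_int \<lfloor>x / h\<rfloor>" by (simp add: idx_def)
  then have "real (idx h x) \<le> x / h" "x / h < real (idx h x) + 1" by linarith+
  then show "real (idx h x) * h \<le> x" "x < (real (idx h x) + 1) * h"
    using assms by (auto simp: field_simps)
qed

lemma idx_leI:
  assumes "h > 0" "x < (real n + 1) * h" shows "idx h x \<le> n"
proof -
  have "x / h < real n + 1" using assms by (simp add: divide_less_eq)
  then show ?thesis by (simp add: idx_def floor_less_iff nat_le_iff) linarith
qed

lemma idx_geI:
  assumes "h > 0" "real n * h \<le> x" shows "n \<le> idx h x"
proof -
  have "real n \<le> x / h" using assms by (simp add: le_divide_eq)
  then show ?thesis by (simp add: idx_def le_nat_floor)
qed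

lemma idx_eqI: "h > 0 \<Longrightarrow> real n * h \<le> x \<Longrightarrow> x < (real n + 1) * h \<Longrightarrow> idx h x = n"
  by (rule antisym[OF idx_leI idx_geI])

lemma idx_mono: "h > 0 \<Longrightarrow> x \<le> y \<Longrightarrow> idx h x \<le> idx h y"
  unfolding idx_def by (intro nat_mono floor_mono divide_right_mono) auto

lemma stp_measurable [measurable]: "stp h s \<in> borel_measurable borel"
proof -
  have "(\<lambda>x::real. \<lfloor>x / h\<rfloor>) \<in> measurable borel (count_space UNIV)" by measurable
  from measurable_compose[OF this, of "\<lambda>i. s (nat i)" borel] show ?thesis
    by (simp add: stp_def[abs_def] idx_def)
qed

lemma set_integrable_bounded_Icc:
  fixes f :: "real \<Rightarrow> real"
  assumes [measurable]: "f \<in> borel_measurable borel" and "\<And>y. y \<in> {a..b} \<Longrightarrow> \<bar>f y\<bar> \<le> B"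
  shows "set_integrable lborel {a..b} f"
  unfolding set_integrable_def
proof (rule Bochner_Integration.integrable_bound)
  show "integrable lborel (\<lambda>y. B * indicator {a..b} y)"
    by (intro integrable_mult_right integrable_real_indicator emeasure_bounded_finite) auto
  show "AE y in lborel. norm (indicator {a..b} y *\<^sub>R f y) \<le> norm (B * indicator {a..b} y)"
    using assms(2) by (intro AE_I2) (force simp: indicator_def)
qed measurable

lemma stp_integral:
  assumes h: "h > 0" and x: "x \<ge> 0"
  shows "(LINT y:{0..x}|lborel. stp h s y)
    = h * (\<Sum>i<idx h x. s i) + (x - real (idx h x) * h) * s (idx h x)"
proof -
  define n where "n = idx h x"
  have n: "real n * h \<le> x" "x < (real n + 1) * h" using idx_bounds[OF h x] by (auto simp: n_def)
  have i: "integrable lborel (\<lambda>y. indicator {a..<b} y * c)" for a b c :: real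
    by (intro integrable_mult_left integrable_real_indicator emeasure_bounded_finite) auto
  have i': "integrable lborel (\<lambda>y. indicator {a..b} y * c)" for a b c :: real
    by (intro integrable_mult_left integrable_real_indicator emeasure_bounded_finite) auto
  have "(LINT y:{0..x}|lborel. stp h s y)
      = (LINT y|lborel. (\<Sum>i<n. indicator {real i * h..<(real i + 1) * h} y * s i) + indicator {real n * h..x} y * s n)"
    unfolding set_lebesgue_integral_def
  proof (intro Bochner_Integration.integral_cong refl)
    fix y
    show "indicator {0..x} y *\<^sub>R stp h s y = (\<Sum>i<n. indicator {real i * h..<(real i + 1) * h} y * s i) + indicator {real n * h..x} y * s n"
    proof (cases "y \<in> {0..x}")
      case False
      have "indicator {real i * h..<(real i + 1) * h} y = (0::real)" if "i < n" for i
      proof -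
        have "(real i + 1) * h \<le> real n * h" using that h by (intro mult_right_mono) auto
        moreover have "0 \<le> real i * h" using h by simp
        ultimately show ?thesis using False n by (auto simp: indicator_def)
      qed
      moreover have "indicator {real n * h..x} y = (0::real)"
      proof -
        have "0 \<le> real n * h" using h by simp
        then show ?thesis using False by (auto simp: indicator_def)
      qed
      ultimately show ?thesis using False by simp
    next
      case True
      define m where "m = idx h y"
      have m: "real m * h \<le> y" "y < (real m + 1) * h" using idx_bounds[OF h, of y] True by (auto simp: m_def)
      have mn: "m \<le> n" unfolding m_def n_def using True by (intro idx_mono h) auto
      have ind: "indicator {real i * h..<(real i + 1) * h} y = (if i = m then 1 else 0 :: real)" for i
      proof (cases "i = m")
        case False
        then have "\<not> (real i * h \<le> y \<and> y < (real i + 1) * h)"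
          using idx_eqI[OF h, of i y] by (auto simp only: m_def)
        then show ?thesis using False by (simp add: indicator_def)
      qed (use m in \<open>simp add: indicator_def\<close>)
      show ?thesis
      proof (cases "m = n")
        case True
        have "indicator {real n * h..x} y = (1::real)" using \<open>y \<in> {0..x}\<close> m \<open>m = n\<close> by simp
        moreover have "(\<Sum>i<n. indicator {real i * h..<(real i + 1) * h} y * s i) = 0"
          using \<open>m = n\<close> by (intro sum.neutral) (simp add: ind)
        moreover have "stp h s y = s n" using \<open>m = n\<close> by (simp add: stp_def m_def)
        ultimately show ?thesis using \<open>y \<in> {0..x}\<close> by simp
      next
        case False
        then have "(real m + 1) * h \<le> real n * h" using mn h by (intro mult_right_mono) auto
        then have "y \<notin> {real n * h..x}" using m by auto
        then have "indicator {real n * h..x} y = (0::real)" by simp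
        moreover have "(\<Sum>i<n. indicator {real i * h..<(real i + 1) * h} y * s i)
            = (\<Sum>i\<in>{m}. indicator {real i * h..<(real i + 1) * h} y * s i)"
          using False mn by (intro sum.mono_neutral_right) (auto simp: ind)
        moreover have "stp h s y = s m" by (simp add: stp_def m_def)
        ultimately show ?thesis using \<open>y \<in> {0..x}\<close> by (simp add: ind)
      qed
    qed
  qed
  also have "\<dots> = (\<Sum>i<n. LINT y|lborel. indicator {real i * h..<(real i + 1) * h} y * s i) + (LINT y|lborel. indicator {real n * h..x} y * s n)"
  proof -
    have "integrable lborel (\<lambda>y. \<Sum>i<n. indicator {real i * h..<(real i + 1) * h} y * s i)"
      by (intro Bochner_Integration.integrable_sum i)
    from Bochner_Integration.integral_add[OF this i'] show ?thesis
      by (simp only: Bochner_Integration.integral_sum[OF i])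
  qed
  also have "(\<Sum>i<n. LINT y|lborel. indicator {real i * h..<(real i + 1) * h} y * s i) = (\<Sum>i<n. h * s i)"
  proof (intro sum.cong refl)
    fix i
    have "real i * h \<le> (real i + 1) * h" using h by (intro mult_right_mono) auto
    then show "(LINT y|lborel. indicator {real i * h..<(real i + 1) * h} y * s i) = h * s i"
      by (simp add: algebra_simps)
  qed
  also have "(LINT y|lborel. indicator {real n * h..x} y * s n) = (x - real n * h) * s n"
    using n by simp
  finally show ?thesis by (simp add: sum_distrib_left n_def)
qed

lemma stp_integral_bounds:
  assumes h: "h > 0" and x: "x \<ge> 0" and s: "\<And>n. s n \<ge> 0"
  shows "h * (\<Sum>i<idx h x. s i) \<le> (LINT y:{0..x}|lborel. stp h s y)"
    "(LINT y:{0..x}|lborel. stp h s y) \<le> h * (\<Sum>i<idx h x. s i) + h * s (idx h x)"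
proof -
  have "0 \<le> x - real (idx h x) * h" "x - real (idx h x) * h \<le> h"
    using idx_bounds[OF h x] by (auto simp: algebra_simps)
  then have "0 \<le> (x - real (idx h x) * h) * s (idx h x)" "(x - real (idx h x) * h) * s (idx h x) \<le> h * s (idx h x)"
    using s[of "idx h x"] by (auto intro: mult_right_mono)
  then show "h * (\<Sum>i<idx h x. s i) \<le> (LINT y:{0..x}|lborel. stp h s y)"
    "(LINT y:{0..x}|lborel. stp h s y) \<le> h * (\<Sum>i<idx h x. s i) + h * s (idx h x)"
    unfolding stp_integral[OF h x] by linarith+
qed

section \<open>Cell averages of the kernel and Riemann sums\<close>

context kernel begin

text \<open>The mean over the cell from \<open>i h\<close> to \<open>(i + 1) h\<close>. An average,
  unlike a point value, gives a meaningful first coefficient although the kernel is unbounded at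
  0.\<close>

definition avg :: "real \<Rightarrow> nat \<Rightarrow> real" where
  "avg h i = (LINT y:{0<..h}|lborel. F (real i * h + y)) / h"

lemma F_int_Ioc: "a \<ge> 0 \<Longrightarrow> set_integrable lborel {a<..b} F"
  by (rule set_integrable_subset[OF F_int[of b]]) auto

lemma avg_eq: "avg h i = (LINT y:{real i * h<..(real i + 1) * h}|lborel. F y) / h"
  using integral_shift_set[of "real i * h" 0 h F] by (simp add: avg_def algebra_simps)

lemma F_shift_int: assumes "c \<ge> 0" shows "set_integrable lborel {0<..b} (\<lambda>y. F (c + y))"
proof -
  have "integrable lborel (\<lambda>y. indicator {c<..c + b} (c + 1 * y) *\<^sub>R F (c + 1 * y))"
    using F_int_Ioc[OF assms, of "c + b"] unfolding set_integrable_def by (rule lborel_integrable_real_affine) simp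
  also have "(\<lambda>y. indicator {c<..c + b} (c + 1 * y) *\<^sub>R F (c + 1 * y)) = (\<lambda>y. indicator {0<..b} y *\<^sub>R F (c + y))"
    by (auto simp: indicator_def)
  finally show ?thesis by (simp add: set_integrable_def)
qed

text \<open>Averaging over cells of equal length preserves sign, monotonicity and second
  differences. The parameter is \<open>l * h\<close> so that \<open>\<mu>\<close> times a sum
  approximates \<open>l\<close> times an integral.\<close>

lemma avg_scheme:
  assumes h: "h > 0" and l: "l > 0" shows "scheme (avg h) (l * h)"
proof
  have ih: "real i * h \<ge> 0" for i :: nat using h by simp
  note FI = F_shift_int[OF ih]
  show "avg h 0 > 0"
  proof -
    obtain x where x: "x > 0" "F x > 0" using F_unb[of 0] by auto
    define m where "m = min x h"
    have m: "m > 0" "m \<le> x" "m \<le> h" using x h by (auto simp: m_def)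
    have "0 < m * F x" using m x by simp
    also have "m * F x = (LINT y:{0<..m}|lborel. F x)" using m by (simp add: set_lebesgue_integral_def)
    also have "\<dots> \<le> (LINT y:{0<..m}|lborel. F y)"
      using m by (intro set_integral_mono F_int_Ioc F_dec) (auto intro!: integrable_real_indicator emeasure_bounded_finite simp: set_integrable_def)
    also have "\<dots> \<le> (LINT y:{0<..h}|lborel. F y)"
      unfolding set_lebesgue_integral_def using m F_int_Ioc[of 0 m] F_int_Ioc[of 0 h]
      by (intro integral_mono) (auto simp: F_nonneg set_integrable_def indicator_def)
    finally show ?thesis using h by (simp add: avg_def)
  qed
  show "avg h n \<ge> 0" for n
    unfolding avg_def set_lebesgue_integral_def using h by (intro divide_nonneg_pos integral_nonneg_AE) (auto simp: F_nonneg)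
  show "avg h (Suc n) \<le> avg h n" for n
  proof -
    have "F (real (Suc n) * h + y) \<le> F (real n * h + y)" if "y \<in> {0<..h}" for y
    proof (rule F_dec)
      show "0 < real n * h + y" using that ih[of n] by (simp only: greaterThanAtMost_iff) linarith
      show "real n * h + y \<le> real (Suc n) * h + y" using h by (simp add: algebra_simps)
    qed
    then have "(LINT y:{0<..h}|lborel. F (real (Suc n) * h + y)) \<le> (LINT y:{0<..h}|lborel. F (real n * h + y))"
      by (rule set_integral_mono[OF FI FI])
    then show ?thesis unfolding avg_def by (rule divide_right_mono) (use h in simp)
  qed
  show "avg h (Suc n) - avg h (Suc (Suc n)) \<le> avg h n - avg h (Suc n)" for n
  proof -
    have "(LINT y:{0<..h}|lborel. 2 * F (real (Suc n) * h + y))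
        \<le> (LINT y:{0<..h}|lborel. F (real n * h + y) + F (real (Suc (Suc n)) * h + y))"
    proof (rule set_integral_mono)
      fix y assume y: "y \<in> {0<..h}"
      have "2 * F ((real n * h + y) + h) \<le> F (real n * h + y) + F ((real n * h + y) + 2 * h)"
      proof (rule F_conv)
        show "0 < real n * h + y" using y ih[of n] by (simp only: greaterThanAtMost_iff) linarith
      qed (use h in simp)
      then show "2 * F (real (Suc n) * h + y) \<le> F (real n * h + y) + F (real (Suc (Suc n)) * h + y)"
        by (simp add: algebra_simps)
    next
      show "set_integrable lborel {0<..h} (\<lambda>y. 2 * F (real (Suc n) * h + y))"
        using FI[of h "Suc n"] by simp
      show "set_integrable lborel {0<..h} (\<lambda>y. F (real n * h + y) + F (real (Suc (Suc n)) * h + y))"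
        by (intro set_integral_add FI)
    qed
    also have "\<dots> = (LINT y:{0<..h}|lborel. F (real n * h + y)) + (LINT y:{0<..h}|lborel. F (real (Suc (Suc n)) * h + y))"
      by (intro set_integral_add FI)
    finally have "2 * (LINT y:{0<..h}|lborel. F (real (Suc n) * h + y)) / h
        \<le> ((LINT y:{0<..h}|lborel. F (real n * h + y)) + (LINT y:{0<..h}|lborel. F (real (Suc (Suc n)) * h + y))) / h"
      using h by (intro divide_right_mono) auto
    then show ?thesis unfolding avg_def by (simp add: add_divide_distrib)
  qed
  show "0 < l * h" using h l by simp
qed

lemma cell_unique:
  assumes "h > 0" "real i * h < y" "y \<le> (real i + 1) * h" "real j * h < y" "y \<le> (real j + 1) * h"
  shows "i = j"
proof -
  have "real i * h < (real j + 1) * h" "real j * h < (real i + 1) * h" using assms by linarith+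
  then have "real i < real j + 1" "real j < real i + 1" using assms(1) by auto
  then show ?thesis by linarith
qed

lemma cell_ex:
  assumes "h > 0" "y > 0" shows "\<exists>i. real i * h < y \<and> y \<le> (real i + 1) * h"
proof -
  define i where "i = nat (\<lceil>y / h\<rceil> - 1)"
  have "y / h > 0" using assms by simp
  then have "\<lceil>y / h\<rceil> \<ge> 1" by linarith
  then have "real i = of_int \<lceil>y / h\<rceil> - 1" by (simp add: i_def)
  then have "real i < y / h" "y / h \<le> real i + 1" by linarith+
  then show ?thesis using assms by (intro exI[of _ i]) (auto simp: field_simps)
qed

lemma avg_sum: assumes h: "h > 0" shows "h * (\<Sum>i<n. avg h i) = (LINT y:{0<..real n * h}|lborel. F y)"
proof (induction n)
  case 0
  then show ?case by (simp add: set_lebesgue_integral_def)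
next
  case (Suc n)
  have le: "real n * h \<le> (real n + 1) * h" using h by (intro mult_right_mono) auto
  have "(LINT y:{0<..real n * h} \<union> {real n * h<..(real n + 1) * h}|lborel. F y)
      = (LINT y:{0<..real n * h}|lborel. F y) + (LINT y:{real n * h<..(real n + 1) * h}|lborel. F y)"
    using h by (intro set_integral_Un F_int_Ioc) auto
  moreover have "{0<..real n * h} \<union> {real n * h<..(real n + 1) * h} = {0<..(real n + 1) * h}"
    using le h by (intro ivl_disj_un_two) (auto simp: mult_nonneg_nonneg)
  ultimately show ?case using Suc h by (simp add: avg_eq algebra_simps)
qed

lemma ci_stp:
  assumes s: "\<And>n. \<bar>s n\<bar> \<le> B n" and B: "mono B" and x: "x \<ge> 0" and h: "h > 0"
  shows "ci (stp h s) F x"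
  unfolding ci_def set_integrable_def
proof (rule Bochner_Integration.integrable_bound)
  show "integrable lborel (\<lambda>y. B (idx h x) * (indicator {0..x} y *\<^sub>R F y))"
    using F_int[of x] unfolding set_integrable_def by (rule integrable_mult_right)
  have "\<bar>s (idx h (x - y))\<bar> \<le> \<bar>B (idx h x)\<bar>" if "y \<ge> 0" for y
  proof -
    have "\<bar>s (idx h (x - y))\<bar> \<le> B (idx h (x - y))" by (rule s)
    also have "\<dots> \<le> B (idx h x)" using that by (intro monoD[OF B] idx_mono h) auto
    finally show ?thesis by simp
  qed
  then show "AE y in lborel. norm (indicator {0..x} y *\<^sub>R (stp h s (x - y) * F y)) \<le> norm (B (idx h x) * (indicator {0..x} y *\<^sub>R F y))"
    by (intro AE_I2) (auto simp: indicator_def stp_def abs_mult F_nonneg intro!: mult_right_mono)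
qed measurable

text \<open>For \<open>y\<close> in cell \<open>i\<close>, the point \<open>x - y\<close> lies in a
  cell of index at most \<open>n - i\<close>, where \<open>n\<close> is the index of
  \<open>x\<close>. Together with \<open>cv_stp_lower\<close> this squeezes the convolution between
  two discrete ones.\<close>

lemma cv_stp_upper:
  assumes h: "h > 0" and x: "x \<ge> 0" and s0: "\<And>n. s n \<ge> 0" and s: "mono s"
  shows "cv (stp h s) F x \<le> h * (\<Sum>i\<le>idx h x. avg h i * s (idx h x - i))"
proof -
  define n where "n = idx h x"
  have n: "x < (real n + 1) * h" using idx_bounds[OF h x] by (auto simp: n_def)
  have ii: "integrable lborel (\<lambda>y. indicator {real i * h<..(real i + 1) * h} y * F y * c)" for i :: nat and c
    using F_int_Ioc[of "real i * h" "(real i + 1) * h"] h unfolding set_integrable_def by (intro integrable_mult_left) auto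
  have "cv (stp h s) F x \<le> (LINT y|lborel. (\<Sum>i\<le>n. indicator {real i * h<..(real i + 1) * h} y * F y * s (n - i)))"
    unfolding cv_def set_lebesgue_integral_def
  proof (rule integral_mono)
    show "integrable lborel (\<lambda>y. indicator {0..x} y *\<^sub>R (stp h s (x - y) * F y))"
      using ci_stp[of s s x h] s0 s x h by (simp add: ci_def set_integrable_def)
    show "integrable lborel (\<lambda>y. \<Sum>i\<le>n. indicator {real i * h<..(real i + 1) * h} y * F y * s (n - i))"
      using ii by (intro Bochner_Integration.integrable_sum)
    fix y
    have nn: "0 \<le> indicator {real i * h<..(real i + 1) * h} y * F y * s (n - i)" for i
      by (auto simp: indicator_def F_nonneg s0)
    show "indicator {0..x} y *\<^sub>R (stp h s (x - y) * F y) \<le> (\<Sum>i\<le>n. indicator {real i * h<..(real i + 1) * h} y * F y * s (n - i))"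
    proof (cases "y \<in> {0<..x}")
      case False
      then have "indicator {0..x} y *\<^sub>R (stp h s (x - y) * F y) = 0"
        by (auto simp: indicator_def F_zero)
      also have "0 \<le> (\<Sum>i\<le>n. indicator {real i * h<..(real i + 1) * h} y * F y * s (n - i))"
        by (intro sum_nonneg nn)
      finally show ?thesis .
    next
      case True
      then obtain i where i: "real i * h < y" "y \<le> (real i + 1) * h" using cell_ex[OF h] by auto
      have "real i * h < (real n + 1) * h" using i True n by auto
      then have "i \<le> n" using h by auto
      have "x - y < (real (n - i) + 1) * h"
        using n i \<open>i \<le> n\<close> by (simp add: of_nat_diff algebra_simps)
      then have "stp h s (x - y) \<le> s (n - i)"
        unfolding stp_def by (intro monoD[OF s] idx_leI h)
      then have "indicator {0..x} y *\<^sub>R (stp h s (x - y) * F y) \<le> indicator {real i * h<..(real i + 1) * h} y * F y * s (n - i)"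
        using i True F_nonneg[of y] by (simp add: mult.commute mult_left_mono)
      also have "\<dots> \<le> (\<Sum>i\<le>n. indicator {real i * h<..(real i + 1) * h} y * F y * s (n - i))"
        using \<open>i \<le> n\<close> nn by (intro member_le_sum) auto
      finally show ?thesis .
    qed
  qed
  also have "\<dots> = (\<Sum>i\<le>n. (LINT y|lborel. indicator {real i * h<..(real i + 1) * h} y * F y * s (n - i)))"
    using ii by (intro Bochner_Integration.integral_sum) auto
  also have "\<dots> = (\<Sum>i\<le>n. h * (avg h i * s (n - i)))"
    using h by (intro sum.cong refl) (simp add: avg_eq set_lebesgue_integral_def)
  finally show ?thesis by (simp add: n_def sum_distrib_left)
qed

text \<open>For \<open>y\<close> in cell \<open>i\<close> one only knows
  \<open>x - y >= (n - 1 - i) h\<close>, hence the loss of one index.\<close>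

lemma cv_stp_lower:
  assumes h: "h > 0" and x: "x \<ge> 0" and s0: "\<And>n. s n \<ge> 0" and s: "mono s"
  shows "h * (\<Sum>i<idx h x. avg h i * s (idx h x - 1 - i)) \<le> cv (stp h s) F x"
proof -
  define n where "n = idx h x"
  have n: "real n * h \<le> x" using idx_bounds[OF h x] by (auto simp: n_def)
  have ii: "integrable lborel (\<lambda>y. indicator {real i * h<..(real i + 1) * h} y * F y * c)" for i :: nat and c
    using F_int_Ioc[of "real i * h" "(real i + 1) * h"] h unfolding set_integrable_def by (intro integrable_mult_left) auto
  have "(\<Sum>i<n. h * (avg h i * s (n - 1 - i))) = (\<Sum>i<n. (LINT y|lborel. indicator {real i * h<..(real i + 1) * h} y * F y * s (n - 1 - i)))"
    using h by (intro sum.cong refl) (simp add: avg_eq set_lebesgue_integral_def)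
  also have "\<dots> = (LINT y|lborel. (\<Sum>i<n. indicator {real i * h<..(real i + 1) * h} y * F y * s (n - 1 - i)))"
    using ii by (intro Bochner_Integration.integral_sum[symmetric]) auto
  also have "\<dots> \<le> cv (stp h s) F x"
    unfolding cv_def set_lebesgue_integral_def
  proof (rule integral_mono)
    show "integrable lborel (\<lambda>y. indicator {0..x} y *\<^sub>R (stp h s (x - y) * F y))"
      using ci_stp[of s s x h] s0 s x h by (simp add: ci_def set_integrable_def)
    show "integrable lborel (\<lambda>y. \<Sum>i<n. indicator {real i * h<..(real i + 1) * h} y * F y * s (n - 1 - i))"
      using ii by (intro Bochner_Integration.integrable_sum)
    fix y
    show "(\<Sum>i<n. indicator {real i * h<..(real i + 1) * h} y * F y * s (n - 1 - i)) \<le> indicator {0..x} y *\<^sub>R (stp h s (x - y) * F y)"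
    proof (cases "\<exists>i<n. real i * h < y \<and> y \<le> (real i + 1) * h")
      case False
      then have "(\<Sum>i<n. indicator {real i * h<..(real i + 1) * h} y * F y * s (n - 1 - i)) = 0"
        by (intro sum.neutral) (auto simp: indicator_def)
      then show ?thesis by (auto simp: indicator_def stp_def F_nonneg s0)
    next
      case True
      then obtain i where i: "i < n" "real i * h < y" "y \<le> (real i + 1) * h" by auto
      have "(\<Sum>i<n. indicator {real i * h<..(real i + 1) * h} y * F y * s (n - 1 - i))
          = (\<Sum>j\<in>{i}. indicator {real j * h<..(real j + 1) * h} y * F y * s (n - 1 - j))"
      proof (rule sum.mono_neutral_right)
        show "\<forall>j\<in>{..<n} - {i}. indicator {real j * h<..(real j + 1) * h} y * F y * s (n - 1 - j) = 0"
        proof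
          fix j assume "j \<in> {..<n} - {i}"
          then have "\<not> (real j * h < y \<and> y \<le> (real j + 1) * h)"
            using cell_unique[OF h _ _ i(2,3), of j] by blast
          then have "indicator {real j * h<..(real j + 1) * h} y = (0::real)" by (simp add: indicator_def)
          then show "indicator {real j * h<..(real j + 1) * h} y * F y * s (n - 1 - j) = 0" by (simp only: mult_zero_left)
        qed
      qed (use i in auto)
      also have "\<dots> = F y * s (n - 1 - i)" using i by simp
      finally have eq: "(\<Sum>i<n. indicator {real i * h<..(real i + 1) * h} y * F y * s (n - 1 - i)) = F y * s (n - 1 - i)" .
      have "(real i + 1) * h \<le> real n * h" using i h by (intro mult_right_mono) auto
      moreover have "0 \<le> real i * h" using h by simp
      ultimately have "0 \<le> y" "y \<le> x" using i(2,3) n by linarith+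
      then have y: "y \<in> {0..x}" by simp
      have "real (n - 1 - i) * h \<le> x - y"
      proof -
        obtain k where k: "n = Suc (i + k)" using i(1) less_iff_Suc_add by auto
        then have "real (n - 1 - i) = real n - 1 - real i" by simp
        then have "real (n - 1 - i) * h = real n * h - (real i + 1) * h" by (simp add: algebra_simps)
        then show ?thesis using n i by linarith
      qed
      then have "s (n - 1 - i) \<le> stp h s (x - y)"
        unfolding stp_def by (intro monoD[OF s] idx_geI h)
      then show ?thesis unfolding eq using y F_nonneg[of y] by (simp add: mult.commute mult_left_mono)
    qed
  qed
  finally show ?thesis by (simp add: n_def sum_distrib_left)
qed

end

section \<open>Discrete scale functions for mesh size h\<close>

locale res_kernel = kernel F for F + fixes l :: real assumes l: "l > 0"
begin

definition Wd :: "real \<Rightarrow> nat \<Rightarrow> real" where "Wd h = scheme.W (avg h) (l * h)"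
definition kd :: "real \<Rightarrow> nat \<Rightarrow> real" where "kd h = scheme.k (avg h) (l * h)"
definition Zd :: "real \<Rightarrow> nat \<Rightarrow> real" where "Zd h = scheme.Z (avg h) (l * h)"
text \<open>The quotient of the difference quotient \<open>k/h\<close> by \<open>W\<close> is
  nonincreasing, but it may be large near 0. The map \<open>q -> 1/(1 + q)\<close> makes it a
  nondecreasing function with values in \<open>(0,1]\<close>, to which Helly's theorem
  applies.\<close>

definition gd :: "real \<Rightarrow> nat \<Rightarrow> real" where "gd h n = 1 / (1 + kd h n / (h * Wd h n))"

lemma sch: "h > 0 \<Longrightarrow> scheme (avg h) (l * h)" by (rule avg_scheme[OF _ l])

lemma Wd_pos: "h > 0 \<Longrightarrow> Wd h n > 0" unfolding Wd_def by (rule scheme.W_pos[OF sch])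
lemma kd_pos: "h > 0 \<Longrightarrow> kd h n > 0" unfolding kd_def by (rule scheme.k_pos[OF sch])
lemma Wd_mono: "h > 0 \<Longrightarrow> mono (Wd h)" unfolding Wd_def by (intro monoI scheme.W_mono[OF sch])
lemma Wd_sum: "h > 0 \<Longrightarrow> Wd h n = (\<Sum>i\<le>n. kd h i)" unfolding Wd_def kd_def by (rule scheme.W_def[OF sch])
lemma Zd_sum: "h > 0 \<Longrightarrow> Zd h n = 1 + l * (h * (\<Sum>j<n. Wd h j))"
  unfolding Wd_def Zd_def by (simp add: scheme.Z_def[OF sch] mult.assoc)
lemma Zd_ge_1: "h > 0 \<Longrightarrow> Zd h n \<ge> 1" unfolding Zd_def by (rule scheme.Z_ge_1[OF sch])
lemma conv_d: "h > 0 \<Longrightarrow> (\<Sum>i\<le>n. avg h i * Wd h (n - i)) = (\<Sum>i\<le>n. Zd h i)"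
  unfolding Wd_def Zd_def by (rule scheme.conv_W[OF sch])
lemma kW_dec_d: "h > 0 \<Longrightarrow> i \<le> j \<Longrightarrow> Wd h i * kd h j \<le> Wd h j * kd h i"
  unfolding Wd_def kd_def by (rule scheme.k_W_dec[OF sch])
text \<open>Index arithmetic for the delay \<open>i - a\<close>, which takes \<open>i\<close> to
  \<open>a\<close> and \<open>j\<close> to \<open>j - i + a\<close>.\<close>

lemma shift_idx:
  fixes a i j :: nat
  assumes "a < i" "i \<le> j"
  shows "\<not> i < i - a" "i - (i - a) = a" "\<not> j < i - a" "j - (i - a) = j - i + a" "1 \<le> i - a"
  using assms by auto

lemma shift_k_d: "h > 0 \<Longrightarrow> a < i \<Longrightarrow> i \<le> j \<Longrightarrow> Wd h a * kd h j \<le> Wd h (j - i + a) * kd h i"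
  using scheme.W_shift_k[OF sch, of h "i - a" i j] unfolding Wd_def kd_def by (simp only: shift_idx if_False)
lemma shift_W_d: "h > 0 \<Longrightarrow> a < i \<Longrightarrow> i \<le> j \<Longrightarrow> Wd h a * Wd h j \<le> Wd h (j - i + a) * Wd h i"
  using scheme.W_shift_W[OF sch, of h i j "i - a"] unfolding Wd_def by (simp only: shift_idx if_False)
lemma shift_Z_d: "h > 0 \<Longrightarrow> a < i \<Longrightarrow> i \<le> j \<Longrightarrow> Wd h a * Zd h j \<le> Wd h (j - i + a) * Zd h i"
  using scheme.W_shift_Z[OF sch, of h i j "i - a"] unfolding Wd_def Zd_def by (simp only: shift_idx if_False)
lemma sq_d: "h > 0 \<Longrightarrow> l * h * (Wd h n)\<^sup>2 \<le> kd h (Suc n) * Zd h n"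
  unfolding Wd_def Zd_def kd_def by (rule scheme.W_sq_le[OF sch])
lemma k_sum_Z_d: "h > 0 \<Longrightarrow> kd h n * (\<Sum>i\<le>n. Zd h i) \<le> Wd h n * Zd h n"
  unfolding Wd_def Zd_def kd_def by (rule scheme.k_sum_Z_le[OF sch])

lemma gd_mono: assumes h: "h > 0" shows "mono (gd h)"
proof (rule monoI)
  fix i j :: nat assume ij: "i \<le> j"
  have "kd h j / (h * Wd h j) \<le> kd h i / (h * Wd h i)"
    using kW_dec_d[OF h ij] Wd_pos[OF h] h by (simp add: field_simps)
  moreover have "0 < kd h j / (h * Wd h j)" using Wd_pos[OF h] kd_pos[OF h] h by simp
  ultimately show "gd h i \<le> gd h j" unfolding gd_def by (intro divide_left_mono) auto
qed

lemma gd_pos: "h > 0 \<Longrightarrow> gd h n > 0" "h > 0 \<Longrightarrow> gd h n \<le> 1"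
  using Wd_pos[of h n] kd_pos[of h n] by (auto simp: gd_def add_pos_pos)

lemma kd_gd: "h > 0 \<Longrightarrow> kd h n / h = (1 / gd h n - 1) * Wd h n"
  using Wd_pos[of h n] by (simp add: gd_def)

text \<open>The range up to 4 contains all cells \<open>0..n\<close> whenever
  \<open>n * h <= 2\<close> and \<open>h <= 1\<close>.\<close>

definition I4 :: real where "I4 = (LINT y:{0<..4}|lborel. F y)"

lemma I4_pos: "I4 > 0"
  using scheme.a0[OF sch[of 4]] by (simp add: avg_def I4_def)

lemma Wd_lower:
  assumes h: "0 < h" "h \<le> 1" and n: "real n * h \<le> 2"
  shows "real (Suc n) * h / I4 \<le> Wd h n"
proof -
  have "h * (\<Sum>i\<le>n. avg h i) = (LINT y:{0<..real (Suc n) * h}|lborel. F y)"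
    using avg_sum[OF h(1), of "Suc n"] by (simp add: lessThan_Suc_atMost)
  also have "\<dots> \<le> I4"
    unfolding I4_def set_lebesgue_integral_def
    using F_int_Ioc[of 0 "real (Suc n) * h"] F_int_Ioc[of 0 4] n h
    by (intro integral_mono) (auto simp: F_nonneg set_integrable_def indicator_def algebra_simps)
  finally have a: "h * (\<Sum>i\<le>n. avg h i) \<le> I4" .
  have "real (Suc n) * h \<le> Wd h n * (\<Sum>i\<le>n. avg h i) * h"
    unfolding Wd_def using h by (intro mult_right_mono scheme.W_lower[OF sch]) auto
  also have "\<dots> = Wd h n * (h * (\<Sum>i\<le>n. avg h i))" by simp
  also have "\<dots> \<le> Wd h n * I4" using a Wd_pos[OF h(1), of n] by (intro mult_left_mono) auto
  finally show ?thesis using I4_pos by (simp add: divide_le_eq)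
qed

lemma Wd_upper:
  "\<exists>h0 M. 0 < h0 \<and> h0 \<le> 1 \<and> (\<forall>h n. 0 < h \<longrightarrow> h \<le> h0 \<longrightarrow> real n * h \<le> 2 \<longrightarrow> Wd h n \<le> M)"
proof -
  obtain x where x: "x > 0" "F x > 1" using F_unb[of 1] by auto
  \<comment> \<open>On \<open>(0,d]\<close> the kernel is at least 1, and
    \<open>l * d <= 1/2\<close>: the window conditions of \<open>W_upper\<close> with
    \<open>C = 1\<close>.\<close>
  define d where "d = min (min x (1 / (2 * l))) 1"
  have d: "d > 0" "d \<le> x" "d \<le> 1" "d \<le> 1 / (2 * l)" using x l by (auto simp: d_def)
  have ld: "l * d \<le> 1 / 2" using d(4) l by (simp add: field_simps)
  have Fd: "1 \<le> F y" if "0 < y" "y \<le> d" for y using F_dec[of y x] that d x by linarith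
  \<comment> \<open>For \<open>h <= d/2\<close> a window of \<open>p\<close> cells is longer than
    \<open>d/2\<close>, so \<open>q\<close> windows cover \<open>[0,2]\<close>.\<close>
  define q where "q = nat \<lceil>4 / d\<rceil> + 1"
  have q: "real q \<ge> 4 / d + 1" using d by (simp add: q_def)
  let ?M = "((\<lambda>x. 2 * ((1 + 2 * l / 1) * x + 1 / 1)) ^^ q) 0"
  have "Wd h n \<le> ?M" if h: "0 < h" "h \<le> d / 2" and n: "real n * h \<le> 2" for h n
  proof -
    define p where "p = idx h d"
    have p1: "real p * h \<le> d" and p2: "d < (real p + 1) * h" using idx_bounds[OF h(1), of d] d by (auto simp: p_def)
    have ph: "d / 2 < real p * h" using p2 h by (simp add: distrib_right)
    then have p: "p > 0" using d h by (cases p) auto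
    show ?thesis
      unfolding Wd_def
    proof (rule scheme.W_upper[OF sch p])
      show "h > 0" by fact
      show "1 \<le> avg h i" if i: "i < p" for i
      proof -
        have ii: "(real i + 1) * h \<le> real p * h" using i h by (intro mult_right_mono) auto
        have "1 \<le> F (real i * h + y)" if "y \<in> {0<..h}" for y
        proof (rule Fd)
          have "0 \<le> real i * h" using h by simp
          then show "0 < real i * h + y" using that by (simp only: greaterThanAtMost_iff) linarith
          show "real i * h + y \<le> d" using that ii p1 by (simp only: greaterThanAtMost_iff distrib_right) linarith
        qed
        then have "(LINT y:{0<..h}|lborel. 1) \<le> (LINT y:{0<..h}|lborel. F (real i * h + y))"
          using h by (intro set_integral_mono F_shift_int)
            (auto simp: set_integrable_def intro!: integrable_real_indicator emeasure_bounded_finite)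
        then show ?thesis using h by (simp add: avg_def set_lebesgue_integral_def)
      qed
      show "l * h * real p \<le> 1 / 2"
      proof -
        have "l * (real p * h) \<le> l * d" using p1 l by (intro mult_left_mono) auto
        then show ?thesis using ld by (simp add: mult_ac)
      qed
      show "n < q * p"
      proof -
        have "(4 / d + 1) * (d / 2) = 2 + d / 2" using d by (simp add: field_simps)
        then have "real n * h < (4 / d + 1) * (d / 2)" using n d by linarith
        also have "\<dots> \<le> real q * (real p * h)" using q ph d by (intro mult_mono) auto
        finally have "real n * h < real (q * p) * h" by (simp add: mult.assoc)
        then have "real n < real (q * p)" using h(1) by (simp only: mult_less_cancel_right_pos)
        then show ?thesis by (simp only: of_nat_less_iff)
      qed
      have "l * (real n * h) \<le> l * 2" using n l by (intro mult_left_mono) auto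
      then show "l * h * real n \<le> 2 * l" by (simp add: mult_ac)
    qed simp
  qed
  then show ?thesis using d by (intro exI[of _ "d / 2"] exI[of _ ?M]) auto
qed

text \<open>Helly's theorem asks for right-continuous nondecreasing functions on the whole line
  under a common bound, so the step function is frozen outside \<open>[0,2]\<close>.\<close>

definition cl :: "real \<Rightarrow> (nat \<Rightarrow> real) \<Rightarrow> real \<Rightarrow> real" where
  "cl h s x = (if x < 0 then 0 else s (idx h (min x 2)))"

lemma cl_mono:
  assumes h: "h > 0" and s: "mono s" "\<And>n. s n \<ge> 0" shows "mono (cl h s)"
proof (rule monoI)
  fix x y :: real assume "x \<le> y"
  then show "cl h s x \<le> cl h s y"
    using s(2) by (auto simp: cl_def intro!: monoD[OF s(1)] idx_mono h)
qed

lemma cl_rcont: assumes h: "h > 0" shows "continuous (at_right x) (cl h s)"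
proof -
  have "\<forall>\<^sub>F y in at_right x. cl h s x = cl h s y"
  proof -
    consider "x < 0" | "0 \<le> x" "x < 2" | "x \<ge> 2" by linarith
    then show ?thesis
    proof cases
      case 1
      then have "\<forall>y>x. y < 0 \<longrightarrow> cl h s x = cl h s y" by (simp add: cl_def)
      then show ?thesis unfolding eventually_at_right_field using 1 by blast
    next
      case 2
      define b where "b = min ((real (idx h x) + 1) * h) 2"
      have b: "x < b" using idx_bounds(2)[OF h 2(1)] 2 by (simp add: b_def)
      have "cl h s x = cl h s y" if "x < y" "y < b" for y
      proof -
        have "real (idx h x) * h \<le> y" using idx_bounds(1)[OF h 2(1)] that by linarith
        moreover have "y < (real (idx h x) + 1) * h" "y < 2" using that by (auto simp: b_def)
        ultimately have "idx h y = idx h x" by (intro idx_eqI h)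
        then show ?thesis using that 2 \<open>y < 2\<close> by (simp add: cl_def)
      qed
      then show ?thesis unfolding eventually_at_right_field using b by blast
    next
      case 3
      then have "\<forall>y>x. y < x + 1 \<longrightarrow> cl h s x = cl h s y" by (simp add: cl_def)
      then show ?thesis unfolding eventually_at_right_field by (intro exI[of _ "x + 1"]) auto
    qed
  qed
  then show ?thesis
    unfolding continuous_within by (rule Lim_transform_eventually[OF tendsto_const])
qed

text \<open>Convergence holds at the continuity points of the limit, and a monotone function has
  only countably many others; these form \<open>D\<close>.\<close>

lemma helly_pair:
  assumes hp: "\<And>j. h j > 0" and s: "\<And>j. mono (s j)" "\<And>j n. s j n \<ge> 0"
    and B: "\<And>j n. real n * h j \<le> 2 \<Longrightarrow> s j n \<le> M"
  shows "\<exists>r f D. strict_mono (r::nat \<Rightarrow> nat) \<and> mono f \<and> (\<forall>x. continuous (at_right x) f) \<and> countable D \<and>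
    (\<forall>x\<in>{0<..<2} - D. (\<lambda>j. stp (h (r j)) (s (r j)) x) \<longlonglongrightarrow> f x)"
proof -
  have M: "\<bar>M\<bar> = M" using B[of 0 0] s(2)[of 0 0] by simp
  have "\<bar>cl (h n) (s n) x\<bar> \<le> M" for n x
    using s(2)[of n] B[of "idx (h n) (min x 2)" n] idx_bounds(1)[OF hp, of "min x 2" n] M
    by (auto simp: cl_def)
  from Helly_selection[of "\<lambda>j. cl (h j) (s j)", OF cl_rcont[OF hp] cl_mono[OF hp s] this]
  obtain r f where r: "strict_mono (r :: nat \<Rightarrow> nat)" and f: "\<forall>x. continuous (at_right x) f" "mono f"
    and lim: "\<And>x. continuous (at x) f \<Longrightarrow> (\<lambda>n. cl (h (r n)) (s (r n)) x) \<longlonglongrightarrow> f x"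
    by blast
  have "countable {x. \<not> isCont f x}" by (rule mono_ctble_discont[OF f(2)])
  moreover have "(\<lambda>j. stp (h (r j)) (s (r j)) x) \<longlonglongrightarrow> f x" if "x \<in> {0<..<2} - {x. \<not> isCont f x}" for x
  proof -
    have "cl (h (r j)) (s (r j)) x = stp (h (r j)) (s (r j)) x" for j
      using that by (simp add: cl_def stp_def)
    then show ?thesis using lim[of x] that by simp
  qed
  ultimately show ?thesis using r f by blast
qed

end

text \<open>\<open>D\<close> holds the countably many points where convergence may fail.
  \<open>gl\<close> is kept right-continuous because it will fix \<open>k\<close> pointwise, whereas
  \<open>Wl\<close> will be replaced by a continuous version.\<close>

locale helly_limit = res_kernel F l for F l +
  fixes h :: "nat \<Rightarrow> real" and Wl gl :: "real \<Rightarrow> real" and D :: "real set" and M :: real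
  assumes h_pos: "\<And>j. h j > 0" and h_le: "\<And>j. h j \<le> 1" and h_lim: "h \<longlonglongrightarrow> 0"
    and mono_W: "mono Wl" and mono_g: "mono gl" and rc_g: "\<And>x. continuous (at_right x) gl"
    and cD: "countable D" and W_le: "\<And>j n. real n * h j \<le> 2 \<Longrightarrow> Wd (h j) n \<le> M"
    and W_lim: "\<And>x. x \<in> {0<..<2} - D \<Longrightarrow> (\<lambda>j. stp (h j) (Wd (h j)) x) \<longlonglongrightarrow> Wl x"
    and g_lim: "\<And>x. x \<in> {0<..<2} - D \<Longrightarrow> (\<lambda>j. stp (h j) (gd (h j)) x) \<longlonglongrightarrow> gl x"

text \<open>Two successive selections: first for \<open>W\<close>, and along that subsequence for
  the transformed quotient.\<close>

lemma (in res_kernel) helly_limit_ex: "\<exists>h Wl gl D M. helly_limit F l h Wl gl D M"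
proof -
  obtain h0 M where h0: "0 < h0" "h0 \<le> 1" and M: "\<And>h n. 0 < h \<Longrightarrow> h \<le> h0 \<Longrightarrow> real n * h \<le> 2 \<Longrightarrow> Wd h n \<le> M"
    using Wd_upper by blast
  define h where "h j = h0 / real (Suc j)" for j
  have h: "0 < h j" "h j \<le> h0" for j using h0 by (auto simp: h_def field_simps)
  have hl: "h \<longlonglongrightarrow> 0"
    using tendsto_mult_left[OF LIMSEQ_inverse_real_of_nat, of h0] by (simp add: h_def[abs_def] divide_inverse)
  have nn: "0 \<le> Wd (h j) n" "0 \<le> gd (h j) n" "gd (h j) n \<le> 1" for j n
    using Wd_pos[of "h j" n] gd_pos[of "h j" n] h(1)[of j] by auto
  obtain r1 f1 D1 where r1: "strict_mono r1" "mono f1" "countable D1"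
    "\<And>x. x \<in> {0<..<2} - D1 \<Longrightarrow> (\<lambda>j. stp (h (r1 j)) (Wd (h (r1 j))) x) \<longlonglongrightarrow> f1 x"
    using helly_pair[of h "\<lambda>j. Wd (h j)" M, OF h(1) Wd_mono[OF h(1)] nn(1) M[OF h]] by blast
  obtain r2 f2 D2 where r2: "strict_mono r2" "mono f2" "countable D2" "\<forall>x. continuous (at_right x) f2"
    "\<And>x. x \<in> {0<..<2} - D2 \<Longrightarrow> (\<lambda>j. stp (h (r1 (r2 j))) (gd (h (r1 (r2 j)))) x) \<longlonglongrightarrow> f2 x"
    using helly_pair[of "\<lambda>j. h (r1 j)" "\<lambda>j. gd (h (r1 j))" 1, OF h(1) gd_mono[OF h(1)] nn(2) nn(3)] by blast
  have "helly_limit F l (\<lambda>j. h (r1 (r2 j))) f1 f2 (D1 \<union> D2) M"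
  proof
    show "(\<lambda>j. h (r1 (r2 j))) \<longlonglongrightarrow> 0"
      using LIMSEQ_subseq_LIMSEQ[OF LIMSEQ_subseq_LIMSEQ[OF hl r1(1)] r2(1)] by (simp add: comp_def)
    show "(\<lambda>j. stp (h (r1 (r2 j))) (Wd (h (r1 (r2 j)))) x) \<longlonglongrightarrow> f1 x" if "x \<in> {0<..<2} - (D1 \<union> D2)" for x
      using LIMSEQ_subseq_LIMSEQ[OF r1(4) r2(1), of x] that by (simp add: comp_def)
    show "h (r1 (r2 j)) \<le> 1" for j using h(2)[of "r1 (r2 j)"] h0 by simp
  qed (use h r1 r2 M in auto)
  then show ?thesis by blast
qed

section \<open>Limit equations for the scale function\<close>

context helly_limit begin

definition C :: "real set" where "C = {0<..<2} - D"

lemma AE_C: "AE y in lborel. y \<in> {0<..<2} \<longrightarrow> y \<in> C"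
proof -
  have "AE y in lborel. y \<notin> D" using countable_imp_null_set_lborel[OF cD] by (rule AE_not_in)
  then show ?thesis by eventually_elim (auto simp: C_def)
qed

lemma C_dense: assumes "0 \<le> a" "a < b" "b \<le> 2" shows "\<exists>c\<in>C. a < c \<and> c < b"
proof -
  have "\<not> {a<..<b} \<subseteq> D"
    using cD countable_subset uncountable_open_interval[of a b] assms by blast
  then show ?thesis using assms by (auto simp: C_def)
qed

lemma C_seq: assumes "0 \<le> x" "x < 2" shows "\<exists>X. (\<forall>n. X n \<in> C \<and> X n > x) \<and> X \<longlonglongrightarrow> x"
proof -
  have "\<exists>c\<in>C. x < c \<and> c < x + (2 - x) / real (Suc n)" for n
  proof (rule C_dense)
    have "(2 - x) / real (Suc n) \<le> (2 - x) / 1" using assms by (intro divide_left_mono) auto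
    then show "x + (2 - x) / real (Suc n) \<le> 2" by simp
  qed (use assms in auto)
  then obtain X where X: "\<And>n. X n \<in> C" "\<And>n. x < X n" "\<And>n. X n < x + (2 - x) / real (Suc n)"
    by metis
  have "X \<longlonglongrightarrow> x"
  proof (rule real_tendsto_sandwich)
    show "\<forall>\<^sub>F n in sequentially. x \<le> X n" by (intro always_eventually allI less_imp_le X)
    show "\<forall>\<^sub>F n in sequentially. X n \<le> x + (2 - x) * inverse (real (Suc n))"
      by (intro always_eventually allI less_imp_le X(3)[unfolded divide_inverse])
    show "(\<lambda>n. x + (2 - x) * inverse (real (Suc n))) \<longlonglongrightarrow> x"
      using tendsto_add[OF tendsto_const[of x] tendsto_mult_left[OF LIMSEQ_inverse_real_of_nat, of "2 - x"]] by simp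
  qed simp
  then show ?thesis using X by blast
qed

lemma C_iff: "x \<in> C \<Longrightarrow> 0 < x" "x \<in> C \<Longrightarrow> x < 2" by (auto simp: C_def)

lemma idx_le2: "0 \<le> x \<Longrightarrow> x \<le> 2 \<Longrightarrow> real (idx (h j) x) * h j \<le> 2"
  using idx_bounds(1)[OF h_pos, of x j] by linarith

abbreviation sW where "sW j \<equiv> stp (h j) (Wd (h j))"
abbreviation sZ where "sZ j \<equiv> stp (h j) (Zd (h j))"

lemma sW_bounds: "0 \<le> x \<Longrightarrow> x \<le> 2 \<Longrightarrow> 0 \<le> sW j x" "0 \<le> x \<Longrightarrow> x \<le> 2 \<Longrightarrow> sW j x \<le> M"
  using less_imp_le[OF Wd_pos[OF h_pos]] W_le[OF idx_le2] by (auto simp: stp_def)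

lemma M_nonneg: "M \<ge> 0" using sW_bounds[of 0 0] by simp

lemma Wl_bounds: assumes "0 < x" "x < 2" shows "0 \<le> Wl x" "Wl x \<le> M"
proof -
  have *: "0 \<le> Wl c" "Wl c \<le> M" if "c \<in> C" for c
    using that C_iff[OF that] sW_bounds[of c] W_lim[of c]
    by (auto simp: C_def intro: LIMSEQ_le_const LIMSEQ_le_const2)
  obtain a where "a \<in> C" "a < x" using C_dense[of 0 x] assms by auto
  then show "0 \<le> Wl x" using *(1)[of a] monoD[OF mono_W, of a x] by simp
  obtain b where "b \<in> C" "x < b" using C_dense[of x 2] assms by auto
  then show "Wl x \<le> M" using *(2)[of b] monoD[OF mono_W, of x b] by simp
qed

lemma Wl_meas [measurable]: "Wl \<in> borel_measurable borel" by (rule borel_measurable_mono[OF mono_W])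
lemma gl_meas [measurable]: "gl \<in> borel_measurable borel" by (rule borel_measurable_mono[OF mono_g])

lemma Wl_L: "L Wl"
proof -
  have "set_integrable lborel {0..2} (\<lambda>x. if 0 < x \<and> x < 2 then Wl x else 0)"
    using Wl_bounds M_nonneg by (intro set_integrable_bounded_Icc[where B = M]) auto
  moreover have "AE x in lborel. x \<in> {0..2} \<longrightarrow> (if 0 < x \<and> x < 2 then Wl x else 0) = Wl x"
    using AE_lborel_singleton[of 0] AE_lborel_singleton[of 2] by eventually_elim auto
  ultimately show ?thesis
    by (subst (asm) set_integrable_cong_AE[where g = Wl]) auto
qed

lemma DCT_step:
  fixes s :: "nat \<Rightarrow> real \<Rightarrow> real" and g :: "real \<Rightarrow> real" and x B :: real
  assumes x: "0 \<le> x" "x \<le> 2" and f: "\<And>j. s j \<in> borel_measurable borel" and g: "g \<in> borel_measurable borel"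
    and b: "\<And>j y. 0 < y \<Longrightarrow> y < x \<Longrightarrow> \<bar>s j y\<bar> \<le> B"
    and lim: "\<And>y. y \<in> C \<Longrightarrow> y < x \<Longrightarrow> (\<lambda>j. s j y) \<longlonglongrightarrow> g y"
  shows "(\<lambda>j. LINT y:{0..x}|lborel. s j y) \<longlonglongrightarrow> (LINT y:{0..x}|lborel. g y)"
  unfolding set_lebesgue_integral_def
proof (rule integral_dominated_convergence[where w = "\<lambda>y. indicator {0..2} y * \<bar>B\<bar>"])
  show "integrable lborel (\<lambda>y::real. indicator {0..2} y * \<bar>B\<bar>)"
    by (intro integrable_mult_left integrable_real_indicator emeasure_bounded_finite) auto
  show "AE y in lborel. norm (indicator {0..x} y *\<^sub>R s j y) \<le> indicator {0..2} y * \<bar>B\<bar>" for j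
    using AE_lborel_singleton[of 0] AE_lborel_singleton[of x]
  proof eventually_elim
    case (elim y)
    then show ?case using b[of y j] x by (auto simp: indicator_def)
  qed
  show "AE y in lborel. (\<lambda>j. indicator {0..x} y *\<^sub>R s j y) \<longlonglongrightarrow> indicator {0..x} y *\<^sub>R g y"
    using AE_C AE_lborel_singleton[of 0] AE_lborel_singleton[of x]
  proof eventually_elim
    case (elim y)
    then show ?case using lim[of y] x by (auto simp: indicator_def)
  qed
qed (use f g in measurable)

lemma sW_int: "0 \<le> x \<Longrightarrow> x \<le> 2 \<Longrightarrow> (\<lambda>j. LINT y:{0..x}|lborel. sW j y) \<longlonglongrightarrow> (LINT y:{0..x}|lborel. Wl y)"
proof (rule DCT_step[where B = M])
  fix j y assume "0 \<le> x" "x \<le> 2" "0 < y" "y < x"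
  then show "\<bar>sW j y\<bar> \<le> M" using sW_bounds[of y j] by simp
qed (auto simp: C_def W_lim)

lemma sum_lim:
  assumes x: "0 \<le> x" "x \<le> 2" and s: "\<And>j n. s j n \<ge> 0" and B: "\<And>j n. real n * h j \<le> 2 \<Longrightarrow> s j n \<le> B"
    and lim: "(\<lambda>j. LINT y:{0..x}|lborel. stp (h j) (s j) y) \<longlonglongrightarrow> c"
  shows "(\<lambda>j. h j * (\<Sum>i<idx (h j) x. s j i)) \<longlonglongrightarrow> c"
proof (rule real_tendsto_sandwich)
  have hB: "h j * s j (idx (h j) x) \<le> h j * B" for j
    by (rule mult_left_mono[OF B[OF idx_le2[OF x]] less_imp_le[OF h_pos]])
  show "\<forall>\<^sub>F j in sequentially. (LINT y:{0..x}|lborel. stp (h j) (s j) y) - h j * B \<le> h j * (\<Sum>i<idx (h j) x. s j i)"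
  proof (intro always_eventually allI)
    show "(LINT y:{0..x}|lborel. stp (h j) (s j) y) - h j * B \<le> h j * (\<Sum>i<idx (h j) x. s j i)" for j
      using stp_integral_bounds(2)[where s = "s j", OF h_pos x(1) s, of j] hB[of j] by linarith
  qed
  show "\<forall>\<^sub>F j in sequentially. h j * (\<Sum>i<idx (h j) x. s j i) \<le> (LINT y:{0..x}|lborel. stp (h j) (s j) y)"
    by (intro always_eventually allI stp_integral_bounds(1)[OF h_pos x(1) s])
  show "(\<lambda>j. (LINT y:{0..x}|lborel. stp (h j) (s j) y) - h j * B) \<longlonglongrightarrow> c"
    using tendsto_diff[OF lim tendsto_mult_right[OF h_lim, of B]] by simp
qed (rule lim)

definition Zl :: "real \<Rightarrow> real" where "Zl x = 1 + l * (LINT y:{0..x}|lborel. Wl y)"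

lemma sZ_lim: assumes x: "0 \<le> x" "x \<le> 2" shows "(\<lambda>j. sZ j x) \<longlonglongrightarrow> Zl x"
proof -
  have "(\<lambda>j. h j * (\<Sum>i<idx (h j) x. Wd (h j) i)) \<longlonglongrightarrow> (LINT y:{0..x}|lborel. Wl y)"
    by (rule sum_lim[OF x less_imp_le[OF Wd_pos[OF h_pos]] W_le sW_int[OF x]])
  then have "(\<lambda>j. 1 + l * (h j * (\<Sum>i<idx (h j) x. Wd (h j) i))) \<longlonglongrightarrow> Zl x"
    unfolding Zl_def by (intro tendsto_intros)
  then show ?thesis by (simp add: stp_def Zd_sum[OF h_pos])
qed

lemma Zd_le: assumes "real n * h j \<le> 2" shows "Zd (h j) n \<le> 1 + l * (2 * M)"
proof -
  have "(\<Sum>i<n. Wd (h j) i) \<le> (\<Sum>i<n. M)"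
  proof (rule sum_mono)
    fix i assume "i \<in> {..<n}"
    then have "real i * h j \<le> real n * h j" using h_pos[of j] by (intro mult_right_mono) auto
    then show "Wd (h j) i \<le> M" using assms by (intro W_le) linarith
  qed
  then have "h j * (\<Sum>i<n. Wd (h j) i) \<le> h j * (real n * M)" using h_pos[of j] by (intro mult_left_mono) auto
  also have "\<dots> = (real n * h j) * M" by simp
  also have "\<dots> \<le> 2 * M" using assms M_nonneg by (intro mult_right_mono)
  finally show ?thesis unfolding Zd_sum[OF h_pos] using l by simp
qed

lemma Zl_eq: "Zl x = 1 + l * cv (\<lambda>_. 1) Wl x" by (simp add: Zl_def cv_one)

lemma Zl_cont: "continuous_on {0..2} Zl"
  unfolding Zl_eq[abs_def] by (intro continuous_intros continuous_cv Wl_L)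

lemma sZ_bounds: "0 \<le> x \<Longrightarrow> x \<le> 2 \<Longrightarrow> 0 \<le> sZ j x" "0 \<le> x \<Longrightarrow> x \<le> 2 \<Longrightarrow> sZ j x \<le> 1 + l * (2 * M)"
proof -
  show "0 \<le> sZ j x" using Zd_ge_1[OF h_pos, of j "idx (h j) x"] unfolding stp_def by linarith
  show "0 \<le> x \<Longrightarrow> x \<le> 2 \<Longrightarrow> sZ j x \<le> 1 + l * (2 * M)" unfolding stp_def by (rule Zd_le[OF idx_le2])
qed

lemma Zl_bounds: "0 \<le> x \<Longrightarrow> x \<le> 2 \<Longrightarrow> Zl x \<le> 1 + l * (2 * M)"
  by (rule LIMSEQ_le_const2[OF sZ_lim]) (auto intro: sZ_bounds)

lemma sZ_int: "0 \<le> x \<Longrightarrow> x \<le> 2 \<Longrightarrow> (\<lambda>j. LINT y:{0..x}|lborel. sZ j y) \<longlonglongrightarrow> (LINT y:{0..x}|lborel. Zl y)"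
proof -
  assume x: "0 \<le> x" "x \<le> 2"
  define g where "g y = indicator {0..2} y * Zl y" for y
  have gm: "g \<in> borel_measurable borel"
    using L_continuous[OF Zl_cont] unfolding set_integrable_def g_def[abs_def]
    by (auto dest: borel_measurable_integrable)
  have "(\<lambda>j. LINT y:{0..x}|lborel. sZ j y) \<longlonglongrightarrow> (LINT y:{0..x}|lborel. g y)"
  proof (rule DCT_step[where B = "1 + l * (2 * M)", OF x _ gm])
    fix j y assume "0 < y" "y < x"
    then show "\<bar>sZ j y\<bar> \<le> 1 + l * (2 * M)" using sZ_bounds[of y j] x by simp
  next
    fix y assume "y \<in> C" "y < x"
    then show "(\<lambda>j. sZ j y) \<longlonglongrightarrow> g y" using sZ_lim[of y] x by (simp add: C_def g_def)
  qed simp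
  also have "(LINT y:{0..x}|lborel. g y) = (LINT y:{0..x}|lborel. Zl y)"
    using x by (intro set_lebesgue_integral_cong) (auto simp: g_def)
  finally show ?thesis .
qed

lemma Zsum_lim: assumes x: "0 \<le> x" "x \<le> 2"
  shows "(\<lambda>j. h j * (\<Sum>i<idx (h j) x. Zd (h j) i)) \<longlonglongrightarrow> (LINT y:{0..x}|lborel. Zl y)"
    "(\<lambda>j. h j * (\<Sum>i\<le>idx (h j) x. Zd (h j) i)) \<longlonglongrightarrow> (LINT y:{0..x}|lborel. Zl y)"
proof -
  have nn: "0 \<le> Zd (h j) n" for j n using Zd_ge_1[OF h_pos, of j n] by linarith
  show 1: "(\<lambda>j. h j * (\<Sum>i<idx (h j) x. Zd (h j) i)) \<longlonglongrightarrow> (LINT y:{0..x}|lborel. Zl y)"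
    by (rule sum_lim[OF x nn Zd_le sZ_int[OF x]])
  have "(\<lambda>j. h j * (\<Sum>i<idx (h j) x. Zd (h j) i) + h j * sZ j x) \<longlonglongrightarrow> (LINT y:{0..x}|lborel. Zl y) + 0 * Zl x"
    by (intro tendsto_add 1 tendsto_mult h_lim sZ_lim x)
  also have "(\<lambda>j. h j * (\<Sum>i<idx (h j) x. Zd (h j) i) + h j * sZ j x) = (\<lambda>j. h j * (\<Sum>i\<le>idx (h j) x. Zd (h j) i))"
    by (simp add: lessThan_Suc_atMost[symmetric] stp_def distrib_left)
  finally show "(\<lambda>j. h j * (\<Sum>i\<le>idx (h j) x. Zd (h j) i)) \<longlonglongrightarrow> (LINT y:{0..x}|lborel. Zl y)" by simp
qed

lemma cv_lim: assumes x: "0 \<le> x" "x < 2" shows "(\<lambda>j. cv (sW j) F x) \<longlonglongrightarrow> cv Wl F x"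
  unfolding cv_def set_lebesgue_integral_def
proof (rule integral_dominated_convergence[where w = "\<lambda>y. M * (indicator {0..x} y *\<^sub>R F y)"])
  show "integrable lborel (\<lambda>y. M * (indicator {0..x} y *\<^sub>R F y))"
    using F_int[of x] unfolding set_integrable_def by (rule integrable_mult_right)
  show "AE y in lborel. norm (indicator {0..x} y *\<^sub>R (sW j (x - y) * F y)) \<le> M * (indicator {0..x} y *\<^sub>R F y)" for j
    using sW_bounds[of "x - _" j] x
    by (intro AE_I2) (auto simp: indicator_def abs_mult F_nonneg intro!: mult_right_mono)
  \<comment> \<open>The points \<open>y\<close> for which \<open>x - y\<close> is exceptional form a
    countable set, hence a null set.\<close>
  have "AE y in lborel. y \<notin> (\<lambda>z. x - z) ` (D \<union> {0})"
    by (intro AE_not_in countable_imp_null_set_lborel countable_image countable_Un cD) simp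
  then show "AE y in lborel. (\<lambda>j. indicator {0..x} y *\<^sub>R (sW j (x - y) * F y)) \<longlonglongrightarrow> indicator {0..x} y *\<^sub>R (Wl (x - y) * F y)"
    using AE_lborel_singleton[of x] AE_lborel_singleton[of 0]
  proof eventually_elim
    case (elim y)
    have "x - y \<notin> D"
    proof
      assume "x - y \<in> D"
      then have "x - (x - y) \<in> (\<lambda>z. x - z) ` (D \<union> {0})" by blast
      then show False using elim(1) by simp
    qed
    then have "(\<lambda>j. sW j (x - y)) \<longlonglongrightarrow> Wl (x - y)" if "0 \<le> y" "y \<le> x"
      using that elim x by (intro W_lim) auto
    then show ?case by (auto simp: indicator_def intro!: tendsto_mult_right)
  qed
qed measurable

text \<open>The discrete convolution identity turns the two Riemann bounds into sums of
  \<open>Z\<close>, which converge to the same integral.\<close>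

lemma cv_Wl: assumes x: "0 \<le> x" "x < 2" shows "cv Wl F x = (LINT y:{0..x}|lborel. Zl y)"
proof (rule LIMSEQ_unique[OF cv_lim[OF x]], rule real_tendsto_sandwich)
  have nn: "0 \<le> Wd (h j) n" for j n using Wd_pos[OF h_pos, of j n] by simp
  show "\<forall>\<^sub>F j in sequentially. cv (sW j) F x \<le> h j * (\<Sum>i\<le>idx (h j) x. Zd (h j) i)"
  proof (intro always_eventually allI)
    show "cv (sW j) F x \<le> h j * (\<Sum>i\<le>idx (h j) x. Zd (h j) i)" for j
      using cv_stp_upper[OF h_pos x(1) nn Wd_mono[OF h_pos], of j j] by (simp add: conv_d[OF h_pos])
  qed
  \<comment> \<open>If the index of \<open>x\<close> is \<open>Suc n\<close>, the lower Riemann sum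
    is the discrete convolution at \<open>n\<close>; at index 0 it is empty.\<close>
  have "h j * (\<Sum>i<idx (h j) x. Zd (h j) i) \<le> cv (sW j) F x" for j
  proof (cases "idx (h j) x")
    case 0
    then show ?thesis using cv_stp_lower[OF h_pos x(1) nn Wd_mono[OF h_pos], of j j] by simp
  next
    case (Suc n)
    have "(\<Sum>i<Suc n. avg (h j) i * Wd (h j) (n - i)) = (\<Sum>i<Suc n. Zd (h j) i)"
      using conv_d[OF h_pos, of j n] by (simp add: lessThan_Suc_atMost)
    then show ?thesis using cv_stp_lower[OF h_pos x(1) nn Wd_mono[OF h_pos], of j j] Suc by simp
  qed
  then show "\<forall>\<^sub>F j in sequentially. h j * (\<Sum>i<idx (h j) x. Zd (h j) i) \<le> cv (sW j) F x" by simp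
qed (use Zsum_lim x in auto)

text \<open>In the convolution at \<open>2 y\<close> the integrand on \<open>(0,y)\<close> is at
  least \<open>Wl y * F y\<close>, because \<open>Wl\<close> increases and \<open>F\<close>
  decreases. The convolution itself is the integral of \<open>Zl\<close> over
  \<open>[0, 2 y]\<close>, so it is of order \<open>y\<close>.\<close>

lemma Wl_F_bound: assumes y: "0 < y" "y < 1" shows "Wl y * F y \<le> 2 * (1 + l * (2 * M))"
proof -
  have "y * (Wl y * F y) = (LINT t:{0<..<y}|lborel. Wl y * F y)" using y by (simp add: set_lebesgue_integral_def)
  also have "\<dots> \<le> (LINT t:{0..2 * y}|lborel. Wl (2 * y - t) * F t)"
    unfolding set_lebesgue_integral_def
  proof (rule integral_mono_AE)
    show "integrable lborel (\<lambda>t. indicator {0<..<y} t *\<^sub>R (Wl y * F y))"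
      by (auto intro!: integrable_real_indicator emeasure_bounded_finite)
    have F2: "integrable lborel (\<lambda>t. M * (indicator {0..2 * y} t *\<^sub>R F t))"
      using F_int[of "2 * y"] unfolding set_integrable_def by (rule integrable_mult_right)
    show "integrable lborel (\<lambda>t. indicator {0..2 * y} t *\<^sub>R (Wl (2 * y - t) * F t))"
    proof (rule Bochner_Integration.integrable_bound[OF F2])
      show "AE t in lborel. norm (indicator {0..2 * y} t *\<^sub>R (Wl (2 * y - t) * F t)) \<le> norm (M * (indicator {0..2 * y} t *\<^sub>R F t))"
        using AE_lborel_singleton[of "2 * y"] AE_lborel_singleton[of 0]
      proof eventually_elim
        case (elim t)
        then show ?case using Wl_bounds[of "2 * y - t"] y F_nonneg[of t] M_nonneg
          by (auto simp: indicator_def abs_mult intro!: mult_right_mono)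
      qed
    qed measurable
    show "AE t in lborel. indicator {0<..<y} t *\<^sub>R (Wl y * F y) \<le> indicator {0..2 * y} t *\<^sub>R (Wl (2 * y - t) * F t)"
      using AE_lborel_singleton[of "2 * y"] AE_lborel_singleton[of 0]
    proof eventually_elim
      case (elim t)
      show ?case
      proof (cases "t \<in> {0<..<y}")
        case True
        then have "Wl y * F y \<le> Wl (2 * y - t) * F t"
          using y Wl_bounds[of "2 * y - t"] F_nonneg by (intro mult_mono monoD[OF mono_W] F_dec) auto
        then show ?thesis using True by simp
      next
        case False
        then show ?thesis using elim Wl_bounds[of "2 * y - t"] y F_nonneg[of t] by (auto simp: indicator_def)
      qed
    qed
  qed
  also have "\<dots> = (LINT t:{0..2 * y}|lborel. Zl t)" using cv_Wl[of "2 * y"] y by (simp add: cv_def)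
  also have "\<dots> \<le> (LINT t:{0..2 * y}|lborel. 1 + l * (2 * M))"
    using y Zl_bounds L_subset[OF L_continuous[OF Zl_cont], of "2 * y"]
    by (intro set_integral_mono) (auto simp: set_integrable_def intro!: integrable_real_indicator emeasure_bounded_finite)
  also have "\<dots> = y * (2 * (1 + l * (2 * M)))" using y by (simp add: set_lebesgue_integral_def)
  finally show ?thesis using y by simp
qed

end

section \<open>Absolute continuity of the limit\<close>

context helly_limit begin

definition B :: "real \<Rightarrow> real" where "B x = 2 * I4 * M / x\<^sup>2"

text \<open>Summing \<open>W i * k n <= W n * k i\<close> over \<open>i <= n\<close> gives
  \<open>k n * sum W <= (W n)^2 <= M * W n\<close>, while the linear lower bound for
  \<open>W\<close> makes \<open>sum W\<close> at least of order \<open>x^2 / h\<close>. So the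
  quotient of \<open>k/h\<close> by \<open>W\<close> is bounded, uniformly in the mesh, on every
  interval away from the origin.\<close>

lemma e_bound:
  assumes x: "0 < x" "x \<le> 2"
  shows "1 / stp (h j) (gd (h j)) x - 1 \<le> B x"
proof -
  define n where "n = idx (h j) x"
  have n2: "real n * h j \<le> 2" using idx_le2[of x j] x by (simp add: n_def)
  have nx: "x < real (Suc n) * h j" using idx_bounds(2)[OF h_pos, of x j] x by (simp add: n_def algebra_simps)
  note hp = h_pos[of j]
  have Wp: "Wd (h j) n > 0" by (rule Wd_pos[OF hp])
  have low: "(h j / I4) * (\<Sum>i\<le>n. real (Suc i)) \<le> (\<Sum>i\<le>n. Wd (h j) i)"
    unfolding sum_distrib_left
  proof (rule sum_mono)
    fix i assume i: "i \<in> {..n}"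
    have "real i * h j \<le> real n * h j" using i hp by (intro mult_right_mono) auto
    then have "real (Suc i) * h j / I4 \<le> Wd (h j) i" using n2 by (intro Wd_lower hp h_le) linarith
    then show "h j / I4 * real (Suc i) \<le> Wd (h j) i" by (simp add: mult.commute)
  qed
  have s: "(real (Suc n))\<^sup>2 / 2 \<le> (\<Sum>i\<le>n. real (Suc i))"
    by (induction n) (auto simp: power2_eq_square algebra_simps)
  have "kd (h j) n * (\<Sum>i\<le>n. Wd (h j) i) = (\<Sum>i\<le>n. Wd (h j) i * kd (h j) n)"
    by (simp add: sum_distrib_right[symmetric])
  also have "\<dots> \<le> (\<Sum>i\<le>n. Wd (h j) n * kd (h j) i)"
    by (intro sum_mono kW_dec_d hp) auto
  also have "\<dots> = Wd (h j) n * Wd (h j) n" by (simp add: sum_distrib_left[symmetric] Wd_sum[OF hp])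
  also have "\<dots> \<le> Wd (h j) n * M" using Wp W_le[OF n2] by (intro mult_left_mono) auto
  finally have 1: "kd (h j) n * (\<Sum>i\<le>n. Wd (h j) i) \<le> Wd (h j) n * M" .
  have kp: "kd (h j) n > 0" by (rule kd_pos[OF hp])
  have "kd (h j) n * ((h j / I4) * ((real (Suc n))\<^sup>2 / 2)) \<le> kd (h j) n * ((h j / I4) * (\<Sum>i\<le>n. real (Suc i)))"
    using kp s hp I4_pos by (intro mult_left_mono) auto
  also have "\<dots> \<le> kd (h j) n * (\<Sum>i\<le>n. Wd (h j) i)" using low kp by (intro mult_left_mono) auto
  finally have "kd (h j) n * ((h j / I4) * ((real (Suc n))\<^sup>2 / 2)) \<le> Wd (h j) n * M" using 1 by linarith
  \<comment> \<open>The factor \<open>2 * I4 * h\<close> clears the denominators and completes the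
    square of \<open>(n + 1) h\<close>, which is larger than \<open>x\<close>.\<close>
  then have "kd (h j) n * ((h j / I4) * ((real (Suc n))\<^sup>2 / 2)) * (2 * I4 * h j) \<le> Wd (h j) n * M * (2 * I4 * h j)"
    using I4_pos hp by (intro mult_right_mono) auto
  moreover have "kd (h j) n * ((h j / I4) * ((real (Suc n))\<^sup>2 / 2)) * (2 * I4 * h j) = kd (h j) n * (real (Suc n) * h j)\<^sup>2"
    using I4_pos by (simp add: power_mult_distrib) (simp add: power2_eq_square)
  ultimately have "kd (h j) n * (real (Suc n) * h j)\<^sup>2 \<le> 2 * I4 * M * (h j * Wd (h j) n)"
    by (simp add: mult_ac)
  moreover have "kd (h j) n * x\<^sup>2 \<le> kd (h j) n * (real (Suc n) * h j)\<^sup>2"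
    using kp x nx by (intro mult_left_mono power_mono) auto
  ultimately have "kd (h j) n * x\<^sup>2 \<le> 2 * I4 * M * (h j * Wd (h j) n)" by linarith
  then have "kd (h j) n / (h j * Wd (h j) n) \<le> B x"
    unfolding B_def using x Wp hp by (simp add: field_simps)
  then show ?thesis by (simp add: stp_def n_def gd_def)
qed

lemma gd_lower: assumes "0 < x" "x \<le> 2" shows "1 / (1 + B x) \<le> stp (h j) (gd (h j)) x"
proof -
  have p: "stp (h j) (gd (h j)) x > 0" unfolding stp_def by (rule gd_pos(1)[OF h_pos])
  have B: "B x \<ge> 0" using I4_pos M_nonneg by (simp add: B_def)
  have "1 \<le> (1 + B x) * stp (h j) (gd (h j)) x"
    using e_bound[OF assms, of j] p by (simp add: field_simps)
  then show ?thesis using B by (simp add: divide_le_eq mult.commute)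
qed

lemma gl_C: assumes "c \<in> C" shows "1 / (1 + B c) \<le> gl c" "gl c \<le> 1"
proof -
  have lim: "(\<lambda>j. stp (h j) (gd (h j)) c) \<longlonglongrightarrow> gl c" using assms by (intro g_lim) (simp add: C_def)
  show "1 / (1 + B c) \<le> gl c"
    by (rule LIMSEQ_le_const[OF lim]) (use gd_lower C_iff[OF assms] in auto)
  show "gl c \<le> 1"
    by (rule LIMSEQ_le_const2[OF lim]) (auto simp: stp_def gd_pos(2)[OF h_pos])
qed

lemma B_nonneg: "B x \<ge> 0" using I4_pos M_nonneg by (simp add: B_def)

lemma gl_bounds: assumes "0 < x" "x < 2" shows "0 < gl x" "gl x \<le> 1"
proof -
  obtain a where "a \<in> C" "a < x" using C_dense[of 0 x] assms by auto
  moreover have "0 < 1 / (1 + B a)" using B_nonneg[of a] by simp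
  ultimately show "0 < gl x" using gl_C(1)[of a] monoD[OF mono_g, of a x] by linarith
  obtain b where "b \<in> C" "x < b" using C_dense[of x 2] assms by auto
  then show "gl x \<le> 1" using gl_C(2)[of b] monoD[OF mono_g, of x b] by simp
qed

text \<open>Undoes the transformation \<open>q -> 1/(1 + q)\<close>: this is the limit of the
  quotient of \<open>k/h\<close> by \<open>W\<close>.\<close>

definition el :: "real \<Rightarrow> real" where "el x = 1 / gl x - 1"
definition kk :: "real \<Rightarrow> real" where "kk x = (if 0 < x \<and> x < 2 then el x * Wl x else 0)"

lemma el_meas [measurable]: "el \<in> borel_measurable borel" unfolding el_def[abs_def] by measurable
lemma kk_meas [measurable]: "kk \<in> borel_measurable borel" unfolding kk_def[abs_def] by measurable

lemma el_nonneg: "0 < x \<Longrightarrow> x < 2 \<Longrightarrow> 0 \<le> el x"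
  using gl_bounds[of x] by (simp add: el_def)

lemma kk_nonneg: "0 \<le> kk x" by (simp add: kk_def el_nonneg Wl_bounds)

abbreviation sk where "sk j \<equiv> stp (h j) (\<lambda>n. kd (h j) n / h j)"

lemma sk_eq: "sk j x = (1 / stp (h j) (gd (h j)) x - 1) * sW j x"
  by (simp add: stp_def kd_gd[OF h_pos])

lemma sk_bounds: assumes "0 < x" "x \<le> 2" shows "0 \<le> sk j x" "sk j x \<le> B x * M"
proof -
  show "0 \<le> sk j x" using kd_pos[OF h_pos, of j "idx (h j) x"] h_pos[of j] by (simp add: stp_def)
  show "sk j x \<le> B x * M"
    unfolding sk_eq using e_bound[OF assms] sW_bounds[of x j] assms B_nonneg by (intro mult_mono) auto
qed

lemma sk_lim: assumes x: "x \<in> C" shows "(\<lambda>j. sk j x) \<longlonglongrightarrow> kk x"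
proof -
  have "(\<lambda>j. (1 / stp (h j) (gd (h j)) x - 1) * sW j x) \<longlonglongrightarrow> el x * Wl x"
    unfolding el_def using x gl_bounds[of x] C_iff[OF x]
    by (intro tendsto_intros g_lim W_lim) (auto simp: C_def)
  then show ?thesis using C_iff[OF x] by (simp add: kk_def sk_eq)
qed

lemma kk_bound: assumes "x \<in> C" shows "kk x \<le> B x * M"
  by (rule LIMSEQ_le_const2[OF sk_lim[OF assms]]) (use sk_bounds C_iff[OF assms] in \<open>auto intro: less_imp_le\<close>)

text \<open>As \<open>k\<close> is the increment of \<open>W\<close>, the step function
  \<open>k/h\<close> integrates to \<open>W\<close> up to the contribution of the cell that contains
  \<open>x\<close>.\<close>

lemma sk_integral:
  assumes x: "0 < x" "x < 2"
  shows "(LINT y:{0..x}|lborel. sk j y) = sW j x - kd (h j) (idx (h j) x) + (x - real (idx (h j) x) * h j) * sk j x"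
proof -
  have "(\<Sum>i<idx (h j) x. kd (h j) i / h j) * h j = (\<Sum>i<idx (h j) x. kd (h j) i)"
    using h_pos[of j] by (simp add: sum_distrib_right)
  moreover have "sW j x = (\<Sum>i<idx (h j) x. kd (h j) i) + kd (h j) (idx (h j) x)"
    by (simp add: stp_def Wd_sum[OF h_pos] lessThan_Suc_atMost[symmetric])
  ultimately show ?thesis
    using x by (subst stp_integral[OF h_pos]) (auto simp: stp_def mult.commute)
qed

lemma sk_integral_lim: assumes x: "x \<in> C" shows "(\<lambda>j. LINT y:{0..x}|lborel. sk j y) \<longlonglongrightarrow> Wl x"
proof -
  note x' = C_iff[OF x]
  have b: "norm ((LINT y:{0..x}|lborel. sk j y) - sW j x) \<le> h j * (B x * M)" for j
  proof -
    note hp = h_pos[of j]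
    have "0 \<le> x - real (idx (h j) x) * h j" "x - real (idx (h j) x) * h j \<le> h j"
      using idx_bounds[OF hp, of x] x' by (auto simp: algebra_simps)
    then have "0 \<le> (x - real (idx (h j) x) * h j) * sk j x" "(x - real (idx (h j) x) * h j) * sk j x \<le> h j * sk j x"
      using sk_bounds[of x j] x' by (auto intro: mult_right_mono)
    moreover have "kd (h j) (idx (h j) x) = h j * sk j x" using hp by (simp add: stp_def)
    moreover have "h j * sk j x \<le> h j * (B x * M)" using sk_bounds[of x j] x' hp by (intro mult_left_mono) auto
    moreover have "0 \<le> h j * sk j x" using sk_bounds[of x j] x' hp by simp
    ultimately show ?thesis using sk_integral[OF x', of j] by (simp add: abs_le_iff)
  qed
  have "(\<lambda>j. (LINT y:{0..x}|lborel. sk j y) - sW j x) \<longlonglongrightarrow> 0"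
    by (rule Lim_null_comparison[OF always_eventually[OF allI, OF b]])
      (use tendsto_mult_right[OF h_lim, of "B x * M"] in simp)
  moreover have "(\<lambda>j. sW j x) \<longlonglongrightarrow> Wl x" using x by (intro W_lim) (simp add: C_def)
  ultimately show ?thesis using tendsto_add by fastforce
qed

lemma sk_set_integrable: assumes "0 \<le> a" "b \<le> 2" shows "set_integrable lborel {a..b} (sk j)"
proof (rule set_integrable_bounded_Icc)
  fix y assume y: "y \<in> {a..b}"
  have "\<bar>kd (h j) n\<bar> \<le> Wd (h j) n" for n
    using Wd_sum[OF h_pos, of j n] member_le_sum[of n "{..n}" "kd (h j)"] less_imp_le[OF kd_pos[OF h_pos]] by simp
  then have "\<bar>sk j y\<bar> \<le> sW j y / h j" using h_pos[of j] by (simp add: stp_def divide_right_mono)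
  also have "\<dots> \<le> M / h j" using sW_bounds[of y j] y assms h_pos[of j] by (intro divide_right_mono) auto
  finally show "\<bar>sk j y\<bar> \<le> M / h j" .
qed simp

text \<open>Between two points of \<open>C\<close> the origin is out of reach, so the approximations
  of \<open>k\<close> are dominated by the constant \<open>B x * M\<close>, and their integrals
  converge to increments of \<open>Wl\<close>.\<close>

lemma kk_integral: assumes xx: "x \<in> C" "x' \<in> C" "x \<le> x'"
  shows "set_integrable lborel {x..x'} kk" "(LINT y:{x..x'}|lborel. kk y) = Wl x' - Wl x"
proof -
  note c = C_iff[OF xx(1)] C_iff[OF xx(2)]
  have B: "B y * M \<le> B x * M" if "x \<le> y" for y
    unfolding B_def using that c I4_pos M_nonneg
    by (intro mult_right_mono divide_left_mono power_mono mult_pos_pos) auto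
  have AEb: "AE y in lborel. y \<in> {x..x'} \<longrightarrow> y \<in> C"
    using AE_C by eventually_elim (use c in auto)
  have w: "integrable lborel (\<lambda>y. indicator {x..x'} y * (B x * M))"
    by (intro integrable_mult_left integrable_real_indicator emeasure_bounded_finite) auto
  show 1: "set_integrable lborel {x..x'} kk"
    unfolding set_integrable_def
  proof (rule Bochner_Integration.integrable_bound[OF w])
    show "AE y in lborel. norm (indicator {x..x'} y *\<^sub>R kk y) \<le> norm (indicator {x..x'} y * (B x * M))"
      using AEb
    proof eventually_elim
      case (elim y)
      then show ?case using kk_nonneg[of y] kk_bound[of y] B[of y] by (auto simp: indicator_def)
    qed
  qed measurable
  have "(\<lambda>j. LINT y:{x..x'}|lborel. sk j y) \<longlonglongrightarrow> (LINT y:{x..x'}|lborel. kk y)"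
    unfolding set_lebesgue_integral_def
  proof (rule integral_dominated_convergence[OF _ _ w])
    show "AE y in lborel. (\<lambda>j. indicator {x..x'} y *\<^sub>R sk j y) \<longlonglongrightarrow> indicator {x..x'} y *\<^sub>R kk y"
      using AEb by eventually_elim (auto simp: indicator_def sk_lim)
    show "AE y in lborel. norm (indicator {x..x'} y *\<^sub>R sk j y) \<le> indicator {x..x'} y * (B x * M)" for j
    proof (intro AE_I2)
      fix y show "norm (indicator {x..x'} y *\<^sub>R sk j y) \<le> indicator {x..x'} y * (B x * M)"
        using sk_bounds[of y j] B[of y] c by (auto simp: indicator_def)
    qed
  qed measurable
  moreover have "(LINT y:{x..x'}|lborel. sk j y) = (LINT y:{0..x'}|lborel. sk j y) - (LINT y:{0..x}|lborel. sk j y)" for j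
  proof -
    have "(LINT y:{0..x} \<union> {x..x'}|lborel. sk j y) = (LINT y:{0..x}|lborel. sk j y) + (LINT y:{x..x'}|lborel. sk j y)"
    proof (rule set_integral_Un_AE)
      show "AE y in lborel. \<not> (y \<in> {0..x} \<and> y \<in> {x..x'})"
        using AE_lborel_singleton[of x] by eventually_elim auto
    qed (use c in \<open>auto intro!: sk_set_integrable\<close>)
    moreover have "{0..x} \<union> {x..x'} = {0..x'}" using c xx by auto
    ultimately show ?thesis by simp
  qed
  moreover have "(\<lambda>j. (LINT y:{0..x'}|lborel. sk j y) - (LINT y:{0..x}|lborel. sk j y)) \<longlonglongrightarrow> Wl x' - Wl x"
    by (intro tendsto_diff sk_integral_lim xx)
  ultimately show "(LINT y:{x..x'}|lborel. kk y) = Wl x' - Wl x"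
    using LIMSEQ_unique by force
qed

text \<open>The integral over each compact part of \<open>(0,2)\<close> is bounded by an increment
  of \<open>Wl\<close>, hence by \<open>M\<close>; monotone convergence exhausts the
  interval.\<close>

lemma kk_L: "L kk"
  unfolding set_integrable_def
proof (rule integrableI_nonneg)
  define A where "A n = {1 / real (Suc n)..2 - 1 / real (Suc n)}" for n
  have bnd: "(\<integral>\<^sup>+ y. indicator (A n) y * ennreal (kk y) \<partial>lborel) \<le> ennreal M" for n
  proof -
    obtain a where a: "a \<in> C" "a < 1 / real (Suc n)" using C_dense[of 0 "1 / real (Suc n)"] by (auto simp: field_simps)
    obtain b where b: "b \<in> C" "max a (2 - 1 / real (Suc n)) < b" using C_dense[of "max a (2 - 1 / real (Suc n))" 2] C_iff[OF a(1)] by (auto simp: le_max_iff_disj)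
    have ab: "a \<le> b" using b by simp
    have "(\<integral>\<^sup>+ y. indicator (A n) y * ennreal (kk y) \<partial>lborel) \<le> (\<integral>\<^sup>+ y. ennreal (indicator {a..b} y *\<^sub>R kk y) \<partial>lborel)"
      using a b by (intro nn_integral_mono) (auto simp: indicator_def A_def)
    also have "\<dots> = ennreal (LINT y:{a..b}|lborel. kk y)"
      unfolding set_lebesgue_integral_def using kk_integral(1)[OF a(1) b(1) ab] kk_nonneg
      by (intro nn_integral_eq_integral) (auto simp: set_integrable_def)
    also have "\<dots> \<le> ennreal M"
      using kk_integral(2)[OF a(1) b(1) ab] Wl_bounds(1)[of a] Wl_bounds(2)[of b] C_iff a b by (intro ennreal_leI) auto
    finally show ?thesis .
  qed
  have "(\<integral>\<^sup>+ y. ennreal (indicator {0..2} y *\<^sub>R kk y) \<partial>lborel) = (\<integral>\<^sup>+ y. (SUP n. indicator (A n) y * ennreal (kk y)) \<partial>lborel)"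
  proof (intro nn_integral_cong)
    fix y :: real
    show "ennreal (indicator {0..2} y *\<^sub>R kk y) = (SUP n. indicator (A n) y * ennreal (kk y))"
    proof (cases "0 < y \<and> y < 2")
      case False
      then have "kk y = 0" by (simp only: kk_def if_False)
      then show ?thesis by simp
    next
      case True
      then obtain n where n: "inverse (real (Suc n)) < min y (2 - y)" using reals_Archimedean[of "min y (2 - y)"] by auto
      then have "y \<in> A n" by (auto simp: A_def inverse_eq_divide)
      then have "ennreal (kk y) \<le> (SUP n. indicator (A n) y * ennreal (kk y))"
        by (intro SUP_upper2[of n]) auto
      moreover have "(SUP n. indicator (A n) y * ennreal (kk y)) \<le> ennreal (kk y)"
        by (rule SUP_least) (auto simp: indicator_def)
      ultimately show ?thesis using True by simp
    qed
  qed
  also have "\<dots> = (SUP n. \<integral>\<^sup>+ y. indicator (A n) y * ennreal (kk y) \<partial>lborel)"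
  proof (rule nn_integral_monotone_convergence_SUP)
    show "incseq (\<lambda>n y. indicator (A n) y * ennreal (kk y))"
    proof (rule incseq_SucI, rule le_funI)
      fix n y
      have "1 / real (Suc (Suc n)) \<le> 1 / real (Suc n)" by (intro divide_left_mono) auto
      then have "A n \<subseteq> A (Suc n)" unfolding A_def by auto
      then show "indicator (A n) y * ennreal (kk y) \<le> indicator (A (Suc n)) y * ennreal (kk y)"
        by (auto simp: indicator_def)
    qed
  qed (simp add: A_def)
  also have "\<dots> \<le> ennreal M" by (rule SUP_least) (rule bnd)
  finally show "(\<integral>\<^sup>+ y. ennreal (indicator {0..2} y *\<^sub>R kk y) \<partial>lborel) < \<infinity>"
    by (simp add: le_less_trans)
qed (auto simp: kk_nonneg)

definition W :: "real \<Rightarrow> real" where "W = cv (\<lambda>_. 1) kk"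

lemma W_cont: "continuous_on {0..2} W" unfolding W_def by (intro continuous_cv kk_L) auto

lemma W_0: "W 0 = 0" by (simp add: W_def cv_at_0)

text \<open>\<open>Wl * F\<close> is bounded near 0 while \<open>F\<close> is unbounded there, which
  forces \<open>Wl(0+) = 0\<close>. A jump at 0 would be invisible to the density
  \<open>kk\<close>.\<close>

lemma Wl_small: assumes e: "e > 0" shows "\<exists>d>0. \<forall>y. 0 < y \<longrightarrow> y < d \<longrightarrow> Wl y < e"
proof -
  define K where "K = 2 * (1 + l * (2 * M))"
  have K: "K \<ge> 0" using l M_nonneg by (simp add: K_def)
  obtain x where x: "x > 0" "F x > K / e" using F_unb by blast
  have "Wl y < e" if y: "0 < y" "y < min x 1" for y
  proof (rule ccontr)
    assume "\<not> Wl y < e"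
    have "K / e < F y" using F_dec[of y x] x y by auto
    then have "K < e * F y" using e by (simp add: field_simps)
    also have "\<dots> \<le> Wl y * F y" using \<open>\<not> Wl y < e\<close> F_nonneg by (intro mult_right_mono) auto
    also have "\<dots> \<le> K" unfolding K_def using y by (intro Wl_F_bound) auto
    finally show False by simp
  qed
  then show ?thesis using x by (intro exI[of _ "min x 1"]) auto
qed

lemma W_diff: assumes "0 \<le> x" "x \<le> x'" "x' \<le> 2" shows "W x' - W x = (LINT y:{x..x'}|lborel. kk y)"
proof -
  have "(LINT y:{0..x} \<union> {x..x'}|lborel. kk y) = (LINT y:{0..x}|lborel. kk y) + (LINT y:{x..x'}|lborel. kk y)"
  proof (rule set_integral_Un_AE)
    show "AE y in lborel. \<not> (y \<in> {0..x} \<and> y \<in> {x..x'})"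
      using AE_lborel_singleton[of x] by eventually_elim auto
    show "set_integrable lborel {0..x} kk" "set_integrable lborel {x..x'} kk"
      using kk_L assms by (auto intro: set_integrable_subset)
  qed auto
  moreover have "{0..x} \<union> {x..x'} = {0..x'}" using assms by auto
  ultimately show ?thesis by (simp add: W_def cv_one)
qed

text \<open>Both functions have the same increments between points of \<open>C\<close>, and both
  tend to 0 at the origin.\<close>

lemma W_Wl: assumes x: "x \<in> C" shows "W x = Wl x"
proof -
  note c = C_iff[OF x]
  obtain X where X: "\<And>n. X n \<in> C" "\<And>n. X n > 0" "X \<longlonglongrightarrow> 0" using C_seq[of 0] by auto
  have ev: "\<forall>\<^sub>F n in sequentially. X n < x" using order_tendstoD(2)[OF X(3)] c by simp
  have eq: "\<forall>\<^sub>F n in sequentially. W x - W (X n) = Wl x - Wl (X n)"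
    using ev
  proof eventually_elim
    case (elim n)
    then show ?case using W_diff[of "X n" x] kk_integral(2)[OF X(1) x, of n] X(2)[of n] c by simp
  qed
  have lim1: "(\<lambda>n. W x - W (X n)) \<longlonglongrightarrow> W x - W 0"
    using X C_iff by (intro tendsto_diff tendsto_const continuous_on_tendsto_compose[OF W_cont X(3)]) (auto intro!: always_eventually less_imp_le)
  have lim2: "(\<lambda>n. Wl x - Wl (X n)) \<longlonglongrightarrow> Wl x - 0"
  proof (intro tendsto_diff tendsto_const, rule tendstoI)
    fix e :: real assume "e > 0"
    then obtain d where d: "d > 0" "\<And>y. 0 < y \<Longrightarrow> y < d \<Longrightarrow> Wl y < e" using Wl_small by blast
    have "\<forall>\<^sub>F n in sequentially. X n < d" using order_tendstoD(2)[OF X(3)] d(1) by simp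
    then show "\<forall>\<^sub>F n in sequentially. dist (Wl (X n)) 0 < e"
    proof eventually_elim
      case (elim n)
      then show ?case using d(2)[of "X n"] X(2)[of n] Wl_bounds(1)[of "X n"] C_iff[OF X(1)] by simp
    qed
  qed
  have "W x - W 0 = Wl x - 0"
    by (rule LIMSEQ_unique[OF Lim_transform_eventually[OF lim1 eq] lim2])
  then show ?thesis by (simp add: W_0)
qed

lemma AE_W_Wl: "AE y in lborel. y \<in> {0..2} \<longrightarrow> W y = Wl y"
  using AE_C AE_lborel_singleton[of 0] AE_lborel_singleton[of 2]
  by eventually_elim (auto simp: W_Wl)

lemma W_L: "L W" by (rule L_continuous[OF W_cont])

definition Z :: "real \<Rightarrow> real" where "Z x = 1 + l * cv (\<lambda>_. 1) W x"

lemma Z_Zl: "x \<le> 2 \<Longrightarrow> Z x = Zl x"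
  unfolding Z_def Zl_eq using cv_cong_right[OF AE_W_Wl _ L_const W_L Wl_L, of x 1] by simp

lemma Z_cont: "continuous_on {0..2} Z"
  unfolding Z_def[abs_def] by (intro continuous_intros continuous_cv W_L)

lemma F_L: "L F" by (rule F_int)

text \<open>The equation for \<open>Wl\<close> holds for \<open>W\<close> almost everywhere and then
  everywhere by continuity, the endpoint 2 included.\<close>

lemma conv_W: assumes x: "x \<in> {0..2}" shows "cv F W x = cv (\<lambda>_. 1) Z x"
proof (rule AE_eq_continuous[OF _ _ _ x])
  show "continuous_on {0..2} (cv F W)" by (rule continuous_cv'[OF W_cont F_L])
  show "continuous_on {0..2} (cv (\<lambda>_. 1) Z)" by (intro continuous_cv L_continuous Z_cont) auto
  show "AE x in lborel. x \<in> {0..2} \<longrightarrow> cv F W x = cv (\<lambda>_. 1) Z x"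
    using AE_lborel_singleton[of 2]
  proof eventually_elim
    case (elim x)
    show ?case
    proof
      assume "x \<in> {0..2}"
      then have x: "0 \<le> x" "x < 2" using elim by auto
      have "cv F W x = cv F Wl x" using x by (intro cv_cong_right[OF AE_W_Wl _ F_L W_L Wl_L]) simp
      also have "\<dots> = (LINT y:{0..x}|lborel. Zl y)" using cv_Wl[OF x] by (simp add: cv_comm)
      also have "\<dots> = cv (\<lambda>_. 1) Z x" unfolding cv_one using x by (intro set_lebesgue_integral_cong) (auto simp: Z_Zl)
      finally show "cv F W x = cv (\<lambda>_. 1) Z x" .
    qed
  qed
qed

end

section \<open>The scale function\<close>

text \<open>\<open>k\<close> is the derivative of the scale function \<open>W\<close>, with its left limit as the value at 2.\<close>

locale scale_fn = kernel F for F + fixes l :: real and k :: "real \<Rightarrow> real"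
  assumes l_pos: "l > 0" and k_nonneg: "\<And>x. 0 \<le> k x" and k_L: "L k"
    and k_lim: "(k \<longlongrightarrow> k 2) (at_left 2)"
  fixes W Z :: "real \<Rightarrow> real"
  defines "W \<equiv> cv (\<lambda>_. 1) k" and "Z \<equiv> \<lambda>x. 1 + l * cv (\<lambda>_. 1) W x"
  assumes W_pos: "\<And>x. 0 < x \<Longrightarrow> x \<le> 2 \<Longrightarrow> W x > 0"
    and conv_W: "\<And>x. x \<in> {0..2} \<Longrightarrow> cv F W x = cv (\<lambda>_. 1) Z x"
    and W_W: "\<And>x y. 0 \<le> y \<Longrightarrow> y \<le> x \<Longrightarrow> x \<le> 2 \<Longrightarrow> W (x - y) * W 2 \<le> W (2 - y) * W x"
    and W_Z: "\<And>x y. 0 \<le> y \<Longrightarrow> y \<le> x \<Longrightarrow> x \<le> 2 \<Longrightarrow> W (x - y) * Z 2 \<le> W (2 - y) * Z x"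
    and W_k: "\<And>x y. 0 \<le> y \<Longrightarrow> y \<le> x \<Longrightarrow> x < 2 \<Longrightarrow> 0 < x \<Longrightarrow> W (x - y) * k 2 \<le> W (2 - y) * k x"
    and sq_le: "l * (W 2)\<^sup>2 \<le> Z 2 * k 2"
    and V_le: "k 2 * cv (\<lambda>_. 1) Z 2 \<le> Z 2 * W 2"

section \<open>Passage of the inequalities to the limit\<close>

context helly_limit begin

text \<open>The strict gap between \<open>x' - x + u\<close> and \<open>w\<close> leaves room for
  the rounding of all four indices once the mesh is fine.\<close>

lemma idx_ev:
  assumes c: "0 < u" "u < x" "x < x'" "x' - x + u < w" "w < 2"
  shows "\<forall>\<^sub>F j in sequentially. idx (h j) u < idx (h j) x \<and> idx (h j) x \<le> idx (h j) x' \<and>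
    idx (h j) x' - idx (h j) x + idx (h j) u \<le> idx (h j) w"
proof -
  have "0 < min (x - u) ((w - (x' - x + u)) / 2)" using c by simp
  from order_tendstoD(2)[OF h_lim this] show ?thesis
  proof eventually_elim
    case (elim j)
    note hp = h_pos[of j]
    have hs: "h j \<le> x - u" "2 * h j \<le> w - (x' - x + u)" using elim by auto
    define a i p b where "a = idx (h j) u" and "i = idx (h j) x" and "p = idx (h j) x'" and "b = idx (h j) w"
    have b1: "real a * h j \<le> u" "x < (real i + 1) * h j" "real p * h j \<le> x'" "w < (real b + 1) * h j"
      using idx_bounds[OF hp] c by (auto simp: a_def i_def p_def b_def)
    have "real a * h j < real i * h j" using b1(1,2) hs(1) by (simp add: distrib_right)
    then have ai: "a < i" using hp by simp
    have ip: "i \<le> p" unfolding i_def p_def using c by (intro idx_mono hp) simp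
    have "(real p - real i + real a) * h j < real b * h j"
      using b1 hs(2) by (simp add: algebra_simps)
    then have "real p - real i + real a < real b" using hp by simp
    then have "p - i + a \<le> b" using ip by linarith
    then show ?case using ai ip by (simp add: a_def i_def p_def b_def)
  qed
qed

text \<open>Because of the strict gap, the discrete inequalities hold on all sufficiently fine grids
  and pass to the limit; the gap is closed afterwards by continuity.\<close>

lemma shift_C:
  assumes c: "u \<in> C" "x \<in> C" "x' \<in> C" "w \<in> C" and o: "u < x" "x < x'" "x' - x + u < w"
  shows "Wl u * kk x' \<le> Wl w * kk x" "Wl u * Wl x' \<le> Wl w * Wl x" "Wl u * Zl x' \<le> Wl w * Zl x"
proof -
  have ev: "\<forall>\<^sub>F j in sequentially. idx (h j) u < idx (h j) x \<and> idx (h j) x \<le> idx (h j) x' \<and>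
    idx (h j) x' - idx (h j) x + idx (h j) u \<le> idx (h j) w"
    using c C_iff by (intro idx_ev o) auto
  have W: "(\<lambda>j. sW j y) \<longlonglongrightarrow> Wl y" if "y \<in> C" for y using that by (intro W_lim) (simp add: C_def)
  have Z: "(\<lambda>j. sZ j y) \<longlonglongrightarrow> Zl y" if "y \<in> C" for y using C_iff[OF that] by (intro sZ_lim) auto
  have ev': "\<forall>\<^sub>F j in sequentially. sW j u * sk j x' \<le> sW j w * sk j x \<and> sW j u * sW j x' \<le> sW j w * sW j x \<and> sW j u * sZ j x' \<le> sW j w * sZ j x"
    using ev
  proof eventually_elim
    case (elim j)
    note hp = h_pos[of j]
    let ?a = "idx (h j) u" and ?i = "idx (h j) x" and ?p = "idx (h j) x'" and ?b = "idx (h j) w"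
    have m: "Wd (h j) (?p - ?i + ?a) * z \<le> Wd (h j) ?b * z" if "z \<ge> 0" for z
      using monoD[OF Wd_mono[OF hp], of "?p - ?i + ?a" ?b] elim that by (intro mult_right_mono) auto
    have "Wd (h j) ?a * kd (h j) ?p \<le> Wd (h j) ?b * kd (h j) ?i"
      using shift_k_d[OF hp, of ?a ?i ?p] m[OF less_imp_le[OF kd_pos[OF hp]], of ?i] elim by linarith
    then have "Wd (h j) ?a * kd (h j) ?p / h j \<le> Wd (h j) ?b * kd (h j) ?i / h j"
      using hp by (intro divide_right_mono) auto
    moreover have "Wd (h j) ?a * Wd (h j) ?p \<le> Wd (h j) ?b * Wd (h j) ?i"
      using shift_W_d[OF hp, of ?a ?i ?p] m[OF less_imp_le[OF Wd_pos[OF hp]], of ?i] elim by linarith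
    moreover have "Wd (h j) ?a * Zd (h j) ?p \<le> Wd (h j) ?b * Zd (h j) ?i"
      using shift_Z_d[OF hp, of ?a ?i ?p] m[of "Zd (h j) ?i"] Zd_ge_1[OF hp, of ?i] elim by linarith
    ultimately show ?case by (simp add: stp_def)
  qed
  show "Wl u * kk x' \<le> Wl w * kk x"
    by (rule tendsto_le[OF _ tendsto_mult[OF W sk_lim] tendsto_mult[OF W sk_lim]])
      (use c ev' in \<open>auto elim: eventually_mono\<close>)
  show "Wl u * Wl x' \<le> Wl w * Wl x"
    by (rule tendsto_le[OF _ tendsto_mult[OF W W] tendsto_mult[OF W W]])
      (use c ev' in \<open>auto elim: eventually_mono\<close>)
  show "Wl u * Zl x' \<le> Wl w * Zl x"
    by (rule tendsto_le[OF _ tendsto_mult[OF W Z] tendsto_mult[OF W Z]])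
      (use c ev' in \<open>auto elim: eventually_mono\<close>)
qed

text \<open>The discrete inequality has \<open>k\<close> at index \<open>n + 1\<close>.
  Multiplication by \<open>W n\<close> and the monotonicity of \<open>k/W\<close> bring it back to
  index \<open>n\<close>; this costs a third power and a point \<open>w > x\<close> that absorbs
  \<open>W (n + 1)\<close>.\<close>

lemma sq_C: assumes c: "x \<in> C" "w \<in> C" and o: "x < w"
  shows "l * (Wl x)^3 \<le> Wl w * kk x * Zl x"
proof (rule tendsto_le)
  show "(\<lambda>j. l * (sW j x)^3) \<longlonglongrightarrow> l * (Wl x)^3"
    using c by (intro tendsto_intros W_lim) (simp add: C_def)
  show "(\<lambda>j. sW j w * sk j x * sZ j x) \<longlonglongrightarrow> Wl w * kk x * Zl x"
    using c C_iff[OF c(1)] by (intro tendsto_intros W_lim sk_lim sZ_lim) (auto simp: C_def)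
  show "\<forall>\<^sub>F j in sequentially. l * (sW j x)^3 \<le> sW j w * sk j x * sZ j x"
  proof -
    have "\<forall>\<^sub>F j in sequentially. h j < w - x" by (rule order_tendstoD(2)[OF h_lim]) (use o in simp)
    then show ?thesis
    proof eventually_elim
    case (elim j)
    note hp = h_pos[of j]
    let ?n = "idx (h j) x" and ?b = "idx (h j) w"
    have "real (Suc ?n) * h j \<le> w"
      using idx_bounds(1)[OF hp, of x] elim C_iff[OF c(1)] by (simp add: distrib_right)
    then have nb: "Suc ?n \<le> ?b" by (intro idx_geI hp)
    have Wp: "0 < Wd (h j) ?n" and kp: "0 < kd (h j) ?n" by (rule Wd_pos[OF hp], rule kd_pos[OF hp])
    have Zp: "0 \<le> Zd (h j) ?n" using Zd_ge_1[OF hp, of ?n] by linarith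
    have "h j * (l * (Wd (h j) ?n)^3) = Wd (h j) ?n * (l * h j * (Wd (h j) ?n)\<^sup>2)"
      by (simp add: power2_eq_square power3_eq_cube)
    also have "\<dots> \<le> Wd (h j) ?n * (kd (h j) (Suc ?n) * Zd (h j) ?n)"
      using Wp by (intro mult_left_mono sq_d hp) auto
    also have "\<dots> = (Wd (h j) ?n * kd (h j) (Suc ?n)) * Zd (h j) ?n" by simp
    also have "\<dots> \<le> (Wd (h j) (Suc ?n) * kd (h j) ?n) * Zd (h j) ?n"
      using Zp by (intro mult_right_mono kW_dec_d hp) auto
    also have "\<dots> \<le> (Wd (h j) ?b * kd (h j) ?n) * Zd (h j) ?n"
      using Zp kp nb by (intro mult_right_mono monoD[OF Wd_mono[OF hp]]) auto
    finally have "l * (Wd (h j) ?n)^3 \<le> (Wd (h j) ?b * kd (h j) ?n) * Zd (h j) ?n / h j"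
      using hp by (simp add: le_divide_eq mult.commute)
    then show ?case by (simp add: stp_def)
    qed
  qed
qed simp

lemma V_C: assumes c: "x \<in> C" shows "kk x * (LINT y:{0..x}|lborel. Zl y) \<le> Wl x * Zl x"
proof (rule tendsto_le)
  show "(\<lambda>j. sk j x * (h j * (\<Sum>i\<le>idx (h j) x. Zd (h j) i))) \<longlonglongrightarrow> kk x * (LINT y:{0..x}|lborel. Zl y)"
    using C_iff[OF c] by (intro tendsto_mult sk_lim c Zsum_lim) auto
  show "(\<lambda>j. sW j x * sZ j x) \<longlonglongrightarrow> Wl x * Zl x"
    using c C_iff[OF c] by (intro tendsto_mult W_lim sZ_lim) (auto simp: C_def)
  show "\<forall>\<^sub>F j in sequentially. sk j x * (h j * (\<Sum>i\<le>idx (h j) x. Zd (h j) i)) \<le> sW j x * sZ j x"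
  proof (intro always_eventually allI)
    fix j
    have "h j \<noteq> 0" using h_pos[of j] by simp
    then show "sk j x * (h j * (\<Sum>i\<le>idx (h j) x. Zd (h j) i)) \<le> sW j x * sZ j x"
      using k_sum_Z_d[OF h_pos, of j "idx (h j) x"] by (simp add: stp_def)
  qed
qed simp

lemma Wl_lower: assumes c: "x \<in> C" shows "x / I4 \<le> Wl x"
proof (rule LIMSEQ_le_const)
  show "(\<lambda>j. sW j x) \<longlonglongrightarrow> Wl x" using c by (intro W_lim) (simp add: C_def)
  have "x / I4 \<le> sW j x" for j
  proof -
    note hp = h_pos[of j]
    have "x < real (Suc (idx (h j) x)) * h j" using idx_bounds(2)[OF hp, of x] C_iff[OF c] by (simp add: algebra_simps)
    then have "x / I4 \<le> real (Suc (idx (h j) x)) * h j / I4" using I4_pos by (intro divide_right_mono) auto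
    also have "\<dots> \<le> sW j x"
      unfolding stp_def using C_iff[OF c] by (intro Wd_lower hp h_le idx_le2) auto
    finally show ?thesis .
  qed
  then show "\<exists>N. \<forall>n\<ge>N. x / I4 \<le> sW n x" by blast
qed

lemma kk_integrable: "integrable lborel kk"
proof -
  have "(\<lambda>x. indicator {0..2} x *\<^sub>R kk x) = kk" by (auto simp: fun_eq_iff indicator_def kk_def)
  then show ?thesis using kk_L by (simp only: set_integrable_def)
qed

lemma mono_W': "mono W"
proof (rule monoI)
  fix x y :: real assume "x \<le> y"
  have i: "integrable lborel (\<lambda>t. indicator {0..z} t *\<^sub>R kk t)" for z :: real
    using kk_integrable by (intro integrable_mult_indicator) auto
  show "W x \<le> W y"
    unfolding W_def cv_one set_lebesgue_integral_def
    using i \<open>x \<le> y\<close> kk_nonneg by (intro integral_mono) (auto simp: indicator_def)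
qed

lemma W_meas [measurable]: "W \<in> borel_measurable borel" by (rule borel_measurable_mono[OF mono_W'])

text \<open>The pointwise choice matters, because the boundary conditions at the far endpoint
  involve \<open>k 2\<close>. \<open>gl\<close> is nondecreasing, so this supremum is its left limit
  at 2; inside the interval, \<open>kf\<close> is fixed by the right-continuous \<open>gl\<close>
  and the continuous \<open>W\<close>.\<close>

definition gb :: real where "gb = Sup (gl ` {0<..<2})"
definition kf :: "real \<Rightarrow> real" where
  "kf x = (if 0 < x \<and> x < 2 then el x * W x else if x = 2 then (1 / gb - 1) * W 2 else 0)"

lemma gl_le_gb: "0 < x \<Longrightarrow> x < 2 \<Longrightarrow> gl x \<le> gb"
  unfolding gb_def using gl_bounds by (intro cSup_upper) (auto intro!: bdd_aboveI[of _ 1])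

lemma gb_bounds: "0 < gb" "gb \<le> 1"
proof -
  show "0 < gb" using gl_le_gb[of 1] gl_bounds(1)[of 1] by simp
  show "gb \<le> 1" unfolding gb_def using gl_bounds by (intro cSup_least) auto
qed

lemma gl_tendsto: "(gl \<longlongrightarrow> gb) (at_left 2)"
proof (rule order_tendstoI)
  fix a assume "a < gb"
  then obtain x where x: "0 < x" "x < 2" "a < gl x"
    unfolding gb_def using gl_bounds by (subst (asm) less_cSup_iff) (auto intro!: bdd_aboveI[of _ 1])
  have "\<forall>y>x. y < 2 \<longrightarrow> a < gl y" using x(3) monoD[OF mono_g] by (meson less_imp_le less_le_trans)
  then show "\<forall>\<^sub>F y in at_left 2. a < gl y" unfolding eventually_at_left_field using x by blast
next
  fix a assume "gb < a"
  then have "\<forall>y>0. y < 2 \<longrightarrow> gl y < a" using gl_le_gb by (meson le_less_trans)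
  then show "\<forall>\<^sub>F y in at_left 2. gl y < a" unfolding eventually_at_left_field by (intro exI[of _ 0]) auto
qed

lemma W_nonneg: "0 \<le> W x"
  unfolding W_def cv_one set_lebesgue_integral_def by (intro integral_nonneg_AE) (auto simp: kk_nonneg)

lemma kf_nonneg: "0 \<le> kf x"
  unfolding kf_def using el_nonneg[of x] W_nonneg gb_bounds by (auto simp: divide_simps)

lemma kf_kk: "x \<in> C \<Longrightarrow> kf x = kk x"
  using C_iff[of x] by (simp add: kf_def kk_def W_Wl)

lemma AE_kf: "AE y in lborel. y \<in> {0..2} \<longrightarrow> kk y = kf y"
  using AE_C AE_lborel_singleton[of 0] AE_lborel_singleton[of 2]
  by eventually_elim (auto simp: kf_kk)

lemma kf_meas [measurable]: "kf \<in> borel_measurable borel" unfolding kf_def[abs_def] by measurable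

lemma kf_L: "L kf"
proof -
  have "set_integrable lborel {0..2} kk \<longleftrightarrow> set_integrable lborel {0..2} kf"
    using AE_kf by (intro set_integrable_cong_AE) auto
  then show ?thesis using kk_L by simp
qed

lemma W_kf: "x \<le> 2 \<Longrightarrow> cv (\<lambda>_. 1) kf x = W x"
  unfolding W_def using cv_cong_right[OF AE_kf _ L_const kk_L kf_L, of x 1] by simp

lemma kf_lim: "(kf \<longlongrightarrow> kf 2) (at_left 2)"
proof -
  have "((\<lambda>x. (1 / gl x - 1) * W x) \<longlongrightarrow> (1 / gb - 1) * W 2) (at_left 2)"
  proof (intro tendsto_intros gl_tendsto)
    have "(W \<longlongrightarrow> W 2) (at 2 within {0..2})" using W_cont by (simp add: continuous_on_def)
    then show "(W \<longlongrightarrow> W 2) (at_left 2)" by (simp add: at_within_Icc_at_left)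
  qed (use gb_bounds in auto)
  moreover have "\<forall>\<^sub>F x in at_left 2. (1 / gl x - 1) * W x = kf x"
    unfolding eventually_at_left_field by (intro exI[of _ 0]) (auto simp: kf_def el_def)
  ultimately have "(kf \<longlongrightarrow> (1 / gb - 1) * W 2) (at_left 2)" by (rule Lim_transform_eventually)
  then show ?thesis by (simp add: kf_def)
qed

lemma seq_cont:
  assumes f: "continuous_on {0..2} f" and X: "X \<longlonglongrightarrow> x" and "\<And>n. X n \<in> {0..2}" "x \<in> {0..2}"
  shows "(\<lambda>n. f (X n)) \<longlonglongrightarrow> f (x :: real)"
  by (rule continuous_on_tendsto_compose[OF f X]) (use assms in auto)

lemma kf_rcont:
  assumes x: "0 < x" "x < 2" and X: "\<And>n. X n \<in> C" "\<And>n. X n > x" "X \<longlonglongrightarrow> x"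
  shows "(\<lambda>n. kf (X n)) \<longlonglongrightarrow> kf x"
proof -
  have "filterlim X (at_right x) sequentially"
    using X by (intro tendsto_imp_filterlim_at_right) auto
  moreover have "(gl \<longlongrightarrow> gl x) (at_right x)" using rc_g[of x] by (simp add: continuous_within)
  ultimately have "(\<lambda>n. gl (X n)) \<longlonglongrightarrow> gl x" by (rule filterlim_compose[rotated])
  moreover have "(\<lambda>n. W (X n)) \<longlonglongrightarrow> W x"
  proof (rule seq_cont[OF W_cont X(3)])
    show "X n \<in> {0..2}" for n using C_iff[OF X(1), of n] by auto
  qed (use x in auto)
  ultimately have "(\<lambda>n. (1 / gl (X n) - 1) * W (X n)) \<longlonglongrightarrow> (1 / gl x - 1) * W x"
    using gl_bounds[OF x] by (intro tendsto_intros) auto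
  then show ?thesis using x C_iff[OF X(1)] by (simp add: kf_def el_def)
qed

text \<open>Each argument is approached from the right through points of \<open>C\<close>: there
  \<open>kf\<close> converges, since \<open>gl\<close> is right-continuous, and the strict
  inequalities between the arguments persist along the sequences.\<close>

lemma shift_all:
  assumes o: "0 < u" "u < x" "x < x'" "x' < 2" "x' - x + u < w" "w < 2"
  shows "W u * kf x' \<le> W w * kf x" "W u * W x' \<le> W w * W x" "W u * Z x' \<le> W w * Z x"
proof -
  have *: "\<exists>X. (\<forall>n. X n \<in> C) \<and> (\<forall>n. X n > y) \<and> X \<longlonglongrightarrow> y" if "0 < y" "y < 2" for y
    using C_seq[of y] that by auto
  obtain U where U: "\<And>n. U n \<in> C" "\<And>n. U n > u" "U \<longlonglongrightarrow> u" using *[of u] o by auto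
  obtain X where X: "\<And>n. X n \<in> C" "\<And>n. X n > x" "X \<longlonglongrightarrow> x" using *[of x] o by auto
  obtain X' where X': "\<And>n. X' n \<in> C" "\<And>n. X' n > x'" "X' \<longlonglongrightarrow> x'" using *[of x'] o by auto
  obtain Y where Y: "\<And>n. Y n \<in> C" "\<And>n. Y n > w" "Y \<longlonglongrightarrow> w" using *[of w] o by auto
  have "\<forall>\<^sub>F n in sequentially. 0 < X n - U n"
    by (rule order_tendstoD(1)[OF tendsto_diff[OF X(3) U(3)]]) (use o in simp)
  moreover have "\<forall>\<^sub>F n in sequentially. 0 < X' n - X n"
    by (rule order_tendstoD(1)[OF tendsto_diff[OF X'(3) X(3)]]) (use o in simp)
  moreover have "\<forall>\<^sub>F n in sequentially. 0 < Y n - (X' n - X n + U n)"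
    by (rule order_tendstoD(1)[OF tendsto_diff[OF Y(3) tendsto_add[OF tendsto_diff[OF X'(3) X(3)] U(3)]]]) (use o in simp)
  ultimately have ev: "\<forall>\<^sub>F n in sequentially. W (U n) * kf (X' n) \<le> W (Y n) * kf (X n)
      \<and> W (U n) * W (X' n) \<le> W (Y n) * W (X n) \<and> W (U n) * Z (X' n) \<le> W (Y n) * Z (X n)"
  proof eventually_elim
    case (elim n)
    then show ?case
      using shift_C[OF U(1) X(1) X'(1) Y(1), of n n n n] C_iff[OF X(1), of n] C_iff[OF X'(1), of n]
      by (simp add: W_Wl U X X' Y kf_kk Z_Zl)
  qed
  have C02: "y \<in> {0..2}" if "y \<in> C" for y using C_iff[OF that] by auto
  have WU: "(\<lambda>n. W (U n)) \<longlonglongrightarrow> W u" by (rule seq_cont[OF W_cont U(3) C02[OF U(1)]]) (use o in auto)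
  have WX: "(\<lambda>n. W (X n)) \<longlonglongrightarrow> W x" by (rule seq_cont[OF W_cont X(3) C02[OF X(1)]]) (use o in auto)
  have WX': "(\<lambda>n. W (X' n)) \<longlonglongrightarrow> W x'" by (rule seq_cont[OF W_cont X'(3) C02[OF X'(1)]]) (use o in auto)
  have WY: "(\<lambda>n. W (Y n)) \<longlonglongrightarrow> W w" by (rule seq_cont[OF W_cont Y(3) C02[OF Y(1)]]) (use o in auto)
  have ZX: "(\<lambda>n. Z (X n)) \<longlonglongrightarrow> Z x" by (rule seq_cont[OF Z_cont X(3) C02[OF X(1)]]) (use o in auto)
  have ZX': "(\<lambda>n. Z (X' n)) \<longlonglongrightarrow> Z x'" by (rule seq_cont[OF Z_cont X'(3) C02[OF X'(1)]]) (use o in auto)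
  have kX: "(\<lambda>n. kf (X n)) \<longlonglongrightarrow> kf x" by (rule kf_rcont[OF _ _ X]) (use o in auto)
  have kX': "(\<lambda>n. kf (X' n)) \<longlonglongrightarrow> kf x'" by (rule kf_rcont[OF _ _ X']) (use o in auto)
  show "W u * kf x' \<le> W w * kf x"
    by (rule tendsto_le[OF _ tendsto_mult[OF WY kX] tendsto_mult[OF WU kX']]) (use ev in \<open>auto elim: eventually_mono\<close>)
  show "W u * W x' \<le> W w * W x"
    by (rule tendsto_le[OF _ tendsto_mult[OF WY WX] tendsto_mult[OF WU WX']]) (use ev in \<open>auto elim: eventually_mono\<close>)
  show "W u * Z x' \<le> W w * Z x"
    by (rule tendsto_le[OF _ tendsto_mult[OF WY ZX] tendsto_mult[OF WU ZX']]) (use ev in \<open>auto elim: eventually_mono\<close>)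
qed

text \<open>With \<open>w = 2 - y\<close> fixed, \<open>x'\<close> tends to 2 as
  \<open>2 - t\<close> while \<open>u = x - y - 2 t\<close> tends to \<open>x - y\<close>; the
  different speeds leave a strict gap of \<open>3 t\<close>.\<close>

lemma shift_end:
  assumes o: "0 < y" "y < x" "x < 2" and f: "(f \<longlongrightarrow> f 2) (at_left 2)"
    and ineq: "\<And>u x' w. 0 < u \<Longrightarrow> u < x \<Longrightarrow> x < x' \<Longrightarrow> x' < 2 \<Longrightarrow> x' - x + u < w \<Longrightarrow> w < 2 \<Longrightarrow> W u * f x' \<le> W w * f x"
  shows "W (x - y) * f 2 \<le> W (2 - y) * f x"
proof -
  \<comment> \<open>The margins \<open>2 e < x - y\<close> and \<open>e < 2 - x\<close> keep
    \<open>u\<close> positive and \<open>x'\<close> to the right of \<open>x\<close>.\<close>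
  define e where "e = min (x - y) (2 - x) / 4"
  have e: "0 < e" "2 * e < x - y" "e < 2 - x" using o by (auto simp: e_def)
  define t where "t n = e * inverse (real (Suc n))" for n
  have t: "0 < t n" "t n \<le> e" for n using e by (auto simp: t_def divide_inverse[symmetric] divide_le_eq)
  have tl: "t \<longlonglongrightarrow> 0" unfolding t_def[abs_def] using tendsto_mult_left[OF LIMSEQ_inverse_real_of_nat, of e] by simp
  have le: "W (x - y - 2 * t n) * f (2 - t n) \<le> W (2 - y) * f x" for n
    using t[of n] e o by (intro ineq) auto
  have 1: "(\<lambda>n. W (x - y - 2 * t n)) \<longlonglongrightarrow> W (x - y)"
  proof (rule seq_cont[OF W_cont])
    show "(\<lambda>n. x - y - 2 * t n) \<longlonglongrightarrow> x - y" using tendsto_diff[OF tendsto_const tendsto_mult_left[OF tl, of 2], of "x - y"] by simp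
    show "x - y - 2 * t n \<in> {0..2}" for n using t[of n] e o by auto
  qed (use o in auto)
  have "filterlim (\<lambda>n. 2 - t n) (at_left 2) sequentially"
  proof (rule tendsto_imp_filterlim_at_left)
    show "(\<lambda>n. 2 - t n) \<longlonglongrightarrow> 2" using tendsto_diff[OF tendsto_const tl, of 2] by simp
  qed (use t in auto)
  then have 2: "(\<lambda>n. f (2 - t n)) \<longlonglongrightarrow> f 2" by (rule filterlim_compose[OF f])
  show ?thesis by (rule LIMSEQ_le_const2[OF tendsto_mult[OF 1 2]]) (use le in auto)
qed

text \<open>The cases \<open>y = 0\<close> and \<open>y = x\<close> follow from the open range by
  continuity in \<open>y\<close>.\<close>

lemma shift_end':
  assumes o: "0 \<le> y" "y \<le> x" "0 < x" "x < 2" and f: "(f \<longlongrightarrow> f 2) (at_left 2)"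
    and ineq: "\<And>u x' w. 0 < u \<Longrightarrow> u < x \<Longrightarrow> x < x' \<Longrightarrow> x' < 2 \<Longrightarrow> x' - x + u < w \<Longrightarrow> w < 2 \<Longrightarrow> W u * f x' \<le> W w * f x"
  shows "W (x - y) * f 2 \<le> W (2 - y) * f x"
proof -
  have cl: "closure {0<..<x} = {0..x}" using o by (intro closure_greaterThanLessThan) simp
  have "continuous_on (closure {0<..<x}) (\<lambda>y. W (x - y) * f 2 - W (2 - y) * f x)"
    unfolding cl using o by (intro continuous_intros continuous_on_compose2[OF W_cont]) auto
  then have "W (x - y) * f 2 - W (2 - y) * f x \<le> 0"
    by (rule continuous_le_on_closure) (use o cl shift_end[OF _ _ o(4) f ineq] in auto)
  then show ?thesis by simp
qed

lemma cont_at_left: "continuous_on {0..2} f \<Longrightarrow> (f \<longlongrightarrow> f 2) (at_left (2::real))" for f :: "real \<Rightarrow> real"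
  using at_within_Icc_at_left[of "0::real" 2] by (auto simp: continuous_on_def dest!: bspec[of _ _ 2])

lemma W_pos': assumes "0 < x" shows "0 < W x"
proof -
  obtain c where c: "c \<in> C" "c < x" using C_dense[of 0 "min x 2"] assms by auto
  have "0 < c / I4" using C_iff[OF c(1)] I4_pos by simp
  then show ?thesis using Wl_lower[OF c(1)] W_Wl[OF c(1)] monoD[OF mono_W', of c x] c(2) by simp
qed

lemma C_seq_left: "\<exists>X. (\<forall>n. X n \<in> C) \<and> filterlim X (at_left 2) sequentially"
proof -
  have "\<exists>c\<in>C. 2 - inverse (real (Suc n)) < c \<and> c < 2" for n
    by (rule C_dense) (auto simp: divide_inverse[symmetric] field_simps)
  then obtain X where X: "\<And>n. X n \<in> C" "\<And>n. 2 - inverse (real (Suc n)) < X n" "\<And>n. X n < 2" by metis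
  have "X \<longlonglongrightarrow> 2"
  proof (rule real_tendsto_sandwich[of "\<lambda>n. 2 - inverse (real (Suc n))" _ _ "\<lambda>_. 2"])
    show "(\<lambda>n. 2 - inverse (real (Suc n))) \<longlonglongrightarrow> 2"
      using tendsto_diff[OF tendsto_const LIMSEQ_inverse_real_of_nat, of 2] by simp
  qed (use X in \<open>auto intro!: always_eventually less_imp_le\<close>)
  then show ?thesis using X by (intro exI[of _ X]) (auto intro!: tendsto_imp_filterlim_at_left)
qed

text \<open>In the cubic inequality \<open>w\<close> decreases to \<open>x\<close>, and then one
  factor \<open>W x > 0\<close> cancels.\<close>

lemma sq_C': assumes x: "x \<in> C" shows "l * (W x)\<^sup>2 \<le> Z x * kf x"
proof -
  note c = C_iff[OF x]
  obtain X where X: "\<And>n. X n \<in> C" "\<And>n. X n > x" "X \<longlonglongrightarrow> x" using C_seq[of x] c by auto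
  have "l * (W x)^3 \<le> W (X n) * (kf x * Z x)" for n
    using sq_C[OF x X(1) X(2), of n] x X(1)[of n] c by (simp add: W_Wl kf_kk Z_Zl mult.assoc)
  moreover have "(\<lambda>n. W (X n)) \<longlonglongrightarrow> W x"
  proof (rule seq_cont[OF W_cont X(3)])
    show "X n \<in> {0..2}" for n using C_iff[OF X(1), of n] by auto
  qed (use c in auto)
  ultimately have "l * (W x)^3 \<le> W x * (kf x * Z x)"
    by (intro LIMSEQ_le_const[OF tendsto_mult_right]) auto
  then have "W x * (l * (W x)\<^sup>2) \<le> W x * (Z x * kf x)" by (simp add: power2_eq_square power3_eq_cube mult_ac)
  then show ?thesis using W_pos'[OF c(1)] by simp
qed

lemma V_C': assumes x: "x \<in> C" shows "kf x * cv (\<lambda>_. 1) Z x \<le> Z x * W x"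
proof -
  note c = C_iff[OF x]
  have "cv (\<lambda>_. 1) Z x = (LINT y:{0..x}|lborel. Zl y)"
    unfolding cv_one using c by (intro set_lebesgue_integral_cong) (auto simp: Z_Zl)
  then show ?thesis using V_C[OF x] c x by (simp add: W_Wl kf_kk Z_Zl mult.commute)
qed

lemma scale_fn_kf: "scale_fn F l kf"
proof -
  have Weq: "cv (\<lambda>_. 1) (cv (\<lambda>_. 1) kf) x = cv (\<lambda>_. 1) W x" if "x \<le> 2" for x
    using that by (intro cv_cong_all) (auto simp: W_kf)
  have Zeq: "1 + l * cv (\<lambda>_. 1) (cv (\<lambda>_. 1) kf) x = Z x" if "x \<le> 2" for x
    using Weq[OF that] by (simp add: Z_def)
  obtain X where X: "\<And>n. X n \<in> C" "filterlim X (at_left 2) sequentially" using C_seq_left by blast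
  have lim: "(\<lambda>n. f (X n)) \<longlonglongrightarrow> f 2" if "(f \<longlongrightarrow> f 2) (at_left 2)" for f :: "real \<Rightarrow> real"
    by (rule filterlim_compose[OF that X(2)])
  have W2: "(\<lambda>n. W (X n)) \<longlonglongrightarrow> W 2" by (rule lim[OF cont_at_left[OF W_cont]])
  have Z2: "(\<lambda>n. Z (X n)) \<longlonglongrightarrow> Z 2" by (rule lim[OF cont_at_left[OF Z_cont]])
  have k2: "(\<lambda>n. kf (X n)) \<longlonglongrightarrow> kf 2" by (rule lim[OF kf_lim])
  have V2: "(\<lambda>n. cv (\<lambda>_. 1) Z (X n)) \<longlonglongrightarrow> cv (\<lambda>_. 1) Z 2"
    by (rule lim[OF cont_at_left[OF continuous_cv[OF _ L_continuous[OF Z_cont]]]]) auto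
  show ?thesis
  proof
    show "l > 0" by (rule l)
    show "0 \<le> kf x" for x by (rule kf_nonneg)
    show "L kf" by (rule kf_L)
    show "(kf \<longlongrightarrow> kf 2) (at_left 2)" by (rule kf_lim)
    show "0 < cv (\<lambda>_. 1) kf x" if "0 < x" "x \<le> 2" for x using that by (simp add: W_kf W_pos')
    show "cv F (cv (\<lambda>_. 1) kf) x = cv (\<lambda>_. 1) (\<lambda>x. 1 + l * cv (\<lambda>_. 1) (cv (\<lambda>_. 1) kf) x) x" if "x \<in> {0..2}" for x
    proof -
      have "cv F (cv (\<lambda>_. 1) kf) x = cv F W x" using that by (intro cv_cong_all) (auto simp: W_kf)
      moreover have "cv (\<lambda>_. 1) (\<lambda>x. 1 + l * cv (\<lambda>_. 1) (cv (\<lambda>_. 1) kf) x) x = cv (\<lambda>_. 1) Z x"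
        using that by (intro cv_cong_all) (auto simp: Zeq)
      ultimately show ?thesis using conv_W[OF that] by simp
    qed
    show "cv (\<lambda>_. 1) kf (x - y) * cv (\<lambda>_. 1) kf 2 \<le> cv (\<lambda>_. 1) kf (2 - y) * cv (\<lambda>_. 1) kf x"
      if o: "0 \<le> y" "y \<le> x" "x \<le> 2" for x y
    proof -
      have "W (x - y) * W 2 \<le> W (2 - y) * W x"
      proof -
        consider "x = 0" | "x = 2" | "0 < x" "x < 2" using o by linarith
        then show ?thesis
        proof cases
          case 1
          then show ?thesis using o W_nonneg by (simp add: W_0)
        next
          case 3
          then show ?thesis
            using o by (intro shift_end' cont_at_left W_cont shift_all(2)) auto
        qed simp
      qed
      then show ?thesis using o by (simp add: W_kf)
    qed
    show "cv (\<lambda>_. 1) kf (x - y) * (1 + l * cv (\<lambda>_. 1) (cv (\<lambda>_. 1) kf) 2) \<le> cv (\<lambda>_. 1) kf (2 - y) * (1 + l * cv (\<lambda>_. 1) (cv (\<lambda>_. 1) kf) x)"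
      if o: "0 \<le> y" "y \<le> x" "x \<le> 2" for x y
    proof -
      have "W (x - y) * Z 2 \<le> W (2 - y) * Z x"
      proof -
        consider "x = 0" | "x = 2" | "0 < x" "x < 2" using o by linarith
        then show ?thesis
        proof cases
          case 1
          then show ?thesis using o W_nonneg by (simp add: W_0 Z_def cv_at_0)
        next
          case 3
          then show ?thesis
            using o by (intro shift_end' cont_at_left Z_cont shift_all(3)) auto
        qed simp
      qed
      then show ?thesis using o by (simp add: W_kf Zeq)
    qed
    show "cv (\<lambda>_. 1) kf (x - y) * kf 2 \<le> cv (\<lambda>_. 1) kf (2 - y) * kf x"
      if o: "0 \<le> y" "y \<le> x" "x < 2" "0 < x" for x y
    proof -
      have "W (x - y) * kf 2 \<le> W (2 - y) * kf x"
        using o by (intro shift_end' kf_lim shift_all(1)) auto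
      then show ?thesis using o by (simp add: W_kf)
    qed
    have "l * (W 2)\<^sup>2 \<le> Z 2 * kf 2"
      by (rule LIMSEQ_le[OF tendsto_mult_left[OF tendsto_power[OF W2]] tendsto_mult[OF Z2 k2]])
        (use sq_C' X in auto)
    then show "l * (cv (\<lambda>_. 1) kf 2)\<^sup>2 \<le> (1 + l * cv (\<lambda>_. 1) (cv (\<lambda>_. 1) kf) 2) * kf 2"
      by (simp add: W_kf Zeq)
    have "kf 2 * cv (\<lambda>_. 1) Z 2 \<le> Z 2 * W 2"
      by (rule LIMSEQ_le[OF tendsto_mult[OF k2 V2] tendsto_mult[OF Z2 W2]])
        (use V_C' X in auto)
    moreover have "cv (\<lambda>_. 1) (\<lambda>x. 1 + l * cv (\<lambda>_. 1) (cv (\<lambda>_. 1) kf) x) 2 = cv (\<lambda>_. 1) Z 2"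
      by (intro cv_cong_all) (auto simp: Zeq)
    ultimately show "kf 2 * cv (\<lambda>_. 1) (\<lambda>x. 1 + l * cv (\<lambda>_. 1) (cv (\<lambda>_. 1) kf) x) 2
        \<le> (1 + l * cv (\<lambda>_. 1) (cv (\<lambda>_. 1) kf) 2) * cv (\<lambda>_. 1) kf 2"
      by (simp add: W_kf Zeq)
  qed
qed

end

lemma (in res_kernel) scale_fn_ex: "\<exists>k. scale_fn F l k"
  using helly_limit_ex helly_limit.scale_fn_kf by blast

section \<open>Weak derivatives\<close>

text \<open>\<open>bmp 0\<close> is the usual smooth function that is flat at 0. The powers of
  \<open>1/x\<close> close the family under differentiation, up to linear combinations.\<close>

definition bmp :: "nat \<Rightarrow> real \<Rightarrow> real" where
  "bmp n x = (if x > 0 then (1 / x) ^ n * exp (- (1 / x)) else 0)"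

lemma bmp_lim_0: "(bmp n \<longlongrightarrow> 0) (at 0)"
  unfolding filterlim_at_split
proof
  have "\<forall>\<^sub>F x in at_left 0. 0 = bmp n x"
    unfolding eventually_at_left_field by (intro exI[of _ "-1"]) (auto simp: bmp_def)
  then show "(bmp n \<longlongrightarrow> 0) (at_left 0)" by (rule Lim_transform_eventually[OF tendsto_const])
  have "((\<lambda>x::real. x ^ n / exp x) \<longlongrightarrow> 0) at_top" by (rule tendsto_power_div_exp_0)
  from filterlim_compose[OF this filterlim_inverse_at_top_right]
  have "((\<lambda>x::real. (inverse x) ^ n / exp (inverse x)) \<longlongrightarrow> 0) (at_right 0)" .
  moreover have "\<forall>\<^sub>F x in at_right (0::real). (inverse x) ^ n / exp (inverse x) = bmp n x"
    unfolding eventually_at_right_field by (intro exI[of _ 1]) (auto simp: bmp_def exp_minus field_simps)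
  ultimately show "(bmp n \<longlongrightarrow> 0) (at_right 0)" by (rule Lim_transform_eventually)
qed

lemma bmp_deriv: "(bmp n has_real_derivative (bmp (n + 2) x - real n * bmp (n + 1) x)) (at x)"
proof -
  consider "x > 0" | "x < 0" | "x = 0" by linarith
  then show ?thesis
  proof cases
    case 1
    have "((\<lambda>x. (1 / x) ^ n * exp (- (1 / x))) has_real_derivative (bmp (n + 2) x - real n * bmp (n + 1) x)) (at x)"
    proof -
      have "((\<lambda>x. 1 / x) has_real_derivative - ((1 / x)\<^sup>2)) (at x)"
        using 1 by (auto intro!: derivative_eq_intros simp: power2_eq_square field_simps)
      note p = DERIV_power[OF this, of n]
      have e: "((\<lambda>x. exp (- (1 / x))) has_real_derivative exp (- (1 / x)) * (1 / x)\<^sup>2) (at x)"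
        using 1 by (auto intro!: derivative_eq_intros simp: power2_eq_square field_simps)
      show ?thesis
        by (rule DERIV_cong[OF DERIV_mult[OF p e]]) (use 1 in \<open>cases n; simp add: bmp_def power2_eq_square algebra_simps\<close>)
    qed
    then show ?thesis
      by (rule has_field_derivative_transform_within_open[of _ _ _ "{0<..}"]) (use 1 in \<open>auto simp: bmp_def\<close>)
  next
    case 2
    have "((\<lambda>x. 0) has_real_derivative (bmp (n + 2) x - real n * bmp (n + 1) x)) (at x)"
      using 2 by (simp add: bmp_def)
    then show ?thesis
      by (rule has_field_derivative_transform_within_open[of _ _ _ "{..<0}"]) (use 2 in \<open>auto simp: bmp_def\<close>)
  next
    case 3
    have "((\<lambda>h. (bmp n (0 + h) - bmp n 0) / h) \<longlongrightarrow> 0) (at 0)"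
      by (rule Lim_transform_eventually[OF bmp_lim_0[of "Suc n"]])
        (auto simp: eventually_at_filter bmp_def)
    then show ?thesis using 3 by (simp add: DERIV_def bmp_def)
  qed
qed

text \<open>An algebra of functions that is stable under differentiation: membership yields all
  iterated derivatives at once, as \<open>test_function\<close> demands.\<close>

inductive_set SM :: "(real \<Rightarrow> real) set" where
  SM_bmp: "(\<lambda>x. bmp n (c * x + d)) \<in> SM"
| SM_const: "(\<lambda>x. c) \<in> SM"
| SM_add: "f \<in> SM \<Longrightarrow> g \<in> SM \<Longrightarrow> (\<lambda>x. f x + g x) \<in> SM"
| SM_mult: "f \<in> SM \<Longrightarrow> g \<in> SM \<Longrightarrow> (\<lambda>x. f x * g x) \<in> SM"

lemma SM_deriv_ex: "f \<in> SM \<Longrightarrow> \<exists>f'\<in>SM. \<forall>x. (f has_real_derivative f' x) (at x)"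
proof (induction rule: SM.induct)
  case (SM_bmp n c d)
  have "((\<lambda>x. bmp n (c * x + d)) has_real_derivative ((bmp (n + 2) (c * x + d) - real n * bmp (n + 1) (c * x + d)) * c)) (at x)" for x
    by (rule DERIV_chain2[OF bmp_deriv]) (auto intro!: derivative_eq_intros)
  then have "((\<lambda>x. bmp n (c * x + d)) has_real_derivative ((bmp (n + 2) (c * x + d) + (- real n) * bmp (n + 1) (c * x + d)) * c)) (at x)" for x
    by simp
  then show ?case by (intro bexI[of _ "\<lambda>x. (bmp (n + 2) (c * x + d) + (- real n) * bmp (n + 1) (c * x + d)) * c"])
      (simp, rule SM.SM_mult[OF SM.SM_add[OF SM.SM_bmp SM.SM_mult[OF SM.SM_const SM.SM_bmp]] SM.SM_const])
next
  case (SM_const c)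
  show ?case by (intro bexI[of _ "\<lambda>_. 0"]) (auto intro: SM.intros)
next
  case (SM_add f g)
  then obtain f' g' where "f' \<in> SM" "g' \<in> SM" "\<And>x. (f has_real_derivative f' x) (at x)" "\<And>x. (g has_real_derivative g' x) (at x)"
    by blast
  then show ?case by (intro bexI[of _ "\<lambda>x. f' x + g' x"]) (auto intro!: SM.intros derivative_intros)
next
  case (SM_mult f g)
  then obtain f' g' where *: "f' \<in> SM" "g' \<in> SM" "\<And>x. (f has_real_derivative f' x) (at x)" "\<And>x. (g has_real_derivative g' x) (at x)"
    by blast
  have "((\<lambda>x. f x * g x) has_real_derivative (f' x * g x + g' x * f x)) (at x)" for x
    by (rule DERIV_mult[OF *(3,4)])
  then show ?case using * SM_mult.hyps by (intro bexI[of _ "\<lambda>x. f' x * g x + g' x * f x"]) (auto intro!: SM.intros)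
qed

lemma SM_deriv: assumes "f \<in> SM" shows "deriv f \<in> SM" "(f has_real_derivative deriv f x) (at x)"
proof -
  obtain f' where f': "f' \<in> SM" "\<And>x. (f has_real_derivative f' x) (at x)" using SM_deriv_ex[OF assms] by blast
  then have "deriv f = f'" using DERIV_imp_deriv by blast
  then show "deriv f \<in> SM" "(f has_real_derivative deriv f x) (at x)" using f' by auto
qed

lemma SM_derivs: "f \<in> SM \<Longrightarrow> (deriv ^^ n) f \<in> SM"
  by (induction n) (auto simp: SM_deriv)

lemma SM_diff: "f \<in> SM \<Longrightarrow> f differentiable (at x)"
  using SM_deriv(2) real_differentiable_def by blast

lemma SM_cont: "f \<in> SM \<Longrightarrow> continuous_on A f"
  using SM_deriv(2)[of f] DERIV_isCont continuous_at_imp_continuous_on by blast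

lemma SM_meas: "f \<in> SM \<Longrightarrow> f \<in> borel_measurable borel"
  using SM_cont[of f UNIV] by (intro borel_measurable_continuous_onI)

text \<open>Smooth cut-offs that converge to the indicator of the open interval from
  \<open>a\<close> to \<open>b\<close> as \<open>n\<close> grows.\<close>

definition chi :: "nat \<Rightarrow> real \<Rightarrow> real \<Rightarrow> real \<Rightarrow> real" where
  "chi n a b x = bmp 0 (real n * x + (- real n * a)) * bmp 0 (- real n * x + real n * b)"

lemma chi_SM: "chi n a b \<in> SM" unfolding chi_def[abs_def] by (intro SM.intros)

lemma bmp0_bounds: "0 \<le> bmp 0 x" "bmp 0 x \<le> 1" by (auto simp: bmp_def)

lemma chi_bounds: "0 \<le> chi n a b x" "chi n a b x \<le> 1"
  unfolding chi_def using bmp0_bounds by (auto intro: mult_le_one)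

lemma chi_zero: assumes "x \<notin> {a<..<b}" shows "chi n a b x = 0"
proof -
  have "real n * x + (- real n * a) \<le> 0 \<or> - real n * x + real n * b \<le> 0"
    using assms by (auto simp: not_less intro: mult_left_mono)
  then show ?thesis by (auto simp: chi_def bmp_def)
qed

lemma chi_lim: assumes "x \<in> {a<..<b}" shows "(\<lambda>n. chi n a b x) \<longlonglongrightarrow> 1"
proof -
  have *: "(\<lambda>n. bmp 0 (real n * c)) \<longlonglongrightarrow> 1" if c: "c > 0" for c
  proof -
    have "(\<lambda>n. exp (- ((1 / c) * (1 / real n)))) \<longlonglongrightarrow> exp (- ((1 / c) * 0))"
      by (intro tendsto_intros lim_1_over_n)
    moreover have "\<forall>\<^sub>F n in sequentially. exp (- ((1 / c) * (1 / real n))) = bmp 0 (real n * c)"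
      using eventually_gt_at_top[of 0] by eventually_elim (use c in \<open>simp add: bmp_def mult.commute\<close>)
    ultimately show ?thesis using Lim_transform_eventually by fastforce
  qed
  have "(\<lambda>n. bmp 0 (real n * (x - a)) * bmp 0 (real n * (b - x))) \<longlonglongrightarrow> 1 * 1"
    using assms by (intro tendsto_mult *) auto
  then show ?thesis by (simp add: chi_def algebra_simps)
qed

lemma test_chi: assumes "-1 < a" "b < 1" shows "test_function (chi n a b)"
  unfolding test_function_def
proof (intro conjI allI)
  show "(deriv ^^ m) (chi n a b) differentiable (at x)" for m x
    by (intro SM_diff SM_derivs chi_SM)
  show "\<exists>K. compact K \<and> K \<subseteq> {-1<..<1} \<and> (\<forall>x. x \<notin> K \<longrightarrow> chi n a b x = 0)"
    by (rule exI[of _ "{a..b}"]) (use assms in \<open>auto intro!: chi_zero\<close>)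
qed

text \<open>Mean zero is what makes the primitive vanish again to the right of \<open>b\<close>;
  this provides enough derivatives of test functions.\<close>

lemma test_antideriv:
  assumes th: "\<theta> \<in> SM" and z: "\<And>x. x \<notin> {a..b} \<Longrightarrow> \<theta> x = 0" and ab: "-1 < a" "b < 1"
    and i0: "(LINT x|lborel. \<theta> x) = 0"
  shows "\<exists>\<eta>. test_function \<eta> \<and> deriv \<eta> = \<theta>"
proof -
  have nz: "a \<le> y \<and> y \<le> b" if "\<theta> y \<noteq> 0" for y using z[of y] that by auto
  define \<eta> where "\<eta> u = (LBINT y=ereal (-1)..ereal u. \<theta> y)" for u :: real
  have d: "(\<eta> has_real_derivative \<theta> x) (at x)" for x
  proof -
    have "((\<lambda>u. LBINT y=ereal (-1)..ereal u. \<theta> y) has_vector_derivative (\<theta> x)) (at x within {- \<bar>x\<bar> - 2..\<bar>x\<bar> + 2})"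
      by (rule interval_integral_FTC2[OF _ _ SM_cont[OF th]]) auto
    moreover have "at x within {- \<bar>x\<bar> - 2..\<bar>x\<bar> + 2} = at x"
      by (intro at_within_interior) (auto simp: interior_atLeastAtMost_real)
    ultimately show ?thesis
      by (simp add: has_real_derivative_iff_has_vector_derivative \<eta>_def[abs_def])
  qed
  then have de: "deriv \<eta> = \<theta>" using DERIV_imp_deriv by blast
  have "test_function \<eta>"
    unfolding test_function_def
  proof (intro conjI allI)
    fix n x
    show "(deriv ^^ n) \<eta> differentiable (at x)"
    proof (cases n)
      case 0
      then show ?thesis using d real_differentiable_def by auto
    next
      case (Suc m)
      have "(deriv ^^ Suc m) \<eta> = (deriv ^^ m) \<theta>" by (simp add: funpow_Suc_right de del: funpow.simps)
      then show ?thesis using Suc SM_diff[OF SM_derivs[OF th]] by simp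
    qed
  next
    have "\<eta> x = 0" if x: "x \<notin> {a..b}" for x
    proof (cases "x < a")
      case True
      have "\<theta> y = 0" if "min (-1) x < y" "y < max (-1) x" for y using that True ab by (intro z) auto
      then have "(LBINT y=ereal (-1)..ereal x. \<theta> y) = (LBINT y=ereal (-1)..ereal x. 0)"
        by (intro interval_integral_cong) (auto simp: einterval_iff min_def max_def split: if_splits)
      then show ?thesis by (simp add: \<eta>_def)
    next
      case False
      then have xb: "b < x" using x by auto
      show ?thesis
      proof (cases "-1 \<le> x")
        case True
        have "(LBINT y=ereal (-1)..ereal x. \<theta> y) = (LINT y:{-1<..<x}|lborel. \<theta> y)"
          using True by (simp add: interval_lebesgue_integral_def)
        also have "\<dots> = (LINT y|lborel. \<theta> y)"
          unfolding set_lebesgue_integral_def using ab xb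
          by (intro Bochner_Integration.integral_cong) (auto simp: indicator_def dest!: nz)
        finally show ?thesis by (simp add: \<eta>_def i0)
      next
        case F: False
        then have "\<theta> y = 0" for y using z[of y] False ab xb by (cases "y \<in> {a..b}") auto
        then show ?thesis by (simp add: \<eta>_def)
      qed
    qed
    then show "\<exists>K. compact K \<and> K \<subseteq> {-1<..<1} \<and> (\<forall>x. x \<notin> K \<longrightarrow> \<eta> x = 0)"
      by (intro exI[of _ "{a..b}"]) (use ab in auto)
  qed
  then show ?thesis using de by blast
qed

section \<open>Fundamental lemmas of the calculus of variations\<close>

lemma loc_int_Icc: "locally_integrable w \<Longrightarrow> -1 < a \<Longrightarrow> b < 1 \<Longrightarrow> set_integrable lborel {a..b} w"
proof -
  assume w: "locally_integrable w" and ab: "-1 < a" "b < 1"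
  have "compact {a..b} \<and> {a..b} \<subseteq> {-1<..<1}" using ab by auto
  then show ?thesis using w unfolding locally_integrable_def by blast
qed

lemma chi_integral_lim:
  assumes w: "locally_integrable w" and ab: "-1 < a" "b < 1"
  shows "(\<lambda>n. LINT x:{-1<..<1}|lborel. w x * chi n a b x) \<longlonglongrightarrow> (LINT x:{a..b}|lborel. w x)"
proof -
  have wi: "integrable lborel (\<lambda>x. indicator {a..b} x * w x)"
    using loc_int_Icc[OF w ab] by (simp add: set_integrable_def)
  have eq: "indicator {-1<..<1} x *\<^sub>R (w x * chi n a b x) = (indicator {a..b} x * w x) * chi n a b x" for n x
    using ab chi_zero[of x a b n] by (auto simp: indicator_def)
  have "(\<lambda>n. LINT x|lborel. (indicator {a..b} x * w x) * chi n a b x) \<longlonglongrightarrow> (LINT x|lborel. indicator {a..b} x * w x)"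
  proof (rule integral_dominated_convergence[where w = "\<lambda>x. \<bar>indicator {a..b} x * w x\<bar>"])
    show "AE x in lborel. (\<lambda>n. (indicator {a..b} x * w x) * chi n a b x) \<longlonglongrightarrow> indicator {a..b} x * w x"
      using AE_lborel_singleton[of a] AE_lborel_singleton[of b]
    proof eventually_elim
      case (elim x)
      show ?case
      proof (cases "x \<in> {a<..<b}")
        case True
        from tendsto_mult_left[OF chi_lim[OF this], of "indicator {a..b} x * w x"] show ?thesis by simp
      next
        case False
        then show ?thesis using elim by (auto simp: indicator_def)
      qed
    qed
    show "AE x in lborel. norm ((indicator {a..b} x * w x) * chi n a b x) \<le> \<bar>indicator {a..b} x * w x\<bar>" for n
      using chi_bounds[of n a b] by (intro AE_I2) (simp add: abs_mult mult_left_le)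
    show "(\<lambda>x. (indicator {a..b} x * w x) * chi n a b x) \<in> borel_measurable lborel" for n
      by (rule borel_measurable_times[OF borel_measurable_integrable[OF wi]]) (simp add: SM_meas[OF chi_SM])
  qed (use wi in auto)
  then show ?thesis unfolding set_lebesgue_integral_def eq by simp
qed

lemma AE_zero_of_integrals':
  fixes p :: "real \<Rightarrow> real"
  assumes p: "set_integrable lborel {a..b} p" and z: "\<And>x. x \<in> {a..b} \<Longrightarrow> (LINT y:{a..x}|lborel. p y) = 0"
  shows "AE x in lborel. x \<in> {a..b} \<longrightarrow> p x = 0"
proof (cases "a < b")
  case ab: True
  define c where "c = (b - a) / 2"
  have c: "c > 0" using ab by (simp add: c_def)
  define q where "q y = p (a + c * y)" for y
  have i: "indicator {a..a + c * x} (a + c * y) = (indicator {0..x} y :: real)" for x y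
    using c by (auto simp: indicator_def zero_le_mult_iff)
  have b: "b = a + c * 2" by (simp add: c_def field_simps)
  have "integrable lborel (\<lambda>y. indicator {a..b} (a + c * y) *\<^sub>R p (a + c * y))"
    using p unfolding set_integrable_def by (rule lborel_integrable_real_affine) (use c in simp)
  then have qL: "L q" unfolding b i set_integrable_def q_def .
  have "AE y in lborel. y \<in> {0..2} \<longrightarrow> q y = 0"
  proof (rule AE_zero_of_integrals[OF qL])
    fix x :: real assume x: "x \<in> {0..2}"
    have "(LINT y:{a..a + c * x}|lborel. p y) = c * (LINT y:{0..x}|lborel. q y)"
      unfolding set_lebesgue_integral_def
      using lborel_integral_real_affine[of c "\<lambda>y. indicator {a..a + c * x} y *\<^sub>R p y" a] c by (simp add: i q_def)
    moreover have "a + c * x \<in> {a..b}" using x c unfolding b by auto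
    ultimately show "(LINT y:{0..x}|lborel. q y) = 0" using z[of "a + c * x"] c by simp
  qed
  then obtain N where N: "N \<in> null_sets lborel" "{y. \<not> (y \<in> {0..2} \<longrightarrow> q y = 0)} \<subseteq> N"
    by (auto elim!: AE_E simp: null_sets_def)
  have "AE x in lborel. (x - a) / c \<notin> N"
  proof -
    have N': "N \<in> sets borel" using N(1) by auto
    have "AE x in lborel. - a / c + (1 / c) * x \<notin> N"
      by (rule AE_borel_affine[OF _ _ AE_not_in[OF N(1)]]) (use c N' in \<open>auto intro: measurable_compose[OF _ pred_sets2]\<close>)
    then show ?thesis by (simp add: diff_divide_distrib)
  qed
  then show ?thesis
  proof eventually_elim
    case (elim x)
    show ?case
    proof
      assume x: "x \<in> {a..b}"
      then have "(x - a) / c \<in> {0..2}" using c by (auto simp: b field_simps)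
      then have "q ((x - a) / c) = 0" using elim N(2) by auto
      then show "p x = 0" using c by (simp add: q_def)
    qed
  qed
next
  case False
  have "AE x in lborel. x \<notin> {a..b}" using AE_lborel_singleton[of a] by eventually_elim (use False in auto)
  then show ?thesis by eventually_elim auto
qed

lemma AE_zero_local:
  assumes w: "locally_integrable w" and z: "\<And>a b. -1 < a \<Longrightarrow> a \<le> b \<Longrightarrow> b < 1 \<Longrightarrow> (LINT x:{a..b}|lborel. w x) = 0"
  shows "AE x in lborel. x \<in> {-1<..<1} \<longrightarrow> w x = 0"
proof -
  define e where "e n = inverse (real (Suc n))" for n
  have "AE x in lborel. x \<in> {-1 + e n..1 - e n} \<longrightarrow> w x = 0" for n
  proof (rule AE_zero_of_integrals'[OF loc_int_Icc[OF w]])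
    have "e n > 0" by (simp add: e_def)
    then show "-1 < -1 + e n" "1 - e n < 1" by auto
    then show "(LINT y:{-1 + e n..x}|lborel. w y) = 0" if "x \<in> {-1 + e n..1 - e n}" for x
      using that by (intro z) auto
  qed
  then have "AE x in lborel. \<forall>n. x \<in> {-1 + e n..1 - e n} \<longrightarrow> w x = 0" unfolding AE_all_countable by blast
  then show ?thesis
  proof eventually_elim
    case (elim x)
    show ?case
    proof
      assume "x \<in> {-1<..<1}"
      then obtain n where "e n < min (1 - x) (x + 1)"
        using reals_Archimedean[of "min (1 - x) (x + 1)"] by (auto simp: e_def)
      then show "w x = 0" using elim[rule_format, of n] by auto
    qed
  qed
qed

lemma locally_integrable_diff:
  "locally_integrable u \<Longrightarrow> locally_integrable v \<Longrightarrow> locally_integrable (\<lambda>x. u x - v x)"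
  unfolding locally_integrable_def by (auto intro: set_integral_diff)

lemma locally_integrable_const: "locally_integrable (\<lambda>_. c)"
  unfolding locally_integrable_def
  by (auto simp: set_integrable_def intro!: integrable_real_indicator emeasure_bounded_finite compact_imp_bounded borel_compact)

lemma set_integrable_mult_SM:
  assumes w: "locally_integrable w" and th: "\<theta> \<in> SM" and z: "\<And>x. x \<notin> {a..b} \<Longrightarrow> \<theta> x = 0" and ab: "-1 < a" "b < 1"
  shows "set_integrable lborel {-1<..<1} (\<lambda>x. w x * \<theta> x)"
proof -
  have wi: "integrable lborel (\<lambda>x. indicator {a..b} x * w x)"
    using loc_int_Icc[OF w ab] by (simp add: set_integrable_def)
  have "bounded (\<theta> ` {a..b})" by (intro compact_imp_bounded compact_continuous_image SM_cont th) auto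
  then obtain B where B: "\<And>x. x \<in> {a..b} \<Longrightarrow> \<bar>\<theta> x\<bar> \<le> B" unfolding bounded_iff by (metis image_eqI real_norm_def)
  have "integrable lborel (\<lambda>x. (indicator {a..b} x * w x) * \<theta> x)"
  proof (rule Bochner_Integration.integrable_bound)
    show "integrable lborel (\<lambda>x. (indicator {a..b} x * w x) * B)" using wi by (rule integrable_mult_left)
    show "AE x in lborel. norm ((indicator {a..b} x * w x) * \<theta> x) \<le> norm ((indicator {a..b} x * w x) * B)"
      using B by (intro AE_I2) (force simp: indicator_def abs_mult intro: mult_left_mono)
    show "(\<lambda>x. (indicator {a..b} x * w x) * \<theta> x) \<in> borel_measurable lborel"
      by (rule borel_measurable_times[OF borel_measurable_integrable[OF wi]]) (simp add: SM_meas[OF th])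
  qed
  also have "(\<lambda>x. (indicator {a..b} x * w x) * \<theta> x) = (\<lambda>x. indicator {-1<..<1} x *\<^sub>R (w x * \<theta> x))"
    using ab z by (fastforce simp: indicator_def)
  finally show ?thesis by (simp add: set_integrable_def)
qed

text \<open>Testing with the cut-offs shows in the limit that \<open>w\<close> has integral 0 over
  every compact subinterval.\<close>

lemma du_bois_reymond_0:
  assumes w: "locally_integrable w"
    and z: "\<And>\<eta>. test_function \<eta> \<Longrightarrow> (LINT x:{-1<..<1}|lborel. w x * \<eta> x) = 0"
  shows "AE x in lborel. x \<in> {-1<..<1} \<longrightarrow> w x = 0"
proof (rule AE_zero_local[OF w])
  fix a b :: real assume ab: "-1 < a" "a \<le> b" "b < 1"
  show "(LINT x:{a..b}|lborel. w x) = 0"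
  proof (rule LIMSEQ_unique)
    show "(\<lambda>n. LINT x:{-1<..<1}|lborel. w x * chi n a b x) \<longlonglongrightarrow> (LINT x:{a..b}|lborel. w x)"
      by (rule chi_integral_lim[OF w ab(1,3)])
    show "(\<lambda>n. LINT x:{-1<..<1}|lborel. w x * chi n a b x) \<longlonglongrightarrow> 0"
      by (simp add: z[OF test_chi[OF ab(1,3)]])
  qed
qed

text \<open>Testing with mean-zero combinations of two cut-offs shows that \<open>w\<close> has the
  same mean over any two intervals; this common mean is the constant.\<close>

lemma du_bois_reymond_1:
  assumes w: "locally_integrable w"
    and z: "\<And>\<eta>. test_function \<eta> \<Longrightarrow> (LINT x:{-1<..<1}|lborel. w x * deriv \<eta> x) = 0"
  shows "\<exists>c. AE x in lborel. x \<in> {-1<..<1} \<longrightarrow> w x = c"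
proof -
  have key: "(LINT x:{a..b}|lborel. w x) * (b' - a') = (LINT x:{a'..b'}|lborel. w x) * (b - a)"
    if ab: "-1 < a" "a \<le> b" "b < 1" "-1 < a'" "a' \<le> b'" "b' < 1" for a b a' b'
  proof -
    have one: "locally_integrable (\<lambda>_. 1)" by (rule locally_integrable_const)
    define I where "I n = (LINT x:{-1<..<1}|lborel. 1 * chi n a b x)" for n
    define I' where "I' n = (LINT x:{-1<..<1}|lborel. 1 * chi n a' b' x)" for n
    have z1: "chi n a b x = 0" "chi n a' b' x = 0" if "x \<notin> {min a a'..max b b'}" for x n
      using that by (auto intro!: chi_zero)
    have eq: "(LINT x:{-1<..<1}|lborel. w x * chi n a b x) * I' n = (LINT x:{-1<..<1}|lborel. w x * chi n a' b' x) * I n" for n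
    proof -
      \<comment> \<open>The crosswise weights make the integral of \<open>\<theta>\<close> vanish,
        so it is the derivative of a test function.\<close>
      define \<theta> where "\<theta> x = chi n a b x * I' n + chi n a' b' x * (- I n)" for x
      have th: "\<theta> \<in> SM" unfolding \<theta>_def[abs_def] by (intro SM.intros chi_SM)
      have zz: "\<theta> x = 0" if "x \<notin> {min a a'..max b b'}" for x using z1[OF that] by (simp add: \<theta>_def)
      have nz: "min a a' \<le> x \<and> x \<le> max b b'" if "\<theta> x \<noteq> 0" for x using zz[of x] that by (auto simp del: min_le_iff_disj le_max_iff_disj)
      have m: "-1 < min a a'" "max b b' < 1" using ab by auto
      have ints: "set_integrable lborel {-1<..<1} (\<lambda>x. v x * chi n a b x)" "set_integrable lborel {-1<..<1} (\<lambda>x. v x * chi n a' b' x)"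
        if "locally_integrable v" for v
        using set_integrable_mult_SM[OF that chi_SM z1(1) m] set_integrable_mult_SM[OF that chi_SM z1(2) m] by auto
      have lin: "(LINT x:{-1<..<1}|lborel. v x * \<theta> x) = (LINT x:{-1<..<1}|lborel. v x * chi n a b x) * I' n - (LINT x:{-1<..<1}|lborel. v x * chi n a' b' x) * I n"
        if "locally_integrable v" for v
      proof -
        have "(LINT x:{-1<..<1}|lborel. v x * \<theta> x) = (LINT x:{-1<..<1}|lborel. (v x * chi n a b x) * I' n - (v x * chi n a' b' x) * I n)"
          by (simp add: \<theta>_def algebra_simps)
        also have "\<dots> = (LINT x:{-1<..<1}|lborel. (v x * chi n a b x) * I' n) - (LINT x:{-1<..<1}|lborel. (v x * chi n a' b' x) * I n)"
          by (intro set_integral_diff(2) set_integrable_mult_left ints that)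
        finally show ?thesis by simp
      qed
      have "(LINT x|lborel. \<theta> x) = (LINT x:{-1<..<1}|lborel. 1 * \<theta> x)"
        unfolding set_lebesgue_integral_def using m nz by (intro Bochner_Integration.integral_cong refl) (force simp: indicator_def)
      also have "\<dots> = 0" unfolding lin[OF one] I_def I'_def by simp
      finally have i0: "(LINT x|lborel. \<theta> x) = 0" .
      obtain \<eta> where "test_function \<eta>" "deriv \<eta> = \<theta>" using test_antideriv[OF th zz m i0] by blast
      then have "(LINT x:{-1<..<1}|lborel. w x * \<theta> x) = 0" using z[of \<eta>] by simp
      then show ?thesis unfolding lin[OF w] by simp
    qed
    have lI: "I \<longlonglongrightarrow> b - a" unfolding I_def using chi_integral_lim[OF one ab(1,3)] ab by (simp add: set_lebesgue_integral_def)
    have lI': "I' \<longlonglongrightarrow> b' - a'" unfolding I'_def using chi_integral_lim[OF one ab(4,6)] ab by (simp add: set_lebesgue_integral_def)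
    show ?thesis
      using LIMSEQ_unique[OF tendsto_mult[OF chi_integral_lim[OF w ab(1,3)] lI', unfolded eq]
        tendsto_mult[OF chi_integral_lim[OF w ab(4,6)] lI]] .
  qed
  \<comment> \<open>The mean over a reference interval; 2 is the reciprocal of its length.\<close>
  define c where "c = (LINT x:{0..1/2}|lborel. w x) * 2"
  have "AE x in lborel. x \<in> {-1<..<1} \<longrightarrow> w x - c = 0"
  proof (rule AE_zero_local[OF locally_integrable_diff[OF w locally_integrable_const]])
    fix a b :: real assume ab: "-1 < a" "a \<le> b" "b < 1"
    have "(LINT x:{a..b}|lborel. w x - c) = (LINT x:{a..b}|lborel. w x) - (LINT x:{a..b}|lborel. c)"
      using ab by (intro set_integral_diff(2) loc_int_Icc w locally_integrable_const) auto
    also have "(LINT x:{a..b}|lborel. c) = c * (b - a)" using ab by (simp add: set_lebesgue_integral_def)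
    also have "(LINT x:{a..b}|lborel. w x) = c * (b - a)"
      using key[OF ab, of 0 "1/2"] by (simp add: c_def)
    finally show "(LINT x:{a..b}|lborel. w x - c) = 0" by simp
  qed
  then show ?thesis by (intro exI[of _ c]) (auto elim: eventually_mono)
qed

lemma test_function_facts:
  assumes "test_function \<eta>"
  shows "(\<eta> has_real_derivative deriv \<eta> x) (at x)" "continuous_on A \<eta>" "continuous_on A (deriv \<eta>)"
    "\<exists>a b. -1 < a \<and> b < 1 \<and> (\<forall>x. x \<notin> {a..b} \<longrightarrow> \<eta> x = 0 \<and> deriv \<eta> x = 0)"
proof -
  have d: "(deriv ^^ n) \<eta> differentiable (at x)" for n x using assms by (auto simp: test_function_def)
  show D: "(\<eta> has_real_derivative deriv \<eta> x) (at x)" for x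
    using d[of 0 x] DERIV_deriv_iff_real_differentiable by auto
  show "continuous_on A \<eta>"
    by (meson D DERIV_isCont continuous_at_imp_continuous_on)
  have "isCont (deriv \<eta>) x" for x
    using d[of 1 x] by (auto dest: differentiable_imp_continuous_within)
  then show "continuous_on A (deriv \<eta>)" by (meson continuous_at_imp_continuous_on)
  obtain K where K: "compact K" "K \<subseteq> {-1<..<1}" "\<And>x. x \<notin> K \<Longrightarrow> \<eta> x = 0"
    using assms by (auto simp: test_function_def)
  have "\<exists>a b. -1 < a \<and> b < 1 \<and> K \<subseteq> {a..b}"
  proof (cases "K = {}")
    case False
    obtain a where a: "a \<in> K" "\<And>x. x \<in> K \<Longrightarrow> a \<le> x" using compact_attains_inf[OF K(1) False] by blast
    obtain b where b: "b \<in> K" "\<And>x. x \<in> K \<Longrightarrow> x \<le> b" using compact_attains_sup[OF K(1) False] by blast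
    show ?thesis using a b K(2) by (intro exI[of _ a] exI[of _ b]) auto
  qed (auto intro!: exI[of _ 0])
  then obtain a b where ab: "-1 < a" "b < 1" "K \<subseteq> {a..b}" by blast
  have nz: "\<eta> x = 0" if "x \<notin> {a..b}" for x
    using K(3)[of x] ab(3) that by blast
  have z: "\<eta> x = 0 \<and> deriv \<eta> x = 0" if x: "x \<notin> {a..b}" for x
  proof -
    have "open (- {a..b})" by (intro open_Compl closed_atLeastAtMost)
    then have "((\<lambda>_. 0) has_real_derivative deriv \<eta> x) (at x)"
      by (rule has_field_derivative_transform_within_open[OF D]) (use x nz in auto)
    then have "deriv \<eta> x = 0" using DERIV_unique[OF _ DERIV_const] by blast
    then show ?thesis using nz[OF x] by simp
  qed
  show "\<exists>a b. -1 < a \<and> b < 1 \<and> (\<forall>x. x \<notin> {a..b} \<longrightarrow> \<eta> x = 0 \<and> deriv \<eta> x = 0)"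
    using ab z by blast
qed

lemma continuous_bound:
  assumes "continuous_on {a..b} (f :: real \<Rightarrow> real)" shows "\<exists>B. \<forall>x\<in>{a..b}. \<bar>f x\<bar> \<le> B"
proof -
  have "bounded (f ` {a..b})" by (intro compact_imp_bounded compact_continuous_image assms) auto
  then show ?thesis unfolding bounded_iff by (metis image_eqI real_norm_def)
qed

text \<open>Fubini on the triangle \<open>y <= x\<close>, followed by the fundamental theorem of
  calculus for the test function.\<close>

lemma integration_by_parts:
  assumes v: "set_integrable lborel {-1..1} v" and t: "test_function \<eta>"
  shows "(LINT x:{-1<..<1}|lborel. (LINT y:{-1..x}|lborel. v y) * deriv \<eta> x) = - (LINT x:{-1<..<1}|lborel. v x * \<eta> x)"
proof -
  note tf = test_function_facts[OF t]
  have [measurable]: "deriv \<eta> \<in> borel_measurable borel" using tf(3)[of UNIV] by (intro borel_measurable_continuous_onI)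
  define w where "w y = indicator {-1..1} y * v y" for y
  have w: "integrable lborel w" using v by (simp add: set_integrable_def w_def[abs_def])
  then have [measurable]: "w \<in> borel_measurable borel" by (auto dest: borel_measurable_integrable)
  obtain B where B: "\<And>x. x \<in> {-1..1} \<Longrightarrow> \<bar>deriv \<eta> x\<bar> \<le> B" using continuous_bound[OF tf(3)] by blast
  have B0: "B \<ge> 0" using B[of 0] by auto
  define g where "g x y = indicator {-1<..<1} x * deriv \<eta> x * ((if y \<le> x then 1 else 0) * w y)" for x y
  have g_b: "\<bar>g x y\<bar> \<le> indicator {-1<..<1} x * B * \<bar>w y\<bar>" for x y
    using B[of x] B0 by (auto simp: g_def indicator_def abs_mult intro!: mult_right_mono)
  have wx: "integrable lborel (\<lambda>y. (if y \<le> x then 1 else 0) * w y)" for x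
    by (rule Bochner_Integration.integrable_bound[OF w]) auto
  have i: "integrable (lborel \<Otimes>\<^sub>M lborel) (\<lambda>(x, y). g x y)"
  proof (rule Bochner_Integration.integrable_bound)
    have "integrable lborel (\<lambda>x::real. indicator {-1<..<1} x * (\<bar>B\<bar> * (LINT y|lborel. \<bar>w y\<bar>)))"
      by (intro integrable_mult_left integrable_real_indicator emeasure_bounded_finite) auto
    moreover have "(LINT y|lborel. norm (case (x, y) of (x::real, y) \<Rightarrow> indicator {-1<..<1} x * B * \<bar>w y\<bar>))
        = indicator {-1<..<1} x * (\<bar>B\<bar> * (LINT y|lborel. \<bar>w y\<bar>))" for x :: real
      by (simp add: abs_mult mult.assoc)
    ultimately have i1: "integrable lborel (\<lambda>x::real. LINT y|lborel. norm (case (x, y) of (x::real, y) \<Rightarrow> indicator {-1<..<1} x * B * \<bar>w y\<bar>))"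
      by (simp only:)
    show "integrable (lborel \<Otimes>\<^sub>M lborel) (\<lambda>(x::real, y). indicator {-1<..<1} x * B * \<bar>w y\<bar>)"
    proof (rule lborel_pair.Fubini_integrable)
      show "integrable lborel (\<lambda>x. LINT y|lborel. norm (case (x, y) of (x::real, y) \<Rightarrow> indicator {-1<..<1} x * B * \<bar>w y\<bar>))"
        by (rule i1)
      show "AE x in lborel. integrable lborel (\<lambda>y. case (x, y) of (x::real, y) \<Rightarrow> indicator {-1<..<1} x * B * \<bar>w y\<bar>)"
        using w by (intro AE_I2) (simp add: integrable_mult_right)
    qed measurable
    show "(\<lambda>(x, y). g x y) \<in> borel_measurable (lborel \<Otimes>\<^sub>M lborel)" unfolding g_def by measurable
    show "AE z in lborel \<Otimes>\<^sub>M lborel. norm (case z of (x, y) \<Rightarrow> g x y) \<le> norm (case z of (x::real, y) \<Rightarrow> indicator {-1<..<1} x * B * \<bar>w y\<bar>)"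
    proof (intro AE_I2)
      fix z :: "real \<times> real"
      show "norm (case z of (x, y) \<Rightarrow> g x y) \<le> norm (case z of (x::real, y) \<Rightarrow> indicator {-1<..<1} x * B * \<bar>w y\<bar>)"
        using g_b[of "fst z" "snd z"] by (simp add: case_prod_beta)
    qed
  qed
  have "(LINT x:{-1<..<1}|lborel. (LINT y:{-1..x}|lborel. v y) * deriv \<eta> x) = (LINT x|lborel. (LINT y|lborel. g x y))"
    unfolding set_lebesgue_integral_def
  proof (intro Bochner_Integration.integral_cong refl)
    fix x :: real
    show "indicator {-1<..<1} x *\<^sub>R ((LINT y|lborel. indicator {-1..x} y *\<^sub>R v y) * deriv \<eta> x) = (LINT y|lborel. g x y)"
    proof (cases "x \<in> {-1<..<1}")
      case True
      then have "(LINT y|lborel. indicator {-1..x} y *\<^sub>R v y) = (LINT y|lborel. (if y \<le> x then 1 else 0) * w y)"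
        by (intro Bochner_Integration.integral_cong refl) (auto simp: w_def indicator_def)
      then show ?thesis using True by (simp add: g_def)
    qed (simp add: g_def)
  qed
  also have "\<dots> = (LINT y|lborel. (LINT x|lborel. g x y))" using lborel_pair.Fubini_integral[OF i] by simp
  also have "\<dots> = (LINT y|lborel. - (indicator {-1<..<1} y *\<^sub>R (v y * \<eta> y)))"
  proof (rule integral_cong_AE)
    show "AE y in lborel. (LINT x|lborel. g x y) = - (indicator {-1<..<1} y *\<^sub>R (v y * \<eta> y))"
      using AE_lborel_singleton[of 1] AE_lborel_singleton[of "-1"]
    proof eventually_elim
      case (elim y)
      show ?case
      proof (cases "y \<in> {-1<..<1}")
        case True
        have "\<eta> 1 = 0" using tf(4) by force
        have "(LINT x|lborel. deriv \<eta> x * indicator {y..1} x) = \<eta> 1 - \<eta> y"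
          using True tf(1) tf(3)[of UNIV] by (intro integral_FTC_Icc_real) (auto simp: continuous_on_eq_continuous_at)
        moreover have "(LINT x|lborel. g x y) = (LINT x|lborel. deriv \<eta> x * indicator {y..1} x * w y)"
        proof (rule integral_cong_AE)
          show "AE x in lborel. g x y = deriv \<eta> x * indicator {y..1} x * w y"
            using AE_lborel_singleton[of 1] by eventually_elim (use True in \<open>auto simp: g_def indicator_def\<close>)
        qed (unfold g_def, measurable)
        ultimately show ?thesis using True \<open>\<eta> 1 = 0\<close> by (simp add: w_def mult.commute)
      next
        case False
        then have "w y = 0" using elim by (auto simp: w_def indicator_def)
        then show ?thesis using False by (simp add: g_def)
      qed
    qed
    have "(\<lambda>(y, x). g x y) \<in> borel_measurable (lborel \<Otimes>\<^sub>M lborel)" unfolding g_def by measurable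
    then show "(\<lambda>y. LINT x|lborel. g x y) \<in> borel_measurable lborel"
      by (rule lborel.borel_measurable_lebesgue_integral)
    have [measurable]: "\<eta> \<in> borel_measurable borel" using tf(2)[of UNIV] by (intro borel_measurable_continuous_onI)
    have "(\<lambda>y. - (indicator {-1<..<1} y * (w y * \<eta> y))) \<in> borel_measurable lborel" by measurable
    also have "(\<lambda>y. - (indicator {-1<..<1} y * (w y * \<eta> y))) = (\<lambda>y. - (indicator {-1<..<1} y *\<^sub>R (v y * \<eta> y)))"
      by (auto simp: fun_eq_iff w_def indicator_def)
    finally show "(\<lambda>y. - (indicator {-1<..<1} y *\<^sub>R (v y * \<eta> y))) \<in> borel_measurable lborel" .
  qed
  finally show ?thesis by (simp add: set_lebesgue_integral_def)
qed

lemma integrable_loc: "set_integrable lborel {-1..1} v \<Longrightarrow> locally_integrable v"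
  unfolding locally_integrable_def
proof (intro allI impI)
  fix K :: "real set" assume v: "set_integrable lborel {-1..1} v" and K: "compact K \<and> K \<subseteq> {-1<..<1}"
  then have "K \<in> sets borel" by (auto intro: borel_compact)
  then show "set_integrable lborel K v"
    using K by (intro set_integrable_subset[OF v]) auto
qed

lemma antideriv_cont:
  fixes v :: "real \<Rightarrow> real"
  assumes v: "set_integrable lborel {-1..1} v" shows "continuous_on {-1..1} (\<lambda>x. LINT y:{-1..x}|lborel. v y)"
proof -
  have "L (\<lambda>y. v (-1 + y))"
    unfolding set_integrable_def
    using lborel_integrable_real_affine[OF v[unfolded set_integrable_def], of 1 "-1"]
    by (rule back_subst[of "integrable lborel"]) (auto simp: fun_eq_iff indicator_def)
  then have c: "continuous_on {0..2} (cv (\<lambda>_. 1) (\<lambda>y. v (-1 + y)))" by (intro continuous_cv) auto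
  have eq: "(LINT y:{-1..x}|lborel. v y) = cv (\<lambda>_. 1) (\<lambda>y. v (-1 + y)) (x + 1)" for x
  proof -
    have "(LINT y|lborel. indicator {-1..x} y *\<^sub>R v y) = (LINT y|lborel. indicator {-1..x} (-1 + 1 * y) *\<^sub>R v (-1 + 1 * y))"
      using lborel_integral_real_affine[of 1 "\<lambda>y. indicator {-1..x} y *\<^sub>R v y" "-1"] by simp
    also have "\<dots> = (LINT y|lborel. indicator {0..x + 1} y *\<^sub>R v (-1 + y))"
      by (intro Bochner_Integration.integral_cong) (auto simp: indicator_def)
    finally show ?thesis by (simp add: cv_one set_lebesgue_integral_def)
  qed
  show ?thesis unfolding eq by (rule continuous_on_compose2[OF c]) (auto intro!: continuous_intros)
qed

lemma set_integrable_mult_cont: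
  assumes w: "locally_integrable w" and c: "continuous_on UNIV \<theta>" and z: "\<And>x. x \<notin> {a..b} \<Longrightarrow> \<theta> x = 0" and ab: "-1 < a" "b < 1"
  shows "set_integrable lborel {-1<..<1} (\<lambda>x. w x * \<theta> x)"
proof -
  have wi: "integrable lborel (\<lambda>x. indicator {a..b} x * w x)"
    using loc_int_Icc[OF w ab] by (simp add: set_integrable_def)
  obtain B where B: "\<And>x. x \<in> {a..b} \<Longrightarrow> \<bar>\<theta> x\<bar> \<le> B"
    using continuous_bound[OF continuous_on_subset[OF c subset_UNIV]] by blast
  have "integrable lborel (\<lambda>x. (indicator {a..b} x * w x) * \<theta> x)"
  proof (rule Bochner_Integration.integrable_bound)
    show "integrable lborel (\<lambda>x. (indicator {a..b} x * w x) * B)" using wi by (rule integrable_mult_left)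
    show "AE x in lborel. norm ((indicator {a..b} x * w x) * \<theta> x) \<le> norm ((indicator {a..b} x * w x) * B)"
      using B by (intro AE_I2) (force simp: indicator_def abs_mult intro: mult_left_mono)
    show "(\<lambda>x. (indicator {a..b} x * w x) * \<theta> x) \<in> borel_measurable lborel"
      by (rule borel_measurable_times[OF borel_measurable_integrable[OF wi]])
        (simp add: borel_measurable_continuous_onI[OF c])
  qed
  also have "(\<lambda>x. (indicator {a..b} x * w x) * \<theta> x) = (\<lambda>x. indicator {-1<..<1} x *\<^sub>R (w x * \<theta> x))"
    using ab z by (fastforce simp: indicator_def)
  finally show ?thesis by (simp add: set_integrable_def)
qed

lemma set_integrable_mult_test:
  assumes w: "locally_integrable w" and t: "test_function \<eta>"
  shows "set_integrable lborel {-1<..<1} (\<lambda>x. w x * \<eta> x)" "set_integrable lborel {-1<..<1} (\<lambda>x. w x * deriv \<eta> x)"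
proof -
  obtain a b where ab: "-1 < a" "b < 1" "\<And>x. x \<notin> {a..b} \<Longrightarrow> \<eta> x = 0" "\<And>x. x \<notin> {a..b} \<Longrightarrow> deriv \<eta> x = 0"
    using test_function_facts(4)[OF t] by blast
  show "set_integrable lborel {-1<..<1} (\<lambda>x. w x * \<eta> x)" "set_integrable lborel {-1<..<1} (\<lambda>x. w x * deriv \<eta> x)"
    using set_integrable_mult_cont[OF w test_function_facts(2)[OF t] ab(3,1,2)]
      set_integrable_mult_cont[OF w test_function_facts(3)[OF t] ab(4,1,2)] by auto
qed

text \<open>The primitive of \<open>v\<close> satisfies the same weak equation, so its difference
  from \<open>u\<close> is constant almost everywhere.\<close>

lemma weak_deriv_antideriv:
  assumes d: "has_weak_deriv u v" and v: "set_integrable lborel {-1..1} v"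
  shows "\<exists>c. AE x in lborel. x \<in> {-1<..<1} \<longrightarrow> u x = c + (LINT y:{-1..x}|lborel. v y)"
proof -
  let ?U = "\<lambda>x. LINT y:{-1..x}|lborel. v y"
  have u: "locally_integrable u" using d by (simp add: has_weak_deriv_def)
  have U: "locally_integrable ?U"
    by (intro integrable_loc borel_integrable_atLeastAtMost' antideriv_cont v)
  have "\<exists>c. AE x in lborel. x \<in> {-1<..<1} \<longrightarrow> u x - ?U x = c"
  proof (rule du_bois_reymond_1[OF locally_integrable_diff[OF u U]])
    fix \<eta> assume t: "test_function \<eta>"
    have "(LINT x:{-1<..<1}|lborel. (u x - ?U x) * deriv \<eta> x)
        = (LINT x:{-1<..<1}|lborel. u x * deriv \<eta> x) - (LINT x:{-1<..<1}|lborel. ?U x * deriv \<eta> x)"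
      unfolding left_diff_distrib by (intro set_integral_diff(2) set_integrable_mult_test u U t)
    then show "(LINT x:{-1<..<1}|lborel. (u x - ?U x) * deriv \<eta> x) = 0"
      using integration_by_parts[OF v t] d t by (simp add: has_weak_deriv_def)
  qed
  then show ?thesis by (auto simp: algebra_simps)
qed

lemma weak_deriv_unique:
  assumes "has_weak_deriv u v" "has_weak_deriv u v'"
  shows "AE x in lborel. x \<in> {-1<..<1} \<longrightarrow> v x = v' x"
proof -
  have l: "locally_integrable v" "locally_integrable v'" using assms by (auto simp: has_weak_deriv_def)
  have "AE x in lborel. x \<in> {-1<..<1} \<longrightarrow> v x - v' x = 0"
  proof (rule du_bois_reymond_0[OF locally_integrable_diff[OF l]])
    fix \<eta> assume t: "test_function \<eta>"
    have "(LINT x:{-1<..<1}|lborel. (v x - v' x) * \<eta> x)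
        = (LINT x:{-1<..<1}|lborel. v x * \<eta> x) - (LINT x:{-1<..<1}|lborel. v' x * \<eta> x)"
      unfolding left_diff_distrib by (intro set_integral_diff(2) set_integrable_mult_test l t)
    moreover have "- (LINT x:{-1<..<1}|lborel. v x * \<eta> x) = - (LINT x:{-1<..<1}|lborel. v' x * \<eta> x)"
    proof -
      have *: "(LINT x:{-1<..<1}|lborel. u x * deriv \<eta> x) = - (LINT x:{-1<..<1}|lborel. z x * \<eta> x)"
        if "has_weak_deriv u z" for z
        using that t unfolding has_weak_deriv_def by blast
      show ?thesis using *[OF assms(1)] *[OF assms(2)] by (rule trans[OF sym])
    qed
    ultimately show "(LINT x:{-1<..<1}|lborel. (v x - v' x) * \<eta> x) = 0" by linarith
  qed
  then show ?thesis by eventually_elim simp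
qed

lemma has_weak_deriv_weak_deriv: assumes "has_weak_deriv u v" shows "has_weak_deriv u (weak_deriv u)"
  using someI[of "has_weak_deriv u" v, OF assms] by (simp only: weak_deriv_def)

lemma AE_weak_deriv: "has_weak_deriv u v \<Longrightarrow> AE x in lborel. x \<in> {-1<..<1} \<longrightarrow> weak_deriv u x = v x"
  by (rule weak_deriv_unique[OF has_weak_deriv_weak_deriv]; assumption)

text \<open>Converse of \<open>weak_deriv_antideriv\<close>; the constant drops out because test
  functions vanish at both endpoints.\<close>

lemma has_weak_derivI:
  assumes u: "set_integrable lborel {-1..1} u" and v: "set_integrable lborel {-1..1} v"
    and ae: "AE x in lborel. x \<in> {-1<..<1} \<longrightarrow> u x = c + (LINT y:{-1..x}|lborel. v y)"
  shows "has_weak_deriv u v"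
  unfolding has_weak_deriv_def
proof (intro conjI allI impI)
  define U where "U x = (LINT y:{-1..x}|lborel. v y)" for x
  note ae = ae[folded U_def]
  show lu: "locally_integrable u" and lv: "locally_integrable v" by (rule integrable_loc[OF u], rule integrable_loc[OF v])
  have lU: "locally_integrable U"
    unfolding U_def[abs_def] by (intro integrable_loc borel_integrable_atLeastAtMost' antideriv_cont v)
  fix \<eta> assume t: "test_function \<eta>"
  note tf = test_function_facts[OF t]
  have i: "set_integrable lborel {-1<..<1} (\<lambda>x. c * deriv \<eta> x)" "set_integrable lborel {-1<..<1} (\<lambda>x. U x * deriv \<eta> x)"
    by (intro set_integrable_mult_test locally_integrable_const lU t)+
  have "(LINT x:{-1<..<1}|lborel. u x * deriv \<eta> x) = (LINT x:{-1<..<1}|lborel. c * deriv \<eta> x + U x * deriv \<eta> x)"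
    unfolding set_lebesgue_integral_def
  proof (rule integral_cong_AE)
    show "(\<lambda>x. indicator {-1<..<1} x *\<^sub>R (u x * deriv \<eta> x)) \<in> borel_measurable lborel"
      using set_integrable_mult_test(2)[OF lu t] unfolding set_integrable_def by (rule borel_measurable_integrable)
    show "(\<lambda>x. indicator {-1<..<1} x *\<^sub>R (c * deriv \<eta> x + U x * deriv \<eta> x)) \<in> borel_measurable lborel"
      using set_integral_add(1)[OF i] unfolding set_integrable_def by (rule borel_measurable_integrable)
    show "AE x in lborel. indicator {-1<..<1} x *\<^sub>R (u x * deriv \<eta> x) = indicator {-1<..<1} x *\<^sub>R (c * deriv \<eta> x + U x * deriv \<eta> x)"
      using ae by eventually_elim (auto simp: indicator_def algebra_simps)
  qed
  also have "\<dots> = (LINT x:{-1<..<1}|lborel. c * deriv \<eta> x) + (LINT x:{-1<..<1}|lborel. U x * deriv \<eta> x)"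
    by (rule set_integral_add(2)[OF i])
  also have "(LINT x:{-1<..<1}|lborel. c * deriv \<eta> x) = 0"
  proof -
    have e: "\<eta> 1 = 0" "\<eta> (-1) = 0" "deriv \<eta> 1 = 0" "deriv \<eta> (-1) = 0" using tf(4) by force+
    have "(LINT x|lborel. deriv \<eta> x * indicator {-1..1} x) = \<eta> 1 - \<eta> (-1)"
      using tf(1) tf(3)[of UNIV] by (intro integral_FTC_Icc_real) (auto simp: continuous_on_eq_continuous_at)
    moreover have "(LINT x|lborel. deriv \<eta> x * indicator {-1..1} x) = (LINT x|lborel. indicator {-1<..<1} x * deriv \<eta> x)"
      using e by (intro Bochner_Integration.integral_cong refl) (auto simp: indicator_def order_less_le)
    ultimately show ?thesis using e by (simp add: set_lebesgue_integral_def mult.left_commute)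
  qed
  finally show "(LINT x:{-1<..<1}|lborel. u x * deriv \<eta> x) = - (LINT x:{-1<..<1}|lborel. v x * \<eta> x)"
    using integration_by_parts[OF v t] by (simp add: U_def)
qed

section \<open>Resolvent equations on the interval\<close>

abbreviation one :: "real \<Rightarrow> real" where "one \<equiv> \<lambda>_. 1"

text \<open>One continuous factor makes both sides continuous, which upgrades the identity from
  almost everywhere to everywhere.\<close>

lemma cv_assoc_cont:
  assumes fgh: "L f" "L g" "L h" and c: "continuous_on {0..2} f \<or> continuous_on {0..2} g \<or> continuous_on {0..2} h"
    and x: "x \<in> {0..2}"
  shows "cv f (cv g h) x = cv (cv f g) h x"
proof (rule AE_eq_continuous[OF cv_assoc[OF fgh] _ _ x])
  show "continuous_on {0..2} (cv f (cv g h))"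
    using c
  proof (elim disjE)
    assume "continuous_on {0..2} f" then show ?thesis by (intro continuous_cv L_cv fgh)
  next
    assume "continuous_on {0..2} g" then show ?thesis by (intro continuous_cv' continuous_cv fgh)
  next
    assume "continuous_on {0..2} h" then show ?thesis by (intro continuous_cv' fgh)
  qed
  show "continuous_on {0..2} (cv (cv f g) h)"
    using c
  proof (elim disjE)
    assume "continuous_on {0..2} f" then show ?thesis by (intro continuous_cv fgh)
  next
    assume "continuous_on {0..2} g" then show ?thesis by (intro continuous_cv continuous_cv' fgh)
  next
    assume "continuous_on {0..2} h" then show ?thesis by (intro continuous_cv' L_cv fgh)
  qed
qed

lemma cv_one_assoc: "L f \<Longrightarrow> L g \<Longrightarrow> x \<in> {0..2} \<Longrightarrow> cv one (cv f g) x = cv (cv one f) g x"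
  by (intro cv_assoc_cont L_const) auto

lemma cv_one_assoc': "L f \<Longrightarrow> L g \<Longrightarrow> x \<in> {0..2} \<Longrightarrow> cv one (cv f g) x = cv f (cv one g) x"
  using cv_one_assoc[of g f x] cv_comm by (metis ext)

lemma ci_one: "L f \<Longrightarrow> x \<le> 2 \<Longrightarrow> ci one f x" by (rule ci_continuous) auto

lemma ci_cont: "continuous_on {0..2} f \<Longrightarrow> L g \<Longrightarrow> x \<in> {0..2} \<Longrightarrow> ci f g x"
  by (rule ci_continuous) auto

lemma ci_cont': "continuous_on {0..2} g \<Longrightarrow> L f \<Longrightarrow> x \<in> {0..2} \<Longrightarrow> ci f g x"
  using ci_cont[of g f x] by (simp add: ci_comm)

lemma cv_add_left: "ci f h x \<Longrightarrow> ci g h x \<Longrightarrow> cv (\<lambda>y. f y + g y) h x = cv f h x + cv g h x"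
  using cv_add_right[of h f x g] by (simp add: cv_comm[of _ h] ci_comm[of h])

lemma cv_scale_left: "cv (\<lambda>y. c * f y) g x = c * cv f g x"
  using cv_scale_right[of g c f x] by (simp add: cv_comm[of _ g])

context scale_fn begin

lemma W_def': "W = cv one k" by (simp add: W_def)
lemma Z_def': "Z x = 1 + l * cv one W x" by (simp add: Z_def)

lemma F_L: "L F" by (rule F_int)
lemma W_cont: "continuous_on {0..2} W" unfolding W_def by (intro continuous_cv k_L) auto
lemma W_L: "L W" by (rule L_continuous[OF W_cont])
lemma Z_cont: "continuous_on {0..2} Z" unfolding Z_def by (intro continuous_intros continuous_cv W_L)
lemma Z_L: "L Z" by (rule L_continuous[OF Z_cont])

text \<open>The flux that belongs to the solution \<open>Z\<close>, just as \<open>Z\<close> is the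
  flux that belongs to \<open>W\<close>.\<close>

definition V :: "real \<Rightarrow> real" where "V x = l * cv one Z x"

lemma V_cont: "continuous_on {0..2} V" unfolding V_def[abs_def] by (intro continuous_intros continuous_cv Z_L)
lemma W_0: "W 0 = 0" and Z_0: "Z 0 = 1" by (simp_all add: W_def Z_def cv_at_0)

lemma W_nonneg: "0 \<le> W x"
  unfolding W_def by (rule cv_nonneg) (simp add: k_nonneg)
lemma Z_ge_1: "1 \<le> Z x"
proof -
  have "0 \<le> cv one W x" by (rule cv_nonneg) (simp add: W_nonneg)
  then show ?thesis using l_pos by (simp add: Z_def)
qed
lemma V_pos: "V 2 > 0"
proof -
  have "cv one one 2 \<le> cv one Z 2"
    by (rule cv_mono) (auto simp: Z_ge_1 intro!: ci_one L_const Z_L)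
  moreover have "cv one one 2 = 2" by (simp add: cv_def set_lebesgue_integral_def)
  ultimately show ?thesis using l_pos by (simp add: V_def)
qed

text \<open>Integration turns \<open>F * k\<close> into \<open>F * W\<close>, which
  \<open>conv_W\<close> evaluates; the integration is then cancelled, at the price of a null
  set.\<close>

lemma F_k: "AE x in lborel. x \<in> {0..2} \<longrightarrow> cv F k x = Z x"
proof (rule L_cv_one_cong)
  fix x :: real assume x: "x \<in> {0..2}"
  have "cv one (cv F k) x = cv F (cv one k) x" by (intro cv_one_assoc' F_L k_L x)
  then show "cv one (cv F k) x = cv one Z x" using conv_W[OF x] by (simp add: W_def)
qed (auto intro: L_cv F_L k_L Z_L)

lemma cv_W_eq: "L p \<Longrightarrow> x \<in> {0..2} \<Longrightarrow> cv W p x = cv one (cv k p) x"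
  unfolding W_def by (intro cv_one_assoc[symmetric] k_L)

lemma cv_Z_eq: assumes p: "L p" and x: "x \<in> {0..2}" shows "cv Z p x = cv one p x + l * cv one (cv W p) x"
proof -
  have "cv Z p x = cv one p x + cv (\<lambda>x. l * cv one W x) p x"
    unfolding Z_def using x p by (intro cv_add_left ci_cont continuous_intros continuous_cv W_L) auto
  also have "cv (\<lambda>x. l * cv one W x) p x = l * cv (cv one W) p x" by (rule cv_scale_left)
  finally show ?thesis using cv_one_assoc[OF W_L p x] by simp
qed

lemma cv_F_W: assumes p: "L p" and x: "x \<in> {0..2}" shows "cv F (cv W p) x = cv one (cv Z p) x"
proof -
  have "cv F (cv W p) x = cv (cv F W) p x" by (intro cv_assoc_cont F_L W_L p x) (auto simp: W_cont)
  also have "\<dots> = cv (cv one Z) p x" using x by (intro cv_cong_all conv_W) auto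
  finally show ?thesis using cv_one_assoc[OF Z_L p x] by simp
qed

lemma cv_F_k: assumes p: "L p" shows "AE x in lborel. x \<in> {0..2} \<longrightarrow> cv F (cv k p) x = cv Z p x"
  using cv_assoc[OF F_L k_L p]
proof eventually_elim
  case (elim x)
  then show ?case using cv_cong_left[OF F_k _ L_cv[OF F_L k_L] Z_L p, of x] by auto
qed

text \<open>With \<open>f\<close> and \<open>q\<close> as below: \<open>f' = q\<close>, \<open>f 0 = f0\<close>, the flux \<open>\<Phi> \<star> f'\<close> equals \<open>c\<close> at 0,
  and \<open>l f - (\<Phi> \<star> f')' = p\<close>.\<close>

lemma solution:
  fixes f0 c :: real
  assumes p: "L p"
  defines "f \<equiv> \<lambda>x. f0 * Z x + c * W x - cv W p x"
    and "q \<equiv> \<lambda>x. f0 * (l * W x) + c * k x - cv k p x"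
    and "J \<equiv> \<lambda>x. f0 * V x + c * Z x - cv Z p x"
  shows "continuous_on {0..2} f" "continuous_on {0..2} J" "L q"
    "\<And>x. x \<in> {0..2} \<Longrightarrow> f x = f0 + cv one q x"
    "AE x in lborel. x \<in> {0..2} \<longrightarrow> cv F q x = J x"
    "\<And>x. x \<in> {0..2} \<Longrightarrow> J x = c + cv one (\<lambda>x. l * f x - p x) x"
proof -
  show fc: "continuous_on {0..2} f" unfolding f_def
    by (intro continuous_intros continuous_cv W_cont Z_cont p)
  show Jc: "continuous_on {0..2} J" unfolding J_def
    by (intro continuous_intros continuous_cv Z_cont V_cont p)
  have Lkp: "L (cv k p)" by (intro L_cv k_L p)
  have lW: "L (\<lambda>x. f0 * (l * W x))" "L (\<lambda>x. c * k x)" using W_L k_L by simp_all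
  show qL: "L q" unfolding q_def by (intro L_diff L_add lW Lkp)
  have lin: "cv g q x = f0 * (l * cv g W x) + c * cv g k x - cv g (cv k p) x"
    if "ci g W x" "ci g k x" "ci g (cv k p) x" for g x
    unfolding q_def using that
    by (simp add: cv_diff_right cv_add_right cv_scale_right ci_scale_right ci_add_right)
  show "f x = f0 + cv one q x" if x: "x \<in> {0..2}" for x
  proof -
    have "cv one q x = f0 * (l * cv one W x) + c * cv one k x - cv one (cv k p) x"
      using x by (intro lin ci_one W_L k_L Lkp) auto
    then show ?thesis using cv_W_eq[OF p x] by (simp add: f_def Z_def' W_def' algebra_simps)
  qed
  show "AE x in lborel. x \<in> {0..2} \<longrightarrow> cv F q x = J x"
    using AE_ci[OF F_L k_L] AE_ci[OF F_L Lkp] AE_ci[OF F_L W_L] F_k cv_F_k[OF p]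
  proof eventually_elim
    case (elim x)
    then show ?case using lin[of F x] conv_W[of x] by (auto simp: J_def V_def)
  qed
  show "J x = c + cv one (\<lambda>x. l * f x - p x) x" if x: "x \<in> {0..2}" for x
  proof -
    have x2: "x \<le> 2" using x by simp
    have Lwp: "L (cv W p)" by (intro L_cv W_L p)
    have c1: "ci one Z x" "ci one W x" "ci one (cv W p) x" "ci one f x" "ci one p x"
      by (intro ci_one Z_L W_L Lwp p x2 L_continuous[OF fc])+
    have "cv one (\<lambda>x. l * f x - p x) x = l * cv one f x - cv one p x"
      using c1 by (simp add: cv_diff_right cv_scale_right ci_scale_right)
    also have "cv one f x = f0 * cv one Z x + c * cv one W x - cv one (cv W p) x"
      unfolding f_def using c1 by (simp add: cv_diff_right cv_add_right cv_scale_right ci_scale_right ci_add_right)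
    finally show ?thesis using cv_Z_eq[OF p x] by (simp add: J_def V_def Z_def' algebra_simps)
  qed
qed

text \<open>The variant in which \<open>f\<close> itself is convolved. Here \<open>k\<close> is the
  homogeneous solution: its convolution with \<open>F\<close> starts at the constant 1, while
  \<open>d\<close>, the derivative of \<open>F * f\<close>, vanishes at 0, as condition N*
  requires.\<close>

lemma solution_star:
  fixes c :: real
  assumes p: "L p"
  defines "f \<equiv> \<lambda>x. c * k x - cv W p x" and "d \<equiv> \<lambda>x. c * (l * W x) - cv Z p x"
  shows "L f" "continuous_on {0..2} d"
    "AE x in lborel. x \<in> {0..2} \<longrightarrow> cv F f x = c + cv one d x"
    "\<And>x. x \<in> {0..2} \<Longrightarrow> d x = cv one (\<lambda>x. l * f x - p x) x"
proof -
  have Lwp: "L (cv W p)" by (intro L_cv W_L p)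
  have Lzp: "L (cv Z p)" by (intro L_cv Z_L p)
  show fL: "L f" unfolding f_def using k_L by (intro L_diff Lwp) simp
  show dc: "continuous_on {0..2} d" unfolding d_def
    by (intro continuous_intros continuous_cv Z_cont W_cont p)
  have d1: "cv one d x = c * (l * cv one W x) - cv one (cv Z p) x" if x: "x \<in> {0..2}" for x
    unfolding d_def using x W_L Lzp by (simp add: cv_diff_right cv_scale_right ci_scale_right ci_one)
  show "AE x in lborel. x \<in> {0..2} \<longrightarrow> cv F f x = c + cv one d x"
    using AE_ci[OF F_L k_L] AE_ci[OF F_L Lwp] F_k
  proof eventually_elim
    case (elim x)
    show ?case
    proof
      assume x: "x \<in> {0..2}"
      then have "cv F f x = c * cv F k x - cv F (cv W p) x"
        unfolding f_def using elim by (simp add: cv_diff_right cv_scale_right ci_scale_right)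
      then show "cv F f x = c + cv one d x"
        using elim x by (simp add: cv_F_W[OF p x] d1[OF x] Z_def' algebra_simps)
    qed
  qed
  show "d x = cv one (\<lambda>x. l * f x - p x) x" if x: "x \<in> {0..2}" for x
  proof -
    have x2: "x \<le> 2" using x by simp
    have c1: "ci one k x" "ci one (cv W p) x" "ci one f x" "ci one p x"
      by (intro ci_one k_L Lwp p x2 fL)+
    have "cv one (\<lambda>x. l * f x - p x) x = l * cv one f x - cv one p x"
      using c1 by (simp add: cv_diff_right cv_scale_right ci_scale_right)
    also have "cv one f x = c * cv one k x - cv one (cv W p) x"
      unfolding f_def using c1 by (simp add: cv_diff_right cv_scale_right ci_scale_right)
    finally show ?thesis using cv_Z_eq[OF p x] by (simp add: d_def W_def' algebra_simps)
  qed
qed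

lemma cont_cong_one:
  assumes "continuous_on {0..2} u" "continuous_on {0..2} v" "\<And>x. x \<in> {0..2} \<Longrightarrow> cv one u x = cv one v x" "x \<in> {0..2}"
  shows "u x = v x"
  by (rule AE_eq_continuous[OF L_cv_one_cong[OF L_continuous L_continuous]]) (use assms in auto)

text \<open>Convolving the flux equation with \<open>W\<close> brings in
  \<open>W * F = 1 * Z\<close>. Cancelling one integration leaves
  \<open>1 * q + l W * (1 * q) = c W + W * g\<close>, which is the claim rearranged.\<close>

lemma uniqueness:
  fixes f0 c :: real
  assumes q: "L q" and g: "L g" and J: "AE x in lborel. x \<in> {0..2} \<longrightarrow> cv F q x = c + cv one g x"
  defines "f \<equiv> \<lambda>x. f0 + cv one q x"
  assumes x: "x \<in> {0..2}"
  shows "f x = f0 * Z x + c * W x - cv W (\<lambda>x. l * f x - g x) x"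
proof -
  have fc: "continuous_on {0..2} f" unfolding f_def by (intro continuous_intros continuous_cv q)
  have fL: "L f" by (rule L_continuous[OF fc])
  have Lwf: "L (cv W f)" "L (cv W g)" "L (cv W one)" by (intro L_cv W_L fL g L_const)+
  have Lq1: "L (cv one q)" by (intro L_cv q L_const)
  have eq: "cv one q y + l * cv W (cv one q) y = c * W y + cv W g y" if y: "y \<in> {0..2}" for y
  proof (rule cont_cong_one[OF _ _ _ y])
    show "continuous_on {0..2} (\<lambda>y. cv one q y + l * cv W (cv one q) y)"
      by (intro continuous_intros continuous_cv q W_cont Lq1)
    show "continuous_on {0..2} (\<lambda>y. c * W y + cv W g y)"
      by (intro continuous_intros continuous_cv W_cont g)
    fix z :: real assume z: "z \<in> {0..2}"
    have z2: "z \<le> 2" using z by simp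
    have "cv W (cv F q) z = cv (cv W F) q z" by (intro cv_assoc_cont F_L W_L q z) (simp add: W_cont)
    also have "\<dots> = cv (cv one Z) q z" by (rule cv_cong_all) (use z conv_W in \<open>auto simp: cv_comm[of W F]\<close>)
    also have "\<dots> = cv (cv Z one) q z" by (rule cv_cong_all[OF cv_comm refl])
    also have "\<dots> = cv Z (cv one q) z" by (intro cv_assoc_cont[symmetric] Z_L L_const q z) auto
    also have "\<dots> = cv one (cv one q) z + l * cv one (cv W (cv one q)) z" by (rule cv_Z_eq[OF Lq1 z])
    also have "\<dots> = cv one (\<lambda>y. cv one q y + l * cv W (cv one q) y) z"
      using z2 Lq1 L_cv[OF W_L Lq1] by (simp add: cv_add_right cv_scale_right ci_scale_right ci_one)
    finally have 1: "cv W (cv F q) z = cv one (\<lambda>y. cv one q y + l * cv W (cv one q) y) z" .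
    have "cv W (cv F q) z = cv W (\<lambda>y. c * 1 + cv one g y) z"
      using J z2 by (intro cv_cong_right W_L L_cv F_L q L_add L_const g) auto
    also have "\<dots> = c * cv W one z + cv W (cv one g) z"
      using z g cv_scale_right[of W c one z] by (subst cv_add_right) (auto intro!: ci_cont W_cont L_const L_cv)
    also have "\<dots> = c * cv one W z + cv one (cv W g) z"
      using cv_one_assoc'[OF W_L g z] by (simp add: cv_comm[of W one])
    also have "\<dots> = cv one (\<lambda>y. c * W y + cv W g y) z"
      using z2 W_L Lwf by (simp add: cv_add_right cv_scale_right ci_scale_right ci_one)
    finally show "cv one (\<lambda>y. cv one q y + l * cv W (cv one q) y) z = cv one (\<lambda>y. c * W y + cv W g y) z"
      using 1 by simp
  qed
  have "cv W f x = f0 * cv W one x + cv W (cv one q) x"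
    unfolding f_def using x cv_add_right[of W "\<lambda>_. f0 * 1" x "cv one q"] cv_scale_right[of W f0 one x]
    by (simp add: ci_cont[OF W_cont] L_const Lq1)
  moreover have "cv W (\<lambda>x. l * f x - g x) x = l * cv W f x - cv W g x"
    using x fL g by (simp add: cv_diff_right cv_scale_right ci_scale_right ci_cont[OF W_cont])
  moreover have "cv W one x = cv one W x" by (rule cv_comm)
  ultimately show ?thesis using eq[OF x] by (simp add: f_def Z_def' algebra_simps)
qed

text \<open>Two integrations have to be cancelled here, since \<open>f\<close> and not its primitive
  is determined; the second cancellation is valid almost everywhere. The term with \<open>c\<close>
  survives until the condition at the left endpoint removes it.\<close>

lemma uniqueness_star:
  fixes c :: real
  assumes f: "L f" and g: "L g" and J: "AE x in lborel. x \<in> {0..2} \<longrightarrow> cv F f x = c0 + cv one (\<lambda>y. c + cv one g y) x"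
  shows "AE x in lborel. x \<in> {0..2} \<longrightarrow> f x = c0 * k x + c * W x - cv W (\<lambda>x. l * f x - g x) x"
proof -
  define d where "d = (\<lambda>y. c + cv one g y)"
  note J = J[folded d_def]
  have dc: "continuous_on {0..2} d" unfolding d_def by (intro continuous_intros continuous_cv g)
  have dL: "L d" by (rule L_continuous[OF dc])
  have Lwf: "L (cv W f)" "L (cv W g)" "L (cv W d)" by (intro L_cv W_L f g dL)+
  have eq: "cv Z f y = c0 * W y + cv W d y" if y: "y \<in> {0..2}" for y
  proof (rule cont_cong_one[OF _ _ _ y])
    show "continuous_on {0..2} (cv Z f)" by (intro continuous_cv Z_cont f)
    show "continuous_on {0..2} (\<lambda>y. c0 * W y + cv W d y)" by (intro continuous_intros continuous_cv W_cont dL)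
    fix z :: real assume z: "z \<in> {0..2}"
    have z2: "z \<le> 2" using z by simp
    have "cv W (cv F f) z = cv (cv W F) f z" by (intro cv_assoc_cont F_L W_L f z) (simp add: W_cont)
    also have "\<dots> = cv (cv one Z) f z" by (rule cv_cong_all) (use z conv_W in \<open>auto simp: cv_comm[of W F]\<close>)
    also have "\<dots> = cv one (cv Z f) z" by (intro cv_one_assoc[symmetric] Z_L f z)
    finally have 1: "cv W (cv F f) z = cv one (cv Z f) z" .
    have "cv W (cv F f) z = cv W (\<lambda>y. c0 * 1 + cv one d y) z"
      using J z2 by (intro cv_cong_right W_L L_cv F_L f L_add L_const dL) auto
    also have "\<dots> = c0 * cv W one z + cv W (cv one d) z"
      using z dL cv_scale_right[of W c0 one z] by (subst cv_add_right) (auto intro!: ci_cont W_cont L_const L_cv)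
    also have "\<dots> = c0 * cv one W z + cv one (cv W d) z"
      using cv_one_assoc'[OF W_L dL z] by (simp add: cv_comm[of W one])
    also have "\<dots> = cv one (\<lambda>y. c0 * W y + cv W d y) z"
      using z2 W_L Lwf by (simp add: cv_add_right cv_scale_right ci_scale_right ci_one)
    finally show "cv one (cv Z f) z = cv one (\<lambda>y. c0 * W y + cv W d y) z" using 1 by simp
  qed
  have L1: "L (\<lambda>y. c0 * k y + c * W y + cv W g y)" using k_L W_L Lwf by (intro L_add) auto
  have L2: "L (\<lambda>y. f y + l * cv W f y)" using f Lwf by (intro L_add) auto
  have "AE x in lborel. x \<in> {0..2} \<longrightarrow> f x + l * cv W f x = c0 * k x + c * W x + cv W g x"
  proof (rule L_cv_one_cong[OF L2 L1])
    fix z :: real assume z: "z \<in> {0..2}"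
    have z2: "z \<le> 2" using z by simp
    have "cv one (\<lambda>y. f y + l * cv W f y) z = cv Z f z"
      using z2 f Lwf cv_Z_eq[OF f z] by (simp add: cv_add_right cv_scale_right ci_scale_right ci_one)
    also have "\<dots> = c0 * W z + cv W d z" by (rule eq[OF z])
    also have "cv W d z = c * cv W one z + cv W (cv one g) z"
      unfolding d_def using z g cv_add_right[of W "\<lambda>_. c * 1" z "cv one g"] cv_scale_right[of W c one z]
      by (simp add: ci_cont[OF W_cont] L_const L_cv)
    also have "\<dots> = c * cv one W z + cv one (cv W g) z"
      using cv_one_assoc'[OF W_L g z] by (simp add: cv_comm[of W one])
    also have "c0 * W z + (c * cv one W z + cv one (cv W g) z) = cv one (\<lambda>y. c0 * k y + c * W y + cv W g y) z"
      using z2 k_L W_L Lwf by (simp add: cv_add_right cv_scale_right ci_scale_right ci_add_right ci_one W_def')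
    finally show "cv one (\<lambda>y. f y + l * cv W f y) z = cv one (\<lambda>y. c0 * k y + c * W y + cv W g y) z" .
  qed
  then show ?thesis
  proof eventually_elim
    case (elim x)
    have "cv W (\<lambda>x. l * f x - g x) x = l * cv W f x - cv W g x" if "x \<in> {0..2}"
      using that f g by (simp add: cv_diff_right cv_scale_right ci_scale_right ci_cont[OF W_cont])
    then show ?case using elim by auto
  qed
qed

text \<open>The homogeneous solution that meets the boundary condition when its endpoint is the
  start of the causal problem: \<open>W\<close> has value 0 there, \<open>Z\<close> has flux 0, and
  for \<open>k\<close> the derivative of the convolution with \<open>F\<close> is 0.\<close>

fun HL :: "left_bc \<Rightarrow> real \<Rightarrow> real" where
  "HL Left_D = W" | "HL Left_N = Z" | "HL Left_Nstar = k"

fun HR :: "right_bc \<Rightarrow> real \<Rightarrow> real" where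
  "HR Right_D = W" | "HR Right_N = Z"

text \<open>The value, flux or derivative at 2, according to \<open>a\<close>, of the homogeneous
  solution \<open>HR b\<close>. Reading the table the other way, with \<open>HL a\<close> started
  and the condition \<open>b\<close> imposed at 2, gives the same entries; this symmetry lets it
  serve both directions.\<close>

fun \<beta> :: "left_bc \<Rightarrow> right_bc \<Rightarrow> real" where
  "\<beta> Left_D Right_D = W 2" | "\<beta> Left_D Right_N = Z 2"
| "\<beta> Left_N Right_D = Z 2" | "\<beta> Left_N Right_N = V 2"
| "\<beta> Left_Nstar Right_D = k 2" | "\<beta> Left_Nstar Right_N = l * W 2"

lemma k2_pos: "k 2 > 0"
proof -
  have "0 < l * (W 2)\<^sup>2" using l_pos W_pos[of 2] by simp
  then have "0 < Z 2 * k 2" using sq_le by linarith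
  then show ?thesis using Z_ge_1[of 2] by (simp add: zero_less_mult_iff)
qed

lemma \<beta>_pos: "\<beta> a b > 0"
  using W_pos[of 2] Z_ge_1[of 2] V_pos k2_pos l_pos by (cases a; cases b) auto

lemma HR_cont: "continuous_on {0..2} (HR b)" by (cases b) (auto simp: W_cont Z_cont)
lemma HL_L: "L (HL a)" by (cases a) (auto simp: W_L Z_L k_L)
lemma HR_L: "L (HR a)" by (cases a) (auto simp: W_L Z_L k_L)
lemma HL_nonneg: "0 \<le> HL a x" using W_nonneg[of x] Z_ge_1[of x] k_nonneg[of x] by (cases a) auto
lemma HR_nonneg: "0 \<le> HR a x" using W_nonneg[of x] Z_ge_1[of x] by (cases a) auto

text \<open>\<open>k 2\<close> is eliminated between \<open>sq_le\<close> and \<open>V_le\<close>;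
  the auxiliary factor \<open>l * W 2\<close> cancels at the end.\<close>

lemma VW_le: "V 2 * W 2 \<le> Z 2 * Z 2"
proof -
  have W2: "W 2 > 0" using W_pos[of 2] by simp
  have Z2: "Z 2 > 0" using Z_ge_1[of 2] by simp
  have V: "V 2 * k 2 \<le> l * Z 2 * W 2"
    using mult_left_mono[OF V_le less_imp_le[OF l_pos]] by (simp add: V_def mult_ac)
  have "V 2 * (W 2 * (l * W 2)) = V 2 * (l * (W 2)\<^sup>2)" by (simp add: power2_eq_square mult_ac)
  also have "\<dots> \<le> V 2 * (Z 2 * k 2)" using V_pos sq_le by (intro mult_left_mono) auto
  also have "\<dots> = Z 2 * (V 2 * k 2)" by simp
  also have "\<dots> \<le> Z 2 * (l * Z 2 * W 2)" using V Z2 by (intro mult_left_mono) auto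
  finally have "(V 2 * W 2) * (l * W 2) \<le> (Z 2 * Z 2) * (l * W 2)" by (simp add: mult_ac)
  then show ?thesis using l_pos W2 by simp
qed

lemma H2_pos: "HL a 2 > 0" using W_pos[of 2] Z_ge_1[of 2] k2_pos by (cases a) auto

lemma W_HL: assumes "0 \<le> y" "y \<le> t" "t \<le> 2" "a = Left_Nstar \<longrightarrow> 0 < t \<and> t < 2"
  shows "W (t - y) * HL a 2 \<le> W (2 - y) * HL a t"
  using W_W[OF assms(1-3)] W_Z[OF assms(1-3)] W_k[OF assms(1,2)] assms(4) by (cases a) auto

text \<open>The sign of the Green kernel for \<open>y <= t\<close>; for \<open>y > t\<close> only
  its nonnegative product term remains. The Neumann condition on the right is reduced to the
  Dirichlet one: passing from \<open>W\<close> to \<open>Z\<close>, the factor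
  \<open>HR b (2 - y)\<close> grows at least by \<open>Z 2 / W 2\<close>, whereas
  \<open>\<beta>\<close> grows at most by that much.\<close>

lemma green_nonneg:
  assumes o: "0 \<le> y" "y \<le> t" "t \<le> 2" "a = Left_Nstar \<longrightarrow> 0 < t \<and> t < 2"
  shows "W (t - y) * \<beta> a b \<le> HR b (2 - y) * HL a t"
proof (cases b)
  case Right_D
  then show ?thesis using W_HL[OF o] by (cases a) auto
next
  case Right_N
  have W2: "W 2 > 0" using W_pos[of 2] by simp
  have 1: "\<beta> a b * W 2 \<le> HL a 2 * Z 2"
    using VW_le sq_le Right_N by (cases a) (auto simp: power2_eq_square mult_ac)
  have 2: "Z 2 * W (2 - y) \<le> W 2 * Z (2 - y)"
    using W_Z[of 0 "2 - y"] o by (simp add: mult.commute)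
  have "W (t - y) * \<beta> a b * (HL a 2 * W 2) = (W (t - y) * HL a 2) * (\<beta> a b * W 2)" by simp
  also have "\<dots> \<le> (W (2 - y) * HL a t) * (HL a 2 * Z 2)"
    by (rule mult_mono[OF W_HL[OF o] 1]) (use \<beta>_pos[of a b] W2 W_nonneg HL_nonneg[of a t] in auto)
  also have "\<dots> = (HL a t * HL a 2) * (Z 2 * W (2 - y))" by simp
  also have "\<dots> \<le> (HL a t * HL a 2) * (W 2 * Z (2 - y))"
    using 2 HL_nonneg by (intro mult_left_mono) auto
  also have "\<dots> = (HR b (2 - y) * HL a t) * (HL a 2 * W 2)" using Right_N by simp
  finally show ?thesis using H2_pos[of a] W2 by simp
qed

text \<open>Divided by \<open>\<beta> a b\<close>, this bounds \<open>l\<close> times the mass of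
  the Green kernel by \<open>Z t - (Z t - 1) = 1\<close>. With N on the right and N or N* on the
  left there is equality: no mass is lost.\<close>

lemma green_mass:
  assumes t: "0 \<le> t" "t \<le> 2" shows "l * cv one (HL a) 2 * HR b t \<le> \<beta> a b * Z t"
proof -
  have W2: "W 2 > 0" using W_pos[of 2] by simp
  have Zp: "Z 2 > 0" "Z t > 0" using Z_ge_1[of 2] Z_ge_1[of t] by auto
  have m: "l * cv one (HL a) 2 = (case a of Left_D \<Rightarrow> Z 2 - 1 | Left_N \<Rightarrow> V 2 | Left_Nstar \<Rightarrow> l * W 2)"
    by (cases a) (auto simp: Z_def' V_def W_def')
  show ?thesis
  proof (cases b)
    case Right_N
    then have "l * cv one (HL a) 2 \<le> \<beta> a b" unfolding m by (cases a) auto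
    then show ?thesis using Zp Right_N by (simp add: mult_right_mono)
  next
    case Right_D
    have 1: "W t * Z 2 \<le> W 2 * Z t" using W_Z[of 0 t] t by simp
    have 2: "l * cv one (HL a) 2 * W 2 \<le> \<beta> a b * Z 2"
      unfolding m using Right_D VW_le sq_le W2 Zp by (cases a) (auto simp: power2_eq_square algebra_simps)
    have m0: "0 \<le> l * cv one (HL a) 2"
      using l_pos by (intro mult_nonneg_nonneg cv_nonneg) (auto simp: HL_nonneg)
    have "(l * cv one (HL a) 2 * HR b t) * Z 2 = l * cv one (HL a) 2 * (W t * Z 2)" using Right_D by simp
    also have "\<dots> \<le> l * cv one (HL a) 2 * (W 2 * Z t)" using 1 m0 by (intro mult_left_mono)
    also have "\<dots> = (l * cv one (HL a) 2 * W 2) * Z t" by simp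
    also have "\<dots> \<le> (\<beta> a b * Z 2) * Z t" using 2 Zp by (intro mult_right_mono) auto
    finally have "(l * cv one (HL a) 2 * HR b t) * Z 2 \<le> (\<beta> a b * Z t) * Z 2" by (simp add: mult_ac)
    then show ?thesis using Zp by simp
  qed
qed

text \<open>\<open>H\<close> meets the condition at 0, and the coefficient
  \<open>cv B p 2 / b\<close> enforces the condition at 2.\<close>

definition sol :: "(real \<Rightarrow> real) \<Rightarrow> (real \<Rightarrow> real) \<Rightarrow> real \<Rightarrow> (real \<Rightarrow> real) \<Rightarrow> real \<Rightarrow> real" where
  "sol H B b p t = cv B p 2 / b * H t - cv W p t"

lemma sol_add: "ci B p 2 \<Longrightarrow> ci B q 2 \<Longrightarrow> L p \<Longrightarrow> L q \<Longrightarrow> t \<in> {0..2} \<Longrightarrow>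
    sol H B b (\<lambda>x. p x + q x) t = sol H B b p t + sol H B b q t"
  by (simp add: sol_def cv_add_right ci_cont[OF W_cont] add_divide_distrib algebra_simps)

lemma sol_scale: "sol H B b (\<lambda>x. c * p x) t = c * sol H B b p t"
  by (simp add: sol_def cv_scale_right algebra_simps)

text \<open>The kernel inequality is asked for only on the open range \<open>0 < y < t\<close>,
  which keeps the argument of \<open>k\<close> strictly between 0 and 2.\<close>

lemma sol_nonneg:
  assumes t: "t \<in> {0..2}" and H: "H t \<ge> 0" and b: "b > 0" and B: "\<And>y. B y \<ge> 0"
    and K: "\<And>y. 0 < y \<Longrightarrow> y < t \<Longrightarrow> W (t - y) * b \<le> B (2 - y) * H t"
    and p: "AE y in lborel. y \<in> {0..2} \<longrightarrow> p y \<ge> 0" "L p" "ci B p 2"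
  shows "sol H B b p t \<ge> 0"
proof -
  have "cv W p t \<le> (LINT y:{0..2}|lborel. (H t / b) * (B (2 - y) * p y))"
    unfolding cv_def set_lebesgue_integral_def
  proof (rule integral_mono_AE)
    show "integrable lborel (\<lambda>y. indicator {0..t} y *\<^sub>R (W (t - y) * p y))"
      using ci_cont[OF W_cont p(2) t] by (simp add: ci_def set_integrable_def)
    show "integrable lborel (\<lambda>y. indicator {0..2} y *\<^sub>R (H t / b * (B (2 - y) * p y)))"
      using integrable_mult_right[OF p(3)[unfolded ci_def set_integrable_def], of "H t / b"] by (simp add: mult_ac)
    show "AE y in lborel. indicator {0..t} y *\<^sub>R (W (t - y) * p y) \<le> indicator {0..2} y *\<^sub>R (H t / b * (B (2 - y) * p y))"
      using p(1) AE_lborel_singleton[of 0] AE_lborel_singleton[of t]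
    proof eventually_elim
      case (elim y)
      show ?case
      proof (cases "y \<in> {0..t}")
        case True
        then have "W (t - y) * b \<le> B (2 - y) * H t" using elim by (intro K) auto
        then have "W (t - y) \<le> B (2 - y) * H t / b" using b by (simp add: le_divide_eq)
        then have "W (t - y) * p y \<le> B (2 - y) * H t / b * p y" using elim True t by (intro mult_right_mono) auto
        then show ?thesis using True t by (simp add: mult_ac)
      next
        case False
        have "0 \<le> H t / b * (B (2 - y) * p y)" if "y \<in> {0..2}"
          using that elim H B b by (intro mult_nonneg_nonneg divide_nonneg_pos) auto
        then show ?thesis using False by (auto simp: indicator_def)
      qed
    qed
  qed
  also have "\<dots> = H t / b * cv B p 2" by (simp add: cv_def)
  finally show ?thesis by (simp add: sol_def mult.commute)
qed

end

section \<open>Reduction of the operators to causal convolutions\<close>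

lemma AE_affine:
  assumes "AE x in lborel. P (x::real)" "c \<noteq> 0" shows "AE x in lborel. P (t + c * x)"
proof -
  obtain N where N: "N \<in> null_sets lborel" "{x \<in> space lborel. \<not> P x} \<subseteq> N"
    using assms(1) by (auto simp: eventually_ae_filter)
  have [measurable]: "N \<in> sets borel" using N(1) by (auto dest: null_setsD2)
  have "AE x in lborel. x \<notin> N" using N(1) by (rule AE_not_in)
  then have "AE x in lborel. t + c * x \<notin> N"
    by (intro AE_borel_affine assms(2)) measurable
  then show ?thesis by eventually_elim (use N(2) in auto)
qed

lemma AE_ex_interval:
  assumes "AE x in lborel. P (x::real)" "a < b" shows "\<exists>x\<in>{a<..<b}. P x"
proof (rule ccontr)
  assume "\<not> ?thesis"
  then have "AE x in lborel. x \<notin> {a<..<b}" using assms(1) by (auto elim: eventually_mono)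
  then have "{a<..<b} \<in> null_sets lborel" by (subst (asm) AE_iff_null_sets[symmetric]) auto
  then show False using assms(2) by (auto dest: null_setsD1)
qed

text \<open>This is why a boundary limit in the sense of \<open>vanishes_at\<close> does not depend
  on the chosen representative.\<close>

lemma AE_limits_eq:
  fixes m m' :: "real \<Rightarrow> real"
  assumes ae: "AE t in lborel. t \<in> {a<..<b} \<longrightarrow> m t = m' t" and ab: "a < b" "e = a \<or> e = b"
    and l: "(m \<longlongrightarrow> x) (at e within {a<..<b})" "(m' \<longlongrightarrow> y) (at e within {a<..<b})"
  shows "x = y"
proof (rule ccontr)
  assume "x \<noteq> y"
  then have "\<bar>x - y\<bar> > 0" by simp
  have "((\<lambda>t. \<bar>m t - m' t\<bar>) \<longlongrightarrow> \<bar>x - y\<bar>) (at e within {a<..<b})" by (intro tendsto_intros l)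
  then have "eventually (\<lambda>t. \<bar>m t - m' t\<bar> > 0) (at e within {a<..<b})"
    using \<open>\<bar>x - y\<bar> > 0\<close> by (rule order_tendstoD)
  then obtain d where d: "d > 0" "\<And>t. t \<in> {a<..<b} \<Longrightarrow> t \<noteq> e \<Longrightarrow> dist t e < d \<Longrightarrow> \<bar>m t - m' t\<bar> > 0"
    unfolding eventually_at by blast
  define r where "r = min d (b - a)"
  have r: "r > 0" "r \<le> d" "r \<le> b - a" using d ab by (auto simp: r_def)
  obtain t where t: "t \<in> (if e = a then {a<..<a + r} else {b - r<..<b})" "t \<in> {a<..<b} \<longrightarrow> m t = m' t"
  proof (cases "e = a")
    case True
    then show ?thesis using AE_ex_interval[OF ae, of a "a + r"] r that by auto
  next
    case False
    then show ?thesis using AE_ex_interval[OF ae, of "b - r" b] r that by auto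
  qed
  have "t \<in> {a<..<b}" "t \<noteq> e" "dist t e < d"
    using t(1) ab r by (auto simp: dist_real_def split: if_splits)
  with d(2)[of t] t(2) show False by auto
qed

text \<open>Both directions are reduced to the interval \<open>[0,2]\<close> and to the causal convolution \<open>cv\<close>:
  \<open>s = 1\<close> shifts, \<open>s = -1\<close> reflects.\<close>

definition tr :: "real \<Rightarrow> (real \<Rightarrow> real) \<Rightarrow> real \<Rightarrow> real" where
  "tr s u t = u (s * (t - 1))"

definition itr :: "real \<Rightarrow> (real \<Rightarrow> real) \<Rightarrow> real \<Rightarrow> real" where
  "itr s m x = m (s * x + 1)"

locale orientation =
  fixes s :: real assumes s: "s = 1 \<or> s = -1"
begin

lemma ss: "s * s = 1" "s * (s * x) = x" using s by auto
lemma s_ne: "s \<noteq> 0" "\<bar>s\<bar> = 1" using s by auto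
lemma tr_itr [simp]: "tr s (itr s m) = m" by (rule ext) (use s in \<open>auto simp: tr_def itr_def\<close>)
lemma itr_tr [simp]: "itr s (tr s u) = u" by (rule ext) (use s in \<open>auto simp: tr_def itr_def\<close>)
lemma mem_tr: "s * (t - 1) \<in> {-1..1} \<longleftrightarrow> t \<in> {0..2}" "s * (t - 1) \<in> {-1<..<1} \<longleftrightarrow> t \<in> {0<..<2}" using s by auto

lemma AE_tr1:
  assumes "AE x in lborel. x \<in> {-1<..<1} \<longrightarrow> P x" shows "AE t in lborel. t \<in> {0..2} \<longrightarrow> P (s * (t - 1))"
proof -
  have "AE t in lborel. - s + s * t \<in> {-1<..<1} \<longrightarrow> P (- s + s * t)" by (rule AE_affine[OF assms s_ne(1)])
  then show ?thesis
    using AE_lborel_singleton[of 0] AE_lborel_singleton[of 2]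
  proof eventually_elim
    case (elim t)
    then show ?case using mem_tr(2)[of t] by (auto simp: algebra_simps)
  qed
qed

lemma AE_tr2:
  assumes "AE t in lborel. t \<in> {0..2} \<longrightarrow> P (s * (t - 1))" shows "AE x in lborel. x \<in> {-1..1} \<longrightarrow> P x"
proof -
  have "AE t in lborel. 1 + s * t \<in> {0..2} \<longrightarrow> P (s * ((1 + s * t) - 1))" by (rule AE_affine[OF assms s_ne(1)])
  then show ?thesis by eventually_elim (use s in auto)
qed

lemma L_tr: "set_integrable lborel {-1..1} u \<longleftrightarrow> L (tr s u)"
proof -
  have "integrable lborel (\<lambda>x. indicator {-1..1} x * u x)
    \<longleftrightarrow> integrable lborel (\<lambda>x. indicator {-1..1} (- s + s * x) * u (- s + s * x))"
    by (rule lborel_integrable_real_affine_iff[OF s_ne(1), symmetric])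
  also have "(\<lambda>x. indicator {-1..1} (- s + s * x) * u (- s + s * x)) = (\<lambda>t. indicator {0..2} t * tr s u t)"
    by (rule ext) (use s in \<open>auto simp: tr_def indicator_def algebra_simps\<close>)
  finally show ?thesis by (simp add: set_integrable_def)
qed

lemma LINT_tr: "(LINT x:{-1..1}|lborel. u x) = (LINT t:{0..2}|lborel. tr s u t)"
proof -
  have "(LINT x|lborel. indicator {-1..1} x * u x)
    = (LINT x|lborel. indicator {-1..1} (- s + s * x) * u (- s + s * x))"
    using lborel_integral_real_affine[OF s_ne(1), of "\<lambda>x. indicator {-1..1} x * u x" "-s"] s_ne by simp
  also have "(\<lambda>x. indicator {-1..1} (- s + s * x) * u (- s + s * x)) = (\<lambda>t. indicator {0..2} t * tr s u t)"
    by (rule ext) (use s in \<open>auto simp: tr_def indicator_def algebra_simps\<close>)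
  finally show ?thesis by (simp add: set_lebesgue_integral_def)
qed

text \<open>Under reflection the primitive started at -1 becomes an integral from \<open>t\<close>
  to 2, which is the negative of the causal primitive up to a constant.\<close>

lemma antideriv_tr:
  assumes v: "L (tr s v)"
  shows "\<exists>c. \<forall>t\<in>{0..2}. (LINT y:{-1..s * (t - 1)}|lborel. v y) = c + s * cv one (tr s v) t"
proof -
  have i: "(LINT y:{-1..s * (t - 1)}|lborel. v y) = (LINT z|lborel. indicator (if s = 1 then {0..t} else {t..2}) z * tr s v z)"
    if t: "t \<in> {0..2}" for t
  proof -
    have "(LINT x|lborel. indicator {-1..s * (t - 1)} x * v x)
      = (LINT x|lborel. indicator {-1..s * (t - 1)} (- s + s * x) * v (- s + s * x))"
      using lborel_integral_real_affine[OF s_ne(1), of "\<lambda>x. indicator {-1..s * (t - 1)} x * v x" "-s"] s_ne by simp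
    also have "(\<lambda>x. indicator {-1..s * (t - 1)} (- s + s * x) * v (- s + s * x))
        = (\<lambda>z. indicator (if s = 1 then {0..t} else {t..2}) z * tr s v z)"
      by (rule ext) (use s in \<open>auto simp: tr_def indicator_def algebra_simps\<close>)
    finally show ?thesis by (simp add: set_lebesgue_integral_def)
  qed
  show ?thesis
  proof (cases "s = 1")
    case True
    then show ?thesis using i by (intro exI[of _ 0]) (auto simp: cv_one set_lebesgue_integral_def)
  next
    case False
    have "(LINT z:{t..2}|lborel. tr s v z) = cv one (tr s v) 2 - cv one (tr s v) t" if t: "t \<in> {0..2}" for t
    proof -
      have "(LINT z:{0..t} \<union> {t..2}|lborel. tr s v z) = (LINT z:{0..t}|lborel. tr s v z) + (LINT z:{t..2}|lborel. tr s v z)"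
      proof (rule set_integral_Un_AE)
        show "AE x in lborel. \<not> (x \<in> {0..t} \<and> x \<in> {t..2})"
          using AE_lborel_singleton[of t] by eventually_elim auto
      qed (use t in \<open>auto intro: set_integrable_subset[OF v]\<close>)
      moreover have "{0..t} \<union> {t..2} = {0..2}" using t by auto
      ultimately show ?thesis by (simp add: cv_one)
    qed
    then show ?thesis
      using False s i by (intro exI[of _ "cv one (tr s v) 2"]) (auto simp: set_lebesgue_integral_def)
  qed
qed

text \<open>With both functions integrable, a weak derivative is the same as an integrand up to a
  constant; the chain rule contributes the sign \<open>s\<close>.\<close>

lemma has_weak_deriv_tr:
  assumes u: "L (tr s u)" and v: "L (tr s v)"
  shows "has_weak_deriv u v \<longleftrightarrow> (\<exists>c. AE t in lborel. t \<in> {0..2} \<longrightarrow> tr s u t = c + s * cv one (tr s v) t)"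
proof -
  obtain c where c: "\<And>t. t \<in> {0..2} \<Longrightarrow> (LINT y:{-1..s * (t - 1)}|lborel. v y) = c + s * cv one (tr s v) t"
    using antideriv_tr[OF v] by blast
  show ?thesis
  proof
    assume "has_weak_deriv u v"
    then obtain d where "AE x in lborel. x \<in> {-1<..<1} \<longrightarrow> u x = d + (LINT y:{-1..x}|lborel. v y)"
      using weak_deriv_antideriv v by (auto simp: L_tr)
    from AE_tr1[OF this] show "\<exists>c. AE t in lborel. t \<in> {0..2} \<longrightarrow> tr s u t = c + s * cv one (tr s v) t"
      by (intro exI[of _ "d + c"]) (auto simp: c tr_def elim: eventually_mono)
  next
    assume "\<exists>c. AE t in lborel. t \<in> {0..2} \<longrightarrow> tr s u t = c + s * cv one (tr s v) t"
    then obtain d where d: "AE t in lborel. t \<in> {0..2} \<longrightarrow> tr s u t = d + s * cv one (tr s v) t" by blast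
    have "AE t in lborel. t \<in> {0..2} \<longrightarrow> u (s * (t - 1)) = (d - c) + (LINT y:{-1..s * (t - 1)}|lborel. v y)"
      using d by eventually_elim (auto simp: c tr_def)
    from AE_tr2[OF this] show "has_weak_deriv u v"
      using u v by (intro has_weak_derivI[where c = "d - c"]) (auto simp: L_tr elim: eventually_mono)
  qed
qed

text \<open>\<open>m\<close> is the representative that the solution formulas supply. Its limit
  decides the condition, because every representative with a limit has the same one.\<close>

lemma vanishes_at_tr:
  assumes ae: "AE t in lborel. t \<in> {0..2} \<longrightarrow> tr s h t = m t" and e: "e = 0 \<or> e = 2"
    and m: "(m \<longlongrightarrow> y) (at e within {0<..<2})"
  shows "vanishes_at (s * (e - 1)) h \<longleftrightarrow> y = 0"
proof
  assume "vanishes_at (s * (e - 1)) h"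
  then obtain h' where h': "AE x in lborel. x \<in> {-1<..<1} \<longrightarrow> h' x = h x"
      "(h' \<longlongrightarrow> 0) (at (s * (e - 1)) within {-1<..<1})" unfolding vanishes_at_def by blast
  have "filterlim (\<lambda>t. s * (t - 1)) (at (s * (e - 1)) within {-1<..<1}) (at e within {0<..<2})"
    unfolding filterlim_at
    by (intro conjI tendsto_intros) (use s in \<open>auto simp: eventually_at_filter\<close>)
  from filterlim_compose[OF h'(2) this]
  have "((\<lambda>t. h' (s * (t - 1))) \<longlongrightarrow> 0) (at e within {0<..<2})" .
  moreover have "AE t in lborel. t \<in> {0<..<2} \<longrightarrow> m t = h' (s * (t - 1))"
    using ae AE_tr1[OF h'(1)] by eventually_elim (auto simp: tr_def)
  ultimately show "y = 0" using m e by (intro AE_limits_eq[of 0 2 m _ e]) auto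
next
  assume y: "y = 0"
  have "filterlim (\<lambda>x. s * x + 1) (at e within {0<..<2}) (at (s * (e - 1)) within {-1<..<1})"
  proof -
    have "((\<lambda>x. s * x + 1) \<longlongrightarrow> s * (s * (e - 1)) + 1) (at (s * (e - 1)) within {-1<..<1})" by (intro tendsto_intros)
    then have "((\<lambda>x. s * x + 1) \<longlongrightarrow> e) (at (s * (e - 1)) within {-1<..<1})" using ss by simp
    then show ?thesis unfolding filterlim_at using s by (auto simp: eventually_at_filter)
  qed
  from filterlim_compose[OF m this]
  have "(itr s m \<longlongrightarrow> 0) (at (s * (e - 1)) within {-1<..<1})" by (simp add: y itr_def[abs_def])
  moreover have "AE x in lborel. x \<in> {-1..1} \<longrightarrow> itr s m x = h x"
    by (rule AE_tr2) (use ae in \<open>eventually_elim, use s in \<open>auto simp: itr_def tr_def\<close>\<close>)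
  ultimately show "vanishes_at (s * (e - 1)) h"
    unfolding vanishes_at_def by (intro exI[of _ "itr s m"]) (auto elim: eventually_mono)
qed

end

lemma locally_integrable_measurable:
  assumes "locally_integrable w" shows "(\<lambda>x. indicator {-1..1} x * w x) \<in> borel_measurable borel"
proof -
  define K :: "nat \<Rightarrow> real set" where "K n = {-1 + 1 / real (Suc n)..1 - 1 / real (Suc n)}" for n
  have m: "(\<lambda>x. indicator (K n) x * w x) \<in> borel_measurable borel" for n
  proof -
    have p: "0 < 1 / real (Suc n)" by simp
    have "compact (K n)" by (simp add: K_def)
    moreover have "K n \<subseteq> {-1<..<1}"
      unfolding K_def by (rule subsetI, unfold atLeastAtMost_iff greaterThanLessThan_iff) (use p in linarith)
    ultimately
    have "set_integrable lborel (K n) w" using assms by (auto simp: locally_integrable_def)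
    then show ?thesis unfolding set_integrable_def by (auto dest: borel_measurable_integrable)
  qed
  have "(\<lambda>x. indicator {-1<..<1} x * w x) \<in> borel_measurable borel"
  proof (rule borel_measurable_LIMSEQ_real[OF _ m])
    fix x :: real
    show "(\<lambda>n. indicator (K n) x * w x) \<longlonglongrightarrow> indicator {-1<..<1} x * w x"
    proof (cases "x \<in> {-1<..<1}")
      case True
      then have "eventually (\<lambda>n. 1 / real (Suc n) < min (1 + x) (1 - x)) sequentially"
        by (intro order_tendstoD(2)[OF lim_inverse_n'[THEN LIMSEQ_Suc]]) auto
      then have "eventually (\<lambda>n. indicator (K n) x * w x = indicator {-1<..<1} x * w x) sequentially"
        by eventually_elim (use True in \<open>auto simp: K_def indicator_def\<close>)
      then show ?thesis by (rule tendsto_eventually)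
    next
      case False
      have "0 < 1 / real (Suc n)" for n by simp
      have "x \<notin> K n" for n
        using False \<open>0 < 1 / real (Suc n)\<close> unfolding K_def atLeastAtMost_iff greaterThanLessThan_iff by linarith
      then show ?thesis using False by simp
    qed
  qed
  then have "(\<lambda>x. indicator {-1<..<1} x * w x + indicator {1} x * w 1 + indicator {-1} x * w (-1)) \<in> borel_measurable borel"
    by measurable
  then show ?thesis
    by (rule back_subst[of "\<lambda>f. f \<in> borel_measurable borel"]) (auto simp: fun_eq_iff indicator_def)
qed

text \<open>A weak derivative picked by choice is a priori only locally integrable; agreement with
  an integrable function gives integrability up to the endpoints.\<close>

lemma set_integrable_AE_eq:
  assumes w: "locally_integrable w" and v: "set_integrable lborel {-1..1} v"
    and ae: "AE x in lborel. x \<in> {-1<..<1} \<longrightarrow> w x = v x"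
  shows "set_integrable lborel {-1..1} w"
  unfolding set_integrable_def
proof (rule integrable_cong_AE_imp[OF v[unfolded set_integrable_def]])
  show "(\<lambda>x. indicator {-1..1} x *\<^sub>R w x) \<in> borel_measurable lborel"
    using locally_integrable_measurable[OF w] by simp
  show "AE x in lborel. indicator {-1..1} x *\<^sub>R v x = indicator {-1..1} x *\<^sub>R w x"
    using ae AE_lborel_singleton[of 1] AE_lborel_singleton[of "-1"]
    by eventually_elim (auto simp: indicator_def)
qed

locale oriented_kernel = orientation s + kernel F for s F
begin

abbreviation kf :: "real \<Rightarrow> real" where "kf \<equiv> \<lambda>x. F (s * x)"

lemma FL: "L F" by (rule F_int)

text \<open>The kernel vanishes on the nonpositive half-line, so in either orientation only
  \<open>[0,t]\<close> contributes after the change of variables.\<close>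

lemma conv_tr: assumes t: "t \<in> {0..2}" shows "tr s (conv kf u) t = cv F (tr s u) t"
proof -
  have "tr s (conv kf u) t = (LINT y:{-1..1}|lborel. F (s * (s * (t - 1) - y)) * u y)"
    by (simp add: tr_def conv_def)
  also have "\<dots> = (LINT z:{0..2}|lborel. tr s (\<lambda>y. F (s * (s * (t - 1) - y)) * u y) z)" by (rule LINT_tr)
  also have "\<dots> = cv F (tr s u) t"
    unfolding cv_def set_lebesgue_integral_def
  proof (rule Bochner_Integration.integral_cong[OF refl])
    fix z :: real
    have "s * (s * (t - 1) - s * (z - 1)) = t - z" using s by auto
    moreover have "F (t - z) = 0" if "z \<notin> {0..t}" "z \<ge> 0" using that by (intro F_zero) auto
    ultimately show "indicator {0..2} z *\<^sub>R tr s (\<lambda>y. F (s * (s * (t - 1) - y)) * u y) z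
        = indicator {0..t} z *\<^sub>R (F (t - z) * tr s u z)"
      using t by (auto simp: tr_def indicator_def)
  qed
  finally show ?thesis .
qed

lemma L_conv_tr: assumes "L (tr s u)" shows "L (tr s (conv kf u))"
proof -
  have "L (cv F (tr s u))" by (intro L_cv FL assms)
  then show ?thesis
    unfolding set_integrable_def
    by (rule back_subst[of "integrable lborel"]) (auto simp: fun_eq_iff indicator_def conv_tr)
qed

lemma W11_trD:
  assumes "W11 u"
  shows "L (tr s u)" "L (tr s (weak_deriv u))"
    "\<exists>c. AE t in lborel. t \<in> {0..2} \<longrightarrow> tr s u t = c + s * cv one (tr s (weak_deriv u)) t"
proof -
  obtain v where v: "set_integrable lborel {-1..1} v" "has_weak_deriv u v" and u: "set_integrable lborel {-1..1} u"
    using assms by (auto simp: W11_def)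
  note w = has_weak_deriv_weak_deriv[OF v(2)]
  show u': "L (tr s u)" using u by (simp add: L_tr)
  have "set_integrable lborel {-1..1} (weak_deriv u)"
    by (rule set_integrable_AE_eq[OF _ v(1) AE_weak_deriv[OF v(2)]]) (use w in \<open>simp add: has_weak_deriv_def\<close>)
  then show w': "L (tr s (weak_deriv u))" by (simp add: L_tr)
  show "\<exists>c. AE t in lborel. t \<in> {0..2} \<longrightarrow> tr s u t = c + s * cv one (tr s (weak_deriv u)) t"
    using w has_weak_deriv_tr[OF u' w'] by blast
qed

lemma W11_trI:
  assumes q: "L q" and u: "L (tr s u)" and ae: "AE t in lborel. t \<in> {0..2} \<longrightarrow> tr s u t = c + cv one q t"
  shows "W11 u" "L (tr s (weak_deriv u))" "AE t in lborel. t \<in> {0..2} \<longrightarrow> tr s (weak_deriv u) t = s * q t"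
proof -
  define v where "v = itr s (\<lambda>t. s * q t)"
  have v: "L (tr s v)" using q by (simp add: v_def)
  have d: "has_weak_deriv u v"
    unfolding has_weak_deriv_tr[OF u v]
    by (rule exI[of _ c]) (use ae in \<open>eventually_elim, simp add: v_def cv_scale_right ss\<close>)
  show "W11 u" using u v d by (auto simp: W11_def L_tr)
  then show "L (tr s (weak_deriv u))" by (rule W11_trD(2))
  show "AE t in lborel. t \<in> {0..2} \<longrightarrow> tr s (weak_deriv u) t = s * q t"
    using AE_tr1[OF AE_weak_deriv[OF d]] by eventually_elim (use s in \<open>auto simp: v_def itr_def tr_def\<close>)
qed

text \<open>\<open>q\<close> is \<open>s\<close> times the transformed weak derivative; with this
  choice both equations of the causal system are free of signs.\<close>

lemma is_partial_trD:
  assumes p: "is_partial kf u g" and g: "L (tr s g)"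
  shows "\<exists>c0 c q. L q \<and> (AE t in lborel. t \<in> {0..2} \<longrightarrow> tr s u t = c0 + cv one q t) \<and>
    (AE t in lborel. t \<in> {0..2} \<longrightarrow> cv F q t = c + cv one (tr s g) t)"
proof -
  have W: "W11 u" and d: "has_weak_deriv (conv kf (weak_deriv u)) g"
    using p by (auto simp: is_partial_def partial1_def)
  note u = W11_trD[OF W]
  from u(3) obtain c0 where c0: "AE t in lborel. t \<in> {0..2} \<longrightarrow> tr s u t = c0 + s * cv one (tr s (weak_deriv u)) t" by blast
  from d obtain c where c: "AE t in lborel. t \<in> {0..2} \<longrightarrow> tr s (conv kf (weak_deriv u)) t = c + s * cv one (tr s g) t"
    using has_weak_deriv_tr[OF L_conv_tr[OF u(2)] g] by blast
  have "L (\<lambda>t. s * tr s (weak_deriv u) t)" using u(2) by simp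
  moreover have "AE t in lborel. t \<in> {0..2} \<longrightarrow> tr s u t = c0 + cv one (\<lambda>t. s * tr s (weak_deriv u) t) t"
    using c0 by (simp add: cv_scale_right)
  moreover have "AE t in lborel. t \<in> {0..2} \<longrightarrow> cv F (\<lambda>t. s * tr s (weak_deriv u) t) t = s * c + cv one (tr s g) t"
    using c by eventually_elim (auto simp: conv_tr cv_scale_right distrib_left ss)
  ultimately show ?thesis by blast
qed

lemma is_partial_trI:
  assumes q: "L q" and u: "L (tr s u)" and g: "L (tr s g)"
    and ae: "AE t in lborel. t \<in> {0..2} \<longrightarrow> tr s u t = c0 + cv one q t"
    and ae': "AE t in lborel. t \<in> {0..2} \<longrightarrow> cv F q t = c + cv one (tr s g) t"
  shows "is_partial kf u g" "AE t in lborel. t \<in> {0..2} \<longrightarrow> tr s (partial1 kf u) t = s * cv F q t"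
    "AE t in lborel. t \<in> {0..2} \<longrightarrow> tr s (weak_deriv u) t = s * q t"
proof -
  note w = W11_trI[OF q u ae]
  show "AE t in lborel. t \<in> {0..2} \<longrightarrow> tr s (weak_deriv u) t = s * q t" by (rule w(3))
  show p: "AE t in lborel. t \<in> {0..2} \<longrightarrow> tr s (partial1 kf u) t = s * cv F q t"
  proof (rule AE_I2, rule impI)
    fix t :: real assume t: "t \<in> {0..2}"
    have "cv F (tr s (weak_deriv u)) t = cv F (\<lambda>t. s * q t) t"
      by (rule cv_cong_right[OF w(3) _ FL w(2)]) (use t q in auto)
    then show "tr s (partial1 kf u) t = s * cv F q t" using t by (simp add: partial1_def conv_tr cv_scale_right)
  qed
  have "has_weak_deriv (partial1 kf u) g"
  proof -
    have "AE t in lborel. t \<in> {0..2} \<longrightarrow> tr s (conv kf (weak_deriv u)) t = s * c + s * cv one (tr s g) t"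
      using p ae' unfolding partial1_def by eventually_elim (auto simp: distrib_left)
    then show ?thesis
      unfolding partial1_def using has_weak_deriv_tr[OF L_conv_tr[OF w(2)] g] by blast
  qed
  with w(1) show "is_partial kf u g" by (simp add: is_partial_def)
qed

lemma is_D_trD:
  assumes p: "is_D kf u g" and s1: "s = 1" and u: "L (tr s u)" and g: "L (tr s g)"
  shows "\<exists>c0 c. AE t in lborel. t \<in> {0..2} \<longrightarrow> cv F (tr s u) t = c0 + cv one (\<lambda>y. c + cv one (tr s g) y) t"
proof -
  have d: "has_weak_deriv (conv kf u) (D1 kf u)" "has_weak_deriv (D1 kf u) g" using p by (auto simp: is_D_def)
  \<comment> \<open>\<open>D1 kf u\<close> is only known to be locally integrable. Being a primitive
    of \<open>g\<close> up to null sets, it is integrable up to the endpoints.\<close>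
  obtain c where "AE x in lborel. x \<in> {-1<..<1} \<longrightarrow> D1 kf u x = c + (LINT y:{-1..x}|lborel. g y)"
    using weak_deriv_antideriv[OF d(2)] g by (auto simp: L_tr)
  moreover have "set_integrable lborel {-1..1} (\<lambda>x. c + (LINT y:{-1..x}|lborel. g y))"
    by (rule borel_integrable_atLeastAtMost'[OF continuous_on_add[OF continuous_on_const antideriv_cont]]) (use g in \<open>simp add: L_tr\<close>)
  moreover have "locally_integrable (D1 kf u)" using d(2) by (simp add: has_weak_deriv_def)
  ultimately have D: "L (tr s (D1 kf u))"
    unfolding L_tr[symmetric] using set_integrable_AE_eq by blast
  obtain c0 where c0: "AE t in lborel. t \<in> {0..2} \<longrightarrow> tr s (conv kf u) t = c0 + s * cv one (tr s (D1 kf u)) t"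
    using d(1) has_weak_deriv_tr[OF L_conv_tr[OF u] D] by blast
  obtain c where c: "AE t in lborel. t \<in> {0..2} \<longrightarrow> tr s (D1 kf u) t = c + s * cv one (tr s g) t"
    using d(2) has_weak_deriv_tr[OF D g] by blast
  have cL: "L (\<lambda>y. c + s * cv one (tr s g) y)"
    by (intro L_continuous continuous_on_add continuous_on_mult continuous_on_const continuous_cv[OF continuous_on_const g])
  have e: "cv one (tr s (D1 kf u)) t = cv one (\<lambda>y. c + s * cv one (tr s g) y) t" if "t \<in> {0..2}" for t
    by (rule cv_cong_right[OF c _ L_const D]) (use that cL in auto)
  have "AE t in lborel. t \<in> {0..2} \<longrightarrow> cv F (tr s u) t = c0 + cv one (\<lambda>y. c + cv one (tr s g) y) t"
    using c0
  proof eventually_elim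
    case (elim t)
    then show ?case using conv_tr[of t u] e[of t] s1 by auto
  qed
  then show ?thesis by blast
qed

lemma is_D_trI:
  assumes s1: "s = 1" and u: "L (tr s u)" and g: "L (tr s g)" and d: "continuous_on {0..2} d"
    and ae: "AE t in lborel. t \<in> {0..2} \<longrightarrow> cv F (tr s u) t = c0 + cv one d t"
    and ae': "\<And>t. t \<in> {0..2} \<Longrightarrow> d t = c + cv one (tr s g) t"
  shows "is_D kf u g" "AE t in lborel. t \<in> {0..2} \<longrightarrow> tr s (D1 kf u) t = d t"
proof -
  have dL: "L d" by (rule L_continuous[OF d])
  have D: "has_weak_deriv (conv kf u) (itr s d)"
    using has_weak_deriv_tr[OF L_conv_tr[OF u], of "itr s d"] dL ae
    by (auto simp: conv_tr s1[symmetric] intro!: exI[of _ c0] elim!: eventually_mono)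
  show e: "AE t in lborel. t \<in> {0..2} \<longrightarrow> tr s (D1 kf u) t = d t"
    using AE_tr1[OF AE_weak_deriv[OF D]] unfolding D1_def
    by eventually_elim (use s in \<open>auto simp: itr_def tr_def\<close>)
  have "set_integrable lborel {-1..1} (D1 kf u)" unfolding D1_def
    by (rule set_integrable_AE_eq[OF _ _ AE_weak_deriv[OF D]])
      (use has_weak_deriv_weak_deriv[OF D] dL in \<open>auto simp: has_weak_deriv_def L_tr\<close>)
  then have DL: "L (tr s (D1 kf u))" by (simp add: L_tr)
  have "has_weak_deriv (D1 kf u) g"
    unfolding has_weak_deriv_tr[OF DL g]
    by (rule exI[of _ c]) (use e in \<open>eventually_elim, auto simp: ae' s1\<close>)
  with has_weak_deriv_weak_deriv[OF D] show "is_D kf u g" by (simp add: is_D_def D1_def)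
qed

end

section \<open>Boundary value problems for the resolvent\<close>

locale oriented_scale = scale_fn +
  fixes s :: real assumes s_cases: "s = 1 \<or> s = -1"

sublocale oriented_scale \<subseteq> oriented_kernel s F
  by unfold_locales (rule s_cases)

lemma lim_cont:
  assumes "continuous_on {0..2} (m :: real \<Rightarrow> real)" "e = 0 \<or> e = 2"
  shows "(m \<longlongrightarrow> m e) (at e within {0<..<2})"
proof -
  have "(m \<longlongrightarrow> m e) (at e within {0..2})" using assms by (auto simp: continuous_on_def)
  then show ?thesis by (rule tendsto_within_subset) auto
qed

context oriented_scale begin

lemma k_lim2: "(k \<longlongrightarrow> k 2) (at 2 within {0<..<2})"
  by (rule tendsto_within_subset[OF k_lim]) auto

text \<open>Typed for the reflected orientation, in which the causal problem starts at the right
  endpoint: right conditions sit at the start, left conditions at the end.\<close>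

fun bc_start :: "right_bc \<Rightarrow> (real \<Rightarrow> real) \<Rightarrow> bool" where
  "bc_start Right_D u \<longleftrightarrow> vanishes_at (s * (0 - 1)) u"
| "bc_start Right_N u \<longleftrightarrow> vanishes_at (s * (0 - 1)) (partial1 kf u)"

fun bc_end :: "left_bc \<Rightarrow> (real \<Rightarrow> real) \<Rightarrow> bool" where
  "bc_end Left_D u \<longleftrightarrow> vanishes_at (s * (2 - 1)) u"
| "bc_end Left_N u \<longleftrightarrow> vanishes_at (s * (2 - 1)) (partial1 kf u)"
| "bc_end Left_Nstar u \<longleftrightarrow> vanishes_at (s * (2 - 1)) (weak_deriv u)"

text \<open>Boundary data of the general solution \<open>f0 Z + c W - W * p\<close>: value or flux
  at 0 here, and value, flux or derivative at 2 in \<open>end_val\<close>.\<close>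

fun start_val :: "right_bc \<Rightarrow> real \<Rightarrow> real \<Rightarrow> real" where
  "start_val Right_D f0 c = f0"
| "start_val Right_N f0 c = c"

fun end_val :: "left_bc \<Rightarrow> real \<Rightarrow> real \<Rightarrow> (real \<Rightarrow> real) \<Rightarrow> real" where
  "end_val Left_D f0 c p = f0 * Z 2 + c * W 2 - cv W p 2"
| "end_val Left_N f0 c p = f0 * V 2 + c * Z 2 - cv Z p 2"
| "end_val Left_Nstar f0 c p = f0 * (l * W 2) + c * k 2 - cv k p 2"

lemma partial_form:
  assumes g: "L (tr s g)" and d: "is_partial kf u g"
  shows "\<exists>f0 c. AE t in lborel. t \<in> {0..2} \<longrightarrow>
    tr s u t = f0 * Z t + c * W t - cv W (\<lambda>t. l * tr s u t - tr s g t) t"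
proof -
  obtain f0 c q where q: "L q" and u: "AE t in lborel. t \<in> {0..2} \<longrightarrow> tr s u t = f0 + cv one q t"
    and J: "AE t in lborel. t \<in> {0..2} \<longrightarrow> cv F q t = c + cv one (tr s g) t"
    using is_partial_trD[OF d g] by blast
  have uL: "L (tr s u)" using d by (intro W11_trD(1)) (simp add: is_partial_def)
  have fL: "L (\<lambda>t. f0 + cv one q t)" by (rule L_add[OF L_const L_cv[OF L_const q]])
  have e: "cv W (\<lambda>t. l * (f0 + cv one q t) - tr s g t) t = cv W (\<lambda>t. l * tr s u t - tr s g t) t" if "t \<in> {0..2}" for t
    by (rule cv_cong_right[OF _ _ W_L L_diff[OF L_scale[OF fL] g] L_diff[OF L_scale[OF uL] g]])
      (use u that in \<open>auto elim: eventually_mono\<close>)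
  then have "AE t in lborel. t \<in> {0..2} \<longrightarrow>
    tr s u t = f0 * Z t + c * W t - cv W (\<lambda>t. l * tr s u t - tr s g t) t"
    using u by eventually_elim (use uniqueness[OF q g J, of _ f0] e in auto)
  then show ?thesis by blast
qed

lemma partial_bc:
  assumes uL: "L (tr s u)" and g: "L (tr s g)"
  defines "p \<equiv> \<lambda>t. l * tr s u t - tr s g t"
  assumes pc: "a = Left_Nstar \<Longrightarrow> continuous_on {0..2} p"
    and u: "AE t in lborel. t \<in> {0..2} \<longrightarrow> tr s u t = f0 * Z t + c * W t - cv W p t"
  shows "is_partial kf u g" "bc_start b u \<longleftrightarrow> start_val b f0 c = 0" "bc_end a u \<longleftrightarrow> end_val a f0 c p = 0"
proof -
  have p: "L p" unfolding p_def by (rule L_diff[OF L_scale[OF uL] g])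
  define f where "f = (\<lambda>x. f0 * Z x + c * W x - cv W p x)"
  define q where "q = (\<lambda>x. f0 * (l * W x) + c * k x - cv k p x)"
  define J where "J = (\<lambda>x. f0 * V x + c * Z x - cv Z p x)"
  note sol = solution[OF p, where ?f0.0 = f0 and c = c, folded f_def q_def J_def]
  have fL: "L f" by (rule L_continuous[OF sol(1)])
  have u': "AE t in lborel. t \<in> {0..2} \<longrightarrow> tr s u t = f t" using u by (simp add: f_def)
  have J': "J t = c + cv one (tr s g) t" if t: "t \<in> {0..2}" for t
  proof -
    have "cv one (\<lambda>x. l * f x - p x) t = cv one (tr s g) t"
      by (rule cv_cong_right[OF _ _ L_const L_diff[OF L_scale[OF fL] p] g])
        (use u' t in \<open>auto simp: p_def elim: eventually_mono\<close>)
    then show ?thesis using sol(6)[OF t] by (simp add: f_def J_def)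
  qed
  have a1: "AE t in lborel. t \<in> {0..2} \<longrightarrow> tr s u t = f0 + cv one q t"
    using u' by eventually_elim (use sol(4) in \<open>auto simp: f_def\<close>)
  have a2: "AE t in lborel. t \<in> {0..2} \<longrightarrow> cv F q t = c + cv one (tr s g) t"
    using sol(5) by eventually_elim (use J' in \<open>auto simp: J_def\<close>)
  note I = is_partial_trI[OF sol(3) uL g a1 a2]
  show "is_partial kf u g" by (rule I(1))
  have P: "AE t in lborel. t \<in> {0..2} \<longrightarrow> tr s (partial1 kf u) t = s * J t"
    using I(2) sol(5) by eventually_elim (auto simp: J_def)
  have sJ: "continuous_on {0..2} (\<lambda>t. s * J t)" by (intro continuous_on_mult continuous_on_const sol(2))
  have J0: "J 0 = c" using J'[of 0] by (simp add: cv_at_0)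
  have f0: "f 0 = f0" using sol(4)[of 0] by (simp add: cv_at_0 f_def)
  show "bc_start b u \<longleftrightarrow> start_val b f0 c = 0"
  proof (cases b)
    case Right_D
    then show ?thesis using vanishes_at_tr[OF u' _ lim_cont[OF sol(1)], of 0] by (simp add: f0)
  next
    case Right_N
    then show ?thesis using vanishes_at_tr[OF P _ lim_cont[OF sJ], of 0] s_ne by (simp add: J0)
  qed
  show "bc_end a u \<longleftrightarrow> end_val a f0 c p = 0"
  proof (cases a)
    case Left_D
    then show ?thesis using vanishes_at_tr[OF u' _ lim_cont[OF sol(1)], of 2] by (simp add: f_def)
  next
    case Left_N
    then show ?thesis using vanishes_at_tr[OF P _ lim_cont[OF sJ], of 2] s_ne by (simp add: J_def)
  next
    case Left_Nstar
    \<comment> \<open>The derivative has a limit at 2: \<open>k\<close> has its left limit there,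
      and \<open>k * p\<close> is continuous because in this case \<open>p\<close> is.\<close>
    have "(q \<longlongrightarrow> q 2) (at 2 within {0<..<2})"
      unfolding q_def
      by (intro tendsto_diff tendsto_add tendsto_mult tendsto_const k_lim2 lim_cont W_cont continuous_cv' k_L pc Left_Nstar) auto
    then have lim: "((\<lambda>t. s * q t) \<longlongrightarrow> s * q 2) (at 2 within {0<..<2})" by (intro tendsto_mult tendsto_const)
    have "vanishes_at (s * (2 - 1)) (weak_deriv u) \<longleftrightarrow> s * q 2 = 0" by (rule vanishes_at_tr[OF I(3) _ lim]) simp
    then show ?thesis using s_ne Left_Nstar by (simp add: q_def)
  qed
qed

text \<open>The start condition removes one of the two constants, and the other is multiplied by
  exactly \<open>\<beta> a b\<close>, whose positivity makes the problem uniquely solvable.\<close>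

lemma end_val_eq:
  assumes "start_val b f0 c = 0"
  shows "end_val a f0 c p = (if b = Right_D then c else f0) * \<beta> a b - cv (HL a) p 2"
  using assms by (cases a; cases b) auto

text \<open>The equation alone leaves two constants; the start condition annihilates one and the end
  condition determines the other. Read backwards, the same constants produce a solution.\<close>

lemma partial_sol:
  assumes uL: "L (tr s u)" and g: "L (tr s g)"
  defines "p \<equiv> \<lambda>t. l * tr s u t - tr s g t"
  assumes pc: "a = Left_Nstar \<Longrightarrow> continuous_on {0..2} p"
  shows "is_partial kf u g \<and> bc_start b u \<and> bc_end a u \<longleftrightarrow>
    (AE t in lborel. t \<in> {0..2} \<longrightarrow> tr s u t = sol (HR b) (HL a) (\<beta> a b) p t)" (is "?l \<longleftrightarrow> ?r")
proof
  assume l: ?l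
  obtain f0 c where u: "AE t in lborel. t \<in> {0..2} \<longrightarrow> tr s u t = f0 * Z t + c * W t - cv W p t"
    using partial_form[OF g, of u] l unfolding p_def by blast
  note bc = partial_bc[OF uL g pc[unfolded p_def] u[unfolded p_def], folded p_def]
  have st: "start_val b f0 c = 0" and "end_val a f0 c p = 0" using bc(2,3) l by auto
  then have A: "(if b = Right_D then c else f0) = cv (HL a) p 2 / \<beta> a b"
    using end_val_eq[of b f0 c a p] \<beta>_pos[of a b] by (simp add: field_simps)
  then show ?r using u by eventually_elim (use st A in \<open>cases b; auto simp: sol_def\<close>)
next
  assume r: ?r
  define A where "A = cv (HL a) p 2 / \<beta> a b"
  define f0 where "f0 = (if b = Right_D then 0 else A)"
  define c where "c = (if b = Right_D then A else 0)"
  have u: "AE t in lborel. t \<in> {0..2} \<longrightarrow> tr s u t = f0 * Z t + c * W t - cv W p t"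
    using r by eventually_elim (cases b; auto simp: sol_def A_def f0_def c_def)
  note bc = partial_bc[OF uL g pc[unfolded p_def] u[unfolded p_def], folded p_def]
  have st: "start_val b f0 c = 0" by (cases b) (auto simp: f0_def c_def)
  moreover have "end_val a f0 c p = 0"
    unfolding end_val_eq[OF st] using \<beta>_pos[of a b] by (auto simp: f0_def c_def A_def)
  ultimately show ?l using bc by blast
qed

fun bc_end_star :: "right_bc \<Rightarrow> (real \<Rightarrow> real) \<Rightarrow> bool" where
  "bc_end_star Right_D u \<longleftrightarrow> vanishes_at 1 u"
| "bc_end_star Right_N u \<longleftrightarrow> vanishes_at 1 (D1 F u)"

lemma D_bc:
  assumes s1: "s = 1" and uL: "L (tr s u)" and g: "L (tr s g)"
  defines "p \<equiv> \<lambda>t. l * tr s u t - tr s g t"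
  assumes u: "AE t in lborel. t \<in> {0..2} \<longrightarrow> tr s u t = c * k t - cv W p t"
  shows "is_D F u g" "vanishes_at (-1) (D1 F u)" "bc_end_star b u \<longleftrightarrow> c * \<beta> Left_Nstar b = cv (HR b) p 2"
proof -
  have p: "L p" unfolding p_def by (rule L_diff[OF L_scale[OF uL] g])
  define f where "f = (\<lambda>x. c * k x - cv W p x)"
  define d where "d = (\<lambda>x. c * (l * W x) - cv Z p x)"
  note sol = solution_star[OF p, where c = c, folded f_def d_def]
  have u': "AE t in lborel. t \<in> {0..2} \<longrightarrow> tr s u t = f t" using u by (simp add: f_def)
  have d': "d t = 0 + cv one (tr s g) t" if t: "t \<in> {0..2}" for t
  proof -
    have "cv one (\<lambda>x. l * f x - p x) t = cv one (tr s g) t"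
      by (rule cv_cong_right[OF _ _ L_const L_diff[OF L_scale[OF sol(1)] p] g])
        (use u' t in \<open>auto simp: p_def elim: eventually_mono\<close>)
    then show ?thesis using sol(4)[OF t] by (simp add: f_def d_def)
  qed
  have e: "cv F f t = cv F (tr s u) t" if "t \<in> {0..2}" for t
    by (rule cv_cong_right[OF _ _ FL sol(1) uL]) (use u' that in \<open>auto elim: eventually_mono\<close>)
  then have ae: "AE t in lborel. t \<in> {0..2} \<longrightarrow> cv F (tr s u) t = c + cv one d t"
    using sol(3) by eventually_elim (use e in auto)
  have kf: "kf = F" by (simp add: s1)
  note I = is_D_trI[OF s1 uL g sol(2) ae d', unfolded kf]
  show "is_D F u g" by (rule I(1))
  have d0: "d 0 = 0" using d'[of 0] by (simp add: cv_at_0)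
  show "vanishes_at (-1) (D1 F u)"
    using vanishes_at_tr[OF I(2) _ lim_cont[OF sol(2)], of 0] by (simp add: d0 s1)
  show "bc_end_star b u \<longleftrightarrow> c * \<beta> Left_Nstar b = cv (HR b) p 2"
  proof (cases b)
    case Right_D
    have "(f \<longlongrightarrow> f 2) (at 2 within {0<..<2})"
      unfolding f_def
      by (intro tendsto_diff tendsto_mult tendsto_const k_lim2 lim_cont W_cont continuous_cv p) auto
    then show ?thesis using vanishes_at_tr[OF u', of 2] Right_D by (simp add: f_def s1)
  next
    case Right_N
    then show ?thesis
      using vanishes_at_tr[OF I(2) _ lim_cont[OF sol(2)], of 2] by (simp add: d_def s1 mult.assoc)
  qed
qed

lemma D_sol:
  assumes s1: "s = 1" and uL: "L (tr s u)" and g: "L (tr s g)"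
  defines "p \<equiv> \<lambda>t. l * tr s u t - tr s g t"
  shows "is_D F u g \<and> vanishes_at (-1) (D1 F u) \<and> bc_end_star b u \<longleftrightarrow>
    (AE t in lborel. t \<in> {0..2} \<longrightarrow> tr s u t = sol (HL Left_Nstar) (HR b) (\<beta> Left_Nstar b) p t)" (is "?l \<longleftrightarrow> ?r")
proof
  assume l: ?l
  have kf: "kf = F" by (simp add: s1)
  obtain c c1 where c: "AE t in lborel. t \<in> {0..2} \<longrightarrow> cv F (tr s u) t = c + cv one (\<lambda>y. c1 + cv one (tr s g) y) t"
    using is_D_trD[unfolded kf, of u g] l s1 uL g by blast
  define d where "d = (\<lambda>y. c1 + cv one (tr s g) y)"
  have dc: "continuous_on {0..2} d"
    unfolding d_def by (intro continuous_on_add continuous_on_const continuous_cv[OF continuous_on_const g])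
  have "AE t in lborel. t \<in> {0..2} \<longrightarrow> tr s (D1 F u) t = d t"
    by (rule is_D_trI(2)[OF s1 uL g dc c[folded d_def], unfolded kf]) (simp add: d_def)
  then have "d 0 = 0" using vanishes_at_tr[OF _ _ lim_cont[OF dc], of "D1 F u" 0] l s1 by simp
  \<comment> \<open>Condition N* at -1 says that \<open>d\<close> vanishes at the start, which
    removes the term with \<open>W\<close>.\<close>
  then have "c1 = 0" by (simp add: d_def cv_at_0)
  then have u: "AE t in lborel. t \<in> {0..2} \<longrightarrow> tr s u t = c * k t - cv W p t"
    using uniqueness_star[OF uL g c] unfolding p_def by (auto elim: eventually_mono)
  have A: "c = cv (HR b) p 2 / \<beta> Left_Nstar b"
    using D_bc(3)[OF s1 uL g u[unfolded p_def], of b, folded p_def] l \<beta>_pos[of Left_Nstar b] by (simp add: field_simps)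
  show ?r using u by eventually_elim (use A in \<open>simp add: sol_def\<close>)
next
  assume r: ?r
  define c where "c = cv (HR b) p 2 / \<beta> Left_Nstar b"
  have u: "AE t in lborel. t \<in> {0..2} \<longrightarrow> tr s u t = c * k t - cv W p t"
    using r by eventually_elim (simp add: sol_def c_def)
  have "c * \<beta> Left_Nstar b = cv (HR b) p 2" using \<beta>_pos[of Left_Nstar b] by (simp add: c_def)
  then show ?l using D_bc(1,2)[OF s1 uL g u[unfolded p_def]] D_bc(3)[OF s1 uL g u[unfolded p_def], of b, folded p_def] by blast
qed

end

section \<open>Positivity and contractivity of the solution operators\<close>

context scale_fn begin

lemma ci_HL: "continuous_on {0..2} p \<Longrightarrow> ci (HL a) p 2" by (rule ci_cont'[OF _ HL_L]) auto
lemma ci_HR: "L p \<Longrightarrow> ci (HR b) p 2" by (rule ci_cont[OF HR_cont]) auto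

lemma sol_cont: "continuous_on {0..2} H \<Longrightarrow> L p \<Longrightarrow> continuous_on {0..2} (sol H B b p)"
  unfolding sol_def[abs_def] by (intro continuous_on_diff continuous_on_mult continuous_on_const continuous_cv[OF W_cont])

lemma sol_cong:
  assumes "\<And>t. t \<in> {0..2} \<Longrightarrow> p t = q t" "t \<in> {0..2}" shows "sol H B b p t = sol H B b q t"
proof -
  have "cv B p 2 = cv B q 2" "cv W p t = cv W q t" using assms by (auto intro!: cv_cong_all)
  then show ?thesis by (simp add: sol_def)
qed

lemma L_sol: "L H \<Longrightarrow> L p \<Longrightarrow> L (sol H B b p)"
  unfolding sol_def[abs_def] by (rule L_diff[OF L_scale]) (auto intro: L_continuous continuous_cv W_cont)

text \<open>The backward kernel is the transpose of the forward one: in \<open>green_nonneg\<close>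
  the pair \<open>t\<close>, \<open>y\<close> is replaced by \<open>2 - y\<close>,
  \<open>2 - t\<close>.\<close>

lemma back_nonneg:
  assumes p: "continuous_on {0..2} p" "\<And>y. y \<in> {0..2} \<Longrightarrow> 0 \<le> p y" and t: "t \<in> {0..2}"
  shows "0 \<le> sol (HR b) (HL a) (\<beta> a b) p t"
proof (rule sol_nonneg[OF t HR_nonneg \<beta>_pos HL_nonneg])
  fix y assume "0 < y" "y < t"
  then show "W (t - y) * \<beta> a b \<le> HL a (2 - y) * HR b t"
    using green_nonneg[of "2 - t" "2 - y" a b] t by (simp add: mult.commute)
qed (use p in \<open>auto intro: L_continuous ci_HL\<close>)

text \<open>Positivity applied to \<open>M + p\<close> and \<open>M - p\<close> dominates the
  solution by that for the constant \<open>M\<close>. For the constant 1 the mass bound and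
  \<open>l W * 1 = Z - 1\<close> give at most \<open>1/l\<close>.\<close>

lemma back_contraction:
  assumes p: "continuous_on {0..2} p" "\<And>y. y \<in> {0..2} \<Longrightarrow> \<bar>p y\<bar> \<le> M" and t: "t \<in> {0..2}"
  shows "l * \<bar>sol (HR b) (HL a) (\<beta> a b) p t\<bar> \<le> M"
proof -
  let ?S = "sol (HR b) (HL a) (\<beta> a b)"
  have pL: "L p" "L (\<lambda>t. - 1 * p t)"
    using L_continuous[OF p(1)] by (blast, rule L_scale)
  have c: "continuous_on {0..2} (\<lambda>_. M :: real)" "continuous_on {0..2} (\<lambda>t. - 1 * p t)" using p(1) by (auto intro: continuous_intros)
  have a: "?S (\<lambda>y. M + p y) t = ?S (\<lambda>_. M) t + ?S p t"
    by (rule sol_add[OF ci_HL[OF c(1)] ci_HL[OF p(1)] L_const pL(1) t])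
  have b: "?S (\<lambda>y. M + - 1 * p y) t = ?S (\<lambda>_. M) t + - 1 * ?S p t"
    unfolding sol_scale[symmetric] by (rule sol_add[OF ci_HL[OF c(1)] ci_HL[OF c(2)] L_const pL(2) t])
  have "0 \<le> ?S (\<lambda>y. M + p y) t"
    by (rule back_nonneg[OF continuous_on_add[OF c(1) p(1)] _ t]) (drule p(2), linarith)
  moreover have "0 \<le> ?S (\<lambda>y. M + - 1 * p y) t"
    by (rule back_nonneg[OF continuous_on_add[OF c] _ t]) (drule p(2), linarith)
  ultimately have "\<bar>?S p t\<bar> \<le> ?S (\<lambda>_. M) t" unfolding a b by linarith
  then have 1: "l * \<bar>?S p t\<bar> \<le> l * ?S (\<lambda>_. M) t" using l_pos by (intro mult_left_mono) auto
  have M: "0 \<le> M" using p(2)[of 0] by force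
  have "l * cv W one t = Z t - 1" using t by (simp add: Z_def' cv_comm)
  moreover have "l * (cv (HL a) one 2 / \<beta> a b * HR b t) \<le> Z t"
  proof -
    have "l * cv one (HL a) 2 * HR b t \<le> \<beta> a b * Z t" using t by (intro green_mass) auto
    then show ?thesis using \<beta>_pos[of a b] by (simp add: cv_comm[of "HL a"] divide_le_eq mult_ac)
  qed
  ultimately have "l * ?S one t \<le> 1" by (simp add: sol_def right_diff_distrib)
  moreover have "?S (\<lambda>_. M) t = M * ?S one t" using sol_scale[of "HR b" "HL a" "\<beta> a b" M one t] by simp
  ultimately have "l * ?S (\<lambda>_. M) t \<le> M" using mult_left_mono[OF _ M, of "l * ?S one t" 1] by (simp add: mult_ac)
  with 1 show ?thesis by linarith
qed

lemma back_bc: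
  shows "sol (HR Right_D) (HL a) (\<beta> a Right_D) p 0 = 0" "sol (HR b) (HL Left_D) (\<beta> Left_D b) p 2 = 0"
  using W_pos[of 2] Z_ge_1[of 2] by (auto simp: sol_def cv_at_0 W_0) (cases b; simp)

lemma fwd_nonneg:
  assumes p: "L p" "AE y in lborel. y \<in> {0..2} \<longrightarrow> 0 \<le> p y" and t: "0 < t" "t < 2"
  shows "0 \<le> sol (HL a) (HR b) (\<beta> a b) p t"
proof (rule sol_nonneg)
  fix y assume "0 < y" "y < t"
  then show "W (t - y) * \<beta> a b \<le> HR b (2 - y) * HL a t"
    using t by (intro green_nonneg) auto
qed (use t p in \<open>auto intro: HL_nonneg HR_nonneg \<beta>_pos ci_HR\<close>)

text \<open>Positivity reduces the claim to the absolute value of \<open>p\<close>. When the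
  solution formula is integrated over \<open>[0,2]\<close>, the mass bound is used in the variable
  of \<open>p\<close>, and \<open>cv_Z_eq\<close> splits the resulting convolution with
  \<open>Z\<close> into the norm of \<open>p\<close> and exactly the term that is
  subtracted.\<close>

lemma fwd_contraction:
  assumes p: "L p"
  shows "l * (LINT t:{0..2}|lborel. \<bar>sol (HL a) (HR b) (\<beta> a b) p t\<bar>) \<le> (LINT t:{0..2}|lborel. \<bar>p t\<bar>)"
proof -
  let ?T = "sol (HL a) (HR b) (\<beta> a b)" and ?m = "\<lambda>t. \<bar>p t\<bar>"
  have m: "L ?m" using p by (rule set_integrable_abs)
  have n: "L (\<lambda>t. - 1 * p t)" using p by (rule L_scale)
  have le: "\<bar>?T p t\<bar> \<le> ?T ?m t" if t: "0 < t" "t < 2" for t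
  proof -
    have t': "t \<in> {0..2}" using t by simp
    have a: "?T (\<lambda>y. ?m y + p y) t = ?T ?m t + ?T p t" by (rule sol_add[OF ci_HR[OF m] ci_HR[OF p] m p t'])
    have b: "?T (\<lambda>y. ?m y + - 1 * p y) t = ?T ?m t + - 1 * ?T p t"
      unfolding sol_scale[symmetric] by (rule sol_add[OF ci_HR[OF m] ci_HR[OF n] m n t'])
    have "0 \<le> ?T (\<lambda>y. ?m y + p y) t" by (rule fwd_nonneg[OF L_add[OF m p] _ t]) (rule AE_I2, auto)
    moreover have "0 \<le> ?T (\<lambda>y. ?m y + - 1 * p y) t" by (rule fwd_nonneg[OF L_add[OF m n] _ t]) (rule AE_I2, auto)
    ultimately
    show ?thesis unfolding a b by linarith
  qed
  have "(LINT t:{0..2}|lborel. \<bar>?T p t\<bar>) \<le> (LINT t:{0..2}|lborel. ?T ?m t)"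
  proof (rule set_integral_mono_AE)
    show "L (\<lambda>t. \<bar>?T p t\<bar>)" by (intro set_integrable_abs L_sol HL_L p)
    show "L (?T ?m)" by (intro L_sol HL_L m)
    show "AE t \<in> {0..2} in lborel. \<bar>?T p t\<bar> \<le> ?T ?m t"
      using AE_lborel_singleton[of 0] AE_lborel_singleton[of 2] by eventually_elim (auto intro!: le)
  qed
  also have "\<dots> = cv one (?T ?m) 2" by (simp add: cv_one)
  also have "\<dots> = cv (HR b) ?m 2 / \<beta> a b * cv one (HL a) 2 - cv one (cv W ?m) 2"
  proof -
    have "cv one (?T ?m) 2 = cv one (\<lambda>t. cv (HR b) ?m 2 / \<beta> a b * HL a t) 2 - cv one (cv W ?m) 2"
      unfolding sol_def[abs_def]
      by (intro cv_diff_right ci_one L_scale HL_L L_cv W_L m) auto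
    then show ?thesis by (simp only: cv_scale_right)
  qed
  finally have 1: "l * (LINT t:{0..2}|lborel. \<bar>?T p t\<bar>)
      \<le> l * (cv (HR b) ?m 2 / \<beta> a b * cv one (HL a) 2 - cv one (cv W ?m) 2)"
    using l_pos by (intro mult_left_mono) auto
  have "cv (HR b) ?m 2 * (l * cv one (HL a) 2) \<le> \<beta> a b * cv Z ?m 2"
  proof -
    have "cv ?m (\<lambda>y. (l * cv one (HL a) 2) * HR b y) 2 \<le> cv ?m (\<lambda>y. \<beta> a b * Z y) 2"
    proof (rule cv_mono)
      show "AE y in lborel. y \<in> {0..2} \<longrightarrow> l * cv one (HL a) 2 * HR b y \<le> \<beta> a b * Z y"
        by (rule AE_I2) (auto intro: green_mass)
    qed (auto intro!: ci_cont' m continuous_on_mult continuous_on_const HR_cont Z_cont)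
    then have "(l * cv one (HL a) 2) * cv ?m (HR b) 2 \<le> \<beta> a b * cv ?m Z 2" by (simp only: cv_scale_right)
    then show ?thesis by (simp add: cv_comm[of ?m] mult.commute)
  qed
  then have "cv (HR b) ?m 2 / \<beta> a b * (l * cv one (HL a) 2) \<le> cv Z ?m 2"
    using \<beta>_pos[of a b] by (simp add: divide_le_eq mult_ac)
  moreover have "cv Z ?m 2 = (LINT t:{0..2}|lborel. \<bar>p t\<bar>) + l * cv one (cv W ?m) 2"
    using cv_Z_eq[OF m, of 2] by (simp add: cv_one[of ?m])
  ultimately show ?thesis using 1 by (simp add: right_diff_distrib mult_ac)
qed

end

section \<open>Density of the domains\<close>

text \<open>The smooth approximant \<open>h\<close>, with \<open>r = h''\<close>, keeps the endpoint
  values of \<open>u\<close> and has \<open>h' = 0\<close> at both ends. It is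
  \<open>P o \<sigma>\<close>: the increasing map \<open>\<sigma>\<close> of \<open>[0,2]\<close>
  onto itself has critical points at 0 and 2, and the polynomial \<open>P\<close> approximates
  \<open>u\<close> composed with the inverse of \<open>\<sigma>\<close>.\<close>

lemma polynomial_approx:
  fixes u :: "real \<Rightarrow> real"
  assumes u: "continuous_on {0..2} u" and e: "e > 0"
  shows "\<exists>h0 r. continuous_on {0..2} r \<and> cv one r 2 = 0 \<and> h0 = u 0 \<and> h0 + cv one (cv one r) 2 = u 2 \<and>
    (\<forall>t\<in>{0..2}. \<bar>u t - (h0 + cv one (cv one r) t)\<bar> \<le> e)"
proof -
  define \<sigma> :: "real \<Rightarrow> real" where "\<sigma> t = t\<^sup>2 * (3 - t) / 2" for t
  have \<sigma>d: "(\<sigma> has_real_derivative 3 * t * (2 - t) / 2) (at t)" for t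
    unfolding \<sigma>_def by (auto intro!: derivative_eq_intros simp: power2_eq_square field_simps)
  have \<sigma>c: "continuous_on A \<sigma>" for A
    unfolding \<sigma>_def by (intro continuous_intros) auto
  have \<sigma>0: "\<sigma> 0 = 0" "\<sigma> 2 = 2" by (simp_all add: \<sigma>_def)
  have less: "\<sigma> x < \<sigma> y" if "0 \<le> x" "x < y" "y \<le> 2" for x y
    using that(2)
  proof (rule DERIV_pos_imp_increasing_open)
    fix t assume "x < t" "t < y"
    then show "\<exists>d. (\<sigma> has_real_derivative d) (at t) \<and> 0 < d"
      using \<sigma>d[of t] that by (intro exI conjI) (assumption, simp)
  qed (rule \<sigma>c)
  have inj: "inj_on \<sigma> {0..2}"
    by (rule linorder_inj_onI) (auto dest: less)
  have mono: "\<sigma> x \<le> \<sigma> y" if "0 \<le> x" "x \<le> y" "y \<le> 2" for x y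
    using less[of x y] that by (cases "x = y") auto
  define v where "v = u \<circ> the_inv_into {0..2} \<sigma>"
  have im: "\<sigma> ` {0..2} \<subseteq> {0..2}" using mono[of 0] mono[of _ 2] \<sigma>0 by auto
  have vc: "continuous_on (\<sigma> ` {0..2}) v"
    unfolding v_def
  proof (rule continuous_on_compose)
    show "continuous_on (\<sigma> ` {0..2}) (the_inv_into {0..2} \<sigma>)"
      by (rule continuous_on_inv[OF \<sigma>c]) (auto intro: the_inv_into_f_f[OF inj])
    have "the_inv_into {0..2} \<sigma> ` \<sigma> ` {0..2} \<subseteq> {0..2}" by (auto simp: the_inv_into_f_f[OF inj])
    then show "continuous_on (the_inv_into {0..2} \<sigma> ` \<sigma> ` {0..2}) u" by (rule continuous_on_subset[OF u])
  qed
  have v: "v (\<sigma> t) = u t" if "t \<in> {0..2}" for t using that by (simp add: v_def the_inv_into_f_f[OF inj])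
  obtain g where g: "real_polynomial_function g" "\<And>x. x \<in> \<sigma> ` {0..2} \<Longrightarrow> \<bar>v x - g x\<bar> < e / 4"
    using Stone_Weierstrass_real_polynomial_function[OF _ vc, of "e / 4"] e
    by (metis \<sigma>c compact_continuous_image compact_Icc zero_less_divide_iff zero_less_numeral)
  \<comment> \<open>An affine correction restores the endpoint values: \<open>A\<close> repairs the
    error at 0, and \<open>B\<close> what then remains at 2.\<close>
  define A where "A = u 0 - g 0"
  define B where "B = u 2 - g 2 - A"
  define P where "P x = g x + A + B / 2 * x" for x
  have AB: "\<bar>A\<bar> < e / 4" "\<bar>B + A\<bar> < e / 4"
  proof -
    have "0 \<in> \<sigma> ` {0..2}" "2 \<in> \<sigma> ` {0..2}"
      by (rule image_eqI[of _ _ 0]; simp add: \<sigma>0) (rule image_eqI[of _ _ 2]; simp add: \<sigma>0)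
    then show "\<bar>A\<bar> < e / 4" "\<bar>B + A\<bar> < e / 4"
      using g(2)[of 0] g(2)[of 2] v[of 0] v[of 2] by (simp_all add: A_def B_def \<sigma>0)
  qed
  have Pp: "real_polynomial_function P" unfolding P_def[abs_def]
    by (intro real_polynomial_function.intros g(1) bounded_linear_ident)
  define h where "h t = P (\<sigma> t)" for t
  have \<sigma>p: "real_polynomial_function \<sigma>"
  proof -
    have "real_polynomial_function (\<lambda>t :: real. (1/2) * (t ^ 2 * (3 - t)))"
      by (intro real_polynomial_function.intros real_polynomial_function_power real_polynomial_function_diff bounded_linear_ident)
    then show ?thesis by (simp add: \<sigma>_def[abs_def])
  qed
  have hp: "real_polynomial_function h"
    using real_polynomial_function_compose[OF \<sigma>p[unfolded real_polynomial_function_eq] Pp] by (simp add: h_def[abs_def] comp_def)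
  obtain P' where P': "\<And>x. (P has_real_derivative P' x) (at x)"
    using has_real_derivative_polynomial_function[OF Pp] by blast
  obtain h' where h': "real_polynomial_function h'" "\<And>x. (h has_real_derivative h' x) (at x)"
    using has_real_derivative_polynomial_function[OF hp] by blast
  obtain h'' where h'': "real_polynomial_function h''" "\<And>x. (h' has_real_derivative h'' x) (at x)"
    using has_real_derivative_polynomial_function[OF h'(1)] by blast
  have h'_eq: "h' t = P' (\<sigma> t) * (3 * t * (2 - t) / 2)" for t
  proof (rule DERIV_unique[OF h'(2)])
    show "(h has_real_derivative P' (\<sigma> t) * (3 * t * (2 - t) / 2)) (at t)"
      unfolding h_def[abs_def] by (rule DERIV_chain2[OF P' \<sigma>d])
  qed
  have FTC: "cv one w' t = w t - w 0"
    if "\<And>x. (w has_real_derivative w' x) (at x)" "real_polynomial_function w'" "t \<in> {0..2}" for w w' :: "real \<Rightarrow> real" and t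
  proof -
    have "isCont w' x" for x
      using that(2) continuous_polymonial_function[of w'] by (simp add: real_polynomial_function_eq)
    then have "(LINT x|lborel. w' x * indicator {0..t} x) = w t - w 0"
      using that by (intro integral_FTC_Icc_real) auto
    then show ?thesis by (simp add: cv_one set_lebesgue_integral_def mult.commute)
  qed
  have q: "cv one h'' t = h' t" if "t \<in> {0..2}" for t
    using FTC[OF h''(2,1) that] h'_eq[of 0] by simp
  have hh: "cv one (cv one h'') t = h t - h 0" if t: "t \<in> {0..2}" for t
  proof -
    have "cv one (cv one h'') t = cv one h' t" using t by (intro cv_cong_all q) auto
    then show ?thesis using FTC[OF h'(2,1) t] by simp
  qed
  have h0: "h 0 = u 0" "h 2 = u 2" by (simp_all add: h_def P_def \<sigma>0 A_def B_def field_simps)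
  have "\<bar>u t - h t\<bar> \<le> e" if t: "t \<in> {0..2}" for t
  proof -
    have s: "\<sigma> t \<in> {0..2}" using t im by blast
    have "\<bar>u t - g (\<sigma> t)\<bar> < e / 4" using g(2)[of "\<sigma> t"] v[OF t] t by auto
    moreover have "\<bar>B\<bar> < e / 2" using AB by linarith
    moreover have "\<bar>B / 2 * \<sigma> t\<bar> \<le> \<bar>B\<bar> * 1" using mult_left_mono[of "\<sigma> t" 2 "\<bar>B\<bar>"] s by (simp add: abs_mult)
    ultimately show ?thesis using AB unfolding h_def P_def by linarith
  qed
  then show ?thesis
    using q[of 2] h'_eq[of 2] hh h0 h''(1)
    by (intro exI[of _ "h 0"] exI[of _ h''])
      (auto intro: continuous_on_polymonial_function simp: real_polynomial_function_eq)
qed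

text \<open>A tent of height 1 and width \<open>\<eta>\<close> at the endpoint 2; in a convolution
  evaluated at 2 it meets the other factor near 0.\<close>

definition spike :: "real \<Rightarrow> real \<Rightarrow> real" where
  "spike \<eta> y = max 0 (1 - (2 - y) / \<eta>)"

lemma spike_facts:
  assumes "0 < \<eta>" "\<eta> \<le> 1"
  shows "continuous_on A (spike \<eta>)" "0 \<le> spike \<eta> y" "spike \<eta> 0 = 0" "spike \<eta> 2 = 1"
    "y < 2 - \<eta> \<Longrightarrow> spike \<eta> y = 0" "cv one (spike \<eta>) 2 \<le> \<eta>" "cv one (spike \<eta>) 2 > 0"
proof -
  show c: "continuous_on A (spike \<eta>)" for A unfolding spike_def[abs_def] using assms by (intro continuous_intros) auto
  show "0 \<le> spike \<eta> y" "spike \<eta> 2 = 1" by (auto simp: spike_def)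
  have "2 / \<eta> \<ge> 1" using assms by simp
  then show "spike \<eta> 0 = 0" by (simp add: spike_def)
  show z: "spike \<eta> y = 0" if "y < 2 - \<eta>" for y using that assms by (simp add: spike_def field_simps)
  have m: "cv one (indicator {2 - d..2}) 2 = d" if "0 \<le> d" "d \<le> 1" for d
  proof -
    have "{0..2} \<inter> {2 - d..2} = {2 - d..2}" using that by auto
    then show ?thesis using that by (simp add: cv_one set_lebesgue_integral_def indicator_inter_arith[symmetric])
  qed
  have i: "L (indicator {2 - d..2})" for d
    unfolding set_integrable_def
    by (auto simp: indicator_inter_arith[symmetric] emeasure_lborel_Icc_eq intro!: integrable_real_indicator)
  have "cv one (spike \<eta>) 2 \<le> cv one (indicator {2 - \<eta>..2}) 2"
    by (rule cv_mono) (use assms z in \<open>auto intro!: ci_one L_continuous c i AE_I2 simp: indicator_def\<close>,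
        simp_all add: spike_def)
  then show "cv one (spike \<eta>) 2 \<le> \<eta>" using m[of \<eta>] assms by simp
  have "cv one (\<lambda>y. 1/2 * indicator {2 - \<eta> / 2..2} y) 2 \<le> cv one (spike \<eta>) 2"
  proof (rule cv_mono)
    show "ci one (\<lambda>y. 1/2 * indicator {2 - \<eta> / 2..2} y) 2" by (rule ci_scale_right[OF ci_one[OF i]]) simp
    show "ci one (spike \<eta>) 2" by (rule ci_one[OF L_continuous[OF c]]) simp
  qed (use assms in \<open>auto intro!: AE_I2 simp: indicator_def spike_def field_simps\<close>)
  then show "cv one (spike \<eta>) 2 > 0" unfolding cv_scale_right using m[of "\<eta> / 2"] assms by simp
qed

context scale_fn begin

text \<open>The spike sees \<open>Z\<close> where it is at least 1 and \<open>W\<close> where it is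
  close to \<open>W 0 = 0\<close>. So the convolution with \<open>Z\<close> at 2 can be given any
  value while the convolution with \<open>W\<close> stays uniformly small.\<close>

lemma correction_Z:
  assumes e: "e > 0"
  shows "\<exists>\<rho>. continuous_on {0..2} \<rho> \<and> \<rho> 0 = 0 \<and> cv Z \<rho> 2 = \<delta> \<and> (\<forall>t\<in>{0..2}. \<bar>cv W \<rho> t\<bar> \<le> e)"
proof -
  \<comment> \<open>The multiple of the spike that produces \<open>\<delta>\<close> moves the
    convolution with \<open>W\<close> by at most \<open>\<bar>\<delta>\<bar> * d <= e\<close>; the
    summand 1 covers \<open>\<delta> = 0\<close>.\<close>
  define d where "d = e / (\<bar>\<delta>\<bar> + 1)"
  have d: "d > 0" using e by (simp add: d_def)
  have "(W \<longlongrightarrow> W 0) (at 0 within {0..2})" using W_cont by (auto simp: continuous_on_def)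
  then have "eventually (\<lambda>x. W x < d) (at 0 within {0..2})" using d by (intro order_tendstoD) (auto simp: W_0)
  then obtain r where r: "r > 0" "\<And>x. x \<in> {0..2} \<Longrightarrow> x \<noteq> 0 \<Longrightarrow> dist x 0 < r \<Longrightarrow> W x < d"
    unfolding eventually_at by blast
  define \<eta> where "\<eta> = min 1 (r / 2)"
  have \<eta>: "0 < \<eta>" "\<eta> \<le> 1" "\<eta> < r" using r(1) by (auto simp: \<eta>_def min_def)
  have Wd: "W x \<le> d" if "0 \<le> x" "x \<le> \<eta>" for x
    using r(2)[of x] that \<eta> d by (cases "x = 0") (auto simp: W_0 dist_real_def)
  note sp = spike_facts[OF \<eta>(1,2)]
  have spL: "L (spike \<eta>)" by (rule L_continuous[OF sp(1)])
  have Z: "cv one (spike \<eta>) 2 \<le> cv Z (spike \<eta>) 2"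
  proof -
    have "cv (spike \<eta>) one 2 \<le> cv (spike \<eta>) Z 2"
      by (rule cv_mono) (auto intro!: ci_cont sp L_const Z_L AE_I2 Z_ge_1)
    then show ?thesis by (simp only: cv_comm[of "spike \<eta>"])
  qed
  have Zp: "cv Z (spike \<eta>) 2 > 0" using Z sp(7) by linarith
  have W: "0 \<le> cv W (spike \<eta>) t" "cv W (spike \<eta>) t \<le> d * cv Z (spike \<eta>) 2" if t: "t \<in> {0..2}" for t
  proof -
    show "0 \<le> cv W (spike \<eta>) t" by (rule cv_nonneg) (auto intro!: AE_I2 mult_nonneg_nonneg W_nonneg sp(2))
    have "cv W (spike \<eta>) t = (LINT y:{0..t}|lborel. W (t - y) * spike \<eta> y)" by (simp add: cv_def)
    also have "\<dots> \<le> (LINT y:{0..2}|lborel. d * spike \<eta> y)"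
      unfolding set_lebesgue_integral_def
    proof (rule integral_mono)
      show "integrable lborel (\<lambda>y. indicator {0..t} y *\<^sub>R (W (t - y) * spike \<eta> y))"
        using ci_cont[OF W_cont spL t] by (simp add: ci_def set_integrable_def)
      show "integrable lborel (\<lambda>y. indicator {0..2} y *\<^sub>R (d * spike \<eta> y))"
        using L_scale[OF spL] by (simp add: set_integrable_def)
      fix y :: real
      have "W (t - y) * spike \<eta> y \<le> d * spike \<eta> y" if "y \<in> {0..t}"
      proof (cases "y < 2 - \<eta>")
        case False
        then show ?thesis using that t by (intro mult_right_mono Wd sp(2)) auto
      qed (simp add: sp(5))
      then show "indicator {0..t} y *\<^sub>R (W (t - y) * spike \<eta> y) \<le> indicator {0..2} y *\<^sub>R (d * spike \<eta> y)"
        using t d sp(2)[of y] by (auto simp: indicator_def)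
    qed
    also have "\<dots> = d * cv one (spike \<eta>) 2" by (simp add: cv_one)
    also have "\<dots> \<le> d * cv Z (spike \<eta>) 2" using Z d by (intro mult_left_mono) auto
    finally show "cv W (spike \<eta>) t \<le> d * cv Z (spike \<eta>) 2" .
  qed
  define \<kappa> where "\<kappa> = \<delta> / cv Z (spike \<eta>) 2"
  show ?thesis
  proof (intro exI[of _ "\<lambda>y. \<kappa> * spike \<eta> y"] conjI ballI)
    show "continuous_on {0..2} (\<lambda>y. \<kappa> * spike \<eta> y)" by (intro continuous_on_mult continuous_on_const sp(1))
    show "\<kappa> * spike \<eta> 0 = 0" by (simp add: sp(3))
    show "cv Z (\<lambda>y. \<kappa> * spike \<eta> y) 2 = \<delta>"
      unfolding cv_scale_right using Zp by (simp add: \<kappa>_def)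
    fix t :: real assume t: "t \<in> {0..2}"
    have "\<bar>cv W (\<lambda>y. \<kappa> * spike \<eta> y) t\<bar> = \<bar>\<kappa>\<bar> * cv W (spike \<eta>) t" using W(1)[OF t] by (simp add: cv_scale_right abs_mult)
    also have "\<dots> \<le> \<bar>\<kappa>\<bar> * (d * cv Z (spike \<eta>) 2)" using W(2)[OF t] by (intro mult_left_mono) auto
    also have "\<dots> = \<bar>\<delta>\<bar> * d" using Zp by (simp add: \<kappa>_def)
    also have "\<dots> \<le> e" using e by (simp add: d_def field_simps)
    finally show "\<bar>cv W (\<lambda>y. \<kappa> * spike \<eta> y) t\<bar> \<le> e" .
  qed
qed

text \<open>A narrow spike takes a prescribed value at 2 but has a small integral, so the solution
  hardly changes.\<close>

lemma correction_W:
  assumes e: "e > 0" and H: "continuous_on {0..2} H"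
  shows "\<exists>\<rho>. continuous_on {0..2} \<rho> \<and> \<rho> 0 = 0 \<and> \<rho> 2 = v \<and> (\<forall>t\<in>{0..2}. \<bar>sol H W b \<rho> t\<bar> \<le> e)"
proof -
  obtain M where M: "\<And>y. y \<in> {0..2} \<Longrightarrow> \<bar>W y\<bar> \<le> M" using continuous_bound[OF W_cont] by blast
  obtain N where N: "\<And>y. y \<in> {0..2} \<Longrightarrow> \<bar>H y\<bar> \<le> N" using continuous_bound[OF H] by blast
  have MN: "0 \<le> M" "0 \<le> N" using M[of 0] N[of 0] by force+
  \<comment> \<open>The effect of a spike on the solution per unit of width: first through the
    coefficient of \<open>H\<close>, then through the convolution with \<open>W\<close>.\<close>
  define K where "K = M / \<bar>b\<bar> * N + M"
  have K: "K \<ge> 0" using MN by (simp add: K_def)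
  define \<eta> where "\<eta> = min 1 (e / (\<bar>v\<bar> * K + 1))"
  have vK: "0 \<le> \<bar>v\<bar> * K" using K by simp
  have \<eta>: "0 < \<eta>" "\<eta> \<le> 1" using e vK by (auto simp: \<eta>_def add_nonneg_pos)
  note sp = spike_facts[OF \<eta>]
  have b: "\<bar>cv W (spike \<eta>) t\<bar> \<le> M * \<eta>" if "t \<in> {0..2}" for t
  proof -
    have "\<bar>cv W (spike \<eta>) t\<bar> \<le> M * (LINT y:{0..2}|lborel. \<bar>spike \<eta> y\<bar>)"
      by (rule cv_bound[OF W_cont L_continuous[OF sp(1)] _ M]) (use that in auto)
    also have "(LINT y:{0..2}|lborel. \<bar>spike \<eta> y\<bar>) = cv one (spike \<eta>) 2" by (simp add: cv_one sp(2))
    also have "M * cv one (spike \<eta>) 2 \<le> M * \<eta>" using sp(6) MN by (intro mult_left_mono)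
    finally show ?thesis .
  qed
  show ?thesis
  proof (intro exI[of _ "\<lambda>y. v * spike \<eta> y"] conjI ballI)
    show "continuous_on {0..2} (\<lambda>y. v * spike \<eta> y)" by (intro continuous_on_mult continuous_on_const sp(1))
    show "v * spike \<eta> 0 = 0" "v * spike \<eta> 2 = v" by (simp_all add: sp(3,4))
    fix t :: real assume t: "t \<in> {0..2}"
    have "\<bar>cv W (spike \<eta>) 2 / b * H t\<bar> = \<bar>cv W (spike \<eta>) 2\<bar> / \<bar>b\<bar> * \<bar>H t\<bar>" by (simp add: abs_mult)
    also have "\<dots> \<le> M * \<eta> / \<bar>b\<bar> * N"
      using b[of 2] N[OF t] MN \<eta> by (intro mult_mono divide_right_mono) auto
    finally have 1: "\<bar>cv W (spike \<eta>) 2 / b * H t\<bar> \<le> M * \<eta> / \<bar>b\<bar> * N" .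
    have "\<bar>sol H W b (spike \<eta>) t\<bar> \<le> \<bar>cv W (spike \<eta>) 2 / b * H t\<bar> + \<bar>cv W (spike \<eta>) t\<bar>"
      unfolding sol_def by (rule abs_triangle_ineq4)
    also have "\<dots> \<le> M * \<eta> / \<bar>b\<bar> * N + M * \<eta>" by (rule add_mono[OF 1 b[OF t]])
    also have "\<dots> = K * \<eta>" by (simp add: K_def distrib_right)
    finally have "\<bar>sol H W b (spike \<eta>) t\<bar> \<le> K * \<eta>" .
    then have "\<bar>v\<bar> * \<bar>sol H W b (spike \<eta>) t\<bar> \<le> \<bar>v\<bar> * (K * \<eta>)" by (intro mult_left_mono) auto
    also have "\<dots> \<le> \<bar>v\<bar> * K * (e / (\<bar>v\<bar> * K + 1))"
      unfolding mult.assoc[symmetric] using K by (intro mult_left_mono) (auto simp: \<eta>_def)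
    also have "\<dots> \<le> e" using vK e by (simp add: field_simps)
    finally show "\<bar>sol H W b (\<lambda>y. v * spike \<eta> y) t\<bar> \<le> e" by (simp add: sol_scale abs_mult)
  qed
qed

text \<open>Since \<open>h' = 1 * r\<close> vanishes at 0, the flux \<open>F * h'\<close> has the
  derivative \<open>F * r\<close>. So \<open>p\<close> is the right-hand side of the resolvent
  equation for \<open>h\<close>, and uniqueness expresses \<open>h\<close> and \<open>h'\<close>
  through \<open>p\<close>.\<close>

lemma smooth_rep:
  fixes h0 :: real
  assumes r: "continuous_on {0..2} r" and p_def: "p = (\<lambda>t. l * (h0 + cv one (cv one r) t) - cv F r t)"
  shows "continuous_on {0..2} p" "p 0 = l * h0"
    "\<And>t. t \<in> {0..2} \<Longrightarrow> h0 + cv one (cv one r) t = h0 * Z t - cv W p t"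
    "\<And>t. t \<in> {0..2} \<Longrightarrow> cv one r t = h0 * (l * W t) - cv k p t"
proof -
  have rL: "L r" by (rule L_continuous[OF r])
  have qL: "L (cv one r)" by (rule L_cv[OF L_const rL])
  have \<gamma>: "continuous_on {0..2} (cv F r)" by (rule continuous_cv'[OF r F_L])
  show pc: "continuous_on {0..2} p"
    unfolding p_def
    by (intro continuous_on_diff continuous_on_mult continuous_on_add continuous_on_const \<gamma> continuous_cv[OF continuous_on_const qL])
  have pL: "L p" by (rule L_continuous[OF pc])
  show "p 0 = l * h0" by (simp add: p_def cv_at_0)
  have ae: "AE x in lborel. x \<in> {0..2} \<longrightarrow> cv F (cv one r) x = 0 + cv one (cv F r) x"
    by (rule AE_I2) (simp add: cv_one_assoc'[OF F_L rL])
  show h: "h0 + cv one (cv one r) t = h0 * Z t - cv W p t" if "t \<in> {0..2}" for t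
    using uniqueness[OF qL L_continuous[OF \<gamma>] ae that, where ?f0.0 = h0] by (simp add: p_def)
  define q where "q = (\<lambda>x. h0 * (l * W x) + 0 * k x - cv k p x)"
  have q: "L q" "\<And>t. t \<in> {0..2} \<Longrightarrow> h0 * Z t + 0 * W t - cv W p t = h0 + cv one q t"
    using solution(3,4)[OF pL, where ?f0.0 = h0 and c = 0] unfolding q_def by blast+
  have "AE x in lborel. x \<in> {0..2} \<longrightarrow> cv one r x = q x"
    by (rule L_cv_one_cong[OF qL q(1)]) (use h q(2) in force)
  then have "cv one r t = q t" if "t \<in> {0..2}" for t
  proof (rule AE_eq_continuous[OF _ _ _ that])
    show "continuous_on {0..2} (cv one r)" by (rule continuous_cv[OF continuous_on_const rL])
    have "q = (\<lambda>x. h0 * (l * W x) - cv k p x)" by (simp add: q_def)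
    then show "continuous_on {0..2} q"
      by (auto intro!: continuous_on_diff continuous_on_mult continuous_on_const W_cont continuous_cv' pc k_L)
  qed
  then show "cv one r t = h0 * (l * W t) - cv k p t" if "t \<in> {0..2}" for t using that by (simp add: q_def)
qed

text \<open>The approximant \<open>h\<close> meets the start condition and, as \<open>h' = 0\<close>
  at 2, also the end condition N*. For D at the end \<open>h\<close> is admissible but
  \<open>p 2\<close> need not be 0, as membership in the space demands; for N the flux at the end
  has to be removed. Spikes do both.\<close>

lemma back_dense:
  assumes u: "continuous_on {0..2} u" and bc: "b = Right_D \<Longrightarrow> u 0 = 0" "a = Left_D \<Longrightarrow> u 2 = 0" and e: "e > 0"
  shows "\<exists>p. continuous_on {0..2} p \<and> (b = Right_D \<longrightarrow> p 0 = 0) \<and> (a = Left_D \<longrightarrow> p 2 = 0) \<and>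
    (\<forall>t\<in>{0..2}. \<bar>u t - sol (HR b) (HL a) (\<beta> a b) p t\<bar> \<le> e)"
proof -
  have e2: "e / 2 > 0" using e by simp
  obtain h0 r where r: "continuous_on {0..2} r" and q2: "cv one r 2 = 0" and h0: "h0 = u 0"
    and h2: "h0 + cv one (cv one r) 2 = u 2"
    and ap: "\<And>t. t \<in> {0..2} \<Longrightarrow> \<bar>u t - (h0 + cv one (cv one r) t)\<bar> \<le> e / 2"
    using polynomial_approx[OF u e2] by blast
  define h where "h t = h0 + cv one (cv one r) t" for t
  define p where "p = (\<lambda>t. l * (h0 + cv one (cv one r) t) - cv F r t)"
  note rep = smooth_rep[OF r p_def]
  have pL: "L p" by (rule L_continuous[OF rep(1)])
  have p0: "p 0 = 0" if "b = Right_D" using rep(2) bc(1)[OF that] h0 by simp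
  have h: "h t = h0 * HR b t - cv W p t" if "t \<in> {0..2}" for t
    using rep(3)[OF that] bc(1) h0 by (cases b) (auto simp: h_def)
  have "\<exists>\<rho>. continuous_on {0..2} \<rho> \<and> \<rho> 0 = 0 \<and> (a = Left_D \<longrightarrow> p 2 + \<rho> 2 = 0) \<and>
    (\<forall>t\<in>{0..2}. \<bar>h t - sol (HR b) (HL a) (\<beta> a b) (\<lambda>t. p t + \<rho> t) t\<bar> \<le> e / 2)"
  proof (cases a)
    case Left_D
    obtain \<rho> where \<rho>: "continuous_on {0..2} \<rho>" "\<rho> 0 = 0" "\<rho> 2 = - p 2"
      "\<And>t. t \<in> {0..2} \<Longrightarrow> \<bar>sol (HR b) W (\<beta> a b) \<rho> t\<bar> \<le> e / 2"
      using correction_W[OF e2 HR_cont, of "- p 2" b "\<beta> a b"] by blast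
    have "h0 * \<beta> a b = cv W p 2" using h[of 2] bc(2)[OF Left_D] h2 Left_D by (cases b) (auto simp: h_def)
    then have A: "cv W p 2 / \<beta> a b = h0" using \<beta>_pos[of a b] by (simp add: field_simps)
    have "sol (HR b) (HL a) (\<beta> a b) (\<lambda>t. p t + \<rho> t) t = h t + sol (HR b) W (\<beta> a b) \<rho> t" if t: "t \<in> {0..2}" for t
    proof -
      have "sol (HR b) W (\<beta> a b) (\<lambda>t. p t + \<rho> t) t = sol (HR b) W (\<beta> a b) p t + sol (HR b) W (\<beta> a b) \<rho> t"
        by (rule sol_add[OF _ _ pL L_continuous[OF \<rho>(1)] t]; rule ci_cont[OF W_cont]) (auto intro: pL L_continuous[OF \<rho>(1)])
      moreover have "sol (HR b) W (\<beta> a b) p t = h t" using h[OF t] A by (simp add: sol_def)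
      ultimately show ?thesis using Left_D by simp
    qed
    then show ?thesis using \<rho> by (intro exI[of _ \<rho>]) auto
  next
    case Left_N
    obtain \<rho> where \<rho>: "continuous_on {0..2} \<rho>" "\<rho> 0 = 0" "cv Z \<rho> 2 = h0 * \<beta> a b - cv Z p 2"
      "\<And>t. t \<in> {0..2} \<Longrightarrow> \<bar>cv W \<rho> t\<bar> \<le> e / 2"
      using correction_Z[OF e2, of "h0 * \<beta> a b - cv Z p 2"] by blast
    have \<rho>L: "L \<rho>" by (rule L_continuous[OF \<rho>(1)])
    have "cv Z (\<lambda>t. p t + \<rho> t) 2 = h0 * \<beta> a b"
      using \<rho>(3) cv_add_right[OF ci_cont[OF Z_cont pL] ci_cont[OF Z_cont \<rho>L], of 2] by simp
    then have A: "cv Z (\<lambda>t. p t + \<rho> t) 2 / \<beta> a b = h0" using \<beta>_pos[of a b] by simp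
    have "sol (HR b) (HL a) (\<beta> a b) (\<lambda>t. p t + \<rho> t) t = h t - cv W \<rho> t" if t: "t \<in> {0..2}" for t
      using cv_add_right[OF ci_cont[OF W_cont pL t] ci_cont[OF W_cont \<rho>L t]] h[OF t] A Left_N by (simp add: sol_def)
    then show ?thesis using \<rho> Left_N by (intro exI[of _ \<rho>]) auto
  next
    case Left_Nstar
    have "h0 * \<beta> a b = cv k p 2" using rep(4)[of 2] q2 bc(1) h0 Left_Nstar by (cases b) auto
    then have "cv (HL a) p 2 / \<beta> a b = h0" using \<beta>_pos[of a b] Left_Nstar by (simp add: field_simps)
    then have "sol (HR b) (HL a) (\<beta> a b) (\<lambda>t. p t + 0) t = h t" if t: "t \<in> {0..2}" for t
      using h[OF t] by (simp add: sol_def)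
    then show ?thesis using Left_Nstar e by (intro exI[of _ "\<lambda>_. 0"]) auto
  qed
  then obtain \<rho> where \<rho>: "continuous_on {0..2} \<rho>" "\<rho> 0 = 0" "a = Left_D \<longrightarrow> p 2 + \<rho> 2 = 0"
    "\<And>t. t \<in> {0..2} \<Longrightarrow> \<bar>h t - sol (HR b) (HL a) (\<beta> a b) (\<lambda>t. p t + \<rho> t) t\<bar> \<le> e / 2" by blast
  show ?thesis
  proof (intro exI[of _ "\<lambda>t. p t + \<rho> t"] conjI ballI)
    show "continuous_on {0..2} (\<lambda>t. p t + \<rho> t)" by (intro continuous_on_add rep(1) \<rho>(1))
    fix t :: real assume t: "t \<in> {0..2}"
    show "\<bar>u t - sol (HR b) (HL a) (\<beta> a b) (\<lambda>t. p t + \<rho> t) t\<bar> \<le> e"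
      using ap[OF t] \<rho>(4)[OF t] unfolding h_def by linarith
  qed (use p0 \<rho> in auto)
qed

text \<open>Functions that vanish at both ends are dense in \<open>L1\<close>. For them the
  homogeneous solution can be given the coefficient 0, and only a flux condition at 2 calls for a
  correction.\<close>

lemma fwd_dense:
  assumes u: "continuous_on {0..2} u" and bc: "u 0 = 0" "u 2 = 0" and e: "e > 0"
  shows "\<exists>p. continuous_on {0..2} p \<and> (\<forall>t\<in>{0..2}. \<bar>u t - sol (HL a) (HR b) (\<beta> a b) p t\<bar> \<le> e)"
proof -
  have e2: "e / 2 > 0" using e by simp
  obtain h0 r where r: "continuous_on {0..2} r" and q2: "cv one r 2 = 0" and h0: "h0 = u 0"
    and h2: "h0 + cv one (cv one r) 2 = u 2"
    and ap: "\<And>t. t \<in> {0..2} \<Longrightarrow> \<bar>u t - (h0 + cv one (cv one r) t)\<bar> \<le> e / 2"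
    using polynomial_approx[OF u e2] by blast
  define h where "h t = h0 + cv one (cv one r) t" for t
  define p where "p = (\<lambda>t. l * (h0 + cv one (cv one r) t) - cv F r t)"
  note rep = smooth_rep[OF r p_def]
  have pL: "L p" by (rule L_continuous[OF rep(1)])
  have h: "h t = - cv W p t" if "t \<in> {0..2}" for t
    using rep(3)[OF that] bc(1) h0 by (auto simp: h_def)
  have "\<exists>\<rho>. continuous_on {0..2} \<rho> \<and>
    (\<forall>t\<in>{0..2}. \<bar>h t - sol (HL a) (HR b) (\<beta> a b) (\<lambda>t. p t + \<rho> t) t\<bar> \<le> e / 2)"
  proof (cases b)
    case Right_D
    have "cv W p 2 = 0" using h[of 2] bc h2 by (simp add: h_def)
    then have "sol (HL a) (HR b) (\<beta> a b) (\<lambda>t. p t + 0) t = h t" if t: "t \<in> {0..2}" for t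
      using h[OF t] Right_D by (simp add: sol_def)
    then show ?thesis using e by (intro exI[of _ "\<lambda>_. 0"]) auto
  next
    case Right_N
    obtain \<rho> where \<rho>: "continuous_on {0..2} \<rho>" "cv Z \<rho> 2 = - cv Z p 2"
      "\<And>t. t \<in> {0..2} \<Longrightarrow> \<bar>cv W \<rho> t\<bar> \<le> e / 2"
      using correction_Z[OF e2, of "- cv Z p 2"] by blast
    have \<rho>L: "L \<rho>" by (rule L_continuous[OF \<rho>(1)])
    have "cv Z (\<lambda>t. p t + \<rho> t) 2 = 0"
      using \<rho>(2) cv_add_right[OF ci_cont[OF Z_cont pL] ci_cont[OF Z_cont \<rho>L], of 2] by simp
    then have "sol (HL a) (HR b) (\<beta> a b) (\<lambda>t. p t + \<rho> t) t = h t - cv W \<rho> t" if t: "t \<in> {0..2}" for t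
      using cv_add_right[OF ci_cont[OF W_cont pL t] ci_cont[OF W_cont \<rho>L t]] h[OF t] Right_N by (simp add: sol_def)
    then show ?thesis using \<rho> by (intro exI[of _ \<rho>]) auto
  qed
  then obtain \<rho> where \<rho>: "continuous_on {0..2} \<rho>"
    "\<And>t. t \<in> {0..2} \<Longrightarrow> \<bar>h t - sol (HL a) (HR b) (\<beta> a b) (\<lambda>t. p t + \<rho> t) t\<bar> \<le> e / 2" by blast
  show ?thesis
  proof (intro exI[of _ "\<lambda>t. p t + \<rho> t"] conjI ballI)
    show "continuous_on {0..2} (\<lambda>t. p t + \<rho> t)" by (intro continuous_on_add rep(1) \<rho>(1))
    fix t :: real assume t: "t \<in> {0..2}"
    show "\<bar>u t - sol (HL a) (HR b) (\<beta> a b) (\<lambda>t. p t + \<rho> t) t\<bar> \<le> e"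
      using ap[OF t] \<rho>(2)[OF t] unfolding h_def by linarith
  qed
qed

end

text \<open>Regularity of Lebesgue measure traps the set between a closed \<open>K\<close> and an
  open \<open>U\<close>. A Urysohn function for \<open>K\<close> and the complement of
  \<open>U\<close>, the latter cut to \<open>(0,2)\<close>, differs from the indicator only on a set
  of small measure.\<close>

lemma indicator_approx:
  fixes A :: "real set" and e :: real
  assumes A: "A \<in> sets borel" and e: "e > 0"
  shows "\<exists>g. continuous_on UNIV g \<and> (\<forall>x. x \<notin> {0<..<2} \<longrightarrow> g x = 0) \<and>
    (LINT x:{0..2}|lborel. \<bar>indicator A x - g x\<bar>) \<le> e"
proof -
  define B where "B = A \<inter> {0<..<2}"
  have B: "B \<in> sets borel" "B \<in> sets lebesgue" using A by (auto simp: B_def)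
  have e2: "e / 2 > 0" using e by simp
  obtain U where U: "open U" "B \<subseteq> U" "emeasure lebesgue (U - B) < e / 2"
    using sets_lebesgue_outer_open[OF B(2) e2] by metis
  obtain K where K: "closed K" "K \<subseteq> B" "emeasure lebesgue (B - K) < e / 2"
    using sets_lebesgue_inner_closed[OF B(2) e2] by metis
  define D where "D = (U \<inter> {0<..<2}) - K"
  have Db: "D \<in> sets borel" using U(1) K(1) by (auto simp: D_def)
  have "emeasure lborel D \<le> emeasure lborel ((U - B) \<union> (B - K))"
    using U(1) K(1) B(1) by (intro emeasure_mono) (auto simp: D_def)
  also have "\<dots> \<le> emeasure lborel (U - B) + emeasure lborel (B - K)"
    using U(1) K(1) B(1) by (intro emeasure_subadditive) auto
  also have "\<dots> \<le> ennreal (e / 2) + ennreal (e / 2)"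
    using U K B(1) by (intro add_mono) (auto intro: less_imp_le)
  also have "\<dots> = ennreal e" using e by (simp add: ennreal_plus[symmetric] del: ennreal_plus)
  finally have De: "emeasure lborel D \<le> ennreal e" .
  obtain g :: "real \<Rightarrow> real" where g: "continuous_on UNIV g" "\<And>x. g x \<in> closed_segment 0 1"
    "\<And>x. x \<in> - (U \<inter> {0<..<2}) \<Longrightarrow> g x = 0" "\<And>x. x \<in> K \<Longrightarrow> g x = 1"
  proof (rule Urysohn_local[of UNIV "- (U \<inter> {0<..<2})" K "0::real" 1])
    have "closed (- (U \<inter> {0<..<2}))" using U(1) by (intro closed_Compl open_Int) auto
    then show "closedin (top_of_set UNIV) (- (U \<inter> {0<..<2}))" by simp
    show "closedin (top_of_set UNIV) K" using K(1) by simp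
    show "- (U \<inter> {0<..<2}) \<inter> K = {}" using K(2) U(2) by (auto simp: B_def)
  qed auto
  have g01: "0 \<le> g x" "g x \<le> 1" for x using g(2)[of x] by (auto simp: closed_segment_eq_real_ivl)
  have "(LINT x:{0..2}|lborel. \<bar>indicator A x - g x\<bar>) \<le> (LINT x|lborel. indicator D x)"
    unfolding set_lebesgue_integral_def
  proof (rule integral_mono_AE)
    have gm: "g \<in> borel_measurable borel" by (rule borel_measurable_continuous_onI[OF g(1)])
    show "integrable lborel (\<lambda>x. indicator {0..2} x *\<^sub>R \<bar>indicator A x - g x\<bar>)"
    proof (rule Bochner_Integration.integrable_bound)
      show "integrable lborel (indicator {0..2::real} :: real \<Rightarrow> real)" by (rule integrable_real_indicator) auto
      show "(\<lambda>x. indicator {0..2} x *\<^sub>R \<bar>indicator A x - g x\<bar>) \<in> borel_measurable lborel"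
        using gm A by measurable
      show "AE x in lborel. norm (indicator {0..2} x *\<^sub>R \<bar>indicator A x - g x\<bar>) \<le> norm (indicator {0..2} x :: real)"
      proof (rule AE_I2)
        fix x :: real
        show "norm (indicator {0..2} x *\<^sub>R \<bar>indicator A x - g x\<bar>) \<le> norm (indicator {0..2} x :: real)"
          using g01[of x] by (auto simp: indicator_def)
      qed
    qed
    show "integrable lborel (indicator D :: real \<Rightarrow> real)"
      using Db De by (intro integrable_real_indicator) (auto intro: le_less_trans)
    show "AE x in lborel. indicator {0..2} x *\<^sub>R \<bar>indicator A x - g x\<bar> \<le> indicator D x"
      using AE_lborel_singleton[of 0] AE_lborel_singleton[of 2]
    proof eventually_elim
      case (elim x)
      consider "x \<in> K" | "x \<in> D" | "x \<notin> U \<inter> {0<..<2}" by (auto simp: D_def)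
      then show ?case
      proof cases
        case 1
        then show ?thesis using K(2) g(4) by (auto simp: B_def indicator_def)
      next
        case 2
        then show ?thesis using g01[of x] by (auto simp: indicator_def)
      next
        case 3
        then have "g x = 0" by (intro g(3)) auto
        moreover have "x \<in> {0..2} \<Longrightarrow> x \<notin> A" using 3 U(2) elim by (auto simp: B_def)
        ultimately show ?thesis by (auto simp: indicator_def)
      qed
    qed
  qed
  also have "\<dots> = measure lborel D" by simp
  also have "\<dots> \<le> e" using De e by (simp add: measure_def enn2real_leI)
  finally show ?thesis using g(1,3) by (intro exI[of _ g]) auto
qed

lemma L_integrable: "integrable lborel f \<Longrightarrow> L f"
  unfolding set_integrable_def by (rule integrable_mult_indicator) simp_all

text \<open>The class of functions that can be approximated contains the indicators and is stable
  under sums and dominated limits. Approximants vanishing at 0 and 2 are what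
  \<open>fwd_dense\<close> can handle.\<close>

lemma continuous_dense_L1:
  fixes f :: "real \<Rightarrow> real"
  assumes "integrable lborel f"
  shows "\<forall>e>0. \<exists>g. continuous_on UNIV g \<and> (\<forall>x. x \<notin> {0<..<2} \<longrightarrow> g x = 0) \<and>
    (LINT x:{0..2}|lborel. \<bar>f x - g x\<bar>) \<le> e"
  using assms
proof (induction rule: integrable_induct)
  case (base A c)
  show ?case
  proof (intro allI impI)
    fix e :: real assume e: "e > 0"
    then have "e / (\<bar>c\<bar> + 1) > 0" by (simp add: add_nonneg_pos)
    from indicator_approx[OF _ this, of A] base obtain g where g: "continuous_on UNIV g" "\<And>x. x \<notin> {0<..<2} \<Longrightarrow> g x = 0"
      "(LINT x:{0..2}|lborel. \<bar>indicator A x - g x\<bar>) \<le> e / (\<bar>c\<bar> + 1)" by auto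
    have "(LINT x:{0..2}|lborel. \<bar>indicator A x *\<^sub>R c - c * g x\<bar>) = (LINT x:{0..2}|lborel. \<bar>c\<bar> * \<bar>indicator A x - g x\<bar>)"
      by (intro arg_cong[where f = "set_lebesgue_integral lborel {0..2}"] ext) (simp add: abs_mult[symmetric] algebra_simps)
    also have "\<dots> \<le> \<bar>c\<bar> * (e / (\<bar>c\<bar> + 1))" using mult_left_mono[OF g(3), of "\<bar>c\<bar>"] by simp
    also have "\<dots> \<le> e" using e by (simp add: field_simps)
    finally show "\<exists>g. continuous_on UNIV g \<and> (\<forall>x. x \<notin> {0<..<2} \<longrightarrow> g x = 0) \<and>
      (LINT x:{0..2}|lborel. \<bar>indicator A x *\<^sub>R c - g x\<bar>) \<le> e"
      using g(1,2) by (intro exI[of _ "\<lambda>x. c * g x"]) (auto intro: continuous_on_mult continuous_on_const)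
  qed
next
  case (add f1 f2)
  show ?case
  proof (intro allI impI)
    fix e :: real assume e: "e > 0"
    have e2: "e / 2 > 0" using e by simp
    obtain g1 where g1: "continuous_on UNIV g1" "\<And>x. x \<notin> {0<..<2} \<Longrightarrow> g1 x = 0"
      "(LINT x:{0..2}|lborel. \<bar>f1 x - g1 x\<bar>) \<le> e / 2" using add.IH(1) e2 by blast
    obtain g2 where g2: "continuous_on UNIV g2" "\<And>x. x \<notin> {0<..<2} \<Longrightarrow> g2 x = 0"
      "(LINT x:{0..2}|lborel. \<bar>f2 x - g2 x\<bar>) \<le> e / 2" using add.IH(2) e2 by blast
    have fL: "L f1" "L f2" using add.hyps by (auto intro: L_integrable)
    have gL: "L g1" "L g2" using g1(1) g2(1) by (auto intro!: L_continuous elim: continuous_on_subset)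
    have i: "L (\<lambda>x. \<bar>f1 x - g1 x\<bar>)" "L (\<lambda>x. \<bar>f2 x - g2 x\<bar>)" "L (\<lambda>x. \<bar>f1 x + f2 x - (g1 x + g2 x)\<bar>)"
      by (rule set_integrable_abs[OF L_diff[OF fL(1) gL(1)]], rule set_integrable_abs[OF L_diff[OF fL(2) gL(2)]],
          rule set_integrable_abs[OF L_diff[OF L_add[OF fL] L_add[OF gL]]])
    have "(LINT x:{0..2}|lborel. \<bar>f1 x + f2 x - (g1 x + g2 x)\<bar>) \<le> (LINT x:{0..2}|lborel. \<bar>f1 x - g1 x\<bar> + \<bar>f2 x - g2 x\<bar>)"
      by (rule set_integral_mono[OF i(3) L_add[OF i(1,2)]]) auto
    also have "\<dots> \<le> e" using g1(3) g2(3) set_integral_add(2)[OF i(1,2)] by simp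
    finally show "\<exists>g. continuous_on UNIV g \<and> (\<forall>x. x \<notin> {0<..<2} \<longrightarrow> g x = 0) \<and>
      (LINT x:{0..2}|lborel. \<bar>f1 x + f2 x - g x\<bar>) \<le> e"
      using g1(1,2) g2(1,2) by (intro exI[of _ "\<lambda>x. g1 x + g2 x"]) (auto intro: continuous_on_add)
  qed
next
  case (lim f s)
  show ?case
  proof (intro allI impI)
    fix e :: real assume e: "e > 0"
    have e2: "e / 2 > 0" using e by simp
    have [measurable]: "f \<in> borel_measurable borel" "s i \<in> borel_measurable borel" for i
      using lim.hyps by (auto dest: borel_measurable_integrable)
    have "(\<lambda>i. LINT x|lborel. \<bar>f x - s i x\<bar>) \<longlonglongrightarrow> (LINT x|(lborel :: real measure). 0)"
    proof (rule integral_dominated_convergence[where w = "\<lambda>x. 3 * \<bar>f x\<bar>"])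
      show "AE x in lborel. (\<lambda>i. \<bar>f x - s i x\<bar>) \<longlonglongrightarrow> 0"
      proof (rule AE_I2)
        fix x :: real
        have "(\<lambda>i. \<bar>f x - s i x\<bar>) \<longlonglongrightarrow> \<bar>f x - f x\<bar>" by (intro tendsto_intros lim.hyps) simp
        then show "(\<lambda>i. \<bar>f x - s i x\<bar>) \<longlonglongrightarrow> 0" by simp
      qed
      show "AE x in lborel. norm \<bar>f x - s i x\<bar> \<le> 3 * \<bar>f x\<bar>" for i
      proof (rule AE_I2)
        fix x :: real
        have "\<bar>s i x\<bar> \<le> 2 * \<bar>f x\<bar>" using lim.hyps(3)[of x i] by simp
        then show "norm \<bar>f x - s i x\<bar> \<le> 3 * \<bar>f x\<bar>" unfolding real_norm_def by linarith
      qed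
    qed (use lim.hyps in auto)
    then have "eventually (\<lambda>i. (LINT x|lborel. \<bar>f x - s i x\<bar>) < e / 2) sequentially"
      using e2 by (intro order_tendstoD(2)) auto
    then obtain i where i: "(LINT x|lborel. \<bar>f x - s i x\<bar>) < e / 2"
      using eventually_happens by fastforce
    obtain g where g: "continuous_on UNIV g" "\<And>x. x \<notin> {0<..<2} \<Longrightarrow> g x = 0"
      "(LINT x:{0..2}|lborel. \<bar>s i x - g x\<bar>) \<le> e / 2" using lim.IH e2 by blast
    have fL: "L f" "L (s i)" using lim.hyps by (auto intro: L_integrable)
    have gL: "L g" using g(1) by (auto intro!: L_continuous elim: continuous_on_subset)
    have j: "L (\<lambda>x. \<bar>f x - s i x\<bar>)" "L (\<lambda>x. \<bar>s i x - g x\<bar>)" "L (\<lambda>x. \<bar>f x - g x\<bar>)"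
      by (rule set_integrable_abs[OF L_diff[OF fL]], rule set_integrable_abs[OF L_diff[OF fL(2) gL]],
          rule set_integrable_abs[OF L_diff[OF fL(1) gL]])
    have "(LINT x:{0..2}|lborel. \<bar>f x - g x\<bar>) \<le> (LINT x:{0..2}|lborel. \<bar>f x - s i x\<bar> + \<bar>s i x - g x\<bar>)"
      by (rule set_integral_mono[OF j(3) L_add[OF j(1,2)]]) auto
    also have "\<dots> = (LINT x:{0..2}|lborel. \<bar>f x - s i x\<bar>) + (LINT x:{0..2}|lborel. \<bar>s i x - g x\<bar>)"
      by (rule set_integral_add(2)[OF j(1,2)])
    also have "(LINT x:{0..2}|lborel. \<bar>f x - s i x\<bar>) \<le> (LINT x|lborel. \<bar>f x - s i x\<bar>)"
      unfolding set_lebesgue_integral_def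
      by (rule integral_mono) (use j(1) lim.hyps in \<open>auto simp: set_integrable_def indicator_def\<close>)
    finally have "(LINT x:{0..2}|lborel. \<bar>f x - g x\<bar>) \<le> e" using i g(3) by linarith
    then show "\<exists>g. continuous_on UNIV g \<and> (\<forall>x. x \<notin> {0<..<2} \<longrightarrow> g x = 0) \<and>
      (LINT x:{0..2}|lborel. \<bar>f x - g x\<bar>) \<le> e" using g(1,2) by blast
  qed
qed

text \<open>The interface to semigroup theory. The scale function depends on \<open>l\<close> and
  comes from an existence statement, so it is hidden behind a solution operator \<open>S\<close> for
  functions on \<open>[0,2]\<close>.\<close>

locale backward_resolvent =
  fixes \<phi> :: "real measure" and a :: left_bc and b :: right_bc and l :: real and S :: "(real \<Rightarrow> real) \<Rightarrow> real \<Rightarrow> real"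
  assumes S_cont: "\<And>p. continuous_on {0..2} p \<Longrightarrow> continuous_on {0..2} (S p)"
    and S_cong: "\<And>p q t. (\<And>t. t \<in> {0..2} \<Longrightarrow> p t = q t) \<Longrightarrow> t \<in> {0..2} \<Longrightarrow> S p t = S q t"
    and S_add: "\<And>p q t. continuous_on {0..2} p \<Longrightarrow> continuous_on {0..2} q \<Longrightarrow> t \<in> {0..2} \<Longrightarrow>
      S (\<lambda>x. p x + q x) t = S p t + S q t"
    and S_scale: "\<And>c p t. S (\<lambda>x. c * p x) t = c * S p t"
    and S_nonneg: "\<And>p t. continuous_on {0..2} p \<Longrightarrow> (\<And>y. y \<in> {0..2} \<Longrightarrow> 0 \<le> p y) \<Longrightarrow> t \<in> {0..2} \<Longrightarrow> 0 \<le> S p t"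
    and S_contr: "\<And>p M t. continuous_on {0..2} p \<Longrightarrow> (\<And>y. y \<in> {0..2} \<Longrightarrow> \<bar>p y\<bar> \<le> M) \<Longrightarrow> t \<in> {0..2} \<Longrightarrow> l * \<bar>S p t\<bar> \<le> M"
    and S_bc: "\<And>p. b = Right_D \<Longrightarrow> S p 0 = 0" "\<And>p. a = Left_D \<Longrightarrow> S p 2 = 0"
    and S_graph: "\<And>u g. continuous_on {-1..1} u \<Longrightarrow> continuous_on {-1..1} g \<Longrightarrow>
      is_partial (Phi_minus \<phi>) u g \<and> backward_left_bc \<phi> a u \<and> backward_right_bc \<phi> b u \<longleftrightarrow>
      (\<forall>t\<in>{0..2}. tr (-1) u t = S (\<lambda>t. l * tr (-1) u t - tr (-1) g t) t)"
    and S_dense: "\<And>u e. continuous_on {0..2} u \<Longrightarrow> (b = Right_D \<Longrightarrow> u 0 = 0) \<Longrightarrow> (a = Left_D \<Longrightarrow> u 2 = 0) \<Longrightarrow> e > 0 \<Longrightarrow>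
      \<exists>p. continuous_on {0..2} p \<and> (b = Right_D \<longrightarrow> p 0 = 0) \<and> (a = Left_D \<longrightarrow> p 2 = 0) \<and>
        (\<forall>t\<in>{0..2}. \<bar>u t - S p t\<bar> \<le> e)"

lemma continuous_tr:
  assumes "s = 1 \<or> s = -1" "continuous_on {-1..1} u" shows "continuous_on {0..2} (tr s u)"
  unfolding tr_def[abs_def]
  by (rule continuous_on_compose2[OF assms(2)]) (use assms(1) in \<open>auto intro!: continuous_intros\<close>)

context oriented_scale begin

lemma bc_start_eq: "bc_start b u \<longleftrightarrow> vanishes_at (- s) (case b of Right_D \<Rightarrow> u | Right_N \<Rightarrow> partial1 kf u)"
  by (cases b) simp_all

lemma bc_end_eq: "bc_end a u \<longleftrightarrow>
    vanishes_at s (case a of Left_D \<Rightarrow> u | Left_N \<Rightarrow> partial1 kf u | Left_Nstar \<Rightarrow> weak_deriv u)"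
  by (cases a) simp_all

lemma bc_end_star_eq: "bc_end_star b u \<longleftrightarrow> vanishes_at 1 (case b of Right_D \<Rightarrow> u | Right_N \<Rightarrow> D1 F u)"
  by (cases b) simp_all

end

lemma (in oriented_scale) backward:
  assumes sF: "s = -1" "F = Phi \<phi>"
  shows "backward_resolvent \<phi> a b l (sol (HR b) (HL a) (\<beta> a b))"
proof
  fix p q :: "real \<Rightarrow> real" and t :: real
  assume "continuous_on {0..2} p" "continuous_on {0..2} q" "t \<in> {0..2}"
  then show "sol (HR b) (HL a) (\<beta> a b) (\<lambda>x. p x + q x) t = sol (HR b) (HL a) (\<beta> a b) p t + sol (HR b) (HL a) (\<beta> a b) q t"
    by (intro sol_add ci_HL L_continuous)
next
  fix u g :: "real \<Rightarrow> real" assume ug: "continuous_on {-1..1} u" "continuous_on {-1..1} g"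
  have kf: "kf = Phi_minus \<phi>" by (simp add: fun_eq_iff sF Phi_minus_def)
  have c: "continuous_on {0..2} (tr s u)" "continuous_on {0..2} (tr s g)" by (rule continuous_tr[OF s_cases], fact ug)+
  have p: "continuous_on {0..2} (\<lambda>t. l * tr s u t - tr s g t)"
    by (intro continuous_on_diff continuous_on_mult continuous_on_const c)
  have bc: "bc_start b u \<longleftrightarrow> backward_right_bc \<phi> b u" "bc_end a u \<longleftrightarrow> backward_left_bc \<phi> a u"
    unfolding bc_start_eq bc_end_eq kf by (cases b; simp add: sF(1)) (cases a; simp add: sF(1))
  let ?r = "sol (HR b) (HL a) (\<beta> a b) (\<lambda>t. l * tr s u t - tr s g t)"
  have "is_partial kf u g \<and> bc_start b u \<and> bc_end a u \<longleftrightarrow>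
    (AE t in lborel. t \<in> {0..2} \<longrightarrow> tr s u t = sol (HR b) (HL a) (\<beta> a b) (\<lambda>t. l * tr s u t - tr s g t) t)"
    by (rule partial_sol[OF L_continuous[OF c(1)] L_continuous[OF c(2)] p])
  also have "\<dots> \<longleftrightarrow> (\<forall>t\<in>{0..2}. tr s u t = sol (HR b) (HL a) (\<beta> a b) (\<lambda>t. l * tr s u t - tr s g t) t)"
  proof
    show "\<forall>t\<in>{0..2}. tr s u t = ?r t" if "AE t in lborel. t \<in> {0..2} \<longrightarrow> tr s u t = ?r t"
      using AE_eq_continuous[OF that c(1) sol_cont[OF HR_cont L_continuous[OF p]]] by (intro ballI)
    show "AE t in lborel. t \<in> {0..2} \<longrightarrow> tr s u t = ?r t" if "\<forall>t\<in>{0..2}. tr s u t = ?r t"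
      using that by (intro AE_I2 impI) (rule bspec)
  qed
  finally have *: "is_partial kf u g \<and> bc_start b u \<and> bc_end a u \<longleftrightarrow>
    (\<forall>t\<in>{0..2}. tr s u t = sol (HR b) (HL a) (\<beta> a b) (\<lambda>t. l * tr s u t - tr s g t) t)" .
  show "is_partial (Phi_minus \<phi>) u g \<and> backward_left_bc \<phi> a u \<and> backward_right_bc \<phi> b u \<longleftrightarrow>
      (\<forall>t\<in>{0..2}. tr (-1) u t = sol (HR b) (HL a) (\<beta> a b) (\<lambda>t. l * tr (-1) u t - tr (-1) g t) t)"
    by (subst conj_commute[of "backward_left_bc \<phi> a u"]) (rule *[unfolded kf bc, unfolded sF(1)])
next
  show "\<And>p. b = Right_D \<Longrightarrow> sol (HR b) (HL a) (\<beta> a b) p 0 = 0" "\<And>p. a = Left_D \<Longrightarrow> sol (HR b) (HL a) (\<beta> a b) p 2 = 0"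
    by (simp_all only: back_bc)
next
  show "\<And>p. continuous_on {0..2} p \<Longrightarrow> continuous_on {0..2} (sol (HR b) (HL a) (\<beta> a b) p)"
    by (rule sol_cont[OF HR_cont L_continuous])
next
  show "\<And>p q t. (\<And>t. t \<in> {0..2} \<Longrightarrow> p t = q t) \<Longrightarrow> t \<in> {0..2} \<Longrightarrow>
      sol (HR b) (HL a) (\<beta> a b) p t = sol (HR b) (HL a) (\<beta> a b) q t" by (rule sol_cong)
  show "\<And>c p t. sol (HR b) (HL a) (\<beta> a b) (\<lambda>x. c * p x) t = c * sol (HR b) (HL a) (\<beta> a b) p t" by (rule sol_scale)
qed (rule back_nonneg back_contraction back_dense; assumption)+

lemma (in levy_measure) scale_ex:
  assumes "l > 0" "s = 1 \<or> s = -1" shows "\<exists>k. oriented_scale (Phi \<phi>) l k s"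
proof -
  have "res_kernel (Phi \<phi>) l" using kernel_Phi assms(1) by (intro res_kernel.intro res_kernel_axioms.intro)
  from res_kernel.scale_fn_ex[OF this] show ?thesis
    using assms(2) by (auto intro: oriented_scale.intro oriented_scale_axioms.intro)
qed

lemma (in levy_measure) backward_resolvent_ex:
  assumes "l > 0" shows "\<exists>S. backward_resolvent \<phi> a b l S"
proof -
  obtain k where "oriented_scale (Phi \<phi>) l k (-1)" using scale_ex[OF assms, of "-1"] by auto
  from oriented_scale.backward[OF this refl refl] show ?thesis by blast
qed

locale forward_resolvent =
  fixes \<phi> :: "real measure" and a :: left_bc and b :: right_bc and l :: real and T :: "(real \<Rightarrow> real) \<Rightarrow> real \<Rightarrow> real"
  assumes T_L: "\<And>p. L p \<Longrightarrow> L (T p)"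
    and T_cong: "\<And>p q t. AE t in lborel. t \<in> {0..2} \<longrightarrow> p t = q t \<Longrightarrow> L p \<Longrightarrow> L q \<Longrightarrow> t \<in> {0..2} \<Longrightarrow> T p t = T q t"
    and T_add: "\<And>p q t. L p \<Longrightarrow> L q \<Longrightarrow> t \<in> {0..2} \<Longrightarrow> T (\<lambda>x. p x + q x) t = T p t + T q t"
    and T_scale: "\<And>c p t. T (\<lambda>x. c * p x) t = c * T p t"
    and T_nonneg: "\<And>p. L p \<Longrightarrow> AE y in lborel. y \<in> {0..2} \<longrightarrow> 0 \<le> p y \<Longrightarrow> AE t in lborel. t \<in> {0..2} \<longrightarrow> 0 \<le> T p t"
    and T_contr: "\<And>p. L p \<Longrightarrow> l * (LINT t:{0..2}|lborel. \<bar>T p t\<bar>) \<le> (LINT t:{0..2}|lborel. \<bar>p t\<bar>)"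
    and T_graph: "\<And>u g. L (tr 1 u) \<Longrightarrow> L (tr 1 g) \<Longrightarrow>
      is_forward \<phi> a u g \<and> forward_left_bc \<phi> a u \<and> forward_right_bc \<phi> a b u \<longleftrightarrow>
      (AE t in lborel. t \<in> {0..2} \<longrightarrow> tr 1 u t = T (\<lambda>t. l * tr 1 u t - tr 1 g t) t)"
    and T_dense: "\<And>u e. L u \<Longrightarrow> e > 0 \<Longrightarrow> \<exists>p. L p \<and> (LINT t:{0..2}|lborel. \<bar>u t - T p t\<bar>) \<le> e"

lemma (in oriented_scale) forward:
  assumes sF: "s = 1" "F = Phi \<phi>"
  shows "forward_resolvent \<phi> a b l (sol (HL a) (HR b) (\<beta> a b))"
proof
  fix p q :: "real \<Rightarrow> real" and t :: real
  assume pq: "AE t in lborel. t \<in> {0..2} \<longrightarrow> p t = q t" "L p" "L q" "t \<in> {0..2}"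
  have "cv (HR b) p 2 = cv (HR b) q 2" by (rule cv_cong_right[OF pq(1) _ HR_L pq(2,3)]) simp
  moreover have "cv W p t = cv W q t" by (rule cv_cong_right[OF pq(1) _ W_L pq(2,3)]) (use pq(4) in simp)
  ultimately
  show "sol (HL a) (HR b) (\<beta> a b) p t = sol (HL a) (HR b) (\<beta> a b) q t" by (simp add: sol_def)
next
  fix p q :: "real \<Rightarrow> real" and t :: real
  assume "L p" "L q" "t \<in> {0..2}"
  then show "sol (HL a) (HR b) (\<beta> a b) (\<lambda>x. p x + q x) t = sol (HL a) (HR b) (\<beta> a b) p t + sol (HL a) (HR b) (\<beta> a b) q t"
    by (intro sol_add ci_HR)
next
  fix p :: "real \<Rightarrow> real" assume "L p" "AE y in lborel. y \<in> {0..2} \<longrightarrow> 0 \<le> p y"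
  from fwd_nonneg[OF this] show "AE t in lborel. t \<in> {0..2} \<longrightarrow> 0 \<le> sol (HL a) (HR b) (\<beta> a b) p t"
    using AE_lborel_singleton[of 0] AE_lborel_singleton[of 2] by (auto elim!: eventually_elim2)
next
  fix u g :: "real \<Rightarrow> real" assume ug: "L (tr 1 u)" "L (tr 1 g)"
  note ug' = ug[folded sF(1)]
  have kf: "kf = F" by (simp add: sF(1))
  let ?p = "\<lambda>t. l * tr s u t - tr s g t"
  have "is_forward \<phi> a u g \<and> forward_left_bc \<phi> a u \<and> forward_right_bc \<phi> a b u \<longleftrightarrow>
      (AE t in lborel. t \<in> {0..2} \<longrightarrow> tr s u t = sol (HL a) (HR b) (\<beta> a b) ?p t)"
  proof (cases "a = Left_Nstar")
    case True
    have "bc_end_star b u \<longleftrightarrow> forward_right_bc \<phi> a b u" unfolding bc_end_star_eq by (cases b) (simp_all add: True sF(2))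
    then show ?thesis using D_sol[OF sF(1) ug', of b] by (simp add: True sF(2))
  next
    case False
    \<comment> \<open>In the forward orientation the causal problem starts at the left endpoint, so
      the conditions change places: \<open>b'\<close> encodes the left condition as a start
      condition and \<open>a'\<close> the right one as an end condition. The symmetry of
      \<open>\<beta>\<close> keeps the constant.\<close>
    define a' where "a' = (if b = Right_D then Left_D else Left_N)"
    define b' where "b' = (if a = Left_D then Right_D else Right_N)"
    have ab: "HR b' = HL a" "HL a' = HR b" "\<beta> a' b' = \<beta> a b"
      using False by (cases a; cases b; simp add: a'_def b'_def)+
    have bc: "is_partial kf u g \<longleftrightarrow> is_forward \<phi> a u g" "bc_start b' u \<longleftrightarrow> forward_left_bc \<phi> a u" "bc_end a' u \<longleftrightarrow> forward_right_bc \<phi> a b u"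
      unfolding bc_start_eq bc_end_eq using False by (cases a; cases b; simp add: a'_def b'_def sF)+
    have "is_partial kf u g \<and> bc_start b' u \<and> bc_end a' u \<longleftrightarrow>
      (AE t in lborel. t \<in> {0..2} \<longrightarrow> tr s u t = sol (HR b') (HL a') (\<beta> a' b') ?p t)"
      by (rule partial_sol[OF ug']) (simp add: a'_def split: if_splits)
    then show ?thesis unfolding bc ab .
  qed
  then show "is_forward \<phi> a u g \<and> forward_left_bc \<phi> a u \<and> forward_right_bc \<phi> a b u \<longleftrightarrow>
      (AE t in lborel. t \<in> {0..2} \<longrightarrow> tr 1 u t = sol (HL a) (HR b) (\<beta> a b) (\<lambda>t. l * tr 1 u t - tr 1 g t) t)"
    unfolding sF(1) .
next
  fix u :: "real \<Rightarrow> real" and e :: real assume u: "L u" and e: "e > 0"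
  have "integrable lborel (zx u)" using u by (simp add: L_zx)
  from continuous_dense_L1[OF this] obtain g where g: "continuous_on UNIV g" "\<And>x. x \<notin> {0<..<2} \<Longrightarrow> g x = 0"
    "(LINT x:{0..2}|lborel. \<bar>zx u x - g x\<bar>) \<le> e / 2" using e by (metis half_gt_zero)
  have gc: "continuous_on {0..2} g" by (rule continuous_on_subset[OF g(1)]) simp
  \<comment> \<open>The interval has length 2, so a uniform error \<open>e/4\<close> contributes
    \<open>e/2\<close> to the norm.\<close>
  have "e / 4 > 0" using e by simp
  from fwd_dense[OF gc _ _ this, of a b] g(2) obtain p where p: "continuous_on {0..2} p"
    "\<And>t. t \<in> {0..2} \<Longrightarrow> \<bar>g t - sol (HL a) (HR b) (\<beta> a b) p t\<bar> \<le> e / 4" by auto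
  let ?T = "sol (HL a) (HR b) (\<beta> a b) p"
  have pL: "L p" by (rule L_continuous[OF p(1)])
  have TL: "L ?T" by (rule L_sol[OF HL_L pL])
  have gL: "L g" by (rule L_continuous[OF gc])
  have i: "L (\<lambda>t. \<bar>u t - g t\<bar>)" "L (\<lambda>t. \<bar>u t - ?T t\<bar>)"
    by (rule set_integrable_abs[OF L_diff[OF u gL]], rule set_integrable_abs[OF L_diff[OF u TL]])
  have "(LINT t:{0..2}|lborel. \<bar>u t - ?T t\<bar>) \<le> (LINT t:{0..2}|lborel. \<bar>u t - g t\<bar> + e / 4)"
  proof (rule set_integral_mono[OF i(2) L_add[OF i(1) L_const]])
    fix t :: real assume "t \<in> {0..2}"
    from p(2)[OF this] show "\<bar>u t - ?T t\<bar> \<le> \<bar>u t - g t\<bar> + e / 4" by linarith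
  qed
  also have "\<dots> = (LINT t:{0..2}|lborel. \<bar>u t - g t\<bar>) + (LINT t:{0..2::real}|lborel. e / 4)"
    by (rule set_integral_add(2)[OF i(1) L_const])
  also have "(LINT t:{0..2}|lborel. \<bar>u t - g t\<bar>) = (LINT x:{0..2}|lborel. \<bar>zx u x - g x\<bar>)"
    unfolding set_lebesgue_integral_def by (intro Bochner_Integration.integral_cong) (auto simp: zx_def indicator_def)
  also have "(LINT t:{0..2::real}|lborel. e / 4) = e / 2" by (simp add: set_lebesgue_integral_def)
  finally have "(LINT t:{0..2}|lborel. \<bar>u t - ?T t\<bar>) \<le> e" using g(3) by linarith
  then show "\<exists>p. L p \<and> (LINT t:{0..2}|lborel. \<bar>u t - sol (HL a) (HR b) (\<beta> a b) p t\<bar>) \<le> e"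
    using pL by blast
next
  show "\<And>c p t. sol (HL a) (HR b) (\<beta> a b) (\<lambda>x. c * p x) t = c * sol (HL a) (HR b) (\<beta> a b) p t" by (rule sol_scale)
qed (rule L_sol[OF HL_L] fwd_contraction; assumption)+

lemma (in levy_measure) forward_resolvent_ex:
  assumes "l > 0" shows "\<exists>T. forward_resolvent \<phi> a b l T"
proof -
  obtain k where "oriented_scale (Phi \<phi>) l k 1" using scale_ex[OF assms, of 1] by auto
  from oriented_scale.forward[OF this refl refl] show ?thesis by blast
qed

section \<open>The semigroups\<close>

instance bcontfun :: (metric_space, banach) banach ..

lemma fun_of_linear:
  "fun_of (f + g) x = fun_of f x + fun_of g x" "fun_of (f - g) x = fun_of f x - fun_of g x"
  "fun_of (c *\<^sub>R f) x = c * fun_of f x"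
  by (simp_all add: fun_of_def)

lemma abs_fun_of_le: "\<bar>fun_of f x\<bar> \<le> norm f"
  using norm_bounded[of f "Abs_ival x"] by (simp add: fun_of_def)

lemma bounded_linear_fun_of: "bounded_linear (\<lambda>f. fun_of f x)"
  by (rule bounded_linear_intro[where K = 1]) (simp_all add: fun_of_linear abs_fun_of_le)

lemma continuous_fun_of: "continuous_on A (\<lambda>f. fun_of f x)"
  by (rule linear_continuous_on[OF bounded_linear_fun_of])

text \<open>For the approximation, the truncation of \<open>f\<close> at height \<open>e/2\<close>
  is subtracted from \<open>f\<close>. What remains is supported where the absolute value of
  \<open>f\<close> is at least \<open>e/2\<close>, a compact set that avoids every endpoint at which
  \<open>f\<close> vanishes.\<close>

lemma C0_iff:
  "f \<in> C0 (Omega a b) \<longleftrightarrow> (a = Left_D \<longrightarrow> fun_of f (-1) = 0) \<and> (b = Right_D \<longrightarrow> fun_of f 1 = 0)"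
proof -
  define E where "E = {f. (a = Left_D \<longrightarrow> fun_of f (-1) = 0) \<and> (b = Right_D \<longrightarrow> fun_of f 1 = 0)}"
  define A where "A = {f. \<exists>K. compact K \<and> K \<subseteq> Omega a b \<and> (\<forall>x. x \<notin> K \<longrightarrow> fun_of f x = 0)}"
  have "closed E"
    unfolding E_def
    by (intro closed_Collect_conj closed_Collect_imp open_Collect_const closed_Collect_eq continuous_fun_of continuous_on_const)
  moreover have "A \<subseteq> E"
  proof
    fix f assume "f \<in> A"
    then obtain K where K: "K \<subseteq> Omega a b" "\<And>x. x \<notin> K \<Longrightarrow> fun_of f x = 0" by (auto simp: A_def)
    have "a = Left_D \<Longrightarrow> -1 \<notin> K" "b = Right_D \<Longrightarrow> 1 \<notin> K" using K(1) by (auto simp: Omega_def split: if_splits)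
    then show "f \<in> E" using K(2) by (auto simp: E_def)
  qed
  ultimately have 1: "closure A \<subseteq> E" by (intro closure_minimal)
  have 2: "E \<subseteq> closure A"
  proof
    fix f assume f: "f \<in> E"
    show "f \<in> closure A"
      unfolding closure_approachable
    proof (intro allI impI)
      fix e :: real assume e: "e > 0"
      define h where "h x = fun_of f x - max (- (e / 2)) (min (e / 2) (fun_of f x))" for x
      have "continuous_on {-1..1} h"
        unfolding h_def by (intro continuous_intros continuous_on_fun_of)
      then obtain g where g: "\<And>x. x \<in> {-1..1} \<Longrightarrow> fun_of g x = h x" using continuous_imp_fun_of by blast
      define K where "K = {-1..1} \<inter> (\<lambda>x. \<bar>fun_of f x\<bar>) -` {e / 2..}"
      have "closed K"
        unfolding K_def by (intro continuous_closed_preimage continuous_on_rabs continuous_on_fun_of) auto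
      moreover have "bounded K" by (rule bounded_subset[of "{-1..1}"]) (auto simp: K_def)
      ultimately have "compact K" by (simp add: compact_eq_bounded_closed)
      moreover have "K \<subseteq> Omega a b" using f e by (auto simp: K_def E_def Omega_def)
      moreover have "fun_of g x = 0" if "x \<notin> K" for x
      proof (cases "x \<in> {-1..1}")
        case True
        then have "\<bar>fun_of f x\<bar> < e / 2" using that by (auto simp: K_def)
        then show ?thesis using g[OF True] by (auto simp: h_def)
      next
        case False
        then show ?thesis by (auto simp: fun_of_def)
      qed
      ultimately have "g \<in> A" by (auto simp: A_def)
      moreover have "norm (g - f) \<le> e / 2"
      proof (rule norm_bound)
        fix y
        have "Rep_ival y \<in> {-1..1}" by (rule Rep_ival)
        from g[OF this] show "norm (apply_bcontfun (g - f) y) \<le> e / 2"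
          using e unfolding fun_of_Rep_ival[symmetric] fun_of_linear by (auto simp: h_def)
      qed
      ultimately show "\<exists>y\<in>A. dist y f < e" using e by (intro bexI[of _ g]) (auto simp: dist_norm)
    qed
  qed
  have "C0 (Omega a b) = E" using 1 2 by (auto simp: C0_def A_def)
  then show ?thesis by (simp add: E_def)
qed

section \<open>The backward semigroups on continuous functions\<close>

abbreviation ft :: "(ival \<Rightarrow>\<^sub>C real) \<Rightarrow> real \<Rightarrow> real" where "ft f \<equiv> tr (-1) (fun_of f)"

lemma ft_linear: "ft (f + g) t = ft f t + ft g t" "ft (f - g) t = ft f t - ft g t" "ft (c *\<^sub>R f) t = c * ft f t"
  by (simp_all add: tr_def fun_of_linear)

lemma ft_cont: "continuous_on {0..2} (ft f)" by (rule continuous_tr) (auto intro: continuous_on_fun_of)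

lemma abs_ft_le: "\<bar>ft f t\<bar> \<le> norm f" by (simp add: tr_def abs_fun_of_le)

lemma norm_ft_le:
  assumes "\<And>t. t \<in> {0..2} \<Longrightarrow> \<bar>ft f t\<bar> \<le> M" shows "norm f \<le> M"
proof (rule norm_bound)
  fix y
  have "1 - Rep_ival y \<in> {0..2}" using Rep_ival[of y] by auto
  from assms[OF this] show "norm (apply_bcontfun f y) \<le> M" by (simp add: tr_def fun_of_Rep_ival)
qed

lemma ft_eqI:
  assumes "\<And>t. t \<in> {0..2} \<Longrightarrow> ft f t = ft g t" shows "f = g"
  using norm_ft_le[of "f - g" 0] assms by (simp add: ft_linear)

lemma ft_ex: assumes "continuous_on {0..2} h" shows "\<exists>f. \<forall>t\<in>{0..2}. ft f t = h t"
proof -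
  have "continuous_on {-1..1} (\<lambda>x. h (1 - x))"
    by (rule continuous_on_compose2[OF assms]) (auto intro!: continuous_intros)
  from continuous_imp_fun_of[OF this] obtain f where "\<And>x. x \<in> {-1..1} \<Longrightarrow> fun_of f x = h (1 - x)" by blast
  then show ?thesis by (intro exI[of _ f]) (auto simp: tr_def)
qed

lemma C0_ft: "f \<in> C0 (Omega a b) \<longleftrightarrow> (a = Left_D \<longrightarrow> ft f 2 = 0) \<and> (b = Right_D \<longrightarrow> ft f 0 = 0)"
  by (simp add: C0_iff tr_def)

lemma nonneg_C_ft: "f \<in> nonneg_C \<longleftrightarrow> (\<forall>t\<in>{0..2}. 0 \<le> ft f t)"
proof
  assume *: "\<forall>t\<in>{0..2}. 0 \<le> ft f t"
  show "f \<in> nonneg_C" unfolding nonneg_C_def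
  proof (intro CollectI ballI)
    fix x :: real assume "x \<in> {-1..1}"
    then show "0 \<le> fun_of f x" using bspec[OF *, of "1 - x"] by (simp add: tr_def)
  qed
qed (auto simp: nonneg_C_def tr_def)

lemma closed_nonneg_C: "closed nonneg_C"
proof -
  have eq: "nonneg_C = (\<Inter>x\<in>{-1..1}. {f. 0 \<le> fun_of f x})" by (auto simp: nonneg_C_def)
  show ?thesis
    unfolding eq by (intro closed_INT ballI closed_Collect_le continuous_on_const continuous_fun_of)
qed

text \<open>The choice in \<open>R\<close> is harmless, since the values of \<open>ft\<close> on
  \<open>[0,2]\<close> determine a function. The equivalence \<open>S_graph\<close> yields both
  inclusions between the operator and its resolvent.\<close>

lemma backward_family:
  assumes S: "\<And>l. l > 0 \<Longrightarrow> backward_resolvent \<phi> a b l (S l)"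
  defines "R \<equiv> \<lambda>l f. SOME u. \<forall>t\<in>{0..2}. ft u t = S l (ft f) t"
  shows "resolvent_family (C0 (Omega a b)) (G_minus \<phi> a b) R nonneg_C"
proof -
  have R: "ft (R l f) t = S l (ft f) t" if "l > 0" "t \<in> {0..2}" for l f t
    using someI_ex[OF ft_ex[OF backward_resolvent.S_cont[OF S[OF that(1)] ft_cont[of f]]]] that(2)
    unfolding R_def by blast
  have X: "R l f \<in> C0 (Omega a b)" if "l > 0" for l f
    using backward_resolvent.S_bc[OF S[OF that]] R[OF that] by (simp add: C0_ft)
  have G: "(u, g) \<in> G_minus \<phi> a b \<longleftrightarrow> u \<in> C0 (Omega a b) \<and> g \<in> C0 (Omega a b) \<and>
      (\<forall>t\<in>{0..2}. ft u t = S l (\<lambda>t. l * ft u t - ft g t) t)" if "l > 0" for l u g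
    using backward_resolvent.S_graph[OF S[OF that] continuous_on_fun_of continuous_on_fun_of, of u g]
    by (auto simp only: G_minus_def mem_Collect_eq prod.case)
  have graph: "(R l f, l *\<^sub>R R l f - f) \<in> G_minus \<phi> a b" if l: "l > 0" and f: "f \<in> C0 (Omega a b)" for l f
    unfolding G[OF l]
  proof (intro conjI ballI)
    show "R l f \<in> C0 (Omega a b)" by (rule X[OF l])
    then show "l *\<^sub>R R l f - f \<in> C0 (Omega a b)" using f by (auto simp: C0_ft ft_linear)
    fix t :: real assume t: "t \<in> {0..2}"
    show "ft (R l f) t = S l (\<lambda>t. l * ft (R l f) t - ft (l *\<^sub>R R l f - f) t) t"
      unfolding R[OF l t] by (rule backward_resolvent.S_cong[OF S[OF l] _ t]) (simp add: ft_linear)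
  qed
  show ?thesis
  proof
    show "subspace (C0 (Omega a b))"
      by (auto simp: subspace_def C0_ft ft_linear) (simp_all add: tr_def fun_of_def)
    show "closed (C0 (Omega a b))" by (simp add: C0_def)
    show "closed nonneg_C" by (rule closed_nonneg_C)
    show "c *\<^sub>R f \<in> nonneg_C" if "c > 0" "f \<in> nonneg_C" for c f
      using that by (simp add: nonneg_C_ft ft_linear)
  next
    fix l :: real and f assume l: "l > 0" and f: "f \<in> C0 (Omega a b)"
    note br = S[OF l]
    show "(R l f, l *\<^sub>R R l f - f) \<in> G_minus \<phi> a b" by (rule graph[OF l f])
    show "R l (f + g) = R l f + R l g" for g
    proof (rule ft_eqI)
      fix t :: real assume t: "t \<in> {0..2}"
      have "S l (ft (f + g)) t = S l (\<lambda>t. ft f t + ft g t) t"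
        by (rule backward_resolvent.S_cong[OF br _ t]) (simp add: ft_linear)
      also have "\<dots> = S l (ft f) t + S l (ft g) t" by (rule backward_resolvent.S_add[OF br ft_cont ft_cont t])
      finally show "ft (R l (f + g)) t = ft (R l f + R l g) t" by (simp add: R[OF l t] ft_linear)
    qed
    show "R l (c *\<^sub>R f) = c *\<^sub>R R l f" for c
    proof (rule ft_eqI)
      fix t :: real assume t: "t \<in> {0..2}"
      have "S l (ft (c *\<^sub>R f)) t = S l (\<lambda>t. c * ft f t) t"
        by (rule backward_resolvent.S_cong[OF br _ t]) (simp add: ft_linear)
      then show "ft (R l (c *\<^sub>R f)) t = ft (c *\<^sub>R R l f) t"
        by (simp add: R[OF l t] ft_linear backward_resolvent.S_scale[OF br])
    qed
    have "norm (R l f) \<le> norm f / l"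
    proof (rule norm_ft_le)
      fix t :: real assume t: "t \<in> {0..2}"
      have "l * \<bar>S l (ft f) t\<bar> \<le> norm f" by (rule backward_resolvent.S_contr[OF br ft_cont abs_ft_le t])
      then show "\<bar>ft (R l f) t\<bar> \<le> norm f / l" using l by (simp add: R[OF l t] pos_le_divide_eq mult.commute)
    qed
    then show "l * norm (R l f) \<le> norm f" using l by (simp add: pos_le_divide_eq mult.commute)
    show "R l f \<in> nonneg_C" if "f \<in> nonneg_C"
      unfolding nonneg_C_ft
    proof
      fix t :: real assume t: "t \<in> {0..2}"
      show "0 \<le> ft (R l f) t"
        unfolding R[OF l t] using that by (intro backward_resolvent.S_nonneg[OF br ft_cont _ t]) (auto simp: nonneg_C_ft)
    qed
  next
    fix l :: real and f g assume l: "l > 0" and fg: "(f, g) \<in> G_minus \<phi> a b"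
    have "R l (l *\<^sub>R f - g) = f"
    proof (rule ft_eqI)
      fix t :: real assume t: "t \<in> {0..2}"
      have "S l (ft (l *\<^sub>R f - g)) t = S l (\<lambda>t. l * ft f t - ft g t) t"
        by (rule backward_resolvent.S_cong[OF S[OF l] _ t]) (simp add: ft_linear)
      also have "\<dots> = ft f t" using G[OF l, of f g] fg t by metis
      finally show "ft (R l (l *\<^sub>R f - g)) t = ft f t" by (simp add: R[OF l t])
    qed
    then show "f \<in> C0 (Omega a b) \<and> g \<in> C0 (Omega a b) \<and> R l (l *\<^sub>R f - g) = f" using G[OF l, of f g] fg by blast
  next
    fix f and e :: real assume f: "f \<in> C0 (Omega a b)" and e: "e > 0"
    have e2: "e / 2 > 0" using e by simp
    \<comment> \<open>The range of a single resolvent lies in the domain, so the parameter 1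
      suffices for density.\<close>
    note br = S[OF zero_less_one]
    obtain p where p: "continuous_on {0..2} p" "b = Right_D \<longrightarrow> p 0 = 0" "a = Left_D \<longrightarrow> p 2 = 0"
      "\<And>t. t \<in> {0..2} \<Longrightarrow> \<bar>ft f t - S 1 p t\<bar> \<le> e / 2"
      using backward_resolvent.S_dense[OF br ft_cont _ _ e2, of f] f unfolding C0_ft by blast
    obtain g where g: "\<And>t. t \<in> {0..2} \<Longrightarrow> ft g t = p t" using ft_ex[OF p(1)] by blast
    have "g \<in> C0 (Omega a b)" using p(2,3) by (simp add: C0_ft g)
    from graph[OF zero_less_one this] have "(R 1 g, 1 *\<^sub>R R 1 g - g) \<in> G_minus \<phi> a b" .
    moreover have "norm (f - R 1 g) \<le> e / 2"
    proof (rule norm_ft_le)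
      fix t :: real assume t: "t \<in> {0..2}"
      have "S 1 (ft g) t = S 1 p t" by (rule backward_resolvent.S_cong[OF br g t])
      then show "\<bar>ft (f - R 1 g) t\<bar> \<le> e / 2" using p(4)[OF t] by (simp add: ft_linear R[OF zero_less_one t])
    qed
    ultimately show "\<exists>u v. (u, v) \<in> G_minus \<phi> a b \<and> norm (f - u) < e" using e by (intro exI conjI) auto
  qed
qed

section \<open>The forward semigroups on integrable functions\<close>

interpretation shift: orientation 1 by unfold_locales simp

lemma AE_Leb: "(AE x in Leb. P x) \<longleftrightarrow> (AE t in lborel. t \<in> {0..2} \<longrightarrow> P (1 * (t - 1)))"
proof -
  have "(AE x in Leb. P x) \<longleftrightarrow> (AE x in lborel. x \<in> {-1..1} \<longrightarrow> P x)" by (rule AE_restrict_space_iff) simp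
  moreover have "AE x in lborel. x \<in> {-1<..<1} \<longrightarrow> P x" if "AE x in lborel. x \<in> {-1..1} \<longrightarrow> P x"
    using that by eventually_elim auto
  ultimately show ?thesis using shift.AE_tr1[of P] shift.AE_tr2[of P] by blast
qed

lemma integrable_Leb: "integrable Leb f \<longleftrightarrow> L (tr 1 f)"
proof -
  have "integrable Leb f \<longleftrightarrow> set_integrable lborel {-1..1} f"
    unfolding set_integrable_def by (rule integrable_restrict_space) simp
  then show ?thesis by (simp only: shift.L_tr)
qed

abbreviation rt :: "L1 \<Rightarrow> real \<Rightarrow> real" where "rt f \<equiv> tr 1 (rep_L1 f)"

lemma L_rt: "L (rt f)" using integrable_rep_L1[of f] by (simp only: integrable_Leb)

lemma norm_rt: "norm f = (LINT t:{0..2}|lborel. \<bar>rt f t\<bar>)"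
proof -
  have "norm f = (LINT x:{-1..1}|lborel. \<bar>rep_L1 f x\<bar>)"
    unfolding norm_L1_eq set_lebesgue_integral_def by (rule integral_restrict_space) simp
  also have "\<dots> = (LINT t:{0..2}|lborel. tr 1 (\<lambda>x. \<bar>rep_L1 f x\<bar>) t)" by (rule shift.LINT_tr)
  finally show ?thesis by (simp add: tr_def)
qed

lemma rt_linear:
  "AE t in lborel. t \<in> {0..2} \<longrightarrow> rt (f + g) t = rt f t + rt g t"
  "AE t in lborel. t \<in> {0..2} \<longrightarrow> rt (f - g) t = rt f t - rt g t"
  "AE t in lborel. t \<in> {0..2} \<longrightarrow> rt (c *\<^sub>R f) t = c * rt f t"
  using rep_L1_add[of f g] rep_L1_diff[of f g] rep_L1_scaleR[of c f] unfolding AE_Leb tr_def by blast+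

lemma rt_eqI: "AE t in lborel. t \<in> {0..2} \<longrightarrow> rt f t = rt g t \<Longrightarrow> f = g"
  unfolding L1_eq_iff AE_Leb tr_def by blast

lemma rt_ex: assumes "L h" shows "\<exists>f. AE t in lborel. t \<in> {0..2} \<longrightarrow> rt f t = h t"
proof -
  have "integrable Leb (itr 1 h)" using assms by (simp add: integrable_Leb)
  from rep_abs_L1[OF this] show ?thesis
    unfolding AE_Leb by (intro exI[of _ "abs_L1 (itr 1 h)"]) (simp add: tr_def itr_def)
qed

lemma nonneg_L1_rt: "f \<in> nonneg_L1 \<longleftrightarrow> (AE t in lborel. t \<in> {0..2} \<longrightarrow> 0 \<le> rt f t)"
  by (simp only: nonneg_L1_def mem_Collect_eq AE_Leb tr_def)

lemma LINT_abs_cong: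
  assumes "AE t in lborel. t \<in> {0..2} \<longrightarrow> p t = q t" "L p" "L q"
  shows "(LINT t:{0..2}|lborel. \<bar>p t\<bar>) = (LINT t:{0..2}|lborel. \<bar>q t\<bar>)"
proof -
  have "cv one (\<lambda>t. \<bar>p t\<bar>) 2 = cv one (\<lambda>t. \<bar>q t\<bar>) 2"
    by (rule cv_cong_right[OF _ _ L_const set_integrable_abs[OF assms(2)] set_integrable_abs[OF assms(3)]])
      (use assms(1) in \<open>auto elim: eventually_mono\<close>)
  then show ?thesis by (simp add: cv_one)
qed

text \<open>The integral of the negative part of \<open>f\<close> is at most the distance from
  \<open>f\<close> to any nonnegative function.\<close>

lemma closed_nonneg_L1: "closed nonneg_L1"
  unfolding closure_subset_eq[symmetric]
proof
  fix f assume f: "f \<in> closure nonneg_L1"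
  define m where "m x = max 0 (- rep_L1 f x)" for x
  have mi: "integrable Leb m" unfolding m_def[abs_def] using integrable_rep_L1[of f] by simp
  have "(\<integral>x. m x \<partial>Leb) \<le> e" if e: "e > 0" for e
  proof -
    obtain g where g: "g \<in> nonneg_L1" "dist g f < e" using f e unfolding closure_approachable by blast
    have "(\<integral>x. m x \<partial>Leb) \<le> (\<integral>x. \<bar>rep_L1 (g - f) x\<bar> \<partial>Leb)"
    proof (rule integral_mono_AE[OF mi])
      show "integrable Leb (\<lambda>x. \<bar>rep_L1 (g - f) x\<bar>)" using integrable_rep_L1[of "g - f"] by simp
      show "AE x in Leb. m x \<le> \<bar>rep_L1 (g - f) x\<bar>"
        using g(1)[unfolded nonneg_L1_def mem_Collect_eq] rep_L1_diff[of g f]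
        by eventually_elim (auto simp: m_def)
    qed
    then show ?thesis using g(2) by (simp add: dist_norm norm_L1_eq)
  qed
  then have "(\<integral>x. m x \<partial>Leb) \<le> 0" by (rule field_le_epsilon[where y = 0, simplified])
  moreover have "(\<integral>x. m x \<partial>Leb) \<ge> 0" by (rule integral_nonneg_AE) (simp add: m_def)
  ultimately have "(\<integral>x. m x \<partial>Leb) = 0" by simp
  then have "AE x in Leb. m x = 0"
    by (subst (asm) integral_nonneg_eq_0_iff_AE[OF mi]) (simp_all add: m_def)
  then show "f \<in> nonneg_L1" unfolding nonneg_L1_def mem_Collect_eq
    by eventually_elim (auto simp: m_def max_def split: if_splits)
qed

text \<open>Elements of \<open>L1\<close> are classes, so every identity passes through
  representatives that agree only almost everywhere; \<open>T_cong\<close> makes the solution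
  operator well defined on classes.\<close>

lemma forward_family:
  assumes T: "\<And>l. l > 0 \<Longrightarrow> forward_resolvent \<phi> a b l (T l)"
  defines "R \<equiv> \<lambda>l f. SOME u. AE t in lborel. t \<in> {0..2} \<longrightarrow> rt u t = T l (rt f) t"
  shows "resolvent_family UNIV (G_plus \<phi> a b) R nonneg_L1"
proof -
  have R: "AE t in lborel. t \<in> {0..2} \<longrightarrow> rt (R l f) t = T l (rt f) t" if "l > 0" for l f
    unfolding R_def by (rule someI_ex[OF rt_ex[OF forward_resolvent.T_L[OF T[OF that] L_rt]]])
  have G: "(u, g) \<in> G_plus \<phi> a b \<longleftrightarrow> (AE t in lborel. t \<in> {0..2} \<longrightarrow> rt u t = T l (\<lambda>t. l * rt u t - rt g t) t)"
    if "l > 0" for l u g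
    using forward_resolvent.T_graph[OF T[OF that] L_rt L_rt, of u g]
    by (simp only: G_plus_def mem_Collect_eq prod.case)
  have res: "L (\<lambda>t. l * rt u t - rt g t)" for l u g by (rule L_diff[OF L_scale[OF L_rt] L_rt])
  have graph: "(R l f, l *\<^sub>R R l f - f) \<in> G_plus \<phi> a b" if l: "l > 0" for l f
  proof -
    have "AE t in lborel. t \<in> {0..2} \<longrightarrow> rt f t = l * rt (R l f) t - rt (l *\<^sub>R R l f - f) t"
      using rt_linear(2)[of "l *\<^sub>R R l f" f] rt_linear(3)[of l "R l f"] by eventually_elim simp
    note c = forward_resolvent.T_cong[OF T[OF l] this L_rt res]
    show ?thesis unfolding G[OF l] using R[OF l, of f]
    proof eventually_elim
      case (elim t)
      show ?case using elim c[of t] by simp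
    qed
  qed
  show ?thesis
  proof
    show "subspace (UNIV :: L1 set)" by (rule subspace_UNIV)
    show "closed nonneg_L1" by (rule closed_nonneg_L1)
    show "c *\<^sub>R f \<in> nonneg_L1" if "c > 0" "f \<in> nonneg_L1" for c f
      using that(2) rt_linear(3)[of c f] unfolding nonneg_L1_rt by eventually_elim (use that(1) in auto)
  next
    fix l :: real and f assume l: "l > 0"
    note fr = T[OF l]
    show "(R l f, l *\<^sub>R R l f - f) \<in> G_plus \<phi> a b" by (rule graph[OF l])
    show "R l (f + g) = R l f + R l g" for g
    proof (rule rt_eqI)
      note c = forward_resolvent.T_cong[OF fr rt_linear(1)[of f g] L_rt L_add[OF L_rt L_rt]]
      show "AE t in lborel. t \<in> {0..2} \<longrightarrow> rt (R l (f + g)) t = rt (R l f + R l g) t"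
        using R[OF l, of "f + g"] R[OF l, of f] R[OF l, of g] rt_linear(1)[of "R l f" "R l g"]
      proof eventually_elim
        case (elim t)
        then show ?case using c[of t] forward_resolvent.T_add[OF fr L_rt L_rt, of t f g] by simp
      qed
    qed
    show "R l (c *\<^sub>R f) = c *\<^sub>R R l f" for c
    proof (rule rt_eqI)
      note c = forward_resolvent.T_cong[OF fr rt_linear(3)[of c f] L_rt L_scale[OF L_rt]]
      show "AE t in lborel. t \<in> {0..2} \<longrightarrow> rt (R l (c *\<^sub>R f)) t = rt (c *\<^sub>R R l f) t"
        using R[OF l, of "c *\<^sub>R f"] R[OF l, of f] rt_linear(3)[of c "R l f"]
      proof eventually_elim
        case (elim t)
        then show ?case using c[of t] forward_resolvent.T_scale[OF fr, of c "rt f" t] by simp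
      qed
    qed
    show "l * norm (R l f) \<le> norm f"
      unfolding norm_rt LINT_abs_cong[OF R[OF l] L_rt forward_resolvent.T_L[OF fr L_rt]]
      by (rule forward_resolvent.T_contr[OF fr L_rt])
    show "R l f \<in> nonneg_L1" if "f \<in> nonneg_L1"
      using R[OF l, of f] forward_resolvent.T_nonneg[OF fr L_rt that[unfolded nonneg_L1_rt]]
      unfolding nonneg_L1_rt by eventually_elim auto
  next
    fix l :: real and f g assume l: "l > 0" and fg: "(f, g) \<in> G_plus \<phi> a b"
    have "AE t in lborel. t \<in> {0..2} \<longrightarrow> rt (l *\<^sub>R f - g) t = l * rt f t - rt g t"
      using rt_linear(2)[of "l *\<^sub>R f" g] rt_linear(3)[of l f] by eventually_elim simp
    note c = forward_resolvent.T_cong[OF T[OF l] this L_rt res]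
    have "R l (l *\<^sub>R f - g) = f"
    proof (rule rt_eqI)
      show "AE t in lborel. t \<in> {0..2} \<longrightarrow> rt (R l (l *\<^sub>R f - g)) t = rt f t"
        using R[OF l, of "l *\<^sub>R f - g"] fg[unfolded G[OF l]]
      proof eventually_elim
        case (elim t)
        show ?case
        proof
          assume t: "t \<in> {0..2}"
          have "rt (R l (l *\<^sub>R f - g)) t = T l (rt (l *\<^sub>R f - g)) t" using elim(1) t by blast
          also have "\<dots> = T l (\<lambda>t. l * rt f t - rt g t) t" by (rule c[OF t])
          also have "\<dots> = rt f t" by (rule elim(2)[rule_format, OF t, symmetric])
          finally show "rt (R l (l *\<^sub>R f - g)) t = rt f t" .
        qed
      qed
    qed
    then show "f \<in> UNIV \<and> g \<in> UNIV \<and> R l (l *\<^sub>R f - g) = f" by blast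
  next
    fix f :: L1 and e :: real assume e: "e > 0"
    have e2: "e / 2 > 0" using e by simp
    note fr = T[OF zero_less_one]
    obtain p where p: "L p" "(LINT t:{0..2}|lborel. \<bar>rt f t - T 1 p t\<bar>) \<le> e / 2"
      using forward_resolvent.T_dense[OF fr L_rt e2] by blast
    obtain g where g: "AE t in lborel. t \<in> {0..2} \<longrightarrow> rt g t = p t" using rt_ex[OF p(1)] by blast
    note c = forward_resolvent.T_cong[OF fr g L_rt p(1)]
    have "AE t in lborel. t \<in> {0..2} \<longrightarrow> rt (f - R 1 g) t = rt f t - T 1 p t"
      using rt_linear(2)[of f "R 1 g"] R[OF zero_less_one, of g] by eventually_elim (use c in auto)
    from LINT_abs_cong[OF this L_rt L_diff[OF L_rt forward_resolvent.T_L[OF fr p(1)]]]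
    have "norm (f - R 1 g) \<le> e / 2" using p(2) by (simp add: norm_rt)
    then show "\<exists>u v. (u, v) \<in> G_plus \<phi> a b \<and> norm (f - u) < e"
      using graph[OF zero_less_one, of g] e by (intro exI[of _ "R 1 g"] exI[of _ "1 *\<^sub>R R 1 g - g"] conjI) auto
  qed simp_all
qed

theorem corollary5p2:
  fixes \<phi> :: "real measure" and L :: left_bc and R :: right_bc
  assumes "sets \<phi> = sets (restrict_space borel {0<..})"
    and "(\<integral>\<^sup>+ z. ennreal (min (z\<^sup>2) z) \<partial>\<phi>) < \<infinity>"
    and "(\<integral>\<^sup>+ z \<in> {0<..<1}. ennreal z \<partial>\<phi>) = \<infinity>"
  shows "generates_positive_sc_contraction_semigroup (C0 (Omega L R)) nonneg_C (G_minus \<phi> L R) \<and>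
         generates_positive_sc_contraction_semigroup UNIV nonneg_L1 (G_plus \<phi> L R)"
proof -
  interpret levy_measure \<phi> by unfold_locales (fact assms)+
  obtain S where "\<And>l. l > 0 \<Longrightarrow> backward_resolvent \<phi> L R l (S l)"
    using backward_resolvent_ex[of _ L R] by metis
  from resolvent_family.hille_yosida[OF backward_family[OF this]]
  have "generates_positive_sc_contraction_semigroup (C0 (Omega L R)) nonneg_C (G_minus \<phi> L R)" .
  moreover obtain T where "\<And>l. l > 0 \<Longrightarrow> forward_resolvent \<phi> L R l (T l)"
    using forward_resolvent_ex[of _ L R] by metis
  from resolvent_family.hille_yosida[OF forward_family[OF this]]
  have "generates_positive_sc_contraction_semigroup UNIV nonneg_L1 (G_plus \<phi> L R)" .
  ultimately show ?thesis by blast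
qed

end
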